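(* Let $n\geq 2$ and let $\Sigma$ be a complete $n$-dimensional properly immersed mean convex self-expander in $\mathbb{R}^{n+1}$. Let $B_R$ denote the geodesic ball of $\Sigma$ of radius $R$ centered at a fixed point of $\Sigma$. If there exists a constant $C>0$ such that the squared norm $|A|^2$ of the second fundamental form of $\Sigma$ satisfies $$\int_{B_R}|A|^2e^{\frac{|x|^2}{4}}d\sigma<CR^2$$ for all $R$ sufficiently large, then $\Sigma$ must be a hyperplane $\mathbb{R}^n$ through the origin.
   Context: Manifolds are connected. A self-expander hypersurface is a smooth $n$-dimensional hypersurface $\Sigma$ immersed in Euclidean space $\mathbb{R}^{n+1}$ whose mean curvature satisfies $H=-\frac12\langle x,{\bf n}\rangle$, where $x$ is the position vector, ${\bf n}$ is the unit normal field, and $H$ is defined by ${\bf H}=-H{\bf n}$ with ${\bf H}=\sum_{i=1}^n(\bar\nabla_{e_i}e_i)^\perp$ the mean curvature vector ($\{e_i\}$ a local orthonormal frame of $\Sigma$, $\bar\nabla$ the Euclidean connection). It is mean convex if $H\ge 0$ on $\Sigma$. Properly immersed means that the preimage in $\Sigma$ of every compact subset of $\mathbb{R}^{n+1}$ is compact. $d\sigma$ is the volume element of the induced metric on $\Sigma$. *)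

theory Defs
  imports "HOL-Analysis.Analysis"
begin

text \<open>
  A smooth \<open>n\<close>-manifold is a Hausdorff second countable type \<open>'m\<close> with a smooth atlas. A chart is a
  pair \<open>(U, \<phi>)\<close> of a domain and a map into \<open>real^'n\<close>, whose values outside \<open>U\<close> are irrelevant.
\<close>

type_synonym ('m, 'n) chart = "'m set \<times> ('m \<Rightarrow> real^'n)"

primrec Ck_on :: "nat \<Rightarrow> 'a::euclidean_space set \<Rightarrow> ('a \<Rightarrow> 'b::real_normed_vector) \<Rightarrow> bool" where
  "Ck_on 0 S f \<longleftrightarrow> continuous_on S f"
| "Ck_on (Suc k) S f \<longleftrightarrow>
     (\<forall>x\<in>S. f differentiable (at x)) \<and> (\<forall>v. Ck_on k S (\<lambda>x. frechet_derivative f (at x) v))"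

text \<open>The following is meaningful for open sets only, since derivatives are taken at \<open>at x\<close>.\<close>

definition smooth_on :: "'a::euclidean_space set \<Rightarrow> ('a \<Rightarrow> 'b::real_normed_vector) \<Rightarrow> bool" where
  "smooth_on S f \<longleftrightarrow> (\<forall>k. Ck_on k S f)"

definition chart_image :: "('m, 'n::finite) chart \<Rightarrow> (real^'n) set" where
  "chart_image c = snd c ` fst c"

definition chart_inv :: "('m, 'n::finite) chart \<Rightarrow> real^'n \<Rightarrow> 'm" where
  "chart_inv c = inv_into (fst c) (snd c)"

definition smooth_atlas :: "('m::topological_space, 'n::finite) chart set \<Rightarrow> bool" where
  "smooth_atlas \<A> \<longleftrightarrow>
     (\<forall>c\<in>\<A>. open (fst c) \<and> open (chart_image c) \<and>
        homeomorphism (fst c) (chart_image c) (snd c) (chart_inv c)) \<and>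
     (\<Union>c\<in>\<A>. fst c) = UNIV \<and>
     (\<forall>c\<in>\<A>. \<forall>c'\<in>\<A>. smooth_on (snd c ` (fst c \<inter> fst c')) (snd c' \<circ> chart_inv c))"

definition smooth_map ::
  "('m, 'n::finite) chart set \<Rightarrow> ('m \<Rightarrow> 'e::euclidean_space) \<Rightarrow> bool" where
  "smooth_map \<A> Y \<longleftrightarrow> (\<forall>c\<in>\<A>. smooth_on (chart_image c) (Y \<circ> chart_inv c))"

text \<open>
  The Euclidean derivative of a map \<open>Y\<close> into Euclidean space at \<open>p\<close>, in the direction of the tangent
  vector with coordinates \<open>v\<close> in the chart \<open>c\<close>. For the immersion \<open>F\<close> this is \<open>dF(v)\<close>; for a vector
  field \<open>Y\<close> along \<open>F\<close> it is the Euclidean connection applied to \<open>dF(v)\<close> and \<open>Y\<close>.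
\<close>

definition euclidean_deriv ::
  "('m, 'n::finite) chart \<Rightarrow> 'm \<Rightarrow> real^'n \<Rightarrow> ('m \<Rightarrow> 'e::euclidean_space) \<Rightarrow> 'e" where
  "euclidean_deriv c p v Y = frechet_derivative (Y \<circ> chart_inv c) (at (snd c p)) v"

definition immersion ::
  "('m, 'n::finite) chart set \<Rightarrow> ('m \<Rightarrow> 'e::euclidean_space) \<Rightarrow> bool" where
  "immersion \<A> F \<longleftrightarrow> smooth_map \<A> F \<and>
     (\<forall>c\<in>\<A>. \<forall>p\<in>fst c. inj (\<lambda>v. euclidean_deriv c p v F))"

definition unit_normal_field ::
  "('m, 'n::finite) chart set \<Rightarrow> ('m \<Rightarrow> 'e::euclidean_space) \<Rightarrow> ('m \<Rightarrow> 'e) \<Rightarrow> bool" where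
  "unit_normal_field \<A> F \<nu> \<longleftrightarrow> smooth_map \<A> \<nu> \<and> (\<forall>p. norm (\<nu> p) = 1) \<and>
     (\<forall>c\<in>\<A>. \<forall>p\<in>fst c. \<forall>v. euclidean_deriv c p v F \<bullet> \<nu> p = 0)"

text \<open>
  A local orthonormal frame \<open>e\<close> on a neighbourhood \<open>W\<close> of \<open>p\<close> inside the chart \<open>c\<close> is given by its
  coordinates \<open>E i\<close> in that chart, so \<open>e i q = dF (E i q)\<close> for \<open>q\<close> in \<open>W\<close>.
\<close>

definition frame_field ::
  "('m \<Rightarrow> 'e::euclidean_space) \<Rightarrow> ('m, 'n::finite) chart \<Rightarrow> ('n \<Rightarrow> 'm \<Rightarrow> real^'n) \<Rightarrow> 'n \<Rightarrow> 'm \<Rightarrow> 'e" where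
  "frame_field F c E i q = euclidean_deriv c q (E i q) F"

definition orthonormal_frame_near ::
  "('m::topological_space \<Rightarrow> 'e::euclidean_space) \<Rightarrow> 'm \<Rightarrow>
     ('m, 'n::finite) chart \<Rightarrow> ('n \<Rightarrow> 'm \<Rightarrow> real^'n) \<Rightarrow> bool" where
  "orthonormal_frame_near F p c E \<longleftrightarrow>
     (\<exists>W. open W \<and> p \<in> W \<and> W \<subseteq> fst c \<and>
        (\<forall>i. smooth_on (snd c ` W) (E i \<circ> chart_inv c)) \<and>
        (\<forall>q\<in>W. \<forall>i j. frame_field F c E i q \<bullet> frame_field F c E j q = (if i = j then 1 else 0)))"

text \<open>
  The quantities computed from the chosen frame below are independent of the choice.
\<close>

definition frame_at ::
  "('m::topological_space, 'n::finite) chart set \<Rightarrow> ('m \<Rightarrow> 'e::euclidean_space) \<Rightarrow> 'm \<Rightarrow>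
     ('m, 'n) chart \<times> ('n \<Rightarrow> 'm \<Rightarrow> real^'n)" where
  "frame_at \<A> F p = (SOME (c, E). c \<in> \<A> \<and> orthonormal_frame_near F p c E)"

text \<open>
  Second fundamental form on the frame: the component normal to the hypersurface of the Euclidean
  derivative of \<open>e j\<close> in the direction \<open>e i\<close>, at the point \<open>p\<close>.
\<close>

definition second_fundamental_form ::
  "('m::topological_space, 'n::finite) chart set \<Rightarrow> ('m \<Rightarrow> 'e::euclidean_space) \<Rightarrow> ('m \<Rightarrow> 'e) \<Rightarrow>
     'm \<Rightarrow> 'n \<Rightarrow> 'n \<Rightarrow> 'e" where
  "second_fundamental_form \<A> F \<nu> p i j =
     (case frame_at \<A> F p of (c, E) \<Rightarrow>
        (euclidean_deriv c p (E i p) (frame_field F c E j) \<bullet> \<nu> p) *\<^sub>R \<nu> p)"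

definition sff_norm_sq ::
  "('m::topological_space, 'n::finite) chart set \<Rightarrow> ('m \<Rightarrow> 'e::euclidean_space) \<Rightarrow> ('m \<Rightarrow> 'e) \<Rightarrow>
     'm \<Rightarrow> real" where
  "sff_norm_sq \<A> F \<nu> p =
     (\<Sum>i\<in>UNIV. \<Sum>j\<in>UNIV. (norm (second_fundamental_form \<A> F \<nu> p i j))\<^sup>2)"

definition mean_curvature_vector ::
  "('m::topological_space, 'n::finite) chart set \<Rightarrow> ('m \<Rightarrow> 'e::euclidean_space) \<Rightarrow> ('m \<Rightarrow> 'e) \<Rightarrow>
     'm \<Rightarrow> 'e" where
  "mean_curvature_vector \<A> F \<nu> p = (\<Sum>i\<in>UNIV. second_fundamental_form \<A> F \<nu> p i i)"

text \<open>The sign is such that the mean curvature vector is \<open>- H \<nu>\<close>.\<close>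

definition mean_curvature ::
  "('m::topological_space, 'n::finite) chart set \<Rightarrow> ('m \<Rightarrow> 'e::euclidean_space) \<Rightarrow> ('m \<Rightarrow> 'e) \<Rightarrow>
     'm \<Rightarrow> real" where
  "mean_curvature \<A> F \<nu> p = - (mean_curvature_vector \<A> F \<nu> p \<bullet> \<nu> p)"

definition self_expander ::
  "('m::topological_space, 'n::finite) chart set \<Rightarrow> ('m \<Rightarrow> 'e::euclidean_space) \<Rightarrow> ('m \<Rightarrow> 'e) \<Rightarrow>
     bool" where
  "self_expander \<A> F \<nu> \<longleftrightarrow> (\<forall>p. mean_curvature \<A> F \<nu> p = - (1/2) * (F p \<bullet> \<nu> p))"

definition mean_convex ::
  "('m::topological_space, 'n::finite) chart set \<Rightarrow> ('m \<Rightarrow> 'e::euclidean_space) \<Rightarrow> ('m \<Rightarrow> 'e) \<Rightarrow>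
     bool" where
  "mean_convex \<A> F \<nu> \<longleftrightarrow> (\<forall>p. mean_curvature \<A> F \<nu> p \<ge> 0)"

definition properly_immersed ::
  "('m::topological_space \<Rightarrow> 'e::euclidean_space) \<Rightarrow> bool" where
  "properly_immersed F \<longleftrightarrow> (\<forall>K. compact K \<longrightarrow> compact (F -` K))"

text \<open>
  Piecewise continuously differentiable curves on the unit interval. The length is an extended
  nonnegative integral, because the speed need not be bounded near the exceptional points.
\<close>

definition piecewise_C1_curve ::
  "('m::topological_space, 'n::finite) chart set \<Rightarrow> (real \<Rightarrow> 'm) \<Rightarrow> bool" where
  "piecewise_C1_curve \<A> \<gamma> \<longleftrightarrow> continuous_on {0..1} \<gamma> \<and>
     (\<exists>S. finite S \<and>
        (\<forall>c\<in>\<A>. (snd c \<circ> \<gamma>) C1_differentiable_on (({0..1} - S) \<inter> \<gamma> -` fst c)))"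

definition curve_length :: "('m \<Rightarrow> 'e::euclidean_space) \<Rightarrow> (real \<Rightarrow> 'm) \<Rightarrow> ennreal" where
  "curve_length F \<gamma> =
     (\<integral>\<^sup>+t\<in>{0..1}. ennreal (norm (vector_derivative (F \<circ> \<gamma>) (at t))) \<partial>lborel)"

text \<open>On a connected manifold the infimum below is finite, so \<open>enn2real\<close> loses no information.\<close>

definition geodesic_dist ::
  "('m::topological_space, 'n::finite) chart set \<Rightarrow> ('m \<Rightarrow> 'e::euclidean_space) \<Rightarrow>
     'm \<Rightarrow> 'm \<Rightarrow> real" where
  "geodesic_dist \<A> F p q =
     enn2real (INF \<gamma>\<in>{\<gamma>. piecewise_C1_curve \<A> \<gamma> \<and> \<gamma> 0 = p \<and> \<gamma> 1 = q}. curve_length F \<gamma>)"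

definition geodesic_ball ::
  "('m::topological_space, 'n::finite) chart set \<Rightarrow> ('m \<Rightarrow> 'e::euclidean_space) \<Rightarrow>
     'm \<Rightarrow> real \<Rightarrow> 'm set" where
  "geodesic_ball \<A> F = Metric_space.mball UNIV (geodesic_dist \<A> F)"

definition complete_immersed ::
  "('m::topological_space, 'n::finite) chart set \<Rightarrow> ('m \<Rightarrow> 'e::euclidean_space) \<Rightarrow> bool" where
  "complete_immersed \<A> F \<longleftrightarrow> Metric_space.mcomplete UNIV (geodesic_dist \<A> F)"

definition induced_metric ::
  "('m \<Rightarrow> 'e::euclidean_space) \<Rightarrow> ('m, 'n::finite) chart \<Rightarrow> 'm \<Rightarrow> real^'n^'n" where
  "induced_metric F c p =
     (\<chi> i j. euclidean_deriv c p (axis i 1) F \<bullet> euclidean_deriv c p (axis j 1) F)"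

text \<open>The following determines the Borel measure \<open>\<sigma>\<close> uniquely, the atlas having a countable subcover.\<close>

definition volume_measure ::
  "('m::topological_space, 'n::finite) chart set \<Rightarrow> ('m \<Rightarrow> 'e::euclidean_space) \<Rightarrow>
     'm measure \<Rightarrow> bool" where
  "volume_measure \<A> F \<sigma> \<longleftrightarrow> sets \<sigma> = sets borel \<and>
     (\<forall>c\<in>\<A>. \<forall>B\<in>sets borel. B \<subseteq> fst c \<longrightarrow>
        emeasure \<sigma> B =
          (\<integral>\<^sup>+u\<in>snd c ` B. ennreal (sqrt (det (induced_metric F c (chart_inv c u)))) \<partial>lborel))"

end

theory Submission
  imports Defs
begin

text \<open>
  Write \<open>A = (h\<^sub>a\<^sub>b)\<close> on ambient indices, extended by \<open>0\<close> in the direction of \<open>\<nu>\<close>, and let \<open>L = \<Delta> + \<langle>x, \<nabla>\<cdot>\<rangle> / 2\<close> be the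
  drift Laplacian, which is symmetric for the weight \<open>exp (|x|\<^sup>2 / 4)\<close>. On a self-expander
  \<open>L H = - (1/2 + |A|\<^sup>2) H\<close> and \<open>L |A|\<^sup>2 = 2 |\<nabla>A|\<^sup>2 - (1 + 2 |A|\<^sup>2) |A|\<^sup>2\<close>, so by the strong maximum
  principle \<open>H > 0\<close> everywhere or \<open>H = 0\<close> identically.

  If \<open>H > 0\<close>, the tangential field \<open>V = H\<^sup>2 \<nabla>(|A|\<^sup>2 / H\<^sup>2)\<close> has weighted divergence
  \<open>2 |H \<nabla>A - A \<otimes> \<nabla>H|\<^sup>2 / H\<^sup>2\<close>, which controls \<open>|V|\<^sup>2 / |A|\<^sup>2\<close>. Testing with the square of a cutoff in the geodesic
  distance and using the quadratic growth of the energy, first the total divergence is bounded and then it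
  vanishes. So \<open>H \<nabla>A = A \<otimes> \<nabla>H\<close>, and by Codazzi \<open>A\<close> has rank one, with \<open>|A| = H\<close> and a constant kernel.
  For a unit vector \<open>a\<close> in the kernel and \<open>y = \<langle>a, x\<rangle>\<close>, the field \<open>H\<^sup>2 y / (1 + y\<^sup>2) a\<close> has positive weighted
  divergence, which the same argument excludes.

  If \<open>H = 0\<close>, then \<open>A\<close> is homogeneous of degree \<open>-1\<close> along \<open>x\<close>, so \<open>|A|\<^sup>2 |x|\<close> cannot have a positive maximum on
  the compact preimages of balls; hence \<open>A = 0\<close>, \<open>\<nu>\<close> is constant, and the immersion is a proper local
  homeomorphism onto a hyperplane, which is injective because the hyperplane is simply connected.

  The weighted divergence theorem is only needed against Lipschitz cutoffs and only as an inequality. In a chart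
  it follows from the translation invariance of Lebesgue measure, applied to difference quotients.
\<close>

section \<open>Calculus of \<open>C\<^sup>k\<close> maps\<close>

text \<open>All geometry is carried by scalar functions on the manifold. A tangential tensor is the
  family of its ambient components, and \<open>\<delta> a\<close> takes the \<open>a\<close>-th
  component of the tangential gradient, so that neither Christoffel symbols nor bundles occur. The
  price is that \<open>\<delta> c (h a b)\<close> is not tangential: its normal slots are filled by
  entries of the square \<open>h2\<close>, and \<open>S\<close> is the tangential part. Properness
  enters through the fact that a chord is no longer than a curve. Geodesic balls therefore lie in
  preimages of Euclidean balls, and every cutoff has compact support. Quadratic growth is the
  critical rate. A cutoff at scale \<open>R\<close> has slope \<open>1/R\<close>, and the squared
  slope times the energy stays bounded. This bounds the total divergence. If a smaller ball already
  carries almost all of it, the same estimate is run with a small parameter in the AM-GM step: the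
  part inside is killed by the slope, the part outside has almost no divergence left.\<close>

lemma Ck_on_subset: "Ck_on k S f \<Longrightarrow> T \<subseteq> S \<Longrightarrow> Ck_on k T f"
  by (induction k arbitrary: f) (auto intro: continuous_on_subset)

text \<open>\<open>Ck_on\<close> differentiates at \<open>at x\<close>, so values outside
  \<open>S\<close> count. On an open set, agreement of the functions passes to the derivatives, and
  the induction goes through.\<close>

lemma Ck_on_cong:
  assumes "open S" "\<And>x. x \<in> S \<Longrightarrow> f x = g x"
  shows "Ck_on k S f \<longleftrightarrow> Ck_on k S g"
  using assms(2)
proof (induction k arbitrary: f g)
  case 0
  then show ?case by (auto intro!: continuous_on_cong)
next
  case (Suc k)
  have hd: "(f has_derivative D) (at x) \<longleftrightarrow> (g has_derivative D) (at x)" if "x \<in> S" for x D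
    using Suc.prems that assms(1) has_derivative_transform_within_open by metis
  have 1: "f differentiable (at x) \<longleftrightarrow> g differentiable (at x)" if "x \<in> S" for x
    using hd[OF that] by (auto simp: differentiable_def)
  have 2: "frechet_derivative f (at x) v = frechet_derivative g (at x) v" if "x \<in> S" for x v
    using hd[OF that] by (simp add: frechet_derivative_def)
  have "Ck_on k S (\<lambda>x. frechet_derivative f (at x) v) \<longleftrightarrow> Ck_on k S (\<lambda>x. frechet_derivative g (at x) v)" for v
    by (rule Suc.IH) (simp add: 2)
  with 1 show ?case by simp
qed

text \<open>The workhorse of the closure proofs: once an explicit derivative is known, the step from
  \<open>k\<close> to \<open>Suc k\<close> only asks that this formula be of class
  \<open>k\<close>.\<close>

lemma Ck_on_Suc_iff:
  assumes "open S" "\<And>x. x \<in> S \<Longrightarrow> (f has_derivative f' x) (at x)"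
  shows "Ck_on (Suc k) S f \<longleftrightarrow> (\<forall>v. Ck_on k S (\<lambda>x. f' x v))"
proof -
  have "frechet_derivative f (at x) v = f' x v" if "x \<in> S" for x v
    using assms(2)[OF that] frechet_derivative_at by metis
  then have "Ck_on k S (\<lambda>x. frechet_derivative f (at x) v) \<longleftrightarrow> Ck_on k S (\<lambda>x. f' x v)" for v
    by (intro Ck_on_cong assms) auto
  moreover have "\<forall>x\<in>S. f differentiable (at x)"
    using assms(2) by (auto simp: differentiable_def)
  ultimately show ?thesis by simp
qed

lemma Ck_on_imp_continuous_on: "Ck_on k S f \<Longrightarrow> continuous_on S f"
proof (cases k)
  case (Suc m)
  assume "Ck_on k S f"
  then have "f differentiable_on S"
    unfolding Suc Ck_on.simps differentiable_on_def using differentiable_at_withinI by blast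
  then show ?thesis by (rule differentiable_imp_continuous_on)
qed simp

lemma Ck_on_SucD: "Ck_on (Suc k) S f \<Longrightarrow> Ck_on k S f"
proof (induction k arbitrary: f)
  case 0
  then show ?case using Ck_on_imp_continuous_on[of "Suc 0" S f] by (simp only: Ck_on.simps(1))
next
  case (Suc k)
  then show ?case by (simp only: Ck_on.simps) blast
qed

lemma Ck_on_has_derivative:
  "Ck_on (Suc k) S f \<Longrightarrow> x \<in> S \<Longrightarrow> (f has_derivative frechet_derivative f (at x)) (at x)"
  by (simp add: frechet_derivative_works)

lemma Ck_on_frechet_derivative:
  "Ck_on (Suc k) S f \<Longrightarrow> Ck_on k S (\<lambda>x. frechet_derivative f (at x) v)"
  by simp

lemma Ck_on_const: "open S \<Longrightarrow> Ck_on k S (\<lambda>x. c)"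
proof (induction k arbitrary: c)
  case (Suc k)
  show ?case
    by (subst Ck_on_Suc_iff[where f'="\<lambda>_ _. 0"]) (auto intro: Suc)
qed auto

lemma Ck_on_bounded_linear:
  assumes "bounded_linear l" "open S"
  shows "Ck_on k S l"
proof (cases k)
  case 0
  then show ?thesis using assms linear_continuous_on by auto
next
  case (Suc m)
  have "(l has_derivative l) (at x)" for x
    using assms(1) bounded_linear_imp_has_derivative by blast
  then show ?thesis
    unfolding Suc by (subst Ck_on_Suc_iff[where f'="\<lambda>_. l"]) (auto intro: Ck_on_const assms)
qed

lemma Ck_on_linear_comp:
  assumes "bounded_linear l" "open S" "Ck_on k S f"
  shows "Ck_on k S (\<lambda>x. l (f x))"
  using assms(3)
proof (induction k arbitrary: f)
  case 0
  then show ?case using assms(1) by (auto intro: bounded_linear.continuous_on)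
next
  case (Suc k)
  have "((\<lambda>x. l (f x)) has_derivative (\<lambda>v. l (frechet_derivative f (at x) v))) (at x)" if "x \<in> S" for x
    using Ck_on_has_derivative[OF Suc.prems that] bounded_linear.has_derivative[OF assms(1)] by blast
  then show ?case
    using Suc by (subst Ck_on_Suc_iff[OF assms(2)]) auto
qed

lemma Ck_on_add:
  assumes "open S" "Ck_on k S f" "Ck_on k S g"
  shows "Ck_on k S (\<lambda>x. f x + g x)"
  using assms(2,3)
proof (induction k arbitrary: f g)
  case 0
  then show ?case by (auto intro: continuous_intros)
next
  case (Suc k)
  have "((\<lambda>x. f x + g x) has_derivative (\<lambda>v. frechet_derivative f (at x) v + frechet_derivative g (at x) v)) (at x)"
    if "x \<in> S" for x
    using Suc.prems that by (intro has_derivative_add Ck_on_has_derivative) auto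
  then show ?case
    using Suc by (subst Ck_on_Suc_iff[OF assms(1)]) auto
qed

lemma Ck_on_sum:
  assumes "open S" "\<And>i. i \<in> I \<Longrightarrow> Ck_on k S (f i)"
  shows "Ck_on k S (\<lambda>x. \<Sum>i\<in>I. f i x)"
  using assms(2)
proof (induction I rule: infinite_finite_induct)
  case (insert i I)
  then show ?case by (simp add: Ck_on_add assms(1))
qed (auto intro: Ck_on_const assms)

lemma Ck_on_bilinear:
  assumes "bounded_bilinear P" "open S" "Ck_on k S f" "Ck_on k S g"
  shows "Ck_on k S (\<lambda>x. P (f x) (g x))"
  using assms(3,4)
proof (induction k arbitrary: f g)
  case 0
  then show ?case by (auto intro: bounded_bilinear.continuous_on[OF assms(1)])
next
  case (Suc k)
  have "((\<lambda>x. P (f x) (g x)) has_derivative (\<lambda>v. P (f x) (frechet_derivative g (at x) v)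
      + P (frechet_derivative f (at x) v) (g x))) (at x)"
    if "x \<in> S" for x
    using Suc.prems that by (intro bounded_bilinear.FDERIV[OF assms(1)] Ck_on_has_derivative) auto
  then show ?case
    using Suc.prems
    by (subst Ck_on_Suc_iff[OF assms(2)])
       (auto intro!: Ck_on_add Suc.IH Ck_on_SucD[OF Suc.prems(1)] Ck_on_SucD[OF Suc.prems(2)] assms(2))
qed

lemmas Ck_on_mult = Ck_on_bilinear[OF bounded_bilinear_mult]
lemmas Ck_on_scaleR = Ck_on_bilinear[OF bounded_bilinear_scaleR]

text \<open>\<open>Ck_on\<close> speaks about derivatives in a fixed direction. Expanding over
  \<open>Basis\<close> turns a derivative in a variable direction into finitely many fixed ones with
  variable coefficients.\<close>

lemma linear_componentwise_expansion:
  fixes l :: "'a::euclidean_space \<Rightarrow> 'b::real_vector"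
  assumes "linear l"
  shows "l w = (\<Sum>b\<in>Basis. (w \<bullet> b) *\<^sub>R l b)"
proof -
  have "l w = l (\<Sum>b\<in>Basis. (w \<bullet> b) *\<^sub>R b)"
    by (simp add: euclidean_representation)
  also have "\<dots> = (\<Sum>b\<in>Basis. (w \<bullet> b) *\<^sub>R l b)"
    by (simp add: linear_sum[OF assms] linear_scale[OF assms])
  finally show ?thesis .
qed

lemma Ck_on_compose:
  fixes f :: "'a::euclidean_space \<Rightarrow> 'b::euclidean_space" and g :: "'b \<Rightarrow> 'c::real_normed_vector"
  assumes "open S" "open T" "f ` S \<subseteq> T" "Ck_on k S f" "Ck_on k T g"
  shows "Ck_on k S (\<lambda>x. g (f x))"
  using assms(4,5)
proof (induction k arbitrary: g)
  case 0
  then show ?case using assms(3) by (auto intro: continuous_on_compose2)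
next
  case (Suc k)
  let ?f' = "\<lambda>x. frechet_derivative f (at x)" and ?g' = "\<lambda>x. frechet_derivative g (at x)"
  have d: "((\<lambda>x. g (f x)) has_derivative (\<lambda>v. \<Sum>b\<in>Basis. (?f' x v \<bullet> b) *\<^sub>R ?g' (f x) b)) (at x)"
    if "x \<in> S" for x
  proof -
    have g: "(g has_derivative ?g' (f x)) (at (f x))"
      using Suc.prems that assms(3) by (auto intro!: Ck_on_has_derivative)
    moreover have f: "(f has_derivative ?f' x) (at x)"
      using Suc.prems that assms(3) by (auto intro!: Ck_on_has_derivative)
    ultimately have "((\<lambda>x. g (f x)) has_derivative (\<lambda>v. ?g' (f x) (?f' x v))) (at x)"
      by (rule has_derivative_compose[rotated])
    moreover have "(\<lambda>v. ?g' (f x) (?f' x v)) = (\<lambda>v. \<Sum>b\<in>Basis. (?f' x v \<bullet> b) *\<^sub>R ?g' (f x) b)"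
      by (rule ext, rule linear_componentwise_expansion) (rule has_derivative_linear[OF g])
    ultimately show ?thesis by (simp only:)
  qed
  have "Ck_on k S (\<lambda>x. ?g' (f x) b)" for b
    by (rule Suc.IH) (use Suc.prems Ck_on_SucD in auto)
  moreover have "Ck_on k S (\<lambda>x. ?f' x v \<bullet> b)" for v b
    using Suc.prems by (intro Ck_on_linear_comp[OF bounded_linear_inner_left]) (auto simp: assms(1))
  ultimately show ?case
    by (subst Ck_on_Suc_iff[OF assms(1) d]) (auto intro!: Ck_on_sum Ck_on_scaleR assms(1))
qed

text \<open>The derivative is a product of the inverse itself with a derivative of \<open>f\<close>,
  both known to be one order less regular, so the induction closes. The same happens for square
  roots and exponentials.\<close>

lemma Ck_on_inverse:
  fixes f :: "'a::euclidean_space \<Rightarrow> real"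
  assumes "open S" "Ck_on k S f" "\<And>x. x \<in> S \<Longrightarrow> f x \<noteq> 0"
  shows "Ck_on k S (\<lambda>x. inverse (f x))"
  using assms(2)
proof (induction k)
  case 0
  then show ?case using assms(3) by (auto intro: continuous_intros)
next
  case (Suc k)
  have d: "((\<lambda>x. inverse (f x)) has_derivative
      (\<lambda>v. (- 1) * (inverse (f x) * frechet_derivative f (at x) v * inverse (f x)))) (at x)"
    if "x \<in> S" for x
    using Deriv.has_derivative_inverse[OF assms(3) Ck_on_has_derivative[OF Suc.prems that]] that by simp
  have i: "Ck_on k S (\<lambda>x. inverse (f x))"
    using Suc Ck_on_SucD by blast
  show ?case
    by (subst Ck_on_Suc_iff[OF assms(1) d], assumption)
       (intro allI Ck_on_mult Ck_on_const assms(1) i Ck_on_frechet_derivative Suc.prems)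
qed

lemma Ck_on_sqrt:
  fixes f :: "'a::euclidean_space \<Rightarrow> real"
  assumes "open S" "Ck_on k S f" "\<And>x. x \<in> S \<Longrightarrow> f x > 0"
  shows "Ck_on k S (\<lambda>x. sqrt (f x))"
  using assms(2)
proof (induction k)
  case 0
  then show ?case by (auto intro: continuous_intros)
next
  case (Suc k)
  have d: "((\<lambda>x. sqrt (f x)) has_derivative
      (\<lambda>v. inverse (2 * sqrt (f x)) * frechet_derivative f (at x) v)) (at x)"
    if "x \<in> S" for x
    using has_derivative_real_sqrt[OF assms(3)[OF that] Ck_on_has_derivative[OF Suc.prems that]]
    by (simp add: field_simps)
  have i: "Ck_on k S (\<lambda>x. sqrt (f x))"
    using Suc Ck_on_SucD by blast
  have "Ck_on k S (\<lambda>x. inverse (2 * sqrt (f x)))"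
    using assms(3) by (intro Ck_on_inverse Ck_on_mult Ck_on_const assms(1) i) force
  then show ?case
    by (subst Ck_on_Suc_iff[OF assms(1) d])
       (auto intro!: Ck_on_mult assms(1) Ck_on_frechet_derivative Suc.prems simp del: inverse_mult_distrib)
qed

text \<open>Serves functions given by different formulas on two overlapping open sets, such as
  fields and bumps extended by zero.\<close>

lemma Ck_on_local:
  assumes "\<And>x. x \<in> S \<Longrightarrow> \<exists>T. open T \<and> x \<in> T \<and> Ck_on k T f"
  shows "Ck_on k S f"
  using assms
proof (induction k arbitrary: f)
  case 0
  have "\<exists>T. x \<in> T \<and> open T \<and> continuous_on T f" if "x \<in> S" for x
    using 0[OF that] by auto
  then have "isCont f x" if "x \<in> S" for x
    using that continuous_on_interior interior_open by metis
  then show ?case by (auto intro: continuous_at_imp_continuous_on)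
next
  case (Suc k)
  have "Ck_on k S (\<lambda>x. frechet_derivative f (at x) v)" for v
    by (rule Suc.IH) (use Suc.prems in fastforce)
  then show ?case using Suc.prems by fastforce
qed

lemma smooth_on_imp_Ck_on: "smooth_on S f \<Longrightarrow> Ck_on k S f"
  by (simp add: smooth_on_def)

lemma smooth_on_subset: "smooth_on S f \<Longrightarrow> T \<subseteq> S \<Longrightarrow> smooth_on T f"
  by (auto simp: smooth_on_def intro: Ck_on_subset)

lemma smooth_on_cong:
  "open S \<Longrightarrow> (\<And>x. x \<in> S \<Longrightarrow> f x = g x) \<Longrightarrow> smooth_on S f \<longleftrightarrow> smooth_on S g"
  by (simp add: smooth_on_def cong: Ck_on_cong)

lemma smooth_on_imp_continuous_on: "smooth_on S f \<Longrightarrow> continuous_on S f"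
  using Ck_on_imp_continuous_on smooth_on_def by blast

lemma smooth_on_has_derivative:
  "smooth_on S f \<Longrightarrow> x \<in> S \<Longrightarrow> (f has_derivative frechet_derivative f (at x)) (at x)"
  using Ck_on_has_derivative smooth_on_def by blast

lemma smooth_on_frechet_derivative:
  "smooth_on S f \<Longrightarrow> smooth_on S (\<lambda>x. frechet_derivative f (at x) v)"
  unfolding smooth_on_def using Ck_on_frechet_derivative by blast

lemma smooth_on_const: "open S \<Longrightarrow> smooth_on S (\<lambda>x. c)"
  by (simp add: smooth_on_def Ck_on_const)

lemma smooth_on_bounded_linear: "bounded_linear l \<Longrightarrow> open S \<Longrightarrow> smooth_on S l"
  by (simp add: smooth_on_def Ck_on_bounded_linear)

lemma smooth_on_linear_comp:
  "bounded_linear l \<Longrightarrow> open S \<Longrightarrow> smooth_on S f \<Longrightarrow> smooth_on S (\<lambda>x. l (f x))"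
  by (simp add: smooth_on_def Ck_on_linear_comp)

lemma smooth_on_add:
  "open S \<Longrightarrow> smooth_on S f \<Longrightarrow> smooth_on S g \<Longrightarrow> smooth_on S (\<lambda>x. f x + g x)"
  by (simp add: smooth_on_def Ck_on_add)

lemma smooth_on_sum:
  "open S \<Longrightarrow> (\<And>i. i \<in> I \<Longrightarrow> smooth_on S (f i)) \<Longrightarrow> smooth_on S (\<lambda>x. \<Sum>i\<in>I. f i x)"
  by (simp add: smooth_on_def Ck_on_sum)

lemma smooth_on_bilinear:
  "bounded_bilinear P \<Longrightarrow> open S \<Longrightarrow> smooth_on S f \<Longrightarrow> smooth_on S g \<Longrightarrow>
    smooth_on S (\<lambda>x. P (f x) (g x))"
  by (simp add: smooth_on_def Ck_on_bilinear)

lemmas smooth_on_mult = smooth_on_bilinear[OF bounded_bilinear_mult]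
lemmas smooth_on_scaleR = smooth_on_bilinear[OF bounded_bilinear_scaleR]
lemmas smooth_on_inner = smooth_on_bilinear[OF bounded_bilinear_inner]

lemma smooth_on_compose:
  fixes f :: "'a::euclidean_space \<Rightarrow> 'b::euclidean_space" and g :: "'b \<Rightarrow> 'c::real_normed_vector"
  assumes "open S" "open T" "f ` S \<subseteq> T" "smooth_on S f" "smooth_on T g"
  shows "smooth_on S (\<lambda>x. g (f x))"
  unfolding smooth_on_def
proof
  show "Ck_on k S (\<lambda>x. g (f x))" for k
    by (rule Ck_on_compose[OF assms(1-3) smooth_on_imp_Ck_on[OF assms(4)] smooth_on_imp_Ck_on[OF assms(5)]])
qed

lemma smooth_on_inverse:
  fixes f :: "'a::euclidean_space \<Rightarrow> real"
  shows "open S \<Longrightarrow> smooth_on S f \<Longrightarrow> (\<And>x. x \<in> S \<Longrightarrow> f x \<noteq> 0) \<Longrightarrow> smooth_on S (\<lambda>x. inverse (f x))"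
  by (simp add: smooth_on_def Ck_on_inverse)

lemma smooth_on_sqrt:
  fixes f :: "'a::euclidean_space \<Rightarrow> real"
  shows "open S \<Longrightarrow> smooth_on S f \<Longrightarrow> (\<And>x. x \<in> S \<Longrightarrow> f x > 0) \<Longrightarrow> smooth_on S (\<lambda>x. sqrt (f x))"
  by (simp add: smooth_on_def Ck_on_sqrt)

lemma smooth_on_local:
  assumes "\<And>x. x \<in> S \<Longrightarrow> \<exists>T. open T \<and> x \<in> T \<and> smooth_on T f"
  shows "smooth_on S f"
  unfolding smooth_on_def
proof
  show "Ck_on k S f" for k
  proof (rule Ck_on_local)
    fix x assume "x \<in> S"
    from assms[OF this] obtain T where "open T" "x \<in> T" "smooth_on T f" by blast
    then show "\<exists>T. open T \<and> x \<in> T \<and> Ck_on k T f" by (auto simp: smooth_on_def)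
  qed
qed

lemma smooth_on_componentwise:
  fixes f :: "'a::euclidean_space \<Rightarrow> real^'b"
  assumes "open S" "\<And>i. smooth_on S (\<lambda>x. f x $ i)"
  shows "smooth_on S f"
proof -
  have "smooth_on S (\<lambda>x. \<Sum>i\<in>UNIV. (f x $ i) *\<^sub>R axis i (1::real))"
    by (intro smooth_on_sum smooth_on_scaleR smooth_on_const assms)
  moreover have "(\<Sum>i\<in>UNIV. (f x $ i) *\<^sub>R axis i (1::real)) = f x" for x
    using basis_expansion[of "f x"] by (simp add: scalar_mult_eq_scaleR)
  ultimately show ?thesis by simp
qed

section \<open>Second derivatives, determinants and orthonormal frames\<close>

lemma smooth_on_derivative_along:
  fixes F :: "'a::euclidean_space \<Rightarrow> 'b::real_normed_vector"
  assumes "open S" "smooth_on S F" "smooth_on S E"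
  shows "smooth_on S (\<lambda>u. frechet_derivative F (at u) (E u))"
proof -
  have "smooth_on S (\<lambda>u. \<Sum>b\<in>Basis. (E u \<bullet> b) *\<^sub>R frechet_derivative F (at u) b)"
    using assms by (intro smooth_on_sum smooth_on_scaleR smooth_on_inner smooth_on_const
      smooth_on_frechet_derivative)
  moreover have "frechet_derivative F (at u) (E u)
      = (\<Sum>b\<in>Basis. (E u \<bullet> b) *\<^sub>R frechet_derivative F (at u) b)" if "u \<in> S" for u
    by (rule linear_componentwise_expansion)
       (rule has_derivative_linear[OF smooth_on_has_derivative[OF assms(2) that]])
  ultimately show ?thesis
    using assms(1) by (subst smooth_on_cong[where g="\<lambda>u. \<Sum>b\<in>Basis. (E u \<bullet> b) *\<^sub>R frechet_derivative F (at u) b"]) auto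
qed

lemma line_has_real_derivative:
  assumes "(f has_derivative f') (at (a + s *\<^sub>R v))"
  shows "((\<lambda>s. f (a + s *\<^sub>R v)) has_vector_derivative f' v) (at s)"
proof -
  have "((\<lambda>s. a + s *\<^sub>R v) has_derivative (\<lambda>h. h *\<^sub>R v)) (at s)"
    by (auto intro!: derivative_eq_intros)
  from has_derivative_compose[OF this assms]
  show ?thesis
    using linear_scale[OF has_derivative_linear[OF assms]]
    by (simp add: has_vector_derivative_def)
qed

text \<open>Both iterated derivatives are limits of the same second difference quotient.\<close>

lemma second_difference_mvt:
  fixes f :: "'a::euclidean_space \<Rightarrow> real"
  assumes S: "open S" "smooth_on S f" and t: "t > 0"
    and sub: "\<And>a b. 0 \<le> a \<Longrightarrow> a \<le> t \<Longrightarrow> 0 \<le> b \<Longrightarrow> b \<le> t \<Longrightarrow> x + a *\<^sub>R v + b *\<^sub>R w \<in> S"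
  obtains a b where "0 < a" "a < t" "0 < b" "b < t"
    "f (x + t *\<^sub>R v + t *\<^sub>R w) - f (x + t *\<^sub>R v) - f (x + t *\<^sub>R w) + f x
      = t * t * frechet_derivative (\<lambda>y. frechet_derivative f (at y) v)
          (at (x + a *\<^sub>R v + b *\<^sub>R w)) w"
proof -
  let ?d = "\<lambda>y. frechet_derivative f (at y)"
  let ?dd = "\<lambda>y. frechet_derivative (\<lambda>y. frechet_derivative f (at y) v) (at y)"
  have d: "((\<lambda>s. f (c + s *\<^sub>R v)) has_real_derivative ?d (c + s *\<^sub>R v) v) (at s)"
    if "c + s *\<^sub>R v \<in> S" for c s
    using line_has_real_derivative[OF smooth_on_has_derivative[OF S(2) that]]
    by (simp add: has_real_derivative_iff_has_vector_derivative)
  have dd: "((\<lambda>s. ?d (c + s *\<^sub>R w) v) has_real_derivative ?dd (c + s *\<^sub>R w) w) (at s)"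
    if "c + s *\<^sub>R w \<in> S" for c s
    using line_has_real_derivative[OF smooth_on_has_derivative[OF
        smooth_on_frechet_derivative[OF S(2)] that]]
    by (simp add: has_real_derivative_iff_has_vector_derivative)
  \<comment> \<open>The mean value theorem is applied to this difference in the direction
    \<open>v\<close>, and then to the resulting derivative in the direction
    \<open>w\<close>.\<close>
  define g where "g s = f ((x + t *\<^sub>R w) + s *\<^sub>R v) - f (x + s *\<^sub>R v)" for s
  have "\<exists>a>0. a < t \<and> g t - g 0 = (t - 0) *
      (?d ((x + t *\<^sub>R w) + a *\<^sub>R v) v - ?d (x + a *\<^sub>R v) v)"
  proof (rule MVT2)
    fix s assume s: "0 \<le> s" "s \<le> t"
    have "(x + t *\<^sub>R w) + s *\<^sub>R v \<in> S" "x + s *\<^sub>R v \<in> S"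
      using sub[of s t] sub[of s 0] s t by (simp_all add: algebra_simps)
    then show "(g has_real_derivative
      ?d ((x + t *\<^sub>R w) + s *\<^sub>R v) v - ?d (x + s *\<^sub>R v) v) (at s)"
      unfolding g_def by (intro DERIV_diff d)
  qed (use t in auto)
  then obtain a where a: "0 < a" "a < t"
    "g t - g 0 = t * (?d ((x + t *\<^sub>R w) + a *\<^sub>R v) v - ?d (x + a *\<^sub>R v) v)" by auto
  have "\<exists>b>0. b < t \<and> ?d ((x + a *\<^sub>R v) + t *\<^sub>R w) v - ?d ((x + a *\<^sub>R v) + 0 *\<^sub>R w) v = (t - 0) *
      ?dd ((x + a *\<^sub>R v) + b *\<^sub>R w) w"
    by (rule MVT2) (use t a in \<open>auto intro!: dd sub\<close>)
  then obtain b where b: "0 < b" "b < t"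
    "?d (x + a *\<^sub>R v + t *\<^sub>R w) v - ?d (x + a *\<^sub>R v) v = t * ?dd (x + a *\<^sub>R v + b *\<^sub>R w) w" by auto
  show thesis
  proof (rule that[of a b])
    have "x + t *\<^sub>R w + a *\<^sub>R v = x + a *\<^sub>R v + t *\<^sub>R w" "x + t *\<^sub>R w + t *\<^sub>R v = x + t *\<^sub>R v + t *\<^sub>R w" by simp_all
    with a(3) b(3) show "f (x + t *\<^sub>R v + t *\<^sub>R w) - f (x + t *\<^sub>R v) - f (x + t *\<^sub>R w) + f x
      = t * t * ?dd (x + a *\<^sub>R v + b *\<^sub>R w) w"
      by (simp add: g_def)
  qed (use a b in auto)
qed

lemma second_derivative_symmetric_real:
  fixes f :: "'a::euclidean_space \<Rightarrow> real"
  assumes S: "open S" "smooth_on S f" "x \<in> S"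
  shows "frechet_derivative (\<lambda>y. frechet_derivative f (at y) v) (at x) w
    = frechet_derivative (\<lambda>y. frechet_derivative f (at y) w) (at x) v"
proof -
  define p where "p y = frechet_derivative (\<lambda>y. frechet_derivative f (at y) v) (at y) w" for y
  define q where "q y = frechet_derivative (\<lambda>y. frechet_derivative f (at y) w) (at y) v" for y
  have "smooth_on S p" "smooth_on S q"
    unfolding p_def q_def by (intro smooth_on_frechet_derivative S)+
  then have "isCont p x" "isCont q x"
    using smooth_on_imp_continuous_on S(1,3) continuous_on_eq_continuous_at by blast+
  have "\<bar>p x - q x\<bar> \<le> 2 * e" if "e > 0" for e
  proof -
    obtain d1 where d1: "d1 > 0" "\<And>y. dist y x < d1 \<Longrightarrow> dist (p y) (p x) < e"
      using \<open>isCont p x\<close> \<open>e > 0\<close> unfolding continuous_at_eps_delta by blast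
    obtain d2 where d2: "d2 > 0" "\<And>y. dist y x < d2 \<Longrightarrow> dist (q y) (q x) < e"
      using \<open>isCont q x\<close> \<open>e > 0\<close> unfolding continuous_at_eps_delta by blast
    obtain d3 where d3: "d3 > 0" "ball x d3 \<subseteq> S"
      using S openE by blast
    define d where "d = min d1 (min d2 d3)"
    \<comment> \<open>So short that the parallelogram with sides \<open>t *\<^sub>R v\<close> and
      \<open>t *\<^sub>R w\<close> stays within \<open>d / 2\<close> of \<open>x\<close>; the
      summand 1 covers zero directions.\<close>
    define t where "t = d / (2 * (norm v + norm w + 1))"
    have "d > 0" using d1 d2 d3 by (simp add: d_def)
    have nz: "norm v + norm w + 1 > 0" by (smt (verit) norm_ge_zero)
    have t: "t > 0" using \<open>d > 0\<close> nz by (simp add: t_def)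
    have near: "dist (x + a *\<^sub>R v + b *\<^sub>R w) x < d" if "0 \<le> a" "a \<le> t" "0 \<le> b" "b \<le> t" for a b
    proof -
      have "dist (x + a *\<^sub>R v + b *\<^sub>R w) x = norm (a *\<^sub>R v + b *\<^sub>R w)" by (simp add: dist_norm)
      also have "\<dots> \<le> a * norm v + b * norm w"
        using that norm_triangle_ineq[of "a *\<^sub>R v" "b *\<^sub>R w"] by simp
      also have "\<dots> \<le> t * norm v + t * norm w"
        using that by (intro add_mono mult_right_mono) auto
      also have "\<dots> \<le> t * (norm v + norm w + 1)" using t by (simp add: algebra_simps)
      also have "\<dots> = d / 2" using nz by (simp add: t_def field_simps)
      finally show ?thesis using \<open>d > 0\<close> by simp
    qed
    have sub: "x + a *\<^sub>R v + b *\<^sub>R w \<in> S" if "0 \<le> a" "a \<le> t" "0 \<le> b" "b \<le> t" for a b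
    proof -
      have "x + a *\<^sub>R v + b *\<^sub>R w \<in> ball x d3"
        using near[OF that] by (simp add: d_def dist_commute)
      then show ?thesis using d3(2) by blast
    qed
    have sub': "x + a *\<^sub>R w + b *\<^sub>R v \<in> S" if "0 \<le> a" "a \<le> t" "0 \<le> b" "b \<le> t" for a b
    proof -
      have "x + a *\<^sub>R w + b *\<^sub>R v = x + b *\<^sub>R v + a *\<^sub>R w" by simp
      then show ?thesis using sub[of b a] that by (simp only:)
    qed
    obtain a b where ab: "0 < a" "a < t" "0 < b" "b < t"
      "f (x + t *\<^sub>R v + t *\<^sub>R w) - f (x + t *\<^sub>R v) - f (x + t *\<^sub>R w) + f x
        = t * t * p (x + a *\<^sub>R v + b *\<^sub>R w)"
      unfolding p_def by (rule second_difference_mvt[OF S(1,2) t sub])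
    obtain a' b' where ab': "0 < a'" "a' < t" "0 < b'" "b' < t"
      "f (x + t *\<^sub>R w + t *\<^sub>R v) - f (x + t *\<^sub>R w) - f (x + t *\<^sub>R v) + f x
        = t * t * q (x + a' *\<^sub>R w + b' *\<^sub>R v)"
      unfolding q_def by (rule second_difference_mvt[OF S(1,2) t sub'])
    have c: "x + t *\<^sub>R w + t *\<^sub>R v = x + t *\<^sub>R v + t *\<^sub>R w" by simp
    have "t * t * p (x + a *\<^sub>R v + b *\<^sub>R w) = t * t * q (x + a' *\<^sub>R w + b' *\<^sub>R v)"
      using ab(5) ab'(5) unfolding c by linarith
    moreover have "x + a' *\<^sub>R w + b' *\<^sub>R v = x + b' *\<^sub>R v + a' *\<^sub>R w" by simp
    ultimately have eq: "p (x + a *\<^sub>R v + b *\<^sub>R w) = q (x + b' *\<^sub>R v + a' *\<^sub>R w)"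
      using t by simp
    have "dist (p (x + a *\<^sub>R v + b *\<^sub>R w)) (p x) < e" "dist (q (x + b' *\<^sub>R v + a' *\<^sub>R w)) (q x) < e"
      using near[of a b] near[of b' a'] ab ab' by (auto intro!: d1 d2 simp: d_def)
    then show ?thesis using eq by (auto simp: dist_real_def)
  qed
  then have "\<bar>p x - q x\<bar> \<le> 0 + e" if "e > 0" for e
    using that half_gt_zero[OF that] by fastforce
  then have "\<bar>p x - q x\<bar> \<le> 0" by (rule field_le_epsilon)
  then have "p x = q x" by simp
  then show ?thesis by (simp add: p_def q_def)
qed

lemma frechet_derivative_inner:
  assumes "(f has_derivative f') (at x)"
  shows "frechet_derivative (\<lambda>y. f y \<bullet> b) (at x) v = frechet_derivative f (at x) v \<bullet> b"
proof -
  have "((\<lambda>y. f y \<bullet> b) has_derivative (\<lambda>v. f' v \<bullet> b)) (at x)"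
    using assms by (auto intro!: derivative_eq_intros)
  then show ?thesis
    using frechet_derivative_at[OF assms] frechet_derivative_at[of "\<lambda>y. f y \<bullet> b"] by metis
qed

lemma frechet_derivative_cong_open:
  assumes "open S" "x \<in> S" "\<And>y. y \<in> S \<Longrightarrow> f y = g y"
  shows "frechet_derivative f (at x) = frechet_derivative g (at x)"
proof -
  have "(f has_derivative D) (at x) \<longleftrightarrow> (g has_derivative D) (at x)" for D
    using assms has_derivative_transform_within_open by metis
  then show ?thesis by (simp add: frechet_derivative_def)
qed

lemma second_derivative_symmetric:
  fixes f :: "'a::euclidean_space \<Rightarrow> 'b::euclidean_space"
  assumes S: "open S" "smooth_on S f" "x \<in> S"
  shows "frechet_derivative (\<lambda>y. frechet_derivative f (at y) v) (at x) w
    = frechet_derivative (\<lambda>y. frechet_derivative f (at y) w) (at x) v"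
proof (rule euclidean_eqI)
  fix b :: 'b assume "b \<in> Basis"
  have sm: "smooth_on S (\<lambda>y. f y \<bullet> b)"
    by (intro smooth_on_inner smooth_on_const S)
  have 1: "frechet_derivative (\<lambda>y. f y \<bullet> b) (at y) v = frechet_derivative f (at y) v \<bullet> b" if "y \<in> S" for y v
    using frechet_derivative_inner[OF smooth_on_has_derivative[OF S(2) that]] .
  have 2: "frechet_derivative (\<lambda>y. frechet_derivative f (at y) v) (at x) w \<bullet> b
     = frechet_derivative (\<lambda>y. frechet_derivative (\<lambda>y. f y \<bullet> b) (at y) v) (at x) w" for v w
  proof -
    have "frechet_derivative (\<lambda>y. frechet_derivative f (at y) v) (at x) w \<bullet> b
      = frechet_derivative (\<lambda>y. frechet_derivative f (at y) v \<bullet> b) (at x) w"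
      by (rule frechet_derivative_inner[OF smooth_on_has_derivative[OF smooth_on_frechet_derivative[OF S(2)] S(3)], symmetric])
    also have "\<dots> = frechet_derivative (\<lambda>y. frechet_derivative (\<lambda>y. f y \<bullet> b) (at y) v) (at x) w"
      by (rule fun_cong[OF frechet_derivative_cong_open[OF S(1,3)]]) (simp add: 1)
    finally show ?thesis .
  qed
  show "frechet_derivative (\<lambda>y. frechet_derivative f (at y) v) (at x) w \<bullet> b =
    frechet_derivative (\<lambda>y. frechet_derivative f (at y) w) (at x) v \<bullet> b"
    unfolding 2 by (rule second_derivative_symmetric_real[OF S(1) sm S(3)])
qed

text \<open>In the Leibniz formula a permutation other than the identity moves at least two indices.
  Differentiating one factor leaves another off-diagonal entry, which is zero at the identity, so
  only the diagonal product contributes.\<close>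

lemma has_derivative_det_at_identity:
  fixes M :: "'a::real_normed_vector \<Rightarrow> real^'n^'n"
  assumes M: "\<And>i j. ((\<lambda>x. M x $ i $ j) has_derivative M' i j) (at x)" and 1: "M x = mat 1"
  shows "((\<lambda>x. det (M x)) has_derivative (\<lambda>v. \<Sum>i\<in>UNIV. M' i i v)) (at x)"
proof -
  let ?P = "{p. p permutes (UNIV :: 'n set)}"
  have "((\<lambda>x. det (M x)) has_derivative (\<lambda>v. \<Sum>p\<in>?P. of_int (sign p) *
      (\<Sum>i\<in>UNIV. M' i (p i) v * (\<Prod>j\<in>UNIV - {i}. M x $ j $ p j)))) (at x)"
    unfolding det_def by (intro has_derivative_sum has_derivative_mult_right has_derivative_prod M)
  moreover have "(\<Sum>p\<in>?P. of_int (sign p) *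
      (\<Sum>i\<in>UNIV. M' i (p i) v * (\<Prod>j\<in>UNIV - {i}. M x $ j $ p j))) = (\<Sum>i\<in>UNIV. M' i i v)" for v
  proof -
    have z: "of_int (sign p) * (\<Sum>i\<in>UNIV. M' i (p i) v * (\<Prod>j\<in>UNIV - {i}. M x $ j $ p j)) = 0"
      if "p \<in> ?P - {id}" for p
    proof -
      have "(\<Prod>j\<in>UNIV - {i}. M x $ j $ p j) = 0" for i
      proof -
        have "\<exists>j. j \<noteq> i \<and> p j \<noteq> j"
        proof (rule ccontr)
          assume "\<not> ?thesis"
          then have a: "\<And>j. j \<noteq> i \<Longrightarrow> p j = j" by blast
          have "p i = i"
          proof (rule ccontr)
            assume "p i \<noteq> i"
            then have "p (p i) = p i" by (rule a)
            then show False using \<open>p i \<noteq> i\<close> that by (auto dest!: permutes_inj simp: inj_def)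
          qed
          have "p = id"
          proof
            show "p j = id j" for j using a[of j] \<open>p i = i\<close> by (cases "j = i") simp_all
          qed
          then show False using that by blast
        qed
        then obtain j where "j \<noteq> i" "p j \<noteq> j" by blast
        then have "M x $ j $ p j = 0" using 1 by (simp add: mat_def)
        then show ?thesis using \<open>j \<noteq> i\<close> by (intro prod_zero) auto
      qed
      then show ?thesis by (simp only: mult_zero_right sum.neutral_const)
    qed
    have "(\<Sum>p\<in>?P. of_int (sign p) *
      (\<Sum>i\<in>UNIV. M' i (p i) v * (\<Prod>j\<in>UNIV - {i}. M x $ j $ p j)))
      = (\<Sum>p\<in>{id}. of_int (sign p) * (\<Sum>i\<in>UNIV. M' i (p i) v * (\<Prod>j\<in>UNIV - {i}. M x $ j $ p j)))"
      using z by (intro sum.mono_neutral_right) (auto simp: finite_permutations permutes_id)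
    also have "\<dots> = (\<Sum>i\<in>UNIV. M' i i v)" using 1 by (simp add: mat_def sign_id)
    finally show ?thesis .
  qed
  ultimately show ?thesis by simp
qed

text \<open>Gram-Schmidt, carried out smoothly in the parameter. The clause on vanishing coordinates
  keeps the earlier vectors in the span of the axes from \<open>I\<close>; hence the new vector has
  \<open>a\<close>-th coordinate 1 and cannot vanish before normalisation.\<close>

lemma orthonormal_frame_exists_on:
  fixes F :: "real^'n \<Rightarrow> 'e::euclidean_space" and I :: "'n::finite set"
  assumes S: "open S" "smooth_on S F" "\<And>u. u \<in> S \<Longrightarrow> inj (frechet_derivative F (at u))"
  shows "\<exists>E. (\<forall>i\<in>I. smooth_on S (E i)) \<and> (\<forall>u\<in>S. \<forall>i\<in>I. \<forall>k. k \<notin> I \<longrightarrow> E i u $ k = 0) \<and>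
    (\<forall>u\<in>S. \<forall>i\<in>I. \<forall>j\<in>I. frechet_derivative F (at u) (E i u) \<bullet> frechet_derivative F (at u) (E j u)
       = (if i = j then 1 else 0))"
  using finite[of I]
proof (induction I)
  case (insert a I)
  let ?d = "\<lambda>u. frechet_derivative F (at u)"
  have lin: "linear (?d u)" if "u \<in> S" for u
    using has_derivative_linear[OF smooth_on_has_derivative[OF S(2) that]] .
  from insert obtain E where sm: "\<And>i. i \<in> I \<Longrightarrow> smooth_on S (E i)"
    and sp: "\<And>u i k. u \<in> S \<Longrightarrow> i \<in> I \<Longrightarrow> k \<notin> I \<Longrightarrow> E i u $ k = 0"
    and on: "\<And>u i j. u \<in> S \<Longrightarrow> i \<in> I \<Longrightarrow> j \<in> I \<Longrightarrow> ?d u (E i u) \<bullet> ?d u (E j u) = (if i = j then 1 else 0)"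
    by blast
  define w where "w u = axis a 1 - (\<Sum>j\<in>I. (?d u (axis a 1) \<bullet> ?d u (E j u)) *\<^sub>R E j u)" for u
  have wa: "w u $ a = 1" if "u \<in> S" for u
    using sp[OF that] insert.hyps by (simp add: w_def axis_def sum.neutral)
  have wk: "w u $ k = 0" if "u \<in> S" "k \<notin> insert a I" for u k
    using sp[OF that(1)] that by (simp add: w_def axis_def sum.neutral)
  have smE: "smooth_on S (\<lambda>u. ?d u (E j u))" if "j \<in> I" for j
    by (intro smooth_on_derivative_along S sm that)
  have smw: "smooth_on S w"
  proof -
    have "smooth_on S (\<lambda>u. axis a 1 + - (\<Sum>j\<in>I. (?d u (axis a 1) \<bullet> ?d u (E j u)) *\<^sub>R E j u))"
      by (intro smooth_on_add smooth_on_const smooth_on_sum smooth_on_linear_comp[OF bounded_linear_minus[OF bounded_linear_ident]]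
        smooth_on_scaleR smooth_on_inner smE sm smooth_on_frechet_derivative S)
    then show ?thesis by (simp add: w_def[abs_def])
  qed
  have wn: "?d u (w u) \<noteq> 0" if "u \<in> S" for u
  proof
    assume "?d u (w u) = 0"
    then have "?d u (w u) = ?d u 0" using linear_0[OF lin[OF that]] by simp
    then have "w u = 0" using S(3)[OF that] by (auto dest: injD)
    then show False using wa[OF that] by simp
  qed
  define N where "N u = ?d u (w u) \<bullet> ?d u (w u)" for u
  have Np: "N u > 0" if "u \<in> S" for u using wn[OF that] by (simp add: N_def)
  have smN: "smooth_on S N"
    unfolding N_def by (intro smooth_on_inner smooth_on_derivative_along S smw)
  define e where "e u = inverse (sqrt (N u)) *\<^sub>R w u" for u
  have sme: "smooth_on S e"
    unfolding e_def using Np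
    by (intro smooth_on_scaleR smooth_on_inverse smooth_on_sqrt S smN smw) (auto simp: less_imp_neq[symmetric])
  have ew: "?d u (e u) = inverse (sqrt (N u)) *\<^sub>R ?d u (w u)" if "u \<in> S" for u
    by (simp add: e_def linear_scale[OF lin[OF that]])
  have worth: "?d u (w u) \<bullet> ?d u (E i u) = 0" if "u \<in> S" "i \<in> I" for u i
  proof -
    have "?d u (w u) = ?d u (axis a 1) - (\<Sum>j\<in>I. (?d u (axis a 1) \<bullet> ?d u (E j u)) *\<^sub>R ?d u (E j u))"
      by (simp add: w_def linear_diff[OF lin[OF that(1)]] linear_sum[OF lin[OF that(1)]] linear_scale[OF lin[OF that(1)]])
    moreover have "(\<Sum>j\<in>I. (?d u (axis a 1) \<bullet> ?d u (E j u)) * (?d u (E j u) \<bullet> ?d u (E i u)))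
      = (\<Sum>j\<in>I. if j = i then ?d u (axis a 1) \<bullet> ?d u (E i u) else 0)"
      using on[OF that(1) _ that(2)] by (intro sum.cong) auto
    ultimately show ?thesis
      using that(2) insert.hyps by (simp add: inner_diff_left inner_sum_left)
  qed
  have eorth: "?d u (e u) \<bullet> ?d u (E i u) = 0" if "u \<in> S" "i \<in> I" for u i
    using worth[OF that] ew[OF that(1)] by simp
  have en: "?d u (e u) \<bullet> ?d u (e u) = 1" if "u \<in> S" for u
    using Np[OF that] ew[OF that] by (simp add: N_def[symmetric] field_simps)
  define E' where "E' i = (if i = a then e else E i)" for i
  have "\<forall>i\<in>insert a I. smooth_on S (E' i)"
    using sm sme by (simp add: E'_def)
  moreover have "\<forall>u\<in>S. \<forall>i\<in>insert a I. \<forall>k. k \<notin> insert a I \<longrightarrow> E' i u $ k = 0"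
    using sp wk insert.hyps by (auto simp: E'_def e_def)
  moreover have "\<forall>u\<in>S. \<forall>i\<in>insert a I. \<forall>j\<in>insert a I. ?d u (E' i u) \<bullet> ?d u (E' j u) = (if i = j then 1 else 0)"
    using on eorth en insert.hyps by (auto simp: E'_def inner_commute)
  ultimately show ?case by blast
qed simp

section \<open>Tangential calculus on a hypersurface\<close>

locale hypersurface =
  fixes \<A> :: "('m::{t2_space,second_countable_topology}, 'n::finite) chart set"
    and F \<nu> :: "'m \<Rightarrow> real^'k"
  assumes card_k: "CARD('k) = CARD('n) + 1"
    and atlas: "smooth_atlas \<A>"
    and imm: "immersion \<A> F"
    and normal: "unit_normal_field \<A> F \<nu>"
begin

lemma chart_open: "c \<in> \<A> \<Longrightarrow> open (fst c)"
  and chart_image_open: "c \<in> \<A> \<Longrightarrow> open (chart_image c)"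
  and chart_homeomorphism:
    "c \<in> \<A> \<Longrightarrow> homeomorphism (fst c) (chart_image c) (snd c) (chart_inv c)"
  using atlas by (auto simp: smooth_atlas_def)

lemma chart_inv_apply [simp]: "c \<in> \<A> \<Longrightarrow> p \<in> fst c \<Longrightarrow> chart_inv c (snd c p) = p"
  and chart_apply_inv [simp]: "c \<in> \<A> \<Longrightarrow> u \<in> chart_image c \<Longrightarrow> snd c (chart_inv c u) = u"
  and chart_inv_in [simp]: "c \<in> \<A> \<Longrightarrow> u \<in> chart_image c \<Longrightarrow> chart_inv c u \<in> fst c"
  and continuous_on_chart: "c \<in> \<A> \<Longrightarrow> continuous_on (fst c) (snd c)"
  and continuous_on_chart_inv: "c \<in> \<A> \<Longrightarrow> continuous_on (chart_image c) (chart_inv c)"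
  using chart_homeomorphism[of c] by (auto simp: homeomorphism_def)

lemma chart_in_image [simp]: "p \<in> fst c \<Longrightarrow> snd c p \<in> chart_image c"
  by (simp add: chart_image_def)

lemma ex_chart: obtains c where "c \<in> \<A>" "p \<in> fst c"
  using atlas unfolding smooth_atlas_def by (metis UNIV_I UN_iff)

lemma smooth_map_chart:
  "smooth_map \<A> Y \<Longrightarrow> c \<in> \<A> \<Longrightarrow> smooth_on (chart_image c) (\<lambda>u. Y (chart_inv c u))"
  by (auto simp: smooth_map_def o_def)

lemma smooth_mapI:
  "(\<And>c. c \<in> \<A> \<Longrightarrow> smooth_on (chart_image c) (\<lambda>u. Y (chart_inv c u))) \<Longrightarrow> smooth_map \<A> Y"
  by (auto simp: smooth_map_def o_def)

lemma continuous_on_if_chart: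
  fixes Y :: "'m \<Rightarrow> 'e::topological_space"
  assumes "\<And>c. c \<in> \<A> \<Longrightarrow> continuous_on (chart_image c) (\<lambda>u. Y (chart_inv c u))"
  shows "continuous_on UNIV Y"
proof (rule continuous_at_imp_continuous_on, rule ballI)
  fix p
  obtain c where c: "c \<in> \<A>" "p \<in> fst c" by (rule ex_chart)
  have "continuous_on (fst c) (\<lambda>q. Y (chart_inv c (snd c q)))"
    by (rule continuous_on_compose2[OF assms[OF c(1)] continuous_on_chart[OF c(1)]])
       (auto simp: chart_image_def)
  then have "continuous_on (fst c) Y"
    using c(1) by (simp cong: continuous_on_cong)
  then show "isCont Y p"
    using c chart_open continuous_on_eq_continuous_at by blast
qed

lemma smooth_map_continuous: "smooth_map \<A> Y \<Longrightarrow> continuous_on UNIV Y"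
  by (rule continuous_on_if_chart) (rule smooth_on_imp_continuous_on[OF smooth_map_chart])

definition dF :: "('m, 'n) chart \<Rightarrow> real^'n \<Rightarrow> real^'n \<Rightarrow> real^'k" where
  "dF c u = frechet_derivative (\<lambda>u. F (chart_inv c u)) (at u)"

lemma smooth_F: "smooth_map \<A> F" and smooth_\<nu>: "smooth_map \<A> \<nu>"
  using imm normal by (auto simp: immersion_def unit_normal_field_def)

lemma F_has_derivative:
  "c \<in> \<A> \<Longrightarrow> u \<in> chart_image c \<Longrightarrow> ((\<lambda>u. F (chart_inv c u)) has_derivative dF c u) (at u)"
  unfolding dF_def by (rule smooth_on_has_derivative[OF smooth_map_chart[OF smooth_F]])

lemma linear_dF: "c \<in> \<A> \<Longrightarrow> u \<in> chart_image c \<Longrightarrow> linear (dF c u)"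
  using F_has_derivative has_derivative_linear by blast

lemma euclidean_deriv_F: "euclidean_deriv c p v F = dF c (snd c p) v"
  by (simp add: euclidean_deriv_def dF_def o_def)

lemma inj_dF: "c \<in> \<A> \<Longrightarrow> u \<in> chart_image c \<Longrightarrow> inj (dF c u)"
  using imm unfolding immersion_def euclidean_deriv_F by (metis chart_apply_inv chart_inv_in)

lemma norm_\<nu> [simp]: "norm (\<nu> p) = 1"
  using normal by (simp add: unit_normal_field_def)

lemma \<nu>_\<nu> [simp]: "\<nu> p \<bullet> \<nu> p = 1"
  using norm_\<nu>[of p] unfolding norm_eq_1 .

lemma dF_normal: "c \<in> \<A> \<Longrightarrow> u \<in> chart_image c \<Longrightarrow> dF c u v \<bullet> \<nu> (chart_inv c u) = 0"
  using normal unfolding unit_normal_field_def euclidean_deriv_F by (metis chart_apply_inv chart_inv_in)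

lemma dF_normal': "c \<in> \<A> \<Longrightarrow> p \<in> fst c \<Longrightarrow> dF c (snd c p) v \<bullet> \<nu> p = 0"
  using dF_normal[of c "snd c p"] by simp

lemma ex_frame:
  assumes "c \<in> \<A>"
  obtains E :: "'n \<Rightarrow> real^'n \<Rightarrow> real^'n" where "\<And>i. smooth_on (chart_image c) (E i)"
    "\<And>u i j. u \<in> chart_image c \<Longrightarrow> dF c u (E i u) \<bullet> dF c u (E j u) = (if i = j then 1 else 0)"
proof -
  have "\<exists>E. (\<forall>i\<in>UNIV. smooth_on (chart_image c) (E i)) \<and>
    (\<forall>u\<in>chart_image c. \<forall>i\<in>(UNIV::'n set). \<forall>k. k \<notin> (UNIV::'n set) \<longrightarrow> E i u $ k = 0) \<and>
    (\<forall>u\<in>chart_image c. \<forall>i\<in>UNIV. \<forall>j\<in>UNIV. dF c u (E i u) \<bullet> dF c u (E j u) = (if i = j then 1 else 0))"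
    unfolding dF_def
    by (rule orthonormal_frame_exists_on[OF chart_image_open[OF assms] smooth_map_chart[OF smooth_F assms]])
       (rule inj_dF[OF assms, unfolded dF_def])
  then obtain E :: "'n \<Rightarrow> real^'n \<Rightarrow> real^'n" where E: "\<forall>i\<in>UNIV. smooth_on (chart_image c) (E i)"
    "\<forall>u\<in>chart_image c. \<forall>i\<in>UNIV. \<forall>j\<in>UNIV. dF c u (E i u) \<bullet> dF c u (E j u) = (if i = j then 1 else 0)"
    by (elim exE conjE)
  show thesis by (rule that[of E]) (use E in simp_all)
qed

text \<open>Together with the normal, the frame consists of \<open>CARD('n) + 1 = CARD('k)\<close> orthonormal
  vectors, so it spans.\<close>

lemma orthogonal_frame_eq_0:
  fixes e :: "'n \<Rightarrow> real^'k"
  assumes e: "\<And>i j. e i \<bullet> e j = (if i = j then 1 else 0)" "\<And>i. e i \<bullet> \<nu> p = 0"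
    and w: "w \<bullet> \<nu> p = 0" "\<And>i. w \<bullet> e i = 0"
  shows "w = 0"
proof -
  have "inj e"
    by (rule injI) (metis e(1) zero_neq_one)
  moreover have "\<nu> p \<notin> range e"
    using e(2) \<nu>_\<nu>[of p] by (metis imageE zero_neq_one)
  ultimately have card: "card (insert (\<nu> p) (range e)) = CARD('k)"
    using card_k by (simp add: card_image)
  have "pairwise orthogonal (insert (\<nu> p) (range e))"
    using e by (auto simp: pairwise_def orthogonal_def inner_commute)
  moreover have "e i \<noteq> 0" "\<nu> p \<noteq> 0" for i
    using e(1)[of i i] norm_\<nu>[of p] by (force, metis norm_zero zero_neq_one)
  ultimately have "independent (insert (\<nu> p) (range e))"
    by (intro pairwise_orthogonal_independent) auto
  then have "w \<in> span (insert (\<nu> p) (range e))"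
    using card_ge_dim_independent[of "insert (\<nu> p) (range e)" UNIV] card by (simp add: subset_iff)
  moreover have "orthogonal w x" if "x \<in> insert (\<nu> p) (range e)" for x
    using that w by (auto simp: orthogonal_def)
  ultimately have "orthogonal w w"
    using orthogonal_to_span by blast
  then show ?thesis by (simp add: orthogonal_def)
qed

lemma frame_expansion:
  fixes e :: "'n \<Rightarrow> real^'k"
  assumes e: "\<And>i j. e i \<bullet> e j = (if i = j then 1 else 0)" "\<And>i. e i \<bullet> \<nu> p = 0"
  shows "(\<Sum>i\<in>UNIV. (x \<bullet> e i) *\<^sub>R e i) = x - (x \<bullet> \<nu> p) *\<^sub>R \<nu> p"
proof -
  let ?w = "x - (x \<bullet> \<nu> p) *\<^sub>R \<nu> p - (\<Sum>i\<in>UNIV. (x \<bullet> e i) *\<^sub>R e i)"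
  have "?w = 0"
  proof (rule orthogonal_frame_eq_0[OF e])
    show "?w \<bullet> \<nu> p = 0"
      by (simp add: inner_diff_left inner_sum_left e(2))
    show "?w \<bullet> e j = 0" for j
    proof -
      have "(\<Sum>i\<in>UNIV. (x \<bullet> e i) * (e i \<bullet> e j)) = (\<Sum>i\<in>UNIV. if i = j then x \<bullet> e j else 0)"
        by (intro sum.cong) (auto simp: e(1))
      moreover have "\<nu> p \<bullet> e j = 0" using e(2)[of j] by (simp add: inner_commute)
      ultimately show ?thesis
        by (simp add: inner_diff_left inner_sum_left)
    qed
  qed
  then show ?thesis by simp
qed

lemma frame_coordinates:
  fixes E :: "'n \<Rightarrow> real^'n"
  assumes c: "c \<in> \<A>" "u \<in> chart_image c"
    and E: "\<And>i j. dF c u (E i) \<bullet> dF c u (E j) = (if i = j then 1 else 0)"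
  shows "(\<Sum>i\<in>UNIV. (dF c u v \<bullet> dF c u (E i)) *\<^sub>R E i) = v"
proof -
  note lin = linear_dF[OF c]
  have "dF c u (\<Sum>i\<in>UNIV. (dF c u v \<bullet> dF c u (E i)) *\<^sub>R E i)
      = (\<Sum>i\<in>UNIV. (dF c u v \<bullet> dF c u (E i)) *\<^sub>R dF c u (E i))"
    by (simp add: linear_sum[OF lin] linear_scale[OF lin])
  also have "\<dots> = dF c u v"
    by (subst frame_expansion[where p="chart_inv c u" and e="\<lambda>i. dF c u (E i)"])
       (simp_all add: dF_normal[OF c] E)
  finally show ?thesis using inj_dF[OF c] by (simp add: inj_eq)
qed

text \<open>Surjectivity of the differential onto the orthogonal complement of \<open>\<nu>\<close>:
  it allows tangent vectors to be handled as ambient vectors throughout.\<close>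

lemma tangent_vector_eq_dF:
  assumes c: "c \<in> \<A>" "p \<in> fst c" and x: "x \<bullet> \<nu> p = 0"
  obtains v where "dF c (snd c p) v = x"
proof -
  let ?u = "snd c p"
  have u: "?u \<in> chart_image c" using c by simp
  obtain E :: "'n \<Rightarrow> real^'n \<Rightarrow> real^'n" where "\<And>i. smooth_on (chart_image c) (E i)"
    and E: "\<And>u i j. u \<in> chart_image c \<Longrightarrow> dF c u (E i u) \<bullet> dF c u (E j u) = (if i = j then 1 else 0)"
    using ex_frame[OF c(1)] by blast
  note lin = linear_dF[OF c(1) u]
  have "dF c ?u (\<Sum>i\<in>UNIV. (x \<bullet> dF c ?u (E i ?u)) *\<^sub>R E i ?u)
      = (\<Sum>i\<in>UNIV. (x \<bullet> dF c ?u (E i ?u)) *\<^sub>R dF c ?u (E i ?u))"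
    by (simp add: linear_sum[OF lin] linear_scale[OF lin])
  also have "\<dots> = x"
    by (subst frame_expansion[where p=p and e="\<lambda>i. dF c ?u (E i ?u)"])
       (simp_all add: dF_normal'[OF c] x E[OF u])
  finally show thesis by (rule that)
qed

section \<open>Change of charts and the tangential gradient\<close>

lemma
  assumes c: "c \<in> \<A>" "p \<in> fst c" and c': "c' \<in> \<A>" "p \<in> fst c'"
  shows transition_has_derivative: "((\<lambda>u. snd c (chart_inv c' u)) has_derivative
      frechet_derivative (\<lambda>u. snd c (chart_inv c' u)) (at (snd c' p))) (at (snd c' p))"
    and transition_eventually: "eventually (\<lambda>u. u \<in> chart_image c' \<and> chart_inv c' u \<in> fst c) (nhds (snd c' p))"
proof -
  have "smooth_on (snd c' ` (fst c' \<inter> fst c)) (\<lambda>u. snd c (chart_inv c' u))"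
    using atlas c c' by (auto simp: smooth_atlas_def o_def)
  then show "((\<lambda>u. snd c (chart_inv c' u)) has_derivative
      frechet_derivative (\<lambda>u. snd c (chart_inv c' u)) (at (snd c' p))) (at (snd c' p))"
    by (rule smooth_on_has_derivative) (use c c' in auto)
  have "open (chart_image c' \<inter> chart_inv c' -` fst c)"
    using continuous_on_chart_inv[OF c'(1)] chart_image_open[OF c'(1)] chart_open[OF c(1)]
    by (simp add: continuous_on_open_vimage Int_commute)
  then show "eventually (\<lambda>u. u \<in> chart_image c' \<and> chart_inv c' u \<in> fst c) (nhds (snd c' p))"
    unfolding eventually_nhds using c c' by (intro exI[of _ "chart_image c' \<inter> chart_inv c' -` fst c"]) auto
qed

lemma change_of_chart_derivative:
  fixes f :: "'m \<Rightarrow> 'e::real_normed_vector"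
  assumes c: "c \<in> \<A>" "p \<in> fst c" and c': "c' \<in> \<A>" "p \<in> fst c'"
    and f: "((\<lambda>u. f (chart_inv c u)) has_derivative f') (at (snd c p))"
  shows "((\<lambda>u. f (chart_inv c' u)) has_derivative
     (\<lambda>v. f' (frechet_derivative (\<lambda>u. snd c (chart_inv c' u)) (at (snd c' p)) v))) (at (snd c' p))"
proof -
  let ?t = "\<lambda>u. snd c (chart_inv c' u)"
  have "((\<lambda>u. f (chart_inv c (?t u))) has_derivative
     (\<lambda>v. f' (frechet_derivative ?t (at (snd c' p)) v))) (at (snd c' p))"
    by (rule has_derivative_compose[OF transition_has_derivative[OF c c']]) (simp add: c c' f)
  moreover have "eventually (\<lambda>u. f (chart_inv c (?t u)) = f (chart_inv c' u)) (nhds (snd c' p))"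
    using transition_eventually[OF c c'] by eventually_elim (simp add: c)
  then have "eventually (\<lambda>u. f (chart_inv c (?t u)) = f (chart_inv c' u)) (at (snd c' p))"
    by (simp add: eventually_nhds_conv_at)
  ultimately show ?thesis
    by (rule has_derivative_transform_eventually) (simp_all add: c c')
qed

text \<open>The differential is represented by an ambient vector paired with \<open>dF\<close>,
  which avoids the inverse of the metric; orthogonality to \<open>\<nu>\<close> makes the vector
  unique.\<close>

definition has_tgrad :: "('m \<Rightarrow> real) \<Rightarrow> real^'k \<Rightarrow> 'm \<Rightarrow> bool" where
  "has_tgrad f g p \<longleftrightarrow> g \<bullet> \<nu> p = 0 \<and> (\<forall>c\<in>\<A>. p \<in> fst c \<longrightarrow>
     ((\<lambda>u. f (chart_inv c u)) has_derivative (\<lambda>v. g \<bullet> dF c (snd c p) v)) (at (snd c p)))"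

text \<open>One chart suffices: in another chart both \<open>f\<close> and \<open>F\<close> are
  precomposed with the same transition map, so the representing vector does not change.\<close>

lemma has_tgradI:
  assumes c: "c \<in> \<A>" "p \<in> fst c" and g: "g \<bullet> \<nu> p = 0"
    and f: "((\<lambda>u. f (chart_inv c u)) has_derivative (\<lambda>v. g \<bullet> dF c (snd c p) v)) (at (snd c p))"
  shows "has_tgrad f g p"
  unfolding has_tgrad_def
proof (intro conjI ballI impI g)
  fix c' assume c': "c' \<in> \<A>" "p \<in> fst c'"
  let ?T = "frechet_derivative (\<lambda>u. snd c (chart_inv c' u)) (at (snd c' p))"
  have "((\<lambda>u. F (chart_inv c' u)) has_derivative (\<lambda>v. dF c (snd c p) (?T v))) (at (snd c' p))"
    by (rule change_of_chart_derivative[OF c c']) (simp add: F_has_derivative c)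
  moreover have "((\<lambda>u. F (chart_inv c' u)) has_derivative dF c' (snd c' p)) (at (snd c' p))"
    using c' by (simp add: F_has_derivative)
  ultimately have "dF c' (snd c' p) = (\<lambda>v. dF c (snd c p) (?T v))"
    using has_derivative_unique by blast
  then show "((\<lambda>u. f (chart_inv c' u)) has_derivative (\<lambda>v. g \<bullet> dF c' (snd c' p) v)) (at (snd c' p))"
    using change_of_chart_derivative[OF c c' f] by simp
qed

lemma has_tgrad_chart:
  assumes "has_tgrad f g p" "c \<in> \<A>" "p \<in> fst c"
  shows "((\<lambda>u. f (chart_inv c u)) has_derivative (\<lambda>v. g \<bullet> dF c (snd c p) v)) (at (snd c p))"
  using assms by (auto simp: has_tgrad_def)

lemma has_tgrad_normal: "has_tgrad f g p \<Longrightarrow> g \<bullet> \<nu> p = 0"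
  by (simp add: has_tgrad_def)

text \<open>The difference of two candidates is tangential, hence of the form \<open>dF v\<close>,
  and tested against itself it is zero.\<close>

lemma has_tgrad_unique:
  assumes "has_tgrad f g p" "has_tgrad f g' p"
  shows "g = g'"
proof -
  obtain c where c: "c \<in> \<A>" "p \<in> fst c" by (rule ex_chart)
  have eq: "(\<lambda>v. g \<bullet> dF c (snd c p) v) = (\<lambda>v. g' \<bullet> dF c (snd c p) v)"
    using has_derivative_unique has_tgrad_chart[OF assms(1) c] has_tgrad_chart[OF assms(2) c] by blast
  have "(g - g') \<bullet> \<nu> p = 0"
    using assms by (simp add: has_tgrad_def inner_diff_left)
  then obtain v where "dF c (snd c p) v = g - g'"
    using tangent_vector_eq_dF[OF c] by blast
  then have "(g - g') \<bullet> (g - g') = 0"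
    using fun_cong[OF eq, of v] by (simp add: inner_diff_left)
  then show ?thesis by simp
qed

lemma ex_has_tgrad:
  assumes c: "c \<in> \<A>" "p \<in> fst c"
    and f: "((\<lambda>u. f (chart_inv c u)) has_derivative f') (at (snd c p))"
    and E: "\<And>i j::'n. dF c (snd c p) (E i) \<bullet> dF c (snd c p) (E j) = (if i = j then 1 else 0)"
  shows "has_tgrad f (\<Sum>i\<in>UNIV. f' (E i) *\<^sub>R dF c (snd c p) (E i)) p"
proof (rule has_tgradI[OF c])
  let ?u = "snd c p"
  have u: "?u \<in> chart_image c" using c by simp
  note lin = has_derivative_linear[OF f]
  show "(\<Sum>i\<in>UNIV. f' (E i) *\<^sub>R dF c ?u (E i)) \<bullet> \<nu> p = 0"
    by (simp add: inner_sum_left dF_normal'[OF c])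
  have "f' v = (\<Sum>i\<in>UNIV. f' (E i) *\<^sub>R dF c ?u (E i)) \<bullet> dF c ?u v" for v
  proof -
    have "f' v = f' (\<Sum>i\<in>UNIV. (dF c ?u v \<bullet> dF c ?u (E i)) *\<^sub>R E i)"
      by (subst frame_coordinates[OF c(1) u E]) simp
    also have "\<dots> = (\<Sum>i\<in>UNIV. f' (E i) *\<^sub>R dF c ?u (E i)) \<bullet> dF c ?u v"
      by (simp add: linear_sum[OF lin] linear_scale[OF lin] inner_sum_left inner_sum_right inner_commute mult.commute)
    finally show ?thesis .
  qed
  then have "f' = (\<lambda>v. (\<Sum>i\<in>UNIV. f' (E i) *\<^sub>R dF c ?u (E i)) \<bullet> dF c ?u v)" by blast
  with f show "((\<lambda>u. f (chart_inv c u)) has_derivative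
     (\<lambda>v. (\<Sum>i\<in>UNIV. f' (E i) *\<^sub>R dF c ?u (E i)) \<bullet> dF c ?u v)) (at ?u)" by simp
qed

definition tgrad :: "('m \<Rightarrow> real) \<Rightarrow> 'm \<Rightarrow> real^'k" where
  "tgrad f p = (THE g. has_tgrad f g p)"

lemma tgrad_eqI: "has_tgrad f g p \<Longrightarrow> tgrad f p = g"
  unfolding tgrad_def using has_tgrad_unique by blast

lemma smooth_tgrad_aux:
  fixes E :: "'n \<Rightarrow> real^'n \<Rightarrow> real^'n"
  assumes f: "smooth_map \<A> f" and c: "c \<in> \<A>"
    and E: "\<And>u i j. u \<in> chart_image c \<Longrightarrow> dF c u (E i u) \<bullet> dF c u (E j u) = (if i = j then 1 else 0)"
    and u: "u \<in> chart_image c"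
  shows "has_tgrad f (\<Sum>i\<in>UNIV. frechet_derivative (\<lambda>u. f (chart_inv c u)) (at u) (E i u) *\<^sub>R dF c u (E i u)) (chart_inv c u)"
proof -
  let ?p = "chart_inv c u"
  have "((\<lambda>u. f (chart_inv c u)) has_derivative frechet_derivative (\<lambda>u. f (chart_inv c u)) (at u)) (at u)"
    by (rule smooth_on_has_derivative[OF smooth_map_chart[OF f c] u])
  then show ?thesis
    using ex_has_tgrad[OF c, of ?p f "frechet_derivative (\<lambda>u. f (chart_inv c u)) (at u)" "\<lambda>i. E i u"] c u E[OF u]
    by simp
qed

lemma has_tgrad_tgrad: "smooth_map \<A> f \<Longrightarrow> has_tgrad f (tgrad f p) p"
proof -
  assume f: "smooth_map \<A> f"
  obtain c where c: "c \<in> \<A>" "p \<in> fst c" by (rule ex_chart)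
  obtain E :: "'n \<Rightarrow> real^'n \<Rightarrow> real^'n" where "\<And>i. smooth_on (chart_image c) (E i)"
    and E: "\<And>u i j. u \<in> chart_image c \<Longrightarrow> dF c u (E i u) \<bullet> dF c u (E j u) = (if i = j then 1 else 0)"
    using ex_frame[OF c(1)] by blast
  have "\<exists>g. has_tgrad f g p"
    using smooth_tgrad_aux[OF f c(1) E, of "snd c p"] c by auto
  then show ?thesis using tgrad_eqI by metis
qed

lemma smooth_tgrad: 
  assumes f: "smooth_map \<A> f"
  shows "smooth_map \<A> (tgrad f)"
proof (rule smooth_mapI)
  fix c assume c: "c \<in> \<A>"
  obtain E :: "'n \<Rightarrow> real^'n \<Rightarrow> real^'n" where smE: "\<And>i. smooth_on (chart_image c) (E i)"
    and E: "\<And>u i j. u \<in> chart_image c \<Longrightarrow> dF c u (E i u) \<bullet> dF c u (E j u) = (if i = j then 1 else 0)"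
    using ex_frame[OF c] by blast
  let ?g = "\<lambda>u. \<Sum>i\<in>UNIV. frechet_derivative (\<lambda>u. f (chart_inv c u)) (at u) (E i u) *\<^sub>R dF c u (E i u)"
  have "smooth_on (chart_image c) ?g"
    unfolding dF_def
    by (intro smooth_on_sum smooth_on_scaleR smooth_on_derivative_along chart_image_open c smE
        smooth_map_chart smooth_F f)
  moreover have "tgrad f (chart_inv c u) = ?g u" if "u \<in> chart_image c" for u
    by (rule tgrad_eqI[OF smooth_tgrad_aux[OF f c E that]])
  ultimately show "smooth_on (chart_image c) (\<lambda>u. tgrad f (chart_inv c u))"
    using smooth_on_cong[OF chart_image_open[OF c], of "\<lambda>u. tgrad f (chart_inv c u)" ?g] by simp
qed

section \<open>Calculus rules for the tangential gradient and its components\<close>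

lemma has_tgrad_const: "has_tgrad (\<lambda>p. c) 0 p"
  by (simp add: has_tgrad_def)

lemma has_tgrad_add: "has_tgrad f a p \<Longrightarrow> has_tgrad g b p \<Longrightarrow> has_tgrad (\<lambda>p. f p + g p) (a + b) p"
  unfolding has_tgrad_def inner_add_left by (auto intro!: has_derivative_add)

lemma has_tgrad_mult:
  "has_tgrad f a p \<Longrightarrow> has_tgrad g b p \<Longrightarrow> has_tgrad (\<lambda>p. f p * g p) (f p *\<^sub>R b + g p *\<^sub>R a) p"
  unfolding has_tgrad_def
proof (elim conjE, intro conjI ballI impI)
  fix c assume c: "c \<in> \<A>" "p \<in> fst c"
    and fg: "\<forall>c\<in>\<A>. p \<in> fst c \<longrightarrow> ((\<lambda>u. f (chart_inv c u)) has_derivative (\<lambda>v. a \<bullet> dF c (snd c p) v)) (at (snd c p))"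
      "\<forall>c\<in>\<A>. p \<in> fst c \<longrightarrow> ((\<lambda>u. g (chart_inv c u)) has_derivative (\<lambda>v. b \<bullet> dF c (snd c p) v)) (at (snd c p))"
  have "((\<lambda>u. f (chart_inv c u) * g (chart_inv c u)) has_derivative
     (\<lambda>v. f (chart_inv c (snd c p)) * (b \<bullet> dF c (snd c p) v) + a \<bullet> dF c (snd c p) v * g (chart_inv c (snd c p)))) (at (snd c p))"
    by (rule has_derivative_mult) (use c fg in blast)+
  then show "((\<lambda>u. f (chart_inv c u) * g (chart_inv c u)) has_derivative
     (\<lambda>v. (f p *\<^sub>R b + g p *\<^sub>R a) \<bullet> dF c (snd c p) v)) (at (snd c p))"
    using c by (simp add: inner_add_left mult.commute)
qed (simp add: inner_add_left)

lemma has_tgrad_compose: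
  assumes "has_tgrad f a p" "(\<phi> has_real_derivative d) (at (f p))"
  shows "has_tgrad (\<lambda>p. \<phi> (f p)) (d *\<^sub>R a) p"
  unfolding has_tgrad_def
proof (intro conjI ballI impI)
  show "(d *\<^sub>R a) \<bullet> \<nu> p = 0" using assms(1) by (simp add: has_tgrad_def)
  fix c assume c: "c \<in> \<A>" "p \<in> fst c"
  have "(\<phi> has_derivative (\<lambda>x. d * x)) (at (f (chart_inv c (snd c p))))"
    using c has_field_derivative_imp_has_derivative[OF assms(2)] by simp
  from has_derivative_compose[OF has_tgrad_chart[OF assms(1) c] this]
  show "((\<lambda>u. \<phi> (f (chart_inv c u))) has_derivative (\<lambda>v. (d *\<^sub>R a) \<bullet> dF c (snd c p) v)) (at (snd c p))"
    by simp
qed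

lemma smooth_map_const: "smooth_map \<A> (\<lambda>p. c)"
  by (rule smooth_mapI) (simp add: smooth_on_const chart_image_open)

lemma smooth_map_add:
  "smooth_map \<A> f \<Longrightarrow> smooth_map \<A> g \<Longrightarrow> smooth_map \<A> (\<lambda>p. f p + g p)"
  by (rule smooth_mapI) (simp add: smooth_on_add chart_image_open smooth_map_chart)

lemma smooth_map_mult:
  fixes f g :: "'m \<Rightarrow> real"
  shows "smooth_map \<A> f \<Longrightarrow> smooth_map \<A> g \<Longrightarrow> smooth_map \<A> (\<lambda>p. f p * g p)"
  by (rule smooth_mapI) (simp add: smooth_on_mult chart_image_open smooth_map_chart)

lemma smooth_map_inverse:
  fixes f :: "'m \<Rightarrow> real"
  shows "smooth_map \<A> f \<Longrightarrow> (\<And>p. f p \<noteq> 0) \<Longrightarrow> smooth_map \<A> (\<lambda>p. inverse (f p))"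
  by (rule smooth_mapI) (simp add: smooth_on_inverse chart_image_open smooth_map_chart)

lemma smooth_map_sum:
  "(\<And>i. i \<in> I \<Longrightarrow> smooth_map \<A> (f i)) \<Longrightarrow> smooth_map \<A> (\<lambda>p. \<Sum>i\<in>I. f i p)"
  by (rule smooth_mapI) (simp add: smooth_on_sum chart_image_open smooth_map_chart)

lemma smooth_map_linear:
  "bounded_linear l \<Longrightarrow> smooth_map \<A> f \<Longrightarrow> smooth_map \<A> (\<lambda>p. l (f p))"
  by (rule smooth_mapI) (rule smooth_on_linear_comp[OF _ chart_image_open smooth_map_chart])

lemma smooth_map_nth: "smooth_map \<A> g \<Longrightarrow> smooth_map \<A> (\<lambda>p. g p $ a)"
  by (rule smooth_map_linear[OF bounded_linear_vec_nth])

lemma smooth_map_minus: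
  fixes f :: "'m \<Rightarrow> real"
  shows "smooth_map \<A> f \<Longrightarrow> smooth_map \<A> (\<lambda>p. - f p)"
  by (rule smooth_map_linear[OF bounded_linear_minus[OF bounded_linear_ident]])

lemma smooth_map_diff:
  fixes f g :: "'m \<Rightarrow> real"
  shows "smooth_map \<A> f \<Longrightarrow> smooth_map \<A> g \<Longrightarrow> smooth_map \<A> (\<lambda>p. f p - g p)"
  using smooth_map_add[of f "\<lambda>p. - g p"] smooth_map_minus[of g] by simp

lemma smooth_map_power:
  fixes f :: "'m \<Rightarrow> real"
  shows "smooth_map \<A> f \<Longrightarrow> smooth_map \<A> (\<lambda>p. f p ^ k)"
  by (induction k) (auto intro: smooth_map_const smooth_map_mult)

lemma smooth_\<nu>_nth [simp]: "smooth_map \<A> (\<lambda>p. \<nu> p $ a)"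
  and smooth_F_nth [simp]: "smooth_map \<A> (\<lambda>p. F p $ a)"
  by (intro smooth_map_nth smooth_\<nu> smooth_F)+

text \<open>These derivations of scalar functions replace covariant derivatives. They do not
  commute; the defect is computed in \<open>\<delta>_commute\<close>.\<close>

definition \<delta> :: "'k \<Rightarrow> ('m \<Rightarrow> real) \<Rightarrow> 'm \<Rightarrow> real" where
  "\<delta> a f p = tgrad f p $ a"

lemma smooth_map_\<delta>: "smooth_map \<A> f \<Longrightarrow> smooth_map \<A> (\<delta> a f)"
  unfolding \<delta>_def[abs_def] by (intro smooth_map_nth smooth_tgrad)

lemmas smooth_map_intros = smooth_map_const smooth_map_add smooth_map_mult smooth_map_sum
  smooth_map_nth smooth_F smooth_\<nu> smooth_map_minus smooth_map_diff smooth_map_power smooth_map_\<delta>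

lemma \<delta>_eqI: "has_tgrad f g p \<Longrightarrow> \<delta> a f p = g $ a"
  by (simp add: \<delta>_def tgrad_eqI)

lemma \<delta>_const [simp]: "\<delta> a (\<lambda>p. c) p = 0"
  using \<delta>_eqI[OF has_tgrad_const] by simp

lemma \<delta>_add: "smooth_map \<A> f \<Longrightarrow> smooth_map \<A> g \<Longrightarrow> \<delta> a (\<lambda>p. f p + g p) p = \<delta> a f p + \<delta> a g p"
  using \<delta>_eqI[OF has_tgrad_add[OF has_tgrad_tgrad has_tgrad_tgrad]] by (simp add: \<delta>_def)

lemma \<delta>_mult: "smooth_map \<A> f \<Longrightarrow> smooth_map \<A> g \<Longrightarrow>
    \<delta> a (\<lambda>p. f p * g p) p = f p * \<delta> a g p + \<delta> a f p * g p"
  using \<delta>_eqI[OF has_tgrad_mult[OF has_tgrad_tgrad has_tgrad_tgrad]] by (simp add: \<delta>_def)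

lemma \<delta>_minus: "smooth_map \<A> f \<Longrightarrow> \<delta> a (\<lambda>p. - f p) p = - \<delta> a f p"
  using \<delta>_mult[OF smooth_map_const[of "-1"], of f a p] by simp

lemma \<delta>_diff: "smooth_map \<A> f \<Longrightarrow> smooth_map \<A> g \<Longrightarrow> \<delta> a (\<lambda>p. f p - g p) p = \<delta> a f p - \<delta> a g p"
  using \<delta>_add[of f "\<lambda>p. - g p"] by (simp add: \<delta>_minus smooth_map_minus)

lemma \<delta>_sum: "(\<And>i. i \<in> I \<Longrightarrow> smooth_map \<A> (f i)) \<Longrightarrow> \<delta> a (\<lambda>p. \<Sum>i\<in>I. f i p) p = (\<Sum>i\<in>I. \<delta> a (f i) p)"
  by (induction I rule: infinite_finite_induct) (auto simp: \<delta>_add smooth_map_sum)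

lemma \<delta>_compose:
  "smooth_map \<A> f \<Longrightarrow> (\<phi> has_real_derivative d) (at (f p)) \<Longrightarrow> \<delta> a (\<lambda>p. \<phi> (f p)) p = d * \<delta> a f p"
  using \<delta>_eqI[OF has_tgrad_compose[OF has_tgrad_tgrad]] by (simp add: \<delta>_def)

lemma tgrad_normal: "smooth_map \<A> f \<Longrightarrow> tgrad f p \<bullet> \<nu> p = 0"
  using has_tgrad_tgrad has_tgrad_normal by blast

lemma \<nu>_\<delta>: "smooth_map \<A> f \<Longrightarrow> (\<Sum>a\<in>UNIV. \<nu> p $ a * \<delta> a f p) = 0"
  using tgrad_normal[of f p] by (simp add: inner_vec_def \<delta>_def mult.commute)

lemma sum_\<nu>_sq: "(\<Sum>a\<in>UNIV. \<nu> p $ a * \<nu> p $ a) = 1"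
  using \<nu>_\<nu>[of p] by (simp add: inner_vec_def)

text \<open>The \<open>a\<close>-th column of the orthogonal projection onto the tangent space; it
  is also the gradient of the \<open>a\<close>-th coordinate function.\<close>

definition proj :: "'m \<Rightarrow> 'k \<Rightarrow> real^'k" where
  "proj p a = axis a 1 - (\<nu> p $ a) *\<^sub>R \<nu> p"

lemma proj_nth: "proj p a $ b = (if a = b then 1 else 0) - \<nu> p $ a * \<nu> p $ b"
  by (simp add: proj_def axis_def)

lemma inner_proj: "x \<bullet> proj p a = x $ a - \<nu> p $ a * (x \<bullet> \<nu> p)"
  by (simp add: proj_def inner_diff_right inner_axis)

lemma proj_normal: "proj p a \<bullet> \<nu> p = 0"
  using inner_proj[of "\<nu> p" p a] by (simp add: inner_commute)

lemma \<delta>_F: "\<delta> a (\<lambda>p. F p $ b) p = (if a = b then 1 else 0) - \<nu> p $ a * \<nu> p $ b"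
proof -
  obtain c where c: "c \<in> \<A>" "p \<in> fst c" by (rule ex_chart)
  have "has_tgrad (\<lambda>p. F p $ b) (proj p b) p"
  proof (rule has_tgradI[OF c proj_normal])
    have "((\<lambda>u. F (chart_inv c u) $ b) has_derivative (\<lambda>v. dF c (snd c p) v $ b)) (at (snd c p))"
      using F_has_derivative[OF c(1), of "snd c p"] c
      by (auto intro: bounded_linear.has_derivative[OF bounded_linear_vec_nth])
    moreover have "dF c (snd c p) v $ b = proj p b \<bullet> dF c (snd c p) v" for v
      using inner_proj[of "dF c (snd c p) v" p b] dF_normal'[OF c] by (simp add: inner_commute)
    ultimately show "((\<lambda>u. F (chart_inv c u) $ b) has_derivative (\<lambda>v. proj p b \<bullet> dF c (snd c p) v)) (at (snd c p))"
      by simp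
  qed
  from \<delta>_eqI[OF this] show ?thesis by (auto simp: proj_nth)
qed

text \<open>This gives both the symmetry of the second fundamental form and the commutator formula.\<close>

lemma closed_field_symmetric:
  assumes \<phi>: "smooth_map \<A> \<phi>" and g: "smooth_map \<A> g"
    and eq: "\<And>c u v. c \<in> \<A> \<Longrightarrow> u \<in> chart_image c \<Longrightarrow>
      frechet_derivative (\<lambda>u. \<phi> (chart_inv c u)) (at u) v = g (chart_inv c u) \<bullet> dF c u v"
  shows "(\<Sum>d\<in>UNIV. \<delta> a (\<lambda>p. g p $ d) p * proj p b $ d) = (\<Sum>d\<in>UNIV. \<delta> b (\<lambda>p. g p $ d) p * proj p a $ d)"
proof -
  obtain c where c: "c \<in> \<A>" "p \<in> fst c" by (rule ex_chart)
  let ?u = "snd c p" and ?S = "chart_image c"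
  have u: "?u \<in> ?S" using c by simp
  note S = chart_image_open[OF c(1)]
  have smF: "smooth_on ?S (\<lambda>u. F (chart_inv c u))" and smg: "smooth_on ?S (\<lambda>u. g (chart_inv c u))"
    and sm\<phi>: "smooth_on ?S (\<lambda>u. \<phi> (chart_inv c u))"
    using smooth_map_chart smooth_F g \<phi> c(1) by blast+
  define g' where "g' = frechet_derivative (\<lambda>u. g (chart_inv c u)) (at ?u)"
  have dg: "((\<lambda>u. g (chart_inv c u)) has_derivative g') (at ?u)"
    unfolding g'_def by (rule smooth_on_has_derivative[OF smg u])
  have dd: "frechet_derivative (\<lambda>u. frechet_derivative (\<lambda>u. \<phi> (chart_inv c u)) (at u) v) (at ?u) w
     = g p \<bullet> frechet_derivative (\<lambda>u. dF c u v) (at ?u) w + g' w \<bullet> dF c ?u v" for v w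
  proof -
    have "((\<lambda>u. dF c u v) has_derivative frechet_derivative (\<lambda>u. dF c u v) (at ?u)) (at ?u)"
      unfolding dF_def by (rule smooth_on_has_derivative[OF smooth_on_frechet_derivative[OF smF] u])
    then have "((\<lambda>u. g (chart_inv c u) \<bullet> dF c u v) has_derivative
       (\<lambda>w. g p \<bullet> frechet_derivative (\<lambda>u. dF c u v) (at ?u) w + g' w \<bullet> dF c ?u v)) (at ?u)"
      using dg c by (auto intro!: derivative_eq_intros)
    from frechet_derivative_at[OF this, symmetric]
    have "frechet_derivative (\<lambda>u. g (chart_inv c u) \<bullet> dF c u v) (at ?u) w = g p \<bullet> frechet_derivative (\<lambda>u. dF c u v) (at ?u) w + g' w \<bullet> dF c ?u v" by (rule fun_cong)
    moreover have "frechet_derivative (\<lambda>u. frechet_derivative (\<lambda>u. \<phi> (chart_inv c u)) (at u) v) (at ?u)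
      = frechet_derivative (\<lambda>u. g (chart_inv c u) \<bullet> dF c u v) (at ?u)"
      by (rule frechet_derivative_cong_open[OF S u]) (rule eq[OF c(1)])
    ultimately show ?thesis by simp
  qed
  \<comment> \<open>Second derivatives of \<open>\<phi>\<close> and of \<open>F\<close> are
    symmetric, so in the product rule \<open>dd\<close> only the terms with \<open>g'\<close> can
    differ, and these must agree.\<close>
  have sym: "g' w \<bullet> dF c ?u v = g' v \<bullet> dF c ?u w" for v w
    using dd[of v w] dd[of w v] second_derivative_symmetric[OF S sm\<phi> u, of v w]
      second_derivative_symmetric[OF S smF u, of v w] by (simp add: dF_def)
  have comp: "g' w $ d = tgrad (\<lambda>p. g p $ d) p \<bullet> dF c ?u w" for w d
  proof -
    have "((\<lambda>u. g (chart_inv c u) $ d) has_derivative (\<lambda>w. g' w $ d)) (at ?u)"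
      by (rule bounded_linear.has_derivative[OF bounded_linear_vec_nth dg])
    moreover have "((\<lambda>u. g (chart_inv c u) $ d) has_derivative (\<lambda>w. tgrad (\<lambda>p. g p $ d) p \<bullet> dF c ?u w)) (at ?u)"
      by (rule has_tgrad_chart[OF has_tgrad_tgrad[OF smooth_map_nth[OF g]] c])
    ultimately have "(\<lambda>w. g' w $ d) = (\<lambda>w. tgrad (\<lambda>p. g p $ d) p \<bullet> dF c ?u w)"
      by (rule has_derivative_unique)
    then show ?thesis by (rule fun_cong)
  qed
  obtain va where va: "dF c ?u va = proj p a" using tangent_vector_eq_dF[OF c proj_normal] by blast
  obtain vb where vb: "dF c ?u vb = proj p b" using tangent_vector_eq_dF[OF c proj_normal] by blast
  have "g' va $ d = \<delta> a (\<lambda>p. g p $ d) p" "g' vb $ d = \<delta> b (\<lambda>p. g p $ d) p" for d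
    using comp[of va d] comp[of vb d] tgrad_normal[OF smooth_map_nth[OF g], of d p]
    by (simp_all add: va vb inner_proj \<delta>_def)
  then show ?thesis
    using sym[of va vb] by (simp add: va vb inner_vec_def)
qed

text \<open>The Weingarten map, that is the derivative of \<open>\<nu>\<close>, in ambient
  components. It is the negative of the second fundamental form read against \<open>\<nu>\<close>,
  and with the sign convention of \<open>mean_curvature\<close> its trace is the mean
  curvature.\<close>

definition h :: "'k \<Rightarrow> 'k \<Rightarrow> 'm \<Rightarrow> real" where
  "h a b p = \<delta> a (\<lambda>p. \<nu> p $ b) p"

lemma smooth_h [simp]: "smooth_map \<A> (h a b)"
  unfolding h_def[abs_def] by (intro smooth_map_intros)

lemma h_\<nu>: "(\<Sum>b\<in>UNIV. h a b p * \<nu> p $ b) = 0"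
proof -
  have "\<delta> a (\<lambda>p. \<Sum>b\<in>UNIV. \<nu> p $ b * \<nu> p $ b) p = 0"
    unfolding sum_\<nu>_sq by simp
  moreover have "\<delta> a (\<lambda>p. \<Sum>b\<in>UNIV. \<nu> p $ b * \<nu> p $ b) p = (\<Sum>b\<in>UNIV. 2 * (h a b p * \<nu> p $ b))"
    by (subst \<delta>_sum) (auto intro!: smooth_map_intros sum.cong simp: \<delta>_mult h_def)
  ultimately show ?thesis by (simp add: sum_distrib_left[symmetric])
qed

lemma \<nu>_h: "(\<Sum>a\<in>UNIV. \<nu> p $ a * h a b p) = 0"
  unfolding h_def by (intro \<nu>_\<delta> smooth_map_intros)

lemma sum_proj: "(\<Sum>d\<in>UNIV. x d * proj p b $ d) = x b - \<nu> p $ b * (\<Sum>d\<in>UNIV. x d * \<nu> p $ d)"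
proof -
  have "x d * proj p b $ d = (if b = d then x d else 0) - \<nu> p $ b * (x d * \<nu> p $ d)" for d
    by (simp add: proj_nth algebra_simps)
  then show ?thesis by (simp add: sum_subtractf sum_distrib_left)
qed

text \<open>Since \<open>\<nu>\<close> is orthogonal to all of \<open>dF\<close>, it is a closed
  field with potential zero.\<close>

lemma h_sym: "h a b p = h b a p"
proof -
  have "(\<Sum>d\<in>UNIV. \<delta> a (\<lambda>p. \<nu> p $ d) p * proj p b $ d) = (\<Sum>d\<in>UNIV. \<delta> b (\<lambda>p. \<nu> p $ d) p * proj p a $ d)"
  proof (rule closed_field_symmetric[where \<phi>="\<lambda>p. 0"])
    show "frechet_derivative (\<lambda>u. 0) (at u) v = \<nu> (chart_inv c u) \<bullet> dF c u v"
      if "c \<in> \<A>" "u \<in> chart_image c" for c u v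
      using dF_normal[OF that] frechet_derivative_at[OF has_derivative_const, symmetric]
      by (simp add: inner_commute)
  qed (intro smooth_map_intros)+
  then show ?thesis by (simp add: sum_proj h_def[symmetric] h_\<nu>)
qed

lemma h_\<nu>': "(\<Sum>b\<in>UNIV. h b a p * \<nu> p $ b) = 0"
  using h_\<nu>[of a p] by (simp add: h_sym)

text \<open>Obtained by differentiating the identity that the gradient is orthogonal to
  \<open>\<nu>\<close>.\<close>

lemma \<delta>_\<delta>_\<nu>:
  assumes f: "smooth_map \<A> f"
  shows "(\<Sum>d\<in>UNIV. \<delta> a (\<delta> d f) p * \<nu> p $ d) = - (\<Sum>d\<in>UNIV. h a d p * \<delta> d f p)"
proof -
  have "\<delta> a (\<lambda>p. \<Sum>d\<in>UNIV. \<nu> p $ d * \<delta> d f p) p = 0"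
    using \<nu>_\<delta>[OF f] by simp
  moreover have "\<delta> a (\<lambda>p. \<Sum>d\<in>UNIV. \<nu> p $ d * \<delta> d f p) p
     = (\<Sum>d\<in>UNIV. \<delta> a (\<delta> d f) p * \<nu> p $ d + h a d p * \<delta> d f p)"
    by (subst \<delta>_sum) (auto intro!: smooth_map_intros f sum.cong simp: \<delta>_mult smooth_map_\<delta> f h_def)
  ultimately show ?thesis by (simp add: sum.distrib)
qed

text \<open>The gradient is a closed field with potential \<open>f\<close>, so its derivative is
  symmetric after tangential projection. The projection removes normal components, which
  \<open>\<delta>_\<delta>_\<nu>\<close> expresses through \<open>h\<close>; these are the
  correction terms.\<close>

lemma \<delta>_commute:
  assumes f: "smooth_map \<A> f"
  shows "\<delta> a (\<delta> b f) p = \<delta> b (\<delta> a f) p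
    + \<nu> p $ a * (\<Sum>d\<in>UNIV. h b d p * \<delta> d f p) - \<nu> p $ b * (\<Sum>d\<in>UNIV. h a d p * \<delta> d f p)"
proof -
  have "(\<Sum>d\<in>UNIV. \<delta> a (\<lambda>p. tgrad f p $ d) p * proj p b $ d) = (\<Sum>d\<in>UNIV. \<delta> b (\<lambda>p. tgrad f p $ d) p * proj p a $ d)"
  proof (rule closed_field_symmetric[OF f])
    show "frechet_derivative (\<lambda>u. f (chart_inv c u)) (at u) v = tgrad f (chart_inv c u) \<bullet> dF c u v"
      if "c \<in> \<A>" "u \<in> chart_image c" for c u v
      using frechet_derivative_at[OF has_tgrad_chart[OF has_tgrad_tgrad[OF f] that(1), of "chart_inv c u"], symmetric] that
      by simp
  qed (intro smooth_tgrad f)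
  moreover have "(\<lambda>p. tgrad f p $ d) = \<delta> d f" for d by (simp add: \<delta>_def[abs_def])
  ultimately show ?thesis by (simp add: sum_proj \<delta>_\<delta>_\<nu>[OF f])
qed

end

section \<open>The second fundamental form and Simons' identity\<close>

context hypersurface
begin

lemma parseval_frame:
  fixes e :: "'n \<Rightarrow> real^'k"
  assumes e: "\<And>i j. e i \<bullet> e j = (if i = j then 1 else 0)" "\<And>i. e i \<bullet> \<nu> p = 0"
  shows "(\<Sum>i\<in>UNIV. (x \<bullet> e i) * (y \<bullet> e i)) = x \<bullet> y - (x \<bullet> \<nu> p) * (y \<bullet> \<nu> p)"
proof -
  have "(\<Sum>i\<in>UNIV. (x \<bullet> e i) * (y \<bullet> e i)) = (\<Sum>i\<in>UNIV. (x \<bullet> e i) *\<^sub>R e i) \<bullet> y"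
    by (simp add: inner_sum_left inner_sum_right inner_commute)
  also have "\<dots> = x \<bullet> y - (x \<bullet> \<nu> p) * (y \<bullet> \<nu> p)"
    by (simp add: frame_expansion[OF e] inner_diff_left inner_diff_right inner_commute)
  finally show ?thesis .
qed

definition h_row :: "'m \<Rightarrow> 'k \<Rightarrow> real^'k" where
  "h_row p a = (\<chi> b. h a b p)"

lemma h_row_\<nu>: "h_row p a \<bullet> \<nu> p = 0"
  using h_\<nu>[of a p] by (simp add: h_row_def inner_vec_def)

definition h_form :: "'m \<Rightarrow> real^'k \<Rightarrow> real^'k \<Rightarrow> real" where
  "h_form p x y = (\<Sum>a\<in>UNIV. x $ a * (h_row p a \<bullet> y))"

lemma \<nu>_derivative_inner:
  assumes c: "c \<in> \<A>" "p \<in> fst c"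
    and n': "((\<lambda>u. \<nu> (chart_inv c u)) has_derivative n') (at (snd c p))"
  shows "n' v \<bullet> y = h_form p (dF c (snd c p) v) y"
proof -
  have "n' v $ b = (\<Sum>a\<in>UNIV. h a b p * dF c (snd c p) v $ a)" for b
  proof -
    have "((\<lambda>u. \<nu> (chart_inv c u) $ b) has_derivative (\<lambda>w. n' w $ b)) (at (snd c p))"
      by (rule bounded_linear.has_derivative[OF bounded_linear_vec_nth n'])
    moreover have "((\<lambda>u. \<nu> (chart_inv c u) $ b) has_derivative
        (\<lambda>w. tgrad (\<lambda>p. \<nu> p $ b) p \<bullet> dF c (snd c p) w)) (at (snd c p))"
      by (rule has_tgrad_chart[OF has_tgrad_tgrad[OF smooth_\<nu>_nth] c])
    ultimately have "(\<lambda>w. n' w $ b) = (\<lambda>w. tgrad (\<lambda>p. \<nu> p $ b) p \<bullet> dF c (snd c p) w)"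
      by (rule has_derivative_unique)
    from fun_cong[OF this, of v] show ?thesis
      by (simp add: h_def \<delta>_def inner_vec_def)
  qed
  then have "n' v \<bullet> y = (\<Sum>b\<in>UNIV. \<Sum>a\<in>UNIV. h a b p * dF c (snd c p) v $ a * y $ b)"
    by (simp add: inner_vec_def sum_distrib_right)
  also have "\<dots> = h_form p (dF c (snd c p) v) y"
    by (subst sum.swap) (simp add: h_form_def h_row_def inner_vec_def sum_distrib_left mult_ac)
  finally show ?thesis .
qed

text \<open>Parseval replaces sums over a tangent frame by sums over ambient indices. Nothing is
  lost because the rows and columns of \<open>h\<close> are orthogonal to \<open>\<nu>\<close>; this
  also shows independence of the frame.\<close>

lemma sum_h_form_frame:
  fixes e :: "'n \<Rightarrow> real^'k"
  assumes e: "\<And>i j. e i \<bullet> e j = (if i = j then 1 else 0)" "\<And>i. e i \<bullet> \<nu> p = 0"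
  shows "(\<Sum>i\<in>UNIV. h_form p (e i) (e i)) = (\<Sum>a\<in>UNIV. h a a p)"
    and "(\<Sum>i\<in>UNIV. \<Sum>j\<in>UNIV. (h_form p (e i) (e j))\<^sup>2) = (\<Sum>a\<in>UNIV. \<Sum>b\<in>UNIV. (h a b p)\<^sup>2)"
proof -
  have "(\<Sum>i\<in>UNIV. h_form p (e i) (e i)) = (\<Sum>a\<in>UNIV. \<Sum>i\<in>UNIV. (axis a 1 \<bullet> e i) * (h_row p a \<bullet> e i))"
    unfolding h_form_def by (subst sum.swap) (simp add: inner_axis inner_commute[of "axis _ _"])
  also have "\<dots> = (\<Sum>a\<in>UNIV. axis a 1 \<bullet> h_row p a)"
    by (simp add: parseval_frame[OF e] h_row_\<nu>)
  also have "\<dots> = (\<Sum>a\<in>UNIV. h a a p)"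
    by (simp add: inner_axis inner_commute[of "axis _ _"] h_row_def)
  finally show "(\<Sum>i\<in>UNIV. h_form p (e i) (e i)) = (\<Sum>a\<in>UNIV. h a a p)" .
  define w where "w y = (\<chi> a. h_row p a \<bullet> y)" for y
  have w: "h_form p x y = w y \<bullet> x" for x y
    by (simp add: h_form_def w_def inner_vec_def mult.commute)
  have "w y \<bullet> \<nu> p = 0" for y
  proof -
    have "w y \<bullet> \<nu> p = (\<Sum>b\<in>UNIV. (\<Sum>a\<in>UNIV. \<nu> p $ a * h a b p) * y $ b)"
      unfolding sum_distrib_right
      by (subst sum.swap) (simp add: w_def inner_vec_def h_row_def sum_distrib_left sum_distrib_right mult_ac)
    then show ?thesis by (simp add: \<nu>_h)
  qed
  then have "(\<Sum>i\<in>UNIV. (h_form p (e i) y)\<^sup>2) = w y \<bullet> w y" for y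
    using parseval_frame[OF e, of "w y" "w y"] by (simp add: w power2_eq_square)
  then have "(\<Sum>i\<in>UNIV. \<Sum>j\<in>UNIV. (h_form p (e i) (e j))\<^sup>2) = (\<Sum>j\<in>UNIV. w (e j) \<bullet> w (e j))"
    by (subst sum.swap) simp
  also have "\<dots> = (\<Sum>a\<in>UNIV. \<Sum>j\<in>UNIV. (h_row p a \<bullet> e j) * (h_row p a \<bullet> e j))"
    by (subst sum.swap) (simp add: w_def inner_vec_def)
  also have "\<dots> = (\<Sum>a\<in>UNIV. h_row p a \<bullet> h_row p a)"
    by (simp add: parseval_frame[OF e] h_row_\<nu>)
  also have "\<dots> = (\<Sum>a\<in>UNIV. \<Sum>b\<in>UNIV. (h a b p)\<^sup>2)"
    by (simp add: h_row_def inner_vec_def power2_eq_square)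
  finally show "(\<Sum>i\<in>UNIV. \<Sum>j\<in>UNIV. (h_form p (e i) (e j))\<^sup>2) = (\<Sum>a\<in>UNIV. \<Sum>b\<in>UNIV. (h a b p)\<^sup>2)" .
qed

text \<open>The frame built over a whole chart shows that the description inside \<open>SOME\<close>
  can be satisfied, so the chosen value really is an orthonormal frame.\<close>

lemma frame_at_spec:
  obtains c E where "frame_at \<A> F p = (c, E)" "c \<in> \<A>" "orthonormal_frame_near F p c E"
proof -
  obtain c where c: "c \<in> \<A>" "p \<in> fst c" by (rule ex_chart)
  obtain E :: "'n \<Rightarrow> real^'n \<Rightarrow> real^'n" where smE: "\<And>i. smooth_on (chart_image c) (E i)"
    and E: "\<And>u i j. u \<in> chart_image c \<Longrightarrow> dF c u (E i u) \<bullet> dF c u (E j u) = (if i = j then 1 else 0)"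
    using ex_frame[OF c(1)] by blast
  have "orthonormal_frame_near F p c (\<lambda>i q. E i (snd c q))"
    unfolding orthonormal_frame_near_def
  proof (intro exI[of _ "fst c"] conjI allI ballI)
    fix i
    have "smooth_on (chart_image c) (\<lambda>u. E i (snd c (chart_inv c u)))"
      using smooth_on_cong[OF chart_image_open[OF c(1)], of "\<lambda>u. E i (snd c (chart_inv c u))" "E i"] smE[of i] c
      by simp
    then show "smooth_on (snd c ` fst c) ((\<lambda>q. E i (snd c q)) \<circ> chart_inv c)"
      by (simp add: chart_image_def o_def)
  qed (use c E chart_open in \<open>auto simp: frame_field_def euclidean_deriv_F\<close>)
  then have "\<exists>z. case z of (c, E) \<Rightarrow> c \<in> \<A> \<and> orthonormal_frame_near F p c E"
    using c by blast
  then have "case frame_at \<A> F p of (c, E) \<Rightarrow> c \<in> \<A> \<and> orthonormal_frame_near F p c E"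
    unfolding frame_at_def by (rule someI_ex)
  then show thesis
    by (cases "frame_at \<A> F p") (auto intro: that)
qed

text \<open>Differentiating the orthogonality of \<open>e j\<close> and \<open>\<nu>\<close> moves
  the derivative from the frame to the normal. The chosen frame is smooth only on \<open>W\<close>,
  hence the restriction to the coordinate set \<open>V\<close>.\<close>

lemma second_fundamental_form_frame:
  obtains e :: "'n \<Rightarrow> real^'k" where "\<And>i j. e i \<bullet> e j = (if i = j then 1 else 0)" "\<And>i. e i \<bullet> \<nu> p = 0"
    "\<And>i j. second_fundamental_form \<A> F \<nu> p i j = (- h_form p (e i) (e j)) *\<^sub>R \<nu> p"
proof -
  obtain c E where fr: "frame_at \<A> F p = (c, E)" and c: "c \<in> \<A>" and near: "orthonormal_frame_near F p c E"
    by (rule frame_at_spec)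
  obtain W where W: "open W" "p \<in> W" "W \<subseteq> fst c" "\<And>i. smooth_on (snd c ` W) (E i \<circ> chart_inv c)"
    and on: "\<And>q i j. q \<in> W \<Longrightarrow> frame_field F c E i q \<bullet> frame_field F c E j q = (if i = j then 1 else 0)"
    using near unfolding orthonormal_frame_near_def by blast
  have pc: "p \<in> fst c" using W by blast
  define V where "V = chart_image c \<inter> chart_inv c -` W"
  have V: "open V"
    using continuous_on_chart_inv[OF c] chart_image_open[OF c] W(1)
    unfolding V_def by (simp add: continuous_on_open_vimage Int_commute)
  have VW: "V \<subseteq> snd c ` W"
    using c by (force simp: V_def image_iff)
  let ?u = "snd c p"
  have u: "?u \<in> V" "?u \<in> chart_image c" using pc c W by (auto simp: V_def)
  let ?e = "\<lambda>j u. dF c u (E j (chart_inv c u))"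
  have ff: "frame_field F c E j (chart_inv c u) = ?e j u" if "u \<in> V" for j u
    using that c by (simp add: frame_field_def euclidean_deriv_F V_def)
  have sme: "smooth_on V (?e j)" for j
    unfolding dF_def
    using W(4)[of j] VW
    by (intro smooth_on_derivative_along V smooth_on_subset[OF smooth_map_chart[OF smooth_F c]])
       (auto simp: V_def o_def intro: smooth_on_subset)
  have sff: "second_fundamental_form \<A> F \<nu> p i j = (- h_form p (?e i ?u) (?e j ?u)) *\<^sub>R \<nu> p" for i j
  proof -
    define e' where "e' = frechet_derivative (?e j) (at ?u)"
    define n' where "n' = frechet_derivative (\<lambda>u. \<nu> (chart_inv c u)) (at ?u)"
    have e': "(?e j has_derivative e') (at ?u)"
      unfolding e'_def by (rule smooth_on_has_derivative[OF sme u(1)])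
    have n': "((\<lambda>u. \<nu> (chart_inv c u)) has_derivative n') (at ?u)"
      unfolding n'_def by (rule smooth_on_has_derivative[OF smooth_map_chart[OF smooth_\<nu> c] u(2)])
    have 1: "((\<lambda>u. ?e j u \<bullet> \<nu> (chart_inv c u)) has_derivative
       (\<lambda>v. ?e j ?u \<bullet> n' v + e' v \<bullet> \<nu> p)) (at ?u)"
      using has_derivative_inner[OF e' n'] c pc by simp
    have 2: "((\<lambda>u. 0) has_derivative (\<lambda>v. ?e j ?u \<bullet> n' v + e' v \<bullet> \<nu> p)) (at ?u)"
      by (rule has_derivative_transform_within_open[OF 1 V u(1)]) (auto simp: V_def dF_normal c)
    have "?e j ?u \<bullet> n' v + e' v \<bullet> \<nu> p = 0" for v
      using fun_cong[OF has_derivative_unique[OF 2 has_derivative_const], of v] by simp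
    then have "e' (E i p) \<bullet> \<nu> p = - (n' (E i p) \<bullet> ?e j ?u)"
      by (simp add: inner_commute eq_neg_iff_add_eq_0 add.commute)
    also have "\<dots> = - h_form p (?e i ?u) (?e j ?u)"
      using \<nu>_derivative_inner[OF c pc n'] c pc by simp
    finally have "e' (E i p) \<bullet> \<nu> p = - h_form p (?e i ?u) (?e j ?u)" .
    moreover have "euclidean_deriv c p (E i p) (frame_field F c E j) = e' (E i p)"
      unfolding euclidean_deriv_def e'_def o_def
      by (rule fun_cong[OF frechet_derivative_cong_open[OF V u(1) ff]])
    ultimately show ?thesis
      by (simp add: second_fundamental_form_def fr)
  qed
  show thesis
  proof (rule that[of "\<lambda>i. ?e i ?u"])
    show "?e i ?u \<bullet> ?e j ?u = (if i = j then 1 else 0)" for i j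
      using on[OF W(2), of i j] ff[OF u(1)] c pc by simp
  qed (use dF_normal'[OF c pc] sff in auto)
qed

lemma mean_curvature_eq: "mean_curvature \<A> F \<nu> p = (\<Sum>a\<in>UNIV. h a a p)"
proof -
  obtain e :: "'n \<Rightarrow> real^'k" where e: "\<And>i j. e i \<bullet> e j = (if i = j then 1 else 0)" "\<And>i. e i \<bullet> \<nu> p = 0"
    and s: "\<And>i j. second_fundamental_form \<A> F \<nu> p i j = (- h_form p (e i) (e j)) *\<^sub>R \<nu> p"
    using second_fundamental_form_frame by blast
  show ?thesis
    by (simp add: mean_curvature_def mean_curvature_vector_def s inner_sum_left sum_negf sum_h_form_frame(1)[OF e])
qed

lemma sff_norm_sq_eq: "sff_norm_sq \<A> F \<nu> p = (\<Sum>a\<in>UNIV. \<Sum>b\<in>UNIV. (h a b p)\<^sup>2)"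
proof -
  obtain e :: "'n \<Rightarrow> real^'k" where e: "\<And>i j. e i \<bullet> e j = (if i = j then 1 else 0)" "\<And>i. e i \<bullet> \<nu> p = 0"
    and s: "\<And>i j. second_fundamental_form \<A> F \<nu> p i j = (- h_form p (e i) (e j)) *\<^sub>R \<nu> p"
    using second_fundamental_form_frame by blast
  show ?thesis
    by (simp add: sff_norm_sq_def s sum_h_form_frame(2)[OF e])
qed

end

section \<open>Codazzi and Simons in ambient components\<close>

context hypersurface
begin

lemmas smooth_map_simps [simp] = smooth_map_const smooth_map_add smooth_map_mult smooth_map_sum
  smooth_map_minus smooth_map_diff smooth_map_power smooth_map_\<delta>

lemma \<delta>_cmult: "smooth_map \<A> f \<Longrightarrow> \<delta> a (\<lambda>p. k * f p) p = k * \<delta> a f p"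
  by (simp add: \<delta>_mult)

definition h2 :: "'k \<Rightarrow> 'k \<Rightarrow> 'm \<Rightarrow> real" where
  "h2 a b p = (\<Sum>d\<in>UNIV. h a d p * h d b p)"

definition H :: "'m \<Rightarrow> real" where
  "H p = (\<Sum>a\<in>UNIV. h a a p)"

definition hh :: "'m \<Rightarrow> real" where
  "hh p = (\<Sum>a\<in>UNIV. \<Sum>b\<in>UNIV. (h a b p)\<^sup>2)"

definition dh_sq :: "'m \<Rightarrow> real" where
  "dh_sq p = (\<Sum>c\<in>UNIV. \<Sum>a\<in>UNIV. \<Sum>b\<in>UNIV. (\<delta> c (h a b) p)\<^sup>2)"

definition h2_sq :: "'m \<Rightarrow> real" where
  "h2_sq p = (\<Sum>a\<in>UNIV. \<Sum>b\<in>UNIV. (h2 a b p)\<^sup>2)"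

text \<open>The covariant derivative of the second fundamental form, in ambient components.\<close>

definition S :: "'k \<Rightarrow> 'k \<Rightarrow> 'k \<Rightarrow> 'm \<Rightarrow> real" where
  "S c a b p = \<delta> c (h a b) p + \<nu> p $ a * h2 c b p + \<nu> p $ b * h2 c a p"

text \<open>The ambient trace of second derivatives is the Laplace-Beltrami operator, because
  \<open>\<delta> a\<close> already projects the direction of differentiation. The factor
  \<open>1/2\<close> comes from the weight: \<open>|x|\<^sup>2 / 4\<close> has gradient
  \<open>x / 2\<close> in Euclidean space.\<close>

definition drift_laplacian :: "('m \<Rightarrow> real) \<Rightarrow> 'm \<Rightarrow> real" where
  "drift_laplacian f p = (\<Sum>a\<in>UNIV. \<delta> a (\<delta> a f) p) + (1/2) * (\<Sum>a\<in>UNIV. F p $ a * \<delta> a f p)"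

lemma smooth_h2 [simp]: "smooth_map \<A> (h2 a b)"
  and smooth_H [simp]: "smooth_map \<A> H"
  and smooth_hh [simp]: "smooth_map \<A> hh"
  unfolding h2_def[abs_def] H_def[abs_def] hh_def[abs_def] by simp_all

lemma h2_sym: "h2 a b p = h2 b a p"
  unfolding h2_def using h_sym by (intro sum.cong) (auto simp: mult.commute)

lemma h2_\<nu>: "(\<Sum>b\<in>UNIV. h2 a b p * \<nu> p $ b) = 0"
proof -
  have "(\<Sum>b\<in>UNIV. h2 a b p * \<nu> p $ b) = (\<Sum>d\<in>UNIV. h a d p * (\<Sum>b\<in>UNIV. h d b p * \<nu> p $ b))"
    unfolding h2_def sum_distrib_right sum_distrib_left by (subst sum.swap) (simp add: mult.assoc)
  then show ?thesis by (simp add: h_\<nu>)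
qed

lemma \<nu>_h2: "(\<Sum>b\<in>UNIV. \<nu> p $ b * h2 b a p) = 0"
  using h2_\<nu>[of a p] by (simp add: h2_sym[of _ a] mult.commute)

lemma sum_h2_diag: "(\<Sum>a\<in>UNIV. h2 a a p) = hh p"
  unfolding h2_def hh_def by (intro sum.cong refl) (metis h_sym power2_eq_square)

lemma \<delta>_h_sym: "\<delta> c (h a b) p = \<delta> c (h b a) p"
proof -
  have "h a b = h b a" using h_sym by blast
  then show ?thesis by simp
qed

text \<open>This is the commutator formula for the components of \<open>\<nu>\<close>, since
  \<open>\<delta> a\<close> of the \<open>b\<close>-th component is \<open>h a b\<close>.\<close>

lemma codazzi: "\<delta> c (h a b) p = \<delta> a (h c b) p + \<nu> p $ c * h2 a b p - \<nu> p $ a * h2 c b p"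
proof -
  have "\<delta> a (\<lambda>p. \<nu> p $ b) = h a b" for a b
    by (rule ext) (simp add: h_def)
  then show ?thesis
    using \<delta>_commute[OF smooth_\<nu>_nth, of c a b p] by (simp add: h2_def)
qed

text \<open>The correction terms in \<open>S\<close> absorb exactly the normal terms in
  \<open>codazzi\<close>; this is the classical Codazzi equation.\<close>

lemma S_sym1: "S c a b p = S a c b p"
  unfolding S_def using codazzi[of c a b p] by (simp add: h2_sym[of a c])

lemma \<delta>_h_\<nu>: "(\<Sum>b\<in>UNIV. \<delta> c (h a b) p * \<nu> p $ b) = - h2 c a p"
proof -
  have "\<delta> c (\<lambda>p. \<Sum>b\<in>UNIV. h a b p * \<nu> p $ b) p = 0" by (simp add: h_\<nu>)
  moreover have "\<delta> c (\<lambda>p. \<Sum>b\<in>UNIV. h a b p * \<nu> p $ b) p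
    = (\<Sum>b\<in>UNIV. h a b p * h c b p) + (\<Sum>b\<in>UNIV. \<delta> c (h a b) p * \<nu> p $ b)"
    by (simp add: \<delta>_sum \<delta>_mult sum.distrib h_def[symmetric])
  moreover have "(\<Sum>b\<in>UNIV. h a b p * h c b p) = h2 c a p"
    unfolding h2_def by (intro sum.cong refl) (simp add: h_sym[of a] mult.commute)
  ultimately show ?thesis by simp
qed

lemma \<delta>_h_\<nu>': "(\<Sum>b\<in>UNIV. \<delta> c (h b a) p * \<nu> p $ b) = - h2 c a p"
proof -
  have "(\<Sum>b\<in>UNIV. \<delta> c (h b a) p * \<nu> p $ b) = (\<Sum>b\<in>UNIV. \<delta> c (h a b) p * \<nu> p $ b)"
    by (intro sum.cong refl arg_cong2[where f="(*)"] \<delta>_h_sym)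
  then show ?thesis by (simp only: \<delta>_h_\<nu>)
qed

text \<open>The derivative of \<open>h\<close> splits orthogonally into its tangential part
  \<open>S\<close> and two normal slots. By \<open>\<delta>_h_\<nu>\<close> each slot contributes
  the squared norm of \<open>h2\<close>, and the doubly normal part is zero.\<close>

lemma sum_S_sq: "(\<Sum>c\<in>UNIV. \<Sum>a\<in>UNIV. \<Sum>b\<in>UNIV. (S c a b p)\<^sup>2) = dh_sq p - 2 * h2_sq p"
proof -
  have "(\<Sum>a\<in>UNIV. \<Sum>b\<in>UNIV. (S c a b p)\<^sup>2)
     = (\<Sum>a\<in>UNIV. \<Sum>b\<in>UNIV. (\<delta> c (h a b) p)\<^sup>2) - 2 * (\<Sum>b\<in>UNIV. (h2 c b p)\<^sup>2)" for c
  proof -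
    define d where "d a b = \<delta> c (h a b) p" for a b
    define q where "q b = h2 c b p" for b
    define n where "n b = \<nu> p $ b" for b
    have 1: "(\<Sum>a\<in>UNIV. \<Sum>b\<in>UNIV. d a b * n a * q b) = - (\<Sum>b\<in>UNIV. (q b)\<^sup>2)"
    proof -
      have "(\<Sum>a\<in>UNIV. \<Sum>b\<in>UNIV. d a b * n a * q b) = (\<Sum>b\<in>UNIV. (\<Sum>a\<in>UNIV. d a b * n a) * q b)"
        by (subst sum.swap) (simp add: sum_distrib_right)
      also have "\<dots> = - (\<Sum>b\<in>UNIV. (q b)\<^sup>2)"
        unfolding d_def n_def q_def \<delta>_h_\<nu>' by (simp add: power2_eq_square sum_negf)
      finally show ?thesis .
    qed
    have 2: "(\<Sum>a\<in>UNIV. \<Sum>b\<in>UNIV. d a b * n b * q a) = - (\<Sum>b\<in>UNIV. (q b)\<^sup>2)"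
    proof -
      have "(\<Sum>a\<in>UNIV. \<Sum>b\<in>UNIV. d a b * n b * q a) = (\<Sum>a\<in>UNIV. (\<Sum>b\<in>UNIV. d a b * n b) * q a)"
        by (simp add: sum_distrib_right)
      also have "\<dots> = - (\<Sum>b\<in>UNIV. (q b)\<^sup>2)"
        unfolding d_def n_def q_def \<delta>_h_\<nu> by (simp add: power2_eq_square sum_negf)
      finally show ?thesis .
    qed
    have nn: "(\<Sum>a\<in>UNIV. n a * n a) = 1" by (simp add: n_def sum_\<nu>_sq)
    have qn: "(\<Sum>a\<in>UNIV. q a * n a) = 0" by (simp add: n_def q_def h2_\<nu>)
    have 3: "(\<Sum>a\<in>UNIV. \<Sum>b\<in>UNIV. (n a * n a) * (q b)\<^sup>2) = (\<Sum>b\<in>UNIV. (q b)\<^sup>2)"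
      unfolding sum_product[symmetric] nn by simp
    have 4: "(\<Sum>a\<in>UNIV. \<Sum>b\<in>UNIV. (q a)\<^sup>2 * (n b * n b)) = (\<Sum>b\<in>UNIV. (q b)\<^sup>2)"
      unfolding sum_product[symmetric] nn by simp
    have 5: "(\<Sum>a\<in>UNIV. \<Sum>b\<in>UNIV. (q a * n a) * (q b * n b)) = 0"
      unfolding sum_product[symmetric] qn by simp
    have "(S c a b p)\<^sup>2 = (d a b)\<^sup>2 + 2 * (d a b * n a * q b) + 2 * (d a b * n b * q a)
       + (n a * n a) * (q b)\<^sup>2 + (q a)\<^sup>2 * (n b * n b) + 2 * ((q a * n a) * (q b * n b))" for a b
      unfolding S_def d_def n_def q_def by (simp add: power2_eq_square algebra_simps)
    then have "(\<Sum>a\<in>UNIV. \<Sum>b\<in>UNIV. (S c a b p)\<^sup>2) = (\<Sum>a\<in>UNIV. \<Sum>b\<in>UNIV. (d a b)\<^sup>2)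
       + 2 * (\<Sum>a\<in>UNIV. \<Sum>b\<in>UNIV. d a b * n a * q b) + 2 * (\<Sum>a\<in>UNIV. \<Sum>b\<in>UNIV. d a b * n b * q a)
       + (\<Sum>a\<in>UNIV. \<Sum>b\<in>UNIV. (n a * n a) * (q b)\<^sup>2) + (\<Sum>a\<in>UNIV. \<Sum>b\<in>UNIV. (q a)\<^sup>2 * (n b * n b))
       + 2 * (\<Sum>a\<in>UNIV. \<Sum>b\<in>UNIV. (q a * n a) * (q b * n b))"
      by (simp only: sum.distrib sum_distrib_left)
    then show ?thesis unfolding 1 2 3 4 5 by (simp add: d_def q_def)
  qed
  then show ?thesis
    by (simp add: dh_sq_def h2_sq_def sum_subtractf sum_distrib_left)
qed

lemma \<delta>_hh: "\<delta> c hh p = 2 * (\<Sum>a\<in>UNIV. \<Sum>b\<in>UNIV. h a b p * \<delta> c (h a b) p)"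
  unfolding hh_def[abs_def] power2_eq_square
  by (simp add: \<delta>_sum \<delta>_mult sum_distrib_left algebra_simps)

lemma laplacian_hh:
  "(\<Sum>c\<in>UNIV. \<delta> c (\<delta> c hh) p) = 2 * dh_sq p
     + 2 * (\<Sum>c\<in>UNIV. \<Sum>a\<in>UNIV. \<Sum>b\<in>UNIV. h a b p * \<delta> c (\<delta> c (h a b)) p)"
proof -
  have "\<delta> c (\<delta> c hh) p = 2 * (\<Sum>a\<in>UNIV. \<Sum>b\<in>UNIV. (\<delta> c (h a b) p)\<^sup>2)
     + 2 * (\<Sum>a\<in>UNIV. \<Sum>b\<in>UNIV. h a b p * \<delta> c (\<delta> c (h a b)) p)" for c
  proof -
    have "\<delta> c hh = (\<lambda>p. 2 * (\<Sum>a\<in>UNIV. \<Sum>b\<in>UNIV. h a b p * \<delta> c (h a b) p))"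
      using \<delta>_hh by blast
    then show ?thesis
      by (simp add: \<delta>_sum \<delta>_mult sum.distrib power2_eq_square distrib_left)
  qed
  then show ?thesis by (simp add: dh_sq_def sum.distrib sum_distrib_left)
qed

text \<open>Codazzi moves the index \<open>c\<close> into \<open>h\<close>, the commutator exchanges
  the two derivatives, and Codazzi again turns the inner divergence into the gradient of
  \<open>H\<close>. The term with \<open>h2_sq\<close> is an effect of ambient components and
  cancels the one in \<open>sum_S_sq\<close> when both enter the Laplacian of
  \<open>hh\<close>.\<close>

lemma simons:
  "(\<Sum>c\<in>UNIV. \<Sum>a\<in>UNIV. \<Sum>b\<in>UNIV. h a b p * \<delta> c (\<delta> c (h a b)) p)
     = (\<Sum>a\<in>UNIV. \<Sum>b\<in>UNIV. h a b p * \<delta> a (\<delta> b H) p)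
       + H p * (\<Sum>a\<in>UNIV. \<Sum>b\<in>UNIV. h a b p * h2 a b p) - (hh p)\<^sup>2 - 2 * h2_sq p"
proof -
  \<comment> \<open>The Codazzi equation holds at every point, so it may be differentiated once
    more.\<close>
  have E1: "\<delta> c (\<delta> c (h a b)) p = \<delta> c (\<delta> a (h c b)) p + h c c p * h2 a b p + \<nu> p $ c * \<delta> c (h2 a b) p
      - h c a p * h2 c b p - \<nu> p $ a * \<delta> c (h2 c b) p" for a b c
  proof -
    have "\<delta> c (h a b) = (\<lambda>p. \<delta> a (h c b) p + \<nu> p $ c * h2 a b p - \<nu> p $ a * h2 c b p)"
      using codazzi by blast
    then show ?thesis by (simp add: \<delta>_add \<delta>_diff \<delta>_mult h_def[symmetric])
  qed
  have E2: "\<delta> c (\<delta> a (h c b)) p = \<delta> a (\<delta> c (h c b)) p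
      + \<nu> p $ c * (\<Sum>d\<in>UNIV. h a d p * \<delta> d (h c b) p) - \<nu> p $ a * (\<Sum>d\<in>UNIV. h c d p * \<delta> d (h c b) p)" for a b c
    by (rule \<delta>_commute) simp
  \<comment> \<open>Codazzi makes the divergence of \<open>h\<close> the gradient of
    \<open>H\<close> up to a normal term with \<open>hh\<close>. Differentiating that normal term
    produces \<open>h a b * hh\<close>, which becomes the square of \<open>hh\<close> after
    contraction.\<close>
  have E3: "(\<Sum>c\<in>UNIV. \<delta> a (\<delta> c (h c b)) p) = \<delta> a (\<delta> b H) p - h a b p * hh p - \<nu> p $ b * \<delta> a hh p" for a b
  proof -
    have "(\<Sum>c\<in>UNIV. \<delta> c (h c b) q) = \<delta> b H q - \<nu> q $ b * hh q" for q
    proof -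
      have "\<delta> c (h c b) q = \<delta> b (h c c) q + \<nu> q $ c * h2 c b q - \<nu> q $ b * h2 c c q" for c
        using codazzi[of c b c q] by (simp add: \<delta>_h_sym[of c c b] h2_sym[of b c])
      then have "(\<Sum>c\<in>UNIV. \<delta> c (h c b) q) = (\<Sum>c\<in>UNIV. \<delta> b (h c c) q) - \<nu> q $ b * hh q"
        by (simp add: sum.distrib sum_subtractf \<nu>_h2 sum_distrib_left[symmetric] sum_h2_diag)
      then show ?thesis by (simp add: H_def[abs_def] \<delta>_sum)
    qed
    then have "\<delta> a (\<lambda>q. \<Sum>c\<in>UNIV. \<delta> c (h c b) q) p = \<delta> a (\<lambda>q. \<delta> b H q - \<nu> q $ b * hh q) p"
      by simp
    then show ?thesis by (simp add: \<delta>_sum \<delta>_diff \<delta>_mult h_def[symmetric])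
  qed
  let ?s = "\<lambda>T. \<Sum>c\<in>UNIV. \<Sum>a\<in>UNIV. \<Sum>b\<in>UNIV. h a b p * T c a b"
  have h\<nu>: "(\<Sum>a\<in>UNIV. h a b p * \<nu> p $ a) = 0" for b by (rule h_\<nu>')
  \<comment> \<open>Every term with a free \<open>\<nu>\<close> in the slot \<open>a\<close> is
    killed by the contraction with \<open>h a b\<close>.\<close>
  have n_a: "?s (\<lambda>c a b. \<nu> p $ a * X c b) = 0" for X :: "'k \<Rightarrow> 'k \<Rightarrow> real"
  proof -
    have "(\<Sum>a\<in>UNIV. \<Sum>b\<in>UNIV. h a b p * (\<nu> p $ a * X c b)) = (\<Sum>b\<in>UNIV. (\<Sum>a\<in>UNIV. h a b p * \<nu> p $ a) * X c b)" for c
      by (subst sum.swap) (simp add: sum_distrib_right mult.assoc)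
    then show ?thesis by (simp add: h\<nu>)
  qed
  have T2: "?s (\<lambda>c a b. h c c p * h2 a b p) = H p * (\<Sum>a\<in>UNIV. \<Sum>b\<in>UNIV. h a b p * h2 a b p)"
  proof -
    have "?s (\<lambda>c a b. h c c p * h2 a b p) = (\<Sum>c\<in>UNIV. h c c p * (\<Sum>a\<in>UNIV. \<Sum>b\<in>UNIV. h a b p * h2 a b p))"
      by (simp add: sum_distrib_left mult_ac)
    then show ?thesis by (simp only: H_def sum_distrib_right)
  qed
  have T3: "?s (\<lambda>c a b. \<nu> p $ c * \<delta> c (h2 a b) p) = 0"
  proof -
    have "?s (\<lambda>c a b. \<nu> p $ c * \<delta> c (h2 a b) p) = (\<Sum>a\<in>UNIV. \<Sum>c\<in>UNIV. \<Sum>b\<in>UNIV. h a b p * (\<nu> p $ c * \<delta> c (h2 a b) p))"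
      by (rule sum.swap)
    also have "\<dots> = (\<Sum>a\<in>UNIV. \<Sum>b\<in>UNIV. h a b p * (\<Sum>c\<in>UNIV. \<nu> p $ c * \<delta> c (h2 a b) p))"
      unfolding sum_distrib_left by (intro sum.cong refl sum.swap)
    finally show ?thesis by (simp add: \<nu>_\<delta>)
  qed
  have T4: "?s (\<lambda>c a b. h c a p * h2 c b p) = h2_sq p"
  proof -
    have "(\<Sum>a\<in>UNIV. \<Sum>b\<in>UNIV. h a b p * (h c a p * h2 c b p)) = (\<Sum>b\<in>UNIV. (h2 c b p)\<^sup>2)" for c
    proof -
      have "(\<Sum>a\<in>UNIV. \<Sum>b\<in>UNIV. h a b p * (h c a p * h2 c b p)) = (\<Sum>b\<in>UNIV. (\<Sum>a\<in>UNIV. h c a p * h a b p) * h2 c b p)"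
        by (subst sum.swap) (simp add: sum_distrib_right sum_distrib_left mult_ac)
      then show ?thesis by (simp add: h2_def[symmetric] power2_eq_square)
    qed
    then show ?thesis by (simp add: h2_sq_def)
  qed
  \<comment> \<open>Here \<open>\<nu>\<close> sits in a slot of the derivative of \<open>h\<close>,
    not of \<open>h\<close> itself; by \<open>\<delta>_h_\<nu>'\<close> it leaves
    \<open>- h2\<close> instead of zero.\<close>
  have T1b: "?s (\<lambda>c a b. \<nu> p $ c * (\<Sum>d\<in>UNIV. h a d p * \<delta> d (h c b) p)) = - h2_sq p"
  proof -
    have "?s (\<lambda>c a b. \<nu> p $ c * (\<Sum>d\<in>UNIV. h a d p * \<delta> d (h c b) p))
       = (\<Sum>a\<in>UNIV. \<Sum>b\<in>UNIV. \<Sum>c\<in>UNIV. h a b p * (\<nu> p $ c * (\<Sum>d\<in>UNIV. h a d p * \<delta> d (h c b) p)))"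
      by (subst sum.swap) (intro sum.cong refl sum.swap)
    also have "\<dots> = (\<Sum>a\<in>UNIV. \<Sum>b\<in>UNIV. h a b p * (\<Sum>d\<in>UNIV. h a d p * (\<Sum>c\<in>UNIV. \<delta> d (h c b) p * \<nu> p $ c)))"
    proof (intro sum.cong refl)
      fix a b
      have "(\<Sum>c\<in>UNIV. \<nu> p $ c * (\<Sum>d\<in>UNIV. h a d p * \<delta> d (h c b) p)) = (\<Sum>d\<in>UNIV. h a d p * (\<Sum>c\<in>UNIV. \<delta> d (h c b) p * \<nu> p $ c))"
        unfolding sum_distrib_left by (subst sum.swap) (simp add: mult_ac)
      then show "(\<Sum>c\<in>UNIV. h a b p * (\<nu> p $ c * (\<Sum>d\<in>UNIV. h a d p * \<delta> d (h c b) p)))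
         = h a b p * (\<Sum>d\<in>UNIV. h a d p * (\<Sum>c\<in>UNIV. \<delta> d (h c b) p * \<nu> p $ c))"
        by (simp only: sum_distrib_left[symmetric])
    qed
    also have "\<dots> = - (\<Sum>a\<in>UNIV. \<Sum>b\<in>UNIV. \<Sum>d\<in>UNIV. h a b p * h a d p * h2 d b p)"
      unfolding \<delta>_h_\<nu>' by (simp add: sum_negf sum_distrib_left mult.assoc)
    also have "(\<Sum>a\<in>UNIV. \<Sum>b\<in>UNIV. \<Sum>d\<in>UNIV. h a b p * h a d p * h2 d b p)
       = (\<Sum>b\<in>UNIV. \<Sum>d\<in>UNIV. (\<Sum>a\<in>UNIV. h d a p * h a b p) * h2 d b p)"
    proof -
      have "(\<Sum>a\<in>UNIV. \<Sum>b\<in>UNIV. \<Sum>d\<in>UNIV. h a b p * h a d p * h2 d b p)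
        = (\<Sum>b\<in>UNIV. \<Sum>d\<in>UNIV. \<Sum>a\<in>UNIV. h a b p * h a d p * h2 d b p)"
        by (subst sum.swap) (intro sum.cong refl sum.swap)
      then show ?thesis by (simp add: sum_distrib_right sum_distrib_left h_sym mult_ac)
    qed
    also have "\<dots> = h2_sq p"
      unfolding h2_def[symmetric] h2_sq_def power2_eq_square by (rule sum.swap)
    finally show ?thesis .
  qed
  have T1a: "?s (\<lambda>c a b. \<delta> a (\<delta> c (h c b)) p) = (\<Sum>a\<in>UNIV. \<Sum>b\<in>UNIV. h a b p * \<delta> a (\<delta> b H) p) - (hh p)\<^sup>2"
  proof -
    have "?s (\<lambda>c a b. \<delta> a (\<delta> c (h c b)) p) = (\<Sum>a\<in>UNIV. \<Sum>b\<in>UNIV. \<Sum>c\<in>UNIV. h a b p * \<delta> a (\<delta> c (h c b)) p)"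
      by (subst sum.swap) (intro sum.cong refl sum.swap)
    also have "\<dots> = (\<Sum>a\<in>UNIV. \<Sum>b\<in>UNIV. h a b p * (\<delta> a (\<delta> b H) p - h a b p * hh p - \<nu> p $ b * \<delta> a hh p))"
      by (simp only: sum_distrib_left[symmetric] E3)
    also have "\<dots> = (\<Sum>a\<in>UNIV. \<Sum>b\<in>UNIV. h a b p * \<delta> a (\<delta> b H) p)
       - (\<Sum>a\<in>UNIV. \<Sum>b\<in>UNIV. (h a b p)\<^sup>2 * hh p) - (\<Sum>a\<in>UNIV. (\<Sum>b\<in>UNIV. h a b p * \<nu> p $ b) * \<delta> a hh p)"
      unfolding sum_distrib_right sum_subtractf[symmetric]
      by (intro sum.cong refl) (simp add: power2_eq_square algebra_simps)
    also have "(\<Sum>a\<in>UNIV. \<Sum>b\<in>UNIV. (h a b p)\<^sup>2 * hh p) = (hh p)\<^sup>2"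
      unfolding sum_distrib_right[symmetric] hh_def[symmetric] by (simp add: power2_eq_square)
    finally show ?thesis by (simp add: h_\<nu>)
  qed
  have "?s (\<lambda>c a b. \<delta> c (\<delta> c (h a b)) p) = ?s (\<lambda>c a b. \<delta> a (\<delta> c (h c b)) p)
     + ?s (\<lambda>c a b. \<nu> p $ c * (\<Sum>d\<in>UNIV. h a d p * \<delta> d (h c b) p)) - ?s (\<lambda>c a b. \<nu> p $ a * (\<Sum>d\<in>UNIV. h c d p * \<delta> d (h c b) p))
     + ?s (\<lambda>c a b. h c c p * h2 a b p) + ?s (\<lambda>c a b. \<nu> p $ c * \<delta> c (h2 a b) p)
     - ?s (\<lambda>c a b. h c a p * h2 c b p) - ?s (\<lambda>c a b. \<nu> p $ a * \<delta> c (h2 c b) p)"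
    unfolding E1 E2 sum_subtractf[symmetric] sum.distrib[symmetric]
    by (intro sum.cong refl) (simp only: distrib_left right_diff_distrib)
  then show ?thesis
    unfolding T1a T1b T2 T3 T4 n_a by simp
qed

end

section \<open>Consequences of the self-expander equation\<close>

locale self_expanding = hypersurface \<A> F \<nu>
  for \<A> :: "('m::{t2_space,second_countable_topology}, 'n::finite) chart set"
    and F \<nu> :: "'m \<Rightarrow> real^'k" +
  assumes expander: "self_expander \<A> F \<nu>"
begin

lemma H_eq: "H p = - (1/2) * (F p \<bullet> \<nu> p)"
  using expander unfolding self_expander_def mean_curvature_eq H_def by simp

lemma F_\<nu>: "(\<Sum>a\<in>UNIV. F p $ a * \<nu> p $ a) = - 2 * H p"
  using H_eq[of p] by (simp add: inner_vec_def)

lemma sum_\<delta>_F: "(\<Sum>c\<in>UNIV. \<delta> a (\<lambda>p. F p $ c) p * x c) = x a - \<nu> p $ a * (\<Sum>c\<in>UNIV. \<nu> p $ c * x c)"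
proof -
  have "\<delta> a (\<lambda>p. F p $ c) p * x c = (if a = c then x c else 0) - \<nu> p $ a * (\<nu> p $ c * x c)" for c
    by (simp add: \<delta>_F algebra_simps)
  then show ?thesis by (simp add: sum_subtractf sum_distrib_left)
qed

text \<open>In the derivative of the support function the term with the derivative of
  \<open>F\<close> is the tangential projection of \<open>\<nu>\<close>, which is zero; only the
  derivative of \<open>\<nu>\<close> remains.\<close>

lemma \<delta>_H: "\<delta> b H p = - (1/2) * (\<Sum>c\<in>UNIV. F p $ c * h b c p)"
proof -
  have "H = (\<lambda>p. - (1/2) * (\<Sum>c\<in>UNIV. F p $ c * \<nu> p $ c))"
    using F_\<nu> by (simp add: fun_eq_iff)
  then have "\<delta> b H p = - (1/2) * \<delta> b (\<lambda>p. \<Sum>c\<in>UNIV. F p $ c * \<nu> p $ c) p"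
    by (simp only:, intro \<delta>_cmult) simp
  also have "\<dots> = - (1/2) * (\<Sum>c\<in>UNIV. \<delta> b (\<lambda>p. F p $ c) p * \<nu> p $ c + F p $ c * h b c p)"
    by (simp add: \<delta>_mult \<delta>_sum h_def[symmetric] add.commute)
  finally have "\<delta> b H p = - (1/2) * (\<Sum>c\<in>UNIV. \<delta> b (\<lambda>p. F p $ c) p * \<nu> p $ c + F p $ c * h b c p)" .
  then show ?thesis by (simp add: sum.distrib sum_\<delta>_F sum_\<nu>_sq)
qed

text \<open>Codazzi brings the derivative of \<open>h\<close> into the direction of
  \<open>F\<close>. The component of \<open>F\<close> along \<open>\<nu>\<close> is
  \<open>- 2 * H\<close>, which is where the last term comes from.\<close>

lemma \<delta>_\<delta>_H: "\<delta> a (\<delta> b H) p = - (1/2) * h a b p - (1/2) * (\<Sum>c\<in>UNIV. F p $ c * \<delta> c (h a b) p)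
    - (1/2) * \<nu> p $ a * (\<Sum>c\<in>UNIV. F p $ c * h2 c b p) - H p * h2 a b p"
proof -
  have "\<delta> b H = (\<lambda>p. - (1/2) * (\<Sum>c\<in>UNIV. F p $ c * h b c p))"
    using \<delta>_H by blast
  then have "\<delta> a (\<delta> b H) p = - (1/2) * \<delta> a (\<lambda>p. \<Sum>c\<in>UNIV. F p $ c * h b c p) p"
    by (simp only:, intro \<delta>_cmult) simp
  also have "\<dots> = - (1/2) * (\<Sum>c\<in>UNIV. \<delta> a (\<lambda>p. F p $ c) p * h b c p + F p $ c * \<delta> a (h b c) p)"
    by (simp add: \<delta>_mult \<delta>_sum add.commute)
  also have "(\<Sum>c\<in>UNIV. \<delta> a (\<lambda>p. F p $ c) p * h b c p + F p $ c * \<delta> a (h b c) p)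
     = h a b p + (\<Sum>c\<in>UNIV. F p $ c * \<delta> a (h b c) p)"
    using \<nu>_h[of p b] by (simp add: sum.distrib sum_\<delta>_F h_sym[of b])
  also have "(\<Sum>c\<in>UNIV. F p $ c * \<delta> a (h b c) p) = (\<Sum>c\<in>UNIV. F p $ c * \<delta> c (h a b) p)
     + \<nu> p $ a * (\<Sum>c\<in>UNIV. F p $ c * h2 c b p) - (\<Sum>c\<in>UNIV. F p $ c * \<nu> p $ c) * h2 a b p"
  proof -
    have "F p $ c * \<delta> a (h b c) p = F p $ c * \<delta> c (h a b) p
        + \<nu> p $ a * (F p $ c * h2 c b p) - (F p $ c * \<nu> p $ c) * h2 a b p" for c
    proof -
      have "\<delta> a (h b c) p = \<delta> c (h a b) p + \<nu> p $ a * h2 c b p - \<nu> p $ c * h2 a b p"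
        using codazzi[of a c b p] by (simp only: \<delta>_h_sym[of a b c])
      then show ?thesis by (simp only:) (simp add: algebra_simps)
    qed
    then show ?thesis by (simp only: sum.distrib sum_subtractf sum_distrib_left sum_distrib_right)
  qed
  finally show ?thesis by (simp add: F_\<nu> algebra_simps)
qed

lemma drift_laplacian_H: "drift_laplacian H p = - (1/2 + hh p) * H p"
proof -
  have 1: "(\<Sum>a\<in>UNIV. \<nu> p $ a * (\<Sum>c\<in>UNIV. F p $ c * h2 c a p)) = 0"
  proof -
    have "(\<Sum>a\<in>UNIV. \<nu> p $ a * (\<Sum>c\<in>UNIV. F p $ c * h2 c a p)) = (\<Sum>c\<in>UNIV. F p $ c * (\<Sum>a\<in>UNIV. h2 c a p * \<nu> p $ a))"
      unfolding sum_distrib_left by (subst sum.swap) (simp add: mult_ac)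
    then show ?thesis by (simp add: h2_\<nu>)
  qed
  have 2: "(\<Sum>a\<in>UNIV. \<Sum>c\<in>UNIV. F p $ c * \<delta> c (h a a) p) = (\<Sum>c\<in>UNIV. F p $ c * \<delta> c H p)"
    by (subst sum.swap) (simp add: H_def[abs_def] \<delta>_sum sum_distrib_left)
  have "(\<Sum>a\<in>UNIV. \<delta> a (\<delta> a H) p) = - (1/2) * (\<Sum>a\<in>UNIV. h a a p) - (1/2) * (\<Sum>a\<in>UNIV. \<Sum>c\<in>UNIV. F p $ c * \<delta> c (h a a) p)
     - (1/2) * (\<Sum>a\<in>UNIV. \<nu> p $ a * (\<Sum>c\<in>UNIV. F p $ c * h2 c a p)) - H p * (\<Sum>a\<in>UNIV. h2 a a p)"
    unfolding \<delta>_\<delta>_H by (simp only: sum_subtractf sum_distrib_left mult.assoc)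
  then show ?thesis
    unfolding 1 2 by (simp add: drift_laplacian_def H_def[symmetric] sum_h2_diag algebra_simps)
qed

text \<open>The cubic trace multiplied by \<open>H\<close> appears in Simons' identity and, with the
  opposite sign, in the Hessian of \<open>H\<close>; the first order terms in \<open>F\<close> form
  the drift. Only the gradient of \<open>A\<close> and powers of \<open>hh\<close> are left.\<close>

lemma drift_laplacian_hh:
  "drift_laplacian hh p = 2 * (\<Sum>c\<in>UNIV. \<Sum>a\<in>UNIV. \<Sum>b\<in>UNIV. (S c a b p)\<^sup>2) - (1 + 2 * hh p) * hh p"
proof -
  have 1: "(\<Sum>a\<in>UNIV. \<Sum>b\<in>UNIV. h a b p * (\<nu> p $ a * (\<Sum>c\<in>UNIV. F p $ c * h2 c b p))) = 0"
  proof -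
    have "(\<Sum>a\<in>UNIV. \<Sum>b\<in>UNIV. h a b p * (\<nu> p $ a * (\<Sum>c\<in>UNIV. F p $ c * h2 c b p)))
      = (\<Sum>b\<in>UNIV. (\<Sum>a\<in>UNIV. h a b p * \<nu> p $ a) * (\<Sum>c\<in>UNIV. F p $ c * h2 c b p))"
      by (subst sum.swap) (simp add: sum_distrib_right mult.assoc)
    then show ?thesis by (simp add: h_\<nu>')
  qed
  have 2: "(\<Sum>a\<in>UNIV. \<Sum>b\<in>UNIV. h a b p * (\<Sum>c\<in>UNIV. F p $ c * \<delta> c (h a b) p)) = (1/2) * (\<Sum>c\<in>UNIV. F p $ c * \<delta> c hh p)"
  proof -
    have "(\<Sum>a\<in>UNIV. \<Sum>b\<in>UNIV. h a b p * (\<Sum>c\<in>UNIV. F p $ c * \<delta> c (h a b) p))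
      = (\<Sum>a\<in>UNIV. \<Sum>b\<in>UNIV. \<Sum>c\<in>UNIV. F p $ c * (h a b p * \<delta> c (h a b) p))"
      by (simp add: sum_distrib_left mult_ac)
    also have "\<dots> = (\<Sum>a\<in>UNIV. \<Sum>c\<in>UNIV. \<Sum>b\<in>UNIV. F p $ c * (h a b p * \<delta> c (h a b) p))"
      by (intro sum.cong refl sum.swap)
    also have "\<dots> = (\<Sum>c\<in>UNIV. \<Sum>a\<in>UNIV. \<Sum>b\<in>UNIV. F p $ c * (h a b p * \<delta> c (h a b) p))"
      by (rule sum.swap)
    finally show ?thesis unfolding \<delta>_hh by (simp add: sum_distrib_left)
  qed
  have "h a b p * \<delta> a (\<delta> b H) p = - (1/2) * (h a b p)\<^sup>2
     - (1/2) * (h a b p * (\<Sum>c\<in>UNIV. F p $ c * \<delta> c (h a b) p))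
     - (1/2) * (h a b p * (\<nu> p $ a * (\<Sum>c\<in>UNIV. F p $ c * h2 c b p)))
     - H p * (h a b p * h2 a b p)" for a b
    unfolding \<delta>_\<delta>_H by (simp add: power2_eq_square right_diff_distrib)
  then have "(\<Sum>a\<in>UNIV. \<Sum>b\<in>UNIV. h a b p * \<delta> a (\<delta> b H) p) = - (1/2) * hh p
     - (1/2) * (\<Sum>a\<in>UNIV. \<Sum>b\<in>UNIV. h a b p * (\<Sum>c\<in>UNIV. F p $ c * \<delta> c (h a b) p))
     - (1/2) * (\<Sum>a\<in>UNIV. \<Sum>b\<in>UNIV. h a b p * (\<nu> p $ a * (\<Sum>c\<in>UNIV. F p $ c * h2 c b p)))
     - H p * (\<Sum>a\<in>UNIV. \<Sum>b\<in>UNIV. h a b p * h2 a b p)"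
    unfolding hh_def by (simp only: sum_subtractf sum_distrib_left)
  then have 3: "(\<Sum>a\<in>UNIV. \<Sum>b\<in>UNIV. h a b p * \<delta> a (\<delta> b H) p) = - (1/2) * hh p
     - (1/4) * (\<Sum>c\<in>UNIV. F p $ c * \<delta> c hh p) - H p * (\<Sum>a\<in>UNIV. \<Sum>b\<in>UNIV. h a b p * h2 a b p)"
    unfolding 1 2 by simp
  show ?thesis
    unfolding drift_laplacian_def laplacian_hh simons 3 sum_S_sq
    by (simp add: power2_eq_square algebra_simps)
qed

end

section \<open>The strong maximum principle for the mean curvature\<close>

lemma Ck_on_exp:
  fixes f :: "'a::euclidean_space \<Rightarrow> real"
  assumes "open S" "Ck_on k S f"
  shows "Ck_on k S (\<lambda>x. exp (f x))"
  using assms(2)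
proof (induction k)
  case 0
  then show ?case by (auto intro: continuous_on_exp)
next
  case (Suc k)
  have d: "((\<lambda>x. exp (f x)) has_derivative (\<lambda>v. exp (f x) * frechet_derivative f (at x) v)) (at x)"
    if "x \<in> S" for x
    using Ck_on_has_derivative[OF Suc.prems that] by (auto intro!: derivative_eq_intros)
  have i: "Ck_on k S (\<lambda>x. exp (f x))"
    using Suc Ck_on_SucD by blast
  show ?case
    by (subst Ck_on_Suc_iff[OF assms(1) d], assumption)
       (intro allI Ck_on_mult assms(1) i Ck_on_frechet_derivative Suc.prems)
qed

context hypersurface
begin

lemma smooth_map_exp [simp]:
  fixes f :: "'m \<Rightarrow> real"
  assumes "smooth_map \<A> f" shows "smooth_map \<A> (\<lambda>p. exp (f p))"
proof (rule smooth_mapI)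
  fix c assume c: "c \<in> \<A>"
  show "smooth_on (chart_image c) (\<lambda>u. exp (f (chart_inv c u)))"
    unfolding smooth_on_def
    using Ck_on_exp[OF chart_image_open[OF c] smooth_on_imp_Ck_on[OF smooth_map_chart[OF assms c]]] by blast
qed

lemma tgrad_nth: "tgrad f p $ a = \<delta> a f p"
  by (simp add: \<delta>_def)

lemma inner_tgrad: "tgrad f p \<bullet> x = (\<Sum>a\<in>UNIV. \<delta> a f p * x $ a)"
  by (simp add: inner_vec_def tgrad_nth)

lemma coordinate_line_derivative:
  assumes f: "smooth_map \<A> f" and c: "c \<in> \<A>" and u: "u + t *\<^sub>R v \<in> chart_image c"
  shows "((\<lambda>t. f (chart_inv c (u + t *\<^sub>R v))) has_real_derivative
     tgrad f (chart_inv c (u + t *\<^sub>R v)) \<bullet> dF c (u + t *\<^sub>R v) v) (at t)"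
proof -
  have "((\<lambda>u. f (chart_inv c u)) has_derivative
      (\<lambda>v. tgrad f (chart_inv c (u + t *\<^sub>R v')) \<bullet> dF c (u + t *\<^sub>R v') v)) (at (u + t *\<^sub>R v'))"
    if "v' = v" for v'
    using has_tgrad_chart[OF has_tgrad_tgrad[OF f] c, of "chart_inv c (u + t *\<^sub>R v)"] u c that by simp
  from line_has_real_derivative[OF this[OF refl]] show ?thesis
    by (simp add: has_real_derivative_iff_has_vector_derivative)
qed

lemma chart_line_open:
  assumes c: "c \<in> \<A>" "q \<in> fst c" and W: "open W" "q \<in> W"
  obtains d where "d > 0" "\<And>t. \<bar>t\<bar> < d \<Longrightarrow> snd c q + t *\<^sub>R v \<in> chart_image c"
    "\<And>t. \<bar>t\<bar> < d \<Longrightarrow> chart_inv c (snd c q + t *\<^sub>R v) \<in> W"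
proof -
  let ?V = "(\<lambda>t. snd c q + t *\<^sub>R v) -` (chart_image c \<inter> chart_inv c -` W)"
  have "open (chart_image c \<inter> chart_inv c -` W)"
    using continuous_on_chart_inv[OF c(1)] chart_image_open[OF c(1)] W(1)
    by (simp add: continuous_on_open_vimage Int_commute)
  then have "open ?V"
    by (rule open_vimage) (intro continuous_intros)
  moreover have "0 \<in> ?V" using c W by simp
  ultimately obtain d where "d > 0" "ball 0 d \<subseteq> ?V"
    using openE by blast
  then show thesis by (intro that[of d]) (auto simp: subset_iff)
qed

text \<open>Coordinate lines are enough. For the gradient, the line has the gradient as velocity.
  For the second derivative its velocity is \<open>proj q a\<close>; its acceleration does not
  matter because it is paired with the vanishing gradient.\<close>

lemma local_min_\<delta>:
  assumes f: "smooth_map \<A> f" and W: "open W" "q \<in> W" "\<And>p. p \<in> W \<Longrightarrow> f q \<le> f p"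
  shows "\<delta> a f q = 0" and "0 \<le> \<delta> a (\<delta> a f) q"
proof -
  obtain c where c: "c \<in> \<A>" "q \<in> fst c" by (rule ex_chart)
  let ?u = "snd c q"
  have tg: "tgrad f q = 0"
  proof -
    obtain v where v: "dF c ?u v = tgrad f q"
      using tangent_vector_eq_dF[OF c tgrad_normal[OF f]] by blast
    obtain d where d: "d > 0" "\<And>t. \<bar>t\<bar> < d \<Longrightarrow> ?u + t *\<^sub>R v \<in> chart_image c"
      "\<And>t. \<bar>t\<bar> < d \<Longrightarrow> chart_inv c (?u + t *\<^sub>R v) \<in> W"
      using chart_line_open[OF c W(1,2)] by blast
    have "((\<lambda>t. f (chart_inv c (?u + t *\<^sub>R v))) has_real_derivative tgrad f q \<bullet> tgrad f q) (at 0)"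
      using coordinate_line_derivative[OF f c(1), of ?u 0 v] c v by simp
    then have "tgrad f q \<bullet> tgrad f q = 0"
      by (rule DERIV_local_min[OF _ d(1)]) (use d c W in auto)
    then show ?thesis by simp
  qed
  then show "\<delta> a f q = 0" by (simp add: \<delta>_def)
  show "0 \<le> \<delta> a (\<delta> a f) q"
  proof (rule ccontr)
    assume neg: "\<not> 0 \<le> \<delta> a (\<delta> a f) q"
    obtain v where v: "dF c ?u v = proj q a"
      using tangent_vector_eq_dF[OF c proj_normal] by blast
    obtain d where d: "d > 0" "\<And>t. \<bar>t\<bar> < d \<Longrightarrow> ?u + t *\<^sub>R v \<in> chart_image c"
      "\<And>t. \<bar>t\<bar> < d \<Longrightarrow> chart_inv c (?u + t *\<^sub>R v) \<in> W"
      using chart_line_open[OF c W(1,2)] by blast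
    let ?g = "\<lambda>t. chart_inv c (?u + t *\<^sub>R v)"
    let ?D = "\<lambda>t. dF c (?u + t *\<^sub>R v) v"
    have f1: "((\<lambda>t. f (?g t)) has_real_derivative (\<Sum>b\<in>UNIV. \<delta> b f (?g t) * ?D t $ b)) (at t)" if "\<bar>t\<bar> < d" for t
      using coordinate_line_derivative[OF f c(1) d(2)[OF that]] by (simp add: inner_tgrad)
    have smD: "smooth_on (chart_image c) (\<lambda>u. dF c u v)"
      unfolding dF_def by (intro smooth_on_frechet_derivative smooth_map_chart smooth_F c)
    have "((\<lambda>t. \<Sum>b\<in>UNIV. \<delta> b f (?g t) * ?D t $ b) has_real_derivative \<delta> a (\<delta> a f) q) (at 0)"
    proof -
      have 1: "((\<lambda>t. \<delta> b f (?g t)) has_real_derivative \<delta> a (\<delta> b f) q) (at 0)" for b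
        using coordinate_line_derivative[OF smooth_map_\<delta>[OF f] c(1), of ?u 0 v b] c v
          tgrad_normal[OF smooth_map_\<delta>[OF f]]
        by (simp add: inner_proj \<delta>_def[of a "\<delta> b f"])
      define D' where "D' = frechet_derivative (\<lambda>u. dF c u v) (at (?u + 0 *\<^sub>R v)) v"
      have "((\<lambda>t. ?D t) has_vector_derivative D') (at 0)"
        unfolding D'_def
        by (rule line_has_real_derivative[OF smooth_on_has_derivative[OF smD]]) (use c in simp)
      then have 2: "((\<lambda>t. ?D t $ b) has_real_derivative D' $ b) (at 0)" for b
        using bounded_linear.has_vector_derivative[OF bounded_linear_vec_nth]
        by (simp add: has_real_derivative_iff_has_vector_derivative)
      have "((\<lambda>t. \<Sum>b\<in>UNIV. \<delta> b f (?g t) * ?D t $ b) has_real_derivative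
         (\<Sum>b\<in>UNIV. \<delta> a (\<delta> b f) q * ?D 0 $ b + D' $ b * \<delta> b f (?g 0))) (at 0)"
        by (intro DERIV_sum DERIV_mult 1 2)
      moreover have "(\<Sum>b\<in>UNIV. \<delta> a (\<delta> b f) q * ?D 0 $ b + D' $ b * \<delta> b f (?g 0)) = \<delta> a (\<delta> a f) q"
        using c tg \<delta>_\<delta>_\<nu>[OF f, of a q] by (simp add: v \<delta>_def[of _ f] sum_proj)
      ultimately show ?thesis by simp
    qed
    then obtain e where e: "e > 0" "\<And>h. h > 0 \<Longrightarrow> h < e \<Longrightarrow>
        (\<Sum>b\<in>UNIV. \<delta> b f (?g h) * ?D h $ b) < (\<Sum>b\<in>UNIV. \<delta> b f (?g 0) * ?D 0 $ b)"
      using DERIV_neg_dec_right[of _ "\<delta> a (\<delta> a f) q" 0] neg by force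
    define s where "s = min d e / 2"
    have s: "0 < s" "s < d" "s < e" using d e by (auto simp: s_def)
    have "\<exists>z>0. z < s \<and> f (?g s) - f (?g 0) = (s - 0) * (\<Sum>b\<in>UNIV. \<delta> b f (?g z) * ?D z $ b)"
      by (rule MVT2) (use s in \<open>auto intro!: f1\<close>)
    then obtain z where z: "0 < z" "z < s" "f (?g s) - f (?g 0) = s * (\<Sum>b\<in>UNIV. \<delta> b f (?g z) * ?D z $ b)"
      by auto
    have "(\<Sum>b\<in>UNIV. \<delta> b f (?g z) * ?D z $ b) < 0"
      using e(2)[of z] z s c tg by (simp add: \<delta>_def[of _ f])
    then have "f (?g s) < f (?g 0)"
      using z s mult_pos_neg[of s] by fastforce
    moreover have "f q \<le> f (?g s)" using W(3) d(3)[of s] s by auto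
    ultimately show False using c by simp
  qed
qed

lemma smooth_drift_laplacian [simp]: "smooth_map \<A> f \<Longrightarrow> smooth_map \<A> (drift_laplacian f)"
  unfolding drift_laplacian_def[abs_def]
  by (intro smooth_map_add smooth_map_mult smooth_map_const smooth_map_sum smooth_map_\<delta> smooth_F_nth)

lemma drift_laplacian_diff:
  assumes "smooth_map \<A> f" "smooth_map \<A> g"
  shows "drift_laplacian (\<lambda>p. f p - g p) p = drift_laplacian f p - drift_laplacian g p"
proof -
  have "\<delta> a (\<lambda>p. f p - g p) = (\<lambda>p. \<delta> a f p - \<delta> a g p)" for a
    using \<delta>_diff[OF assms] by blast
  then show ?thesis
    using assms by (simp add: drift_laplacian_def \<delta>_diff sum_subtractf algebra_simps)
qed

lemma drift_laplacian_cmult: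
  assumes "smooth_map \<A> f"
  shows "drift_laplacian (\<lambda>p. k * f p) p = k * drift_laplacian f p"
proof -
  have "\<delta> a (\<lambda>p. k * f p) = (\<lambda>p. k * \<delta> a f p)" for a
    using \<delta>_cmult[OF assms] by blast
  then show ?thesis
    using assms by (simp add: drift_laplacian_def \<delta>_cmult sum_distrib_left algebra_simps)
qed

lemma drift_laplacian_compose:
  assumes f: "smooth_map \<A> f" and \<phi>: "\<And>x. (\<phi> has_real_derivative \<phi>' x) (at x)"
    "\<And>x. (\<phi>' has_real_derivative \<phi>'' x) (at x)"
  shows "drift_laplacian (\<lambda>p. \<phi> (f p)) p = \<phi>' (f p) * drift_laplacian f p
     + \<phi>'' (f p) * (\<Sum>a\<in>UNIV. (\<delta> a f p)\<^sup>2)"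
proof -
  have 1: "\<delta> a (\<lambda>p. \<phi> (f p)) = (\<lambda>p. \<phi>' (f p) * \<delta> a f p)" for a
    using \<delta>_compose[OF f \<phi>(1)] by blast
  have "\<delta> a (\<lambda>p. \<phi>' (f p) * \<delta> a f p) p = \<phi>' (f p) * \<delta> a (\<delta> a f) p + \<phi>'' (f p) * (\<delta> a f p)\<^sup>2" for a
    using \<delta>_eqI[OF has_tgrad_mult[OF has_tgrad_compose[OF has_tgrad_tgrad[OF f] \<phi>(2)]
        has_tgrad_tgrad[OF smooth_map_\<delta>[OF f]]], where a=a]
    by (simp add: tgrad_nth power2_eq_square algebra_simps)
  with 1 show ?thesis
    by (simp add: drift_laplacian_def sum.distrib sum_distrib_left algebra_simps)
qed

lemma open_chart_inv_image:
  assumes "c \<in> \<A>" "open U" "U \<subseteq> chart_image c"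
  shows "open (chart_inv c ` U)"
proof -
  have "chart_inv c ` U = snd c -` U \<inter> fst c"
    using assms by (force simp: image_iff subset_iff)
  then show ?thesis
    using continuous_on_chart[OF assms(1)] chart_open[OF assms(1)] assms(2)
    by (simp add: continuous_on_open_vimage)
qed

lemma compact_chart_inv_image:
  "c \<in> \<A> \<Longrightarrow> K \<subseteq> chart_image c \<Longrightarrow> compact K \<Longrightarrow> compact (chart_inv c ` K)"
  by (rule compact_continuous_image[OF continuous_on_subset[OF continuous_on_chart_inv]])

text \<open>Also the way to constancy of tensors: components such as those of \<open>Q\<close> or of
  \<open>\<nu>\<close> are treated one by one as scalar functions.\<close>

lemma constant_if_\<delta>_0:
  assumes con: "connected (UNIV :: 'm set)" and f: "smooth_map \<A> f" and 0: "\<And>a p. \<delta> a f p = 0"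
  shows "f p = f q"
proof -
  have tg: "tgrad f p = 0" for p using 0 by (simp add: vec_eq_iff tgrad_nth)
  have "f constant_on UNIV"
  proof (rule locally_constant_imp_constant[OF con])
    fix p :: 'm
    obtain c where c: "c \<in> \<A>" "p \<in> fst c" by (rule ex_chart)
    obtain r where r: "r > 0" "ball (snd c p) r \<subseteq> chart_image c"
      using chart_image_open[OF c(1)] chart_in_image[OF c(2)] unfolding open_contains_ball by blast
    have "\<exists>y. \<forall>u\<in>ball (snd c p) r. f (chart_inv c u) = y"
    proof (rule has_derivative_zero_constant)
      fix u assume "u \<in> ball (snd c p) r"
      then have "u \<in> chart_image c" using r by blast
      then have "((\<lambda>u. f (chart_inv c u)) has_derivative (\<lambda>h. 0)) (at u)"
        using has_tgrad_chart[OF has_tgrad_tgrad[OF f] c(1), of "chart_inv c u"] c tg by simp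
      then show "((\<lambda>u. f (chart_inv c u)) has_derivative (\<lambda>h. 0)) (at u within ball (snd c p) r)"
        by (rule has_derivative_at_withinI)
    qed simp
    then obtain y where y: "\<And>u. u \<in> ball (snd c p) r \<Longrightarrow> f (chart_inv c u) = y" by blast
    have "f q = f p" if "q \<in> chart_inv c ` ball (snd c p) r" for q
      using that y y[of "snd c p"] r(1) c by auto
    moreover have "p \<in> chart_inv c ` ball (snd c p) r"
      using r(1) c by (metis centre_in_ball chart_inv_apply imageI)
    moreover have "openin (top_of_set UNIV) (chart_inv c ` ball (snd c p) r)"
      using open_chart_inv_image[OF c(1) open_ball r(2)] by simp
    ultimately show "\<exists>T. openin (top_of_set UNIV) T \<and> p \<in> T \<and> (\<forall>x\<in>T. f x = f p)"
      by blast
  qed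
  then show ?thesis by (auto simp: constant_on_def)
qed

lemma dF_close:
  assumes c: "c \<in> \<A>" "u0 \<in> chart_image c" and e: "e > 0"
  obtains r where "r > 0" "cball u0 r \<subseteq> chart_image c"
    "\<And>u v. u \<in> cball u0 r \<Longrightarrow> norm (dF c u v - dF c u0 v) \<le> e * norm v"
proof -
  let ?n = "real (DIM(real^'n))"
  have n: "?n > 0" by simp
  have "\<forall>\<^sub>F u in nhds u0. \<forall>b\<in>Basis. dist (dF c u b) (dF c u0 b) < e / ?n"
  proof (rule eventually_ball_finite[OF finite_Basis], rule ballI)
    fix b :: "real^'n" assume "b \<in> Basis"
    have "continuous_on (chart_image c) (\<lambda>u. dF c u b)"
      unfolding dF_def
      by (intro smooth_on_imp_continuous_on smooth_on_frechet_derivative smooth_map_chart smooth_F c)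
    then have "isCont (\<lambda>u. dF c u b) u0"
      using c chart_image_open continuous_on_eq_continuous_at by blast
    then show "\<forall>\<^sub>F u in nhds u0. dist (dF c u b) (dF c u0 b) < e / ?n"
      using e n unfolding continuous_at_eps_delta eventually_nhds_metric by simp
  qed
  moreover have "\<forall>\<^sub>F u in nhds u0. u \<in> chart_image c"
    using c chart_image_open eventually_nhds_in_open by blast
  ultimately have "\<forall>\<^sub>F u in nhds u0. u \<in> chart_image c \<and> (\<forall>b\<in>Basis. dist (dF c u b) (dF c u0 b) < e / ?n)"
    by (simp add: eventually_conj)
  then obtain d where d: "d > 0" "\<And>u. dist u u0 < d \<Longrightarrow> u \<in> chart_image c"
    "\<And>u b. dist u u0 < d \<Longrightarrow> b \<in> Basis \<Longrightarrow> dist (dF c u b) (dF c u0 b) < e / ?n"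
    unfolding eventually_nhds_metric by blast
  show thesis
  proof (rule that[of "d/2"])
    show "d / 2 > 0" using d by simp
    show "cball u0 (d/2) \<subseteq> chart_image c" using d by (auto simp: dist_commute)
    fix u v :: "real^'n" assume u: "u \<in> cball u0 (d/2)"
    then have ud: "dist u u0 < d" using d by (simp add: dist_commute)
    note l = linear_componentwise_expansion[OF linear_dF[OF c(1)]]
    have "dF c u v - dF c u0 v = (\<Sum>b\<in>Basis. (v \<bullet> b) *\<^sub>R (dF c u b - dF c u0 b))"
      unfolding l[OF d(2)[OF ud], of v] l[OF c(2), of v] by (simp add: sum_subtractf scaleR_diff_right)
    also have "norm \<dots> \<le> (\<Sum>b\<in>(Basis::(real^'n) set). norm v * (e / ?n))"
    proof (rule sum_norm_le)
      fix b :: "real^'n" assume b: "b \<in> Basis"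
      have "\<bar>v \<bullet> b\<bar> \<le> norm v" using b Basis_le_norm by blast
      moreover have "norm (dF c u b - dF c u0 b) \<le> e / ?n" using d(3)[OF ud b] by (simp add: dist_norm)
      ultimately show "norm ((v \<bullet> b) *\<^sub>R (dF c u b - dF c u0 b)) \<le> norm v * (e / ?n)"
        by (simp add: mult_mono del: times_divide_eq_right)
    qed
    also have "\<dots> = e * norm v" by simp
    finally show "norm (dF c u v - dF c u0 v) \<le> e * norm v" .
  qed
qed

text \<open>The map is close to its differential at \<open>u0\<close>, whose image is orthogonal to
  the normal there, and the normal hardly turns. So even the component tangential at
  \<open>u\<close> dominates the coordinate distance. This controls gradients of the Euclidean
  distance on the sheet and makes \<open>F\<close> bi-Lipschitz in coordinates.\<close>

lemma local_sheet:
  assumes c: "c \<in> \<A>" "u0 \<in> chart_image c"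
  obtains r \<kappa> M where "r > 0" "\<kappa> > 0" "M > 0" "cball u0 r \<subseteq> chart_image c"
    "\<And>u u'. u \<in> cball u0 r \<Longrightarrow> u' \<in> cball u0 r \<Longrightarrow>
       norm (F (chart_inv c u) - F (chart_inv c u')) \<le> M * norm (u - u')"
    "\<And>u u' x. u \<in> cball u0 r \<Longrightarrow> u' \<in> cball u0 r \<Longrightarrow> x = F (chart_inv c u) - F (chart_inv c u') \<Longrightarrow>
       \<kappa> * norm (u - u') \<le> norm (x - (x \<bullet> \<nu> (chart_inv c u)) *\<^sub>R \<nu> (chart_inv c u))"
proof -
  let ?d = "dF c u0" and ?F = "\<lambda>u. F (chart_inv c u)" and ?N = "\<lambda>u. \<nu> (chart_inv c u)"
  obtain B where B: "B > 0" "\<And>v. B * norm v \<le> norm (?d v)"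
    using linear_inj_bounded_below_pos[OF linear_dF[OF c] inj_dF[OF c]] by blast
  obtain K where K: "K > 0" "\<And>v. norm (?d v) \<le> K * norm v"
    using linear_bounded_pos[OF linear_dF[OF c]] by blast
  \<comment> \<open>The errors are \<open>e\<close> for the chord and \<open>e + K * e\<close> for
    its normal part; together they use up exactly half of the lower bound \<open>B\<close>.\<close>
  define e where "e = B / (2 * (2 + K))"
  have "(2 + K) * e = B / 2" using K by (simp add: e_def field_simps)
  then have e: "B - e - (e + K * e) \<ge> B / 2" by (simp add: distrib_right)
  have e0: "e > 0" using B K by (simp add: e_def)
  note e = e0 e
  obtain r1 where r1: "r1 > 0" "cball u0 r1 \<subseteq> chart_image c"
    "\<And>u v. u \<in> cball u0 r1 \<Longrightarrow> norm (dF c u v - ?d v) \<le> e * norm v"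
    using dF_close[OF c e(1)] by blast
  have "isCont ?N u0"
    using smooth_on_imp_continuous_on[OF smooth_map_chart[OF smooth_\<nu> c(1)]] c chart_image_open
      continuous_on_eq_continuous_at by blast
  then obtain r2 where r2: "r2 > 0" "\<And>u. dist u u0 < r2 \<Longrightarrow> dist (?N u) (?N u0) < e"
    using e(1) unfolding continuous_at_eps_delta by blast
  define r where "r = min r1 (r2 / 2)"
  have r: "r > 0" "cball u0 r \<subseteq> cball u0 r1" "r < r2" using r1 r2 by (auto simp: r_def)
  have lin: "norm ((?F u - ?F u') - ?d (u - u')) \<le> e * norm (u - u')"
    if "u \<in> cball u0 r" "u' \<in> cball u0 r" for u u'
  proof -
    have bl: "bounded_linear ?d"
      using F_has_derivative[OF c] has_derivative_bounded_linear by blast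
    have "norm ((?F u - ?d u) - (?F u' - ?d u')) \<le> e * norm (u - u')"
    proof (rule differentiable_bound[where S="cball u0 r" and f'="\<lambda>u v. dF c u v - ?d v"])
      fix w assume "w \<in> cball u0 r"
      then have w: "w \<in> cball u0 r1" "w \<in> chart_image c" using r r1 by blast+
      show "((\<lambda>u. ?F u - ?d u) has_derivative (\<lambda>v. dF c w v - ?d v)) (at w within cball u0 r)"
        by (rule has_derivative_at_withinI[OF has_derivative_diff[OF F_has_derivative[OF c(1) w(2)]
            bounded_linear_imp_has_derivative[OF bl]]])
      show "onorm (\<lambda>v. dF c w v - ?d v) \<le> e"
        by (rule onorm_le) (rule r1(3)[OF w(1)])
    qed (use that in auto)
    then show ?thesis
      by (simp add: linear_diff[OF linear_dF[OF c]] algebra_simps)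
  qed
  show thesis
  proof (rule that[of r "B/2" "K + e"])
    show "r > 0" "B/2 > 0" "K + e > 0" using r B K e by auto
    show "cball u0 r \<subseteq> chart_image c" using r r1 by blast
    fix u u' assume u: "u \<in> cball u0 r" "u' \<in> cball u0 r"
    have "norm (?F u - ?F u') \<le> norm ((?F u - ?F u') - ?d (u - u')) + norm (?d (u - u'))"
      by (metis add.commute diff_add_cancel norm_triangle_ineq)
    then show "norm (?F u - ?F u') \<le> (K + e) * norm (u - u')"
      using lin[OF u] K(2)[of "u - u'"] by (simp add: algebra_simps)
    fix x assume x: "x = ?F u - ?F u'"
    define y where "y = ?d (u - u')"
    have xy: "norm (x - y) \<le> e * norm (u - u')" using lin[OF u] by (simp add: x y_def)
    have "\<bar>x \<bullet> ?N u\<bar> \<le> (e + K * e) * norm (u - u')"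
    proof -
      have "x \<bullet> ?N u = (x - y) \<bullet> ?N u + y \<bullet> (?N u - ?N u0)"
        using dF_normal[OF c, of "u - u'"] by (simp add: y_def inner_diff_left inner_diff_right)
      also have "\<bar>\<dots>\<bar> \<le> norm (x - y) * norm (?N u) + norm y * norm (?N u - ?N u0)"
        by (intro order_trans[OF abs_triangle_ineq] add_mono Cauchy_Schwarz_ineq2)
      also have "\<dots> \<le> e * norm (u - u') + (K * norm (u - u')) * e"
      proof (rule add_mono)
        have "dist u u0 < r2" using u(1) r(3) by (simp add: dist_commute)
        then have "norm (?N u - ?N u0) \<le> e" using r2(2)[of u] by (simp add: dist_norm)
        moreover have "norm y \<le> K * norm (u - u')" using K by (simp add: y_def)
        ultimately show "norm y * norm (?N u - ?N u0) \<le> K * norm (u - u') * e"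
          using K by (intro mult_mono) auto
      qed (use xy in simp)
      finally show ?thesis by (simp add: algebra_simps)
    qed
    moreover have "norm x \<ge> (B - e) * norm (u - u')"
    proof -
      have "norm y \<le> norm x + norm (x - y)" using norm_triangle_sub[of y x] by (simp add: norm_minus_commute)
      then show ?thesis using B(2)[of "u - u'"] xy by (simp add: y_def algebra_simps)
    qed
    moreover have "norm x \<le> norm (x - (x \<bullet> ?N u) *\<^sub>R ?N u) + \<bar>x \<bullet> ?N u\<bar>"
      using norm_triangle_sub[of x "(x \<bullet> ?N u) *\<^sub>R ?N u"] by simp
    ultimately have "(B - e - (e + K * e)) * norm (u - u') \<le> norm (x - (x \<bullet> ?N u) *\<^sub>R ?N u)"
      by (simp add: algebra_simps)
    then show "B/2 * norm (u - u') \<le> norm (x - (x \<bullet> ?N u) *\<^sub>R ?N u)"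
      using mult_right_mono[OF e(2) norm_ge_zero[of "u - u'"]] by linarith
  qed
qed

end

context self_expanding
begin

text \<open>An interior ball argument at a boundary point of the zero set, with the squared
  Euclidean distance \<open>s\<close> from a nearby point \<open>q0\<close> as radial function. The
  exponential barrier \<open>\<psi>\<close> is positive for \<open>s < R2\<close>, zero at the
  nearest zero \<open>p2\<close> of \<open>H\<close>, and a strict subsolution away from
  \<open>q0\<close>. Then \<open>H - \<epsilon> * \<psi>\<close> would have a nonpositive minimum in
  the interior of the region where its drift Laplacian is negative.\<close>

theorem mean_curvature_strong_maximum_principle:
  assumes con: "connected (UNIV :: 'm set)" and H0: "\<And>p. H p \<ge> 0" and z: "H p1 = 0"
  shows "H p = 0"
proof -
  let ?Z = "{p. H p = 0}"
  have clZ: "closed ?Z"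
    by (intro closed_Collect_eq smooth_map_continuous smooth_H continuous_on_const)
  have "open ?Z"
  proof (rule ccontr)
    assume "\<not> open ?Z"
    then have "\<exists>p0\<in>?Z. \<not> (\<exists>T. open T \<and> p0 \<in> T \<and> T \<subseteq> ?Z)"
      unfolding open_subopen[of ?Z] by simp
    then obtain p0 where p0': "p0 \<in> ?Z" "\<not> (\<exists>T. open T \<and> p0 \<in> T \<and> T \<subseteq> ?Z)"
      by (elim bexE)
    have p0: "H p0 = 0" "\<And>T. open T \<Longrightarrow> p0 \<in> T \<Longrightarrow> \<exists>q\<in>T. H q \<noteq> 0"
      using p0' by auto
    obtain c where c: "c \<in> \<A>" "p0 \<in> fst c" by (rule ex_chart)
    let ?u0 = "snd c p0" and ?i = "chart_inv c"
    obtain r \<kappa> M where r: "r > 0" "\<kappa> > 0" "M > 0" "cball ?u0 r \<subseteq> chart_image c"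
      and up: "\<And>u u'. u \<in> cball ?u0 r \<Longrightarrow> u' \<in> cball ?u0 r \<Longrightarrow> norm (F (?i u) - F (?i u')) \<le> M * norm (u - u')"
      and low: "\<And>u u' x. u \<in> cball ?u0 r \<Longrightarrow> u' \<in> cball ?u0 r \<Longrightarrow> x = F (?i u) - F (?i u') \<Longrightarrow>
       \<kappa> * norm (u - u') \<le> norm (x - (x \<bullet> \<nu> (?i u)) *\<^sub>R \<nu> (?i u))"
      using local_sheet[OF c(1) chart_in_image[OF c(2)]] by blast
    have le: "norm (x - (x \<bullet> n) *\<^sub>R n) \<le> norm x" if "norm n = 1" for x n :: "real^'k"
    proof -
      have "norm (x - (x \<bullet> n) *\<^sub>R n) ^ 2 = norm x ^ 2 - (x \<bullet> n)\<^sup>2"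
        using that unfolding norm_eq_1 power2_norm_eq_inner
        by (simp add: inner_diff_left inner_diff_right power2_eq_square inner_commute)
      then have "norm (x - (x \<bullet> n) *\<^sub>R n) ^ 2 \<le> norm x ^ 2" by simp
      then show ?thesis by (rule power2_le_imp_le) simp
    qed
    \<comment> \<open>With \<open>q0\<close> this close to \<open>p0\<close>, the distance from
      \<open>q0\<close> to the zero set is smaller than the distance to the edge of the
      sheet.\<close>
    define r1 where "r1 = min (r/2) (\<kappa> * r / (4 * M))"
    have r1: "r1 > 0" "r1 \<le> r / 2" "M * r1 < \<kappa> * (r / 2)"
      using r by (auto simp: r1_def field_simps min_def)
    obtain q0 where q0: "q0 \<in> ?i ` ball ?u0 r1" "H q0 \<noteq> 0"
    proof -
      have "ball ?u0 r1 \<subseteq> chart_image c" using r1 r by (force simp: subset_iff)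
      then have "open (?i ` ball ?u0 r1)" by (intro open_chart_inv_image c) auto
      moreover have "p0 \<in> ?i ` ball ?u0 r1"
        using r1 c by (metis centre_in_ball chart_inv_apply imageI)
      ultimately show thesis using p0(2) that by blast
    qed
    then obtain w0 where w0: "w0 \<in> ball ?u0 r1" "q0 = ?i w0" by blast
    have w0r: "w0 \<in> cball ?u0 r" using w0 r1 r by (auto simp: dist_commute)
    define N where "N = ?i ` cball ?u0 r"
    have compN: "compact N"
      unfolding N_def by (intro compact_chart_inv_image c r) simp
    have p0N: "p0 \<in> N"
      unfolding N_def by (rule image_eqI[of _ _ "?u0"]) (use c r in auto)
    define s where "s p = (\<Sum>a\<in>UNIV. (F p $ a - F q0 $ a)\<^sup>2)" for p
    have s_norm: "s p = (norm (F p - F q0))\<^sup>2" for p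
      unfolding s_def power2_norm_eq_inner by (simp add: inner_vec_def power2_eq_square)
    have sm_s [simp]: "smooth_map \<A> s" unfolding s_def[abs_def] by simp
    have s_low: "(\<kappa> * norm (u - w0))\<^sup>2 \<le> s (?i u)" if "u \<in> cball ?u0 r" for u
      unfolding s_norm
      using order_trans[OF low[OF that w0r refl] le] w0 r by (intro power_mono) auto
    have s_up: "s (?i u) \<le> (M * norm (u - w0))\<^sup>2" if "u \<in> cball ?u0 r" for u
      unfolding s_norm using up[OF that w0r] w0 by (intro power_mono) auto
    have cont: "continuous_on N f" if "smooth_map \<A> f" for f :: "'m \<Rightarrow> real"
      using smooth_map_continuous[OF that] continuous_on_subset by blast
    \<comment> \<open>A zero of \<open>H\<close> in the sheet that is nearest to \<open>q0\<close>
      in ambient distance, so \<open>H\<close> is positive at all points of the sheet with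
      \<open>s < R2\<close>.\<close>
    obtain p2 where p2: "p2 \<in> N \<inter> ?Z" "\<And>p. p \<in> N \<inter> ?Z \<Longrightarrow> s p2 \<le> s p"
    proof -
      have "compact (N \<inter> ?Z)" using compN clZ by (rule compact_Int_closed)
      moreover have "p0 \<in> N \<inter> ?Z"
        using p0N p0(1) by simp
      moreover have "continuous_on (N \<inter> ?Z) s" using cont[OF sm_s] continuous_on_subset by blast
      ultimately show thesis using continuous_attains_inf[of "N \<inter> ?Z" s] that by blast
    qed
    define R2 where "R2 = s p2"
    have "R2 \<ge> 0" by (simp add: R2_def s_norm)
    have R2_up: "R2 < (\<kappa> * (r / 2))\<^sup>2"
    proof -
      have "p0 \<in> N \<inter> ?Z"
        using p0N p0(1) by simp
      then have "R2 \<le> s (?i ?u0)" using p2(2)[of p0] c by (simp add: R2_def)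
      also have "\<dots> \<le> (M * norm (?u0 - w0))\<^sup>2" using r by (intro s_up) auto
      also have "\<dots> \<le> (M * r1)\<^sup>2"
        using w0 r by (intro power_mono mult_left_mono) (auto simp: dist_norm)
      also have "\<dots> < (\<kappa> * (r / 2))\<^sup>2"
        using r1 r by (intro power_strict_mono) auto
      finally show ?thesis .
    qed
    have R2: "R2 > 0"
    proof -
      obtain u where u: "u \<in> cball ?u0 r" "p2 = ?i u" using p2 by (auto simp: N_def)
      have "u \<noteq> w0" using u w0 q0 p2 by auto
      then have "0 < (\<kappa> * norm (u - w0))\<^sup>2" using r by simp
      also note s_low[OF u(1)]
      finally show ?thesis using u by (simp only: R2_def)
    qed
    have Hpos: "H p > 0" if "p \<in> N" "s p < R2" for p
      proof -
      have "H p \<noteq> 0" using p2(2)[of p] that by (auto simp: R2_def)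
      then show ?thesis using H0[of p] by simp
    qed
    have boundary: "s (?i u) > R2" if "u \<in> cball ?u0 r" "u \<notin> ball ?u0 r" for u
    proof -
      have "norm (u - w0) \<ge> r / 2"
      proof -
        have "dist ?u0 u \<ge> r" "dist ?u0 w0 < r / 2" using that w0 r1 by auto
        then show ?thesis using dist_triangle[of ?u0 u w0] by (simp add: dist_norm norm_minus_commute)
      qed
      then have "(\<kappa> * (r/2))\<^sup>2 \<le> (\<kappa> * norm (u - w0))\<^sup>2"
        using r by (intro power_mono mult_left_mono) auto
      then show ?thesis using s_low[OF that(1)] R2_up by linarith
    qed
    have \<delta>s: "\<delta> a s p = 2 * ((F p - F q0) - ((F p - F q0) \<bullet> \<nu> p) *\<^sub>R \<nu> p) $ a" for a p
    proof -
      have "\<delta> a s p = (\<Sum>b\<in>UNIV. 2 * (\<delta> a (\<lambda>p. F p $ b) p * (F p - F q0) $ b))"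
      proof -
        have "\<delta> a (\<lambda>p. (F p $ b - F q0 $ b) * (F p $ b - F q0 $ b)) p
          = 2 * (\<delta> a (\<lambda>p. F p $ b) p * (F p - F q0) $ b)" for b
          by (simp add: \<delta>_mult \<delta>_diff)
        then show ?thesis
          unfolding s_def[abs_def] power2_eq_square by (subst \<delta>_sum) simp_all
      qed
      also have "\<dots> = 2 * ((F p - F q0) $ a - \<nu> p $ a * (\<Sum>b\<in>UNIV. \<nu> p $ b * (F p - F q0) $ b))"
        by (simp only: sum_distrib_left[symmetric] sum_\<delta>_F)
      finally show ?thesis by (simp add: inner_vec_def mult.commute)
    qed
    \<comment> \<open>The gradient of \<open>s\<close> is twice the tangential part of the chord.
      Where \<open>s \<ge> R2 / 4\<close> the coordinate distance is at least
      \<open>sqrt R2 / (2 * M)\<close>, and \<open>local_sheet\<close> gives this bound for the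
      squared gradient.\<close>
    define \<tau> where "\<tau> = \<kappa>\<^sup>2 * R2 / M\<^sup>2"
    have \<tau>: "\<tau> > 0" using R2 r by (simp add: \<tau>_def)
    have grad_s: "\<tau> \<le> (\<Sum>a\<in>UNIV. (\<delta> a s p)\<^sup>2)" if pN: "p \<in> N" and sp: "s p \<ge> R2 / 4" for p
    proof -
      obtain u where u: "u \<in> cball ?u0 r" "p = ?i u" using pN by (auto simp: N_def)
      let ?x = "F p - F q0"
      have "R2 / 4 \<le> M\<^sup>2 * (norm (u - w0))\<^sup>2" using s_up[OF u(1)] sp u by (simp add: power_mult_distrib)
      then have "\<tau> \<le> 4 * (\<kappa> * norm (u - w0))\<^sup>2"
        using r by (simp add: \<tau>_def power_mult_distrib field_simps)
      also have "\<dots> \<le> 4 * (norm (?x - (?x \<bullet> \<nu> p) *\<^sub>R \<nu> p))\<^sup>2"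
        using low[OF u(1) w0r, of ?x] u w0 r by (intro mult_left_mono power_mono) auto
      also have "\<dots> = (\<Sum>a\<in>UNIV. (\<delta> a s p)\<^sup>2)"
      proof -
        have "4 * (norm y)\<^sup>2 = (\<Sum>a\<in>UNIV. (2 * y $ a)\<^sup>2)" for y :: "real^'k"
          unfolding power2_norm_eq_inner by (simp add: inner_vec_def power2_eq_square sum_distrib_left)
        then show ?thesis unfolding \<delta>s .
      qed
      finally show ?thesis .
    qed
    have "continuous_on N (drift_laplacian s)"
      by (intro cont) simp
    then have "compact (drift_laplacian s ` N)" using compN by (rule compact_continuous_image)
    then obtain Bd where Bd: "\<And>p. p \<in> N \<Longrightarrow> drift_laplacian s p \<le> Bd"
      using compact_imp_bounded[of "drift_laplacian s ` N"] unfolding bounded_real by (auto dest: abs_le_D1)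
    \<comment> \<open>Large enough that the quadratic gradient term of the exponential beats the
      drift Laplacian of \<open>s\<close>, which is at most \<open>Bd\<close> on the compact
      sheet.\<close>
    define \<alpha> where "\<alpha> = (\<bar>Bd\<bar> + 1) / \<tau>"
    have \<alpha>: "\<alpha> > 0" "\<alpha> * \<tau> > Bd" using \<tau> by (auto simp: \<alpha>_def)
    define \<psi> where "\<psi> p = exp (- \<alpha> * s p) - exp (- \<alpha> * R2)" for p
    have sm_\<psi>: "smooth_map \<A> \<psi>" unfolding \<psi>_def[abs_def] by simp
    have L\<psi>: "drift_laplacian \<psi> p > 0" if "p \<in> N" "s p \<ge> R2 / 4" for p
    proof -
      have "drift_laplacian (\<lambda>p. exp (- \<alpha> * s p) - exp (- \<alpha> * R2)) p = - \<alpha> * exp (- \<alpha> * s p) * drift_laplacian s p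
         + \<alpha>\<^sup>2 * exp (- \<alpha> * s p) * (\<Sum>a\<in>UNIV. (\<delta> a s p)\<^sup>2)"
        by (rule drift_laplacian_compose[where \<phi>="\<lambda>x. exp (- \<alpha> * x) - exp (- \<alpha> * R2)"])
           (auto intro!: derivative_eq_intros simp: power2_eq_square)
      also have "\<dots> = \<alpha> * exp (- \<alpha> * s p) * (\<alpha> * (\<Sum>a\<in>UNIV. (\<delta> a s p)\<^sup>2) - drift_laplacian s p)"
        by (simp add: power2_eq_square algebra_simps)
      also have "\<dots> > 0"
      proof -
        have "\<alpha> * \<tau> \<le> \<alpha> * (\<Sum>a\<in>UNIV. (\<delta> a s p)\<^sup>2)"
          using grad_s[OF that] \<alpha> by (intro mult_left_mono) auto
        then have "\<alpha> * (\<Sum>a\<in>UNIV. (\<delta> a s p)\<^sup>2) - drift_laplacian s p > 0"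
          using Bd[OF that(1)] \<alpha> by linarith
        then show ?thesis using \<alpha> by simp
      qed
      finally show ?thesis by (simp add: \<psi>_def[abs_def])
    qed
    obtain \<mu> where \<mu>: "\<mu> > 0" "\<And>p. p \<in> N \<Longrightarrow> s p \<le> R2 / 4 \<Longrightarrow> \<mu> \<le> H p"
    proof (cases "N \<inter> {p. s p \<le> R2 / 4} = {}")
      case True
      then show thesis by (intro that[of 1]) auto
    next
      case False
      have "closed {p. s p \<le> R2 / 4}"
        by (intro closed_Collect_le smooth_map_continuous sm_s continuous_on_const)
      then have "compact (N \<inter> {p. s p \<le> R2 / 4})" using compN by (intro compact_Int_closed)
      moreover have "continuous_on (N \<inter> {p. s p \<le> R2 / 4}) H" using cont[OF smooth_H] continuous_on_subset by blast
      ultimately obtain p where "p \<in> N \<inter> {p. s p \<le> R2 / 4}" "\<And>q. q \<in> N \<inter> {p. s p \<le> R2 / 4} \<Longrightarrow> H p \<le> H q"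
        using continuous_attains_inf False by metis
      then show thesis using Hpos[of p] R2 by (intro that[of "H p"]) auto
    qed
    \<comment> \<open>Since \<open>\<psi> \<le> 1\<close>, half of the lower bound of
      \<open>H\<close> keeps the minimum of \<open>v\<close> out of the core
      \<open>s \<le> R2 / 4\<close>, where the barrier need not be a subsolution.\<close>
    define \<epsilon> where "\<epsilon> = \<mu> / 2"
    define v where "v p = H p - \<epsilon> * \<psi> p" for p
    have sm_v: "smooth_map \<A> v" unfolding v_def[abs_def] using sm_\<psi> by simp
    have eps: "\<epsilon> > 0" using \<mu> by (simp add: \<epsilon>_def)
    obtain q where q: "q \<in> N" "\<And>p. p \<in> N \<Longrightarrow> v q \<le> v p"
    proof -
      have "N \<noteq> {}" using p2 by blast
      then show thesis using continuous_attains_inf[OF compN _ cont[OF sm_v]] that by blast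
    qed
    have "v p2 = 0" using p2 by (simp add: v_def \<psi>_def R2_def)
    then have vq: "v q \<le> 0" using q(2)[of p2] p2 by simp
    have "\<psi> q \<le> 1"
    proof -
      have "exp (- \<alpha> * s q) \<le> 1" using \<alpha> by (simp add: s_norm)
      then show ?thesis using exp_gt_zero[of "- \<alpha> * R2"] unfolding \<psi>_def by linarith
    qed
    have sq: "s q > R2 / 4"
    proof (rule ccontr)
      assume "\<not> s q > R2 / 4"
      then have "\<mu> \<le> H q" using \<mu>(2) q by simp
      moreover have "\<epsilon> * \<psi> q \<le> \<epsilon> * 1" using \<open>\<psi> q \<le> 1\<close> eps by (intro mult_left_mono) auto
      ultimately show False using vq \<mu>(1) unfolding v_def \<epsilon>_def by linarith
    qed
    obtain u where u: "u \<in> cball ?u0 r" "q = ?i u" using q by (auto simp: N_def)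
    have "u \<in> ball ?u0 r"
    proof (rule ccontr)
      assume "u \<notin> ball ?u0 r"
      then have "s q > R2" using boundary u by simp
      then have "\<psi> q < 0" using \<alpha> by (simp add: \<psi>_def)
      then have "v q > 0" using H0[of q] mult_pos_neg[OF eps, of "\<psi> q"] unfolding v_def by linarith
      then show False using vq by simp
    qed
    then have qW: "q \<in> ?i ` ball ?u0 r" using u by blast
    have opW: "open (?i ` ball ?u0 r)"
      using r ball_subset_cball by (intro open_chart_inv_image c) auto
    have minW: "v q \<le> v p" if "p \<in> ?i ` ball ?u0 r" for p
      using that q(2)[of p] ball_subset_cball unfolding N_def by blast
    \<comment> \<open>At the minimum the first order drift vanishes, while the equation for
      \<open>H\<close> and the choice of \<open>\<alpha>\<close> make the same quantity
      negative.\<close>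
    have "0 \<le> drift_laplacian v q"
      unfolding drift_laplacian_def
      using local_min_\<delta>[OF sm_v opW qW minW] by (simp add: sum_nonneg)
    also have "drift_laplacian v q = drift_laplacian H q - \<epsilon> * drift_laplacian \<psi> q"
    proof -
      have "drift_laplacian (\<lambda>p. \<epsilon> * \<psi> p) q = \<epsilon> * drift_laplacian \<psi> q"
        by (rule drift_laplacian_cmult[OF sm_\<psi>])
      moreover have "drift_laplacian v q = drift_laplacian H q - drift_laplacian (\<lambda>p. \<epsilon> * \<psi> p) q"
        unfolding v_def[abs_def] using sm_\<psi> by (intro drift_laplacian_diff) simp_all
      ultimately show ?thesis by simp
    qed
    also have "\<dots> < 0"
    proof -
      have "hh q \<ge> 0" unfolding hh_def by (intro sum_nonneg) simp
      then have "drift_laplacian H q \<le> 0"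
        unfolding drift_laplacian_H using H0[of q] by (simp add: mult_nonpos_nonneg)
      then show ?thesis using mult_pos_pos[OF eps L\<psi>[OF q(1)]] sq by linarith
    qed
    finally show False by simp
  qed
  then have "?Z = {} \<or> ?Z = UNIV"
    using con clZ connected_clopen[of UNIV] by (metis closed_closedin open_openin subtopology_UNIV)
  then show ?thesis using z by blast
qed

end

section \<open>Excluding positive mean curvature\<close>

context hypersurface
begin

text \<open>For tangential \<open>V\<close> this is the divergence of the weighted field divided by
  the weight; applied to a gradient it gives the drift Laplacian.\<close>

definition drift_div :: "('k \<Rightarrow> 'm \<Rightarrow> real) \<Rightarrow> 'm \<Rightarrow> real" where
  "drift_div V p = (\<Sum>a\<in>UNIV. \<delta> a (V a) p) + (1/2) * (\<Sum>a\<in>UNIV. F p $ a * V a p)"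

lemma hh_nonneg [simp]: "0 \<le> hh p"
  unfolding hh_def by (intro sum_nonneg) simp

lemma drift_div_\<delta>: "drift_div (\<lambda>a. \<delta> a f) p = drift_laplacian f p"
  by (simp add: drift_div_def drift_laplacian_def)

lemma drift_div_mult:
  assumes "smooth_map \<A> f" "\<And>a. smooth_map \<A> (V a)"
  shows "drift_div (\<lambda>a p. f p * V a p) p = f p * drift_div V p + (\<Sum>a\<in>UNIV. \<delta> a f p * V a p)"
  using assms by (simp add: drift_div_def \<delta>_mult sum.distrib sum_distrib_left algebra_simps)

lemma drift_div_diff:
  assumes "\<And>a. smooth_map \<A> (V a)" "\<And>a. smooth_map \<A> (W a)"
  shows "drift_div (\<lambda>a p. V a p - W a p) p = drift_div V p - drift_div W p"
  using assms by (simp add: drift_div_def \<delta>_diff sum_subtractf algebra_simps)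

text \<open>The normal corrections in \<open>S\<close> disappear when paired with \<open>h\<close>,
  so \<open>S\<close> may replace the ambient derivative in the derivative of
  \<open>hh\<close>.\<close>

lemma sum_h_S: "(\<Sum>a\<in>UNIV. \<Sum>b\<in>UNIV. h a b p * S c a b p) = \<delta> c hh p / 2"
proof -
  have 1: "(\<Sum>a\<in>UNIV. \<Sum>b\<in>UNIV. h a b p * \<nu> p $ a * h2 c b p) = 0"
  proof -
    have "(\<Sum>a\<in>UNIV. \<Sum>b\<in>UNIV. h a b p * \<nu> p $ a * h2 c b p) = (\<Sum>b\<in>UNIV. (\<Sum>a\<in>UNIV. h a b p * \<nu> p $ a) * h2 c b p)"
      unfolding sum_distrib_right by (rule sum.swap)
    then show ?thesis by (simp add: h_\<nu>')
  qed
  have 2: "(\<Sum>a\<in>UNIV. \<Sum>b\<in>UNIV. h a b p * \<nu> p $ b * h2 c a p) = 0"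
    unfolding sum_distrib_right[symmetric] by (simp add: h_\<nu>)
  have "h a b p * S c a b p = h a b p * \<delta> c (h a b) p + h a b p * \<nu> p $ a * h2 c b p + h a b p * \<nu> p $ b * h2 c a p" for a b
    by (simp add: S_def algebra_simps)
  then have "(\<Sum>a\<in>UNIV. \<Sum>b\<in>UNIV. h a b p * S c a b p) = (\<Sum>a\<in>UNIV. \<Sum>b\<in>UNIV. h a b p * \<delta> c (h a b) p)"
    by (simp only: sum.distrib 1 2 add_0_right)
  then show ?thesis by (simp add: \<delta>_hh)
qed

end

text \<open>Exchanging each index of \<open>h\<close> in turn with an index where
  \<open>\<theta>\<close> does not vanish expresses all entries through the one at
  \<open>c0\<close>.\<close>

lemma symmetric_product_rank_one:
  fixes h :: "'k::finite \<Rightarrow> 'k \<Rightarrow> real" and \<theta> :: "'k \<Rightarrow> real"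
  assumes sym: "\<And>a b c. h a b * \<theta> c = h c b * \<theta> a" and hs: "\<And>a b. h a b = h b a" and nz: "\<theta> c0 \<noteq> 0"
  obtains l where "\<And>a b. h a b = l * \<theta> a * \<theta> b"
proof -
  have "h a b = h c0 c0 / (\<theta> c0)\<^sup>2 * \<theta> a * \<theta> b" for a b
  proof -
    have "h a b * \<theta> c0 = h c0 b * \<theta> a" by (rule sym)
    moreover have "h c0 b * \<theta> c0 = h c0 c0 * \<theta> b"
      using sym[of b c0 c0] hs[of c0 b] by simp
    ultimately show ?thesis
      using nz by (simp add: field_simps power2_eq_square)
  qed
  then show thesis by (rule that)
qed

context self_expanding
begin

text \<open>The integral argument enters only as the assumption \<open>liouville\<close>, so that
  this part is pure tensor calculus. It is used twice: for the quotient of \<open>hh\<close> and the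
  square of \<open>H\<close>, and for a field along a flat direction.\<close>

lemma no_positive_mean_curvature:
  assumes con: "connected (UNIV :: 'm set)" and n2: "CARD('n) \<ge> 2" and Hpos: "\<And>p. H p > 0"
    and liouville: "\<And>V E p. (\<And>a. smooth_map \<A> (V a)) \<Longrightarrow> (\<And>p. (\<Sum>a\<in>UNIV. V a p * \<nu> p $ a) = 0) \<Longrightarrow>
      (\<And>p. drift_div V p = 2 * E p) \<Longrightarrow> (\<And>p. 0 \<le> E p) \<Longrightarrow>
      (\<And>p. (\<Sum>a\<in>UNIV. (V a p)\<^sup>2) \<le> 4 * hh p * E p) \<Longrightarrow> E p = 0"
  shows False
proof -
  define i where "i p = inverse (H p)" for p
  have Hne: "H p \<noteq> 0" for p using Hpos[of p] by simp
  have sm_i [simp]: "smooth_map \<A> i"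
    unfolding i_def[abs_def] by (intro smooth_map_inverse smooth_H Hne)
  have iH: "i p * H p = 1" "H p * i p = 1" for p using Hne by (simp_all add: i_def)
  have \<delta>i: "\<delta> c i p = - (i p)\<^sup>2 * \<delta> c H p" for c p
    unfolding i_def[abs_def]
    by (subst \<delta>_compose[OF smooth_H, of inverse "- ((inverse (H p))\<^sup>2)"])
       (use DERIV_inverse[OF Hne, of p] in \<open>simp_all add: power2_eq_square\<close>)
  \<comment> \<open>\<open>T\<close> is the square of \<open>H\<close> times the covariant
    derivative of \<open>A / H\<close>; its vanishing says that \<open>A / H\<close> is
    parallel.\<close>
  define T where "T c a b p = H p * S c a b p - h a b p * \<delta> c H p" for a b c p
  define E where "E p = (i p)\<^sup>2 * (\<Sum>c\<in>UNIV. \<Sum>a\<in>UNIV. \<Sum>b\<in>UNIV. (T c a b p)\<^sup>2)" for p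
  \<comment> \<open>The square of \<open>H\<close> times the gradient of
    \<open>hh / H\<^sup>2\<close>, with the quotient rule carried out.\<close>
  define V where "V c p = \<delta> c hh p - 2 * (hh p * i p * \<delta> c H p)" for c p
  have smV: "smooth_map \<A> (V c)" for c unfolding V_def[abs_def] by simp
  have VT: "V c p = 2 * i p * (\<Sum>a\<in>UNIV. \<Sum>b\<in>UNIV. h a b p * T c a b p)" for c p
  proof -
    have "h a b p * T c a b p = H p * (h a b p * S c a b p) - (h a b p)\<^sup>2 * \<delta> c H p" for a b
      by (simp add: T_def algebra_simps power2_eq_square)
    then have "(\<Sum>a\<in>UNIV. \<Sum>b\<in>UNIV. h a b p * T c a b p) = H p * (\<delta> c hh p / 2) - hh p * \<delta> c H p"
      by (simp only: sum_subtractf sum_distrib_left[symmetric] sum_distrib_right[symmetric] sum_h_S hh_def[symmetric])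
    then have "2 * i p * (\<Sum>a\<in>UNIV. \<Sum>b\<in>UNIV. h a b p * T c a b p) = (i p * H p) * \<delta> c hh p - 2 * (hh p * i p * \<delta> c H p)"
      by (simp only:) (simp add: algebra_simps)
    then show ?thesis by (simp only: V_def iH mult_1)
  qed
  have E0: "E p = 0" for p
  proof (rule liouville[OF smV])
    fix p
    show "(\<Sum>a\<in>UNIV. V a p * \<nu> p $ a) = 0"
    proof -
      have "(\<Sum>a\<in>UNIV. V a p * \<nu> p $ a) = (\<Sum>a\<in>UNIV. \<nu> p $ a * \<delta> a hh p) - 2 * (hh p * i p) * (\<Sum>a\<in>UNIV. \<nu> p $ a * \<delta> a H p)"
        by (simp add: V_def sum_subtractf sum_distrib_left algebra_simps)
      then show ?thesis by (simp add: \<nu>_\<delta>)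
    qed
    show "0 \<le> E p" unfolding E_def by (intro mult_nonneg_nonneg sum_nonneg) auto
    show "drift_div V p = 2 * E p"
    proof -
      let ?HH = "\<Sum>a\<in>UNIV. (\<delta> a H p)\<^sup>2" and ?hH = "\<Sum>a\<in>UNIV. \<delta> a hh p * \<delta> a H p"
        and ?SS = "\<Sum>c\<in>UNIV. \<Sum>a\<in>UNIV. \<Sum>b\<in>UNIV. (S c a b p)\<^sup>2"
      have V_fun: "V = (\<lambda>c p. \<delta> c hh p - (2 * hh p * i p) * \<delta> c H p)"
        by (simp add: V_def[abs_def] mult.assoc)
      have "\<delta> a (\<lambda>p. 2 * hh p * i p) p * \<delta> a H p = 2 * i p * (\<delta> a hh p * \<delta> a H p) - 2 * hh p * (i p)\<^sup>2 * (\<delta> a H p)\<^sup>2" for a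
        by (simp add: \<delta>_mult \<delta>i power2_eq_square algebra_simps)
      then have "drift_div V p = drift_laplacian hh p - (2 * hh p * i p * drift_laplacian H p
         + (2 * i p * ?hH - 2 * hh p * (i p)\<^sup>2 * ?HH))"
        unfolding V_fun by (simp add: drift_div_diff drift_div_mult drift_div_\<delta> sum_subtractf sum_distrib_left)
      also have "\<dots> = 2 * ?SS - 2 * i p * ?hH + 2 * hh p * (i p)\<^sup>2 * ?HH"
      proof -
        have "2 * hh p * i p * drift_laplacian H p = - (1 + 2 * hh p) * hh p * (i p * H p)"
          by (simp add: drift_laplacian_H algebra_simps)
        then show ?thesis by (simp add: drift_laplacian_hh iH algebra_simps)
      qed
      also have "\<dots> = 2 * E p"
      proof -
        have "(T c a b p)\<^sup>2 = (H p)\<^sup>2 * (S c a b p)\<^sup>2 - 2 * H p * ((h a b p * S c a b p) * \<delta> c H p) + (h a b p)\<^sup>2 * (\<delta> c H p)\<^sup>2" for a b c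
          by (simp add: T_def power2_eq_square algebra_simps)
        then have "(\<Sum>c\<in>UNIV. \<Sum>a\<in>UNIV. \<Sum>b\<in>UNIV. (T c a b p)\<^sup>2) = (H p)\<^sup>2 * ?SS
           - 2 * H p * (\<Sum>c\<in>UNIV. (\<Sum>a\<in>UNIV. \<Sum>b\<in>UNIV. h a b p * S c a b p) * \<delta> c H p)
           + (\<Sum>c\<in>UNIV. (\<Sum>a\<in>UNIV. \<Sum>b\<in>UNIV. (h a b p)\<^sup>2) * (\<delta> c H p)\<^sup>2)"
          by (simp only: sum.distrib sum_subtractf sum_distrib_left sum_distrib_right)
        also have "\<dots> = (H p)\<^sup>2 * ?SS - H p * ?hH + hh p * ?HH"
          by (simp add: sum_h_S hh_def[symmetric] sum_distrib_left algebra_simps)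
        finally have TT: "(\<Sum>c\<in>UNIV. \<Sum>a\<in>UNIV. \<Sum>b\<in>UNIV. (T c a b p)\<^sup>2) = (H p)\<^sup>2 * ?SS - H p * ?hH + hh p * ?HH" .
        have "E p = (i p * H p)\<^sup>2 * ?SS - i p * (i p * H p) * ?hH + (i p)\<^sup>2 * hh p * ?HH"
          unfolding E_def TT by (simp add: power2_eq_square algebra_simps)
        then show ?thesis by (simp add: iH algebra_simps)
      qed
      finally show ?thesis .
    qed
    show "(\<Sum>c\<in>UNIV. (V c p)\<^sup>2) \<le> 4 * hh p * E p"
    proof -
      \<comment> \<open>Cauchy-Schwarz over pairs of indices, separately for each \<open>c\<close>;
        by \<open>VT\<close> the field is a contraction of \<open>h\<close> with
        \<open>T\<close>.\<close>
      have "(\<Sum>a\<in>UNIV. \<Sum>b\<in>UNIV. h a b p * T c a b p)\<^sup>2 \<le> hh p * (\<Sum>a\<in>UNIV. \<Sum>b\<in>UNIV. (T c a b p)\<^sup>2)" for c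
        unfolding hh_def sum.cartesian_product
        using Cauchy_Schwarz_ineq_sum[of "\<lambda>(a, b). h a b p" "\<lambda>(a, b). T c a b p" "UNIV \<times> UNIV"]
        by (simp add: case_prod_beta)
      then have "(V c p)\<^sup>2 \<le> 4 * (i p)\<^sup>2 * (hh p * (\<Sum>a\<in>UNIV. \<Sum>b\<in>UNIV. (T c a b p)\<^sup>2))" for c
        unfolding VT power_mult_distrib by (intro mult_mono) auto
      then have "(\<Sum>c\<in>UNIV. (V c p)\<^sup>2) \<le> (\<Sum>c\<in>UNIV. 4 * (i p)\<^sup>2 * (hh p * (\<Sum>a\<in>UNIV. \<Sum>b\<in>UNIV. (T c a b p)\<^sup>2)))"
        by (rule sum_mono)
      also have "\<dots> = 4 * hh p * E p"
        by (simp add: E_def sum_distrib_left[symmetric] mult_ac)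
      finally show ?thesis .
    qed
  qed
  have T0: "T c a b p = 0" for c a b p
  proof -
    have ip: "(i p)\<^sup>2 > 0" using Hpos[of p] by (simp add: i_def)
    have "(\<Sum>c\<in>UNIV. \<Sum>a\<in>UNIV. \<Sum>b\<in>UNIV. (T c a b p)\<^sup>2) = 0"
      using E0[of p] ip by (simp add: E_def)
    then have "(\<Sum>a\<in>UNIV. \<Sum>b\<in>UNIV. (T c a b p)\<^sup>2) = 0"
      by (subst (asm) sum_nonneg_eq_0_iff) (auto intro!: sum_nonneg)
    then have "(\<Sum>b\<in>UNIV. (T c a b p)\<^sup>2) = 0"
      by (subst (asm) sum_nonneg_eq_0_iff) (auto intro!: sum_nonneg)
    then have "(T c a b p)\<^sup>2 = 0"
      by (subst (asm) sum_nonneg_eq_0_iff) auto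
    then show ?thesis by simp
  qed
  then have HS: "H p * S c a b p = h a b p * \<delta> c H p" for c a b p
    by (simp add: T_def)
  have V0: "V c p = 0" for c p
    by (simp add: VT T0)
  \<comment> \<open>If \<open>H\<close> were constant its drift Laplacian would vanish, but that
    equals \<open>- (1/2 + hh p) * H p < 0\<close>.\<close>
  obtain p1 c1 where p1: "\<delta> c1 H p1 \<noteq> 0"
  proof -
    have "\<exists>p c. \<delta> c H p \<noteq> 0"
    proof (rule ccontr)
      assume "\<not> ?thesis"
      then have "\<delta> c H = (\<lambda>p. 0)" for c by auto
      then have "drift_laplacian H p = 0" for p by (simp add: drift_laplacian_def)
      moreover have "(1/2 + hh p) * H p > 0" for p
        using Hpos by (intro mult_pos_pos add_pos_nonneg) auto
      ultimately show False unfolding drift_laplacian_H by (metis less_irrefl mult_minus_left neg_0_equal_iff_equal)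
    qed
    then show thesis using that by blast
  qed
  \<comment> \<open>With \<open>T = 0\<close> the total symmetry of \<open>S\<close> passes to the
    product of \<open>h\<close> and the gradient of \<open>H\<close>, which forces rank one where
    that gradient is nonzero.\<close>
  obtain l where l: "\<And>a b. h a b p1 = l * \<delta> a H p1 * \<delta> b H p1"
  proof (rule symmetric_product_rank_one[of "\<lambda>a b. h a b p1" "\<lambda>c. \<delta> c H p1" c1])
    show "h a b p1 * \<delta> c H p1 = h c b p1 * \<delta> a H p1" for a b c
      using HS[of p1 c a b] HS[of p1 a c b] S_sym1[of c a b p1] by simp
  qed (use h_sym p1 in auto)
  let ?t = "\<Sum>a\<in>UNIV. \<delta> a H p1 * \<delta> a H p1"
  have Hl: "H p1 = l * ?t" by (simp add: H_def l sum_distrib_left mult.assoc)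
  have h2l: "h2 a b p1 = H p1 * h a b p1" for a b
  proof -
    have "h2 a b p1 = (\<Sum>d\<in>UNIV. (l * l * \<delta> a H p1 * \<delta> b H p1) * (\<delta> d H p1 * \<delta> d H p1))"
      unfolding h2_def l by (intro sum.cong) (auto simp: mult_ac)
    then show ?thesis unfolding sum_distrib_left[symmetric] Hl l by (simp add: mult_ac)
  qed
  have hh1: "hh p1 = (H p1)\<^sup>2"
    using sum_h2_diag[of p1] by (simp add: h2l sum_distrib_left[symmetric] H_def[symmetric] power2_eq_square)
  \<comment> \<open>The quotient \<open>hh / H\<^sup>2\<close> has zero gradient because
    \<open>V = 0\<close>, and at \<open>p1\<close>, where the rank is one, it equals 1.\<close>
  have hhH: "hh p = (H p)\<^sup>2" for p
  proof -
    have "\<delta> c (\<lambda>p. hh p * (i p * i p)) p = 0" for c p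
    proof -
      have "\<delta> c hh p = 2 * (hh p * i p * \<delta> c H p)" using V0[of c p] by (simp add: V_def)
      then show ?thesis by (simp add: \<delta>_mult \<delta>i power2_eq_square algebra_simps)
    qed
    then have "hh p * (i p * i p) = hh p1 * (i p1 * i p1)"
      by (intro constant_if_\<delta>_0[OF con]) simp_all
    also have "\<dots> = 1" using iH[of p1] by (simp add: hh1 power2_eq_square) (metis mult.assoc mult.commute mult_1)
    finally have "hh p * (i p * H p) * (i p * H p) = H p * H p" by (simp add: algebra_simps)
    then show ?thesis by (simp add: iH power2_eq_square)
  qed
  \<comment> \<open>\<open>A / H\<close> is parallel along the hypersurface, but its ambient
    components still turn with the normal: only terms containing \<open>\<nu>\<close> survive in
    \<open>\<delta>B\<close>.\<close>
  define B where "B a b p = h a b p * i p" for a b p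
  have smB [simp]: "smooth_map \<A> (B a b)" for a b unfolding B_def[abs_def] by simp
  have \<delta>B: "\<delta> c (B a b) p = - i p * (\<nu> p $ a * h2 c b p + \<nu> p $ b * h2 c a p)" for a b c p
  proof -
    have "\<delta> c (B a b) p = i p * (i p * H p) * \<delta> c (h a b) p - (i p)\<^sup>2 * (h a b p * \<delta> c H p)"
      unfolding B_def[abs_def] by (simp add: \<delta>_mult \<delta>i iH algebra_simps)
    also have "\<dots> = (i p)\<^sup>2 * (H p * (\<delta> c (h a b) p - S c a b p))"
      unfolding HS[symmetric] by (simp add: power2_eq_square algebra_simps)
    also have "\<dots> = i p * (i p * H p) * (\<delta> c (h a b) p - S c a b p)"
      by (simp add: power2_eq_square algebra_simps)
    finally show ?thesis by (simp add: iH S_def algebra_simps)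
  qed
  have B\<nu>: "(\<Sum>d\<in>UNIV. B a d p * \<nu> p $ d) = 0" for a p
    using h_\<nu>[of a p] by (simp add: B_def mult_ac sum_distrib_left[symmetric] sum_distrib_right[symmetric])
  have Bsym: "B a b p = B b a p" for a b p by (simp add: B_def h_sym)
  \<comment> \<open>The defect of \<open>B\<close> from being idempotent. Its components also turn
    with the normal, so constancy is proved for its squared norm, where the normal terms cancel; the
    norm is zero at \<open>p1\<close>.\<close>
  define W where "W a b p = (\<Sum>d\<in>UNIV. B a d p * B d b p) - B a b p" for a b p
  have smW [simp]: "smooth_map \<A> (W a b)" for a b unfolding W_def[abs_def] by simp
  have Wsym: "W a b p = W b a p" for a b p
    unfolding W_def by (simp add: Bsym[of a] Bsym[of _ b] mult.commute)
  have W\<nu>: "(\<Sum>b\<in>UNIV. W a b p * \<nu> p $ b) = 0" for a p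
  proof -
    have "(\<Sum>b\<in>UNIV. W a b p * \<nu> p $ b) = (\<Sum>b\<in>UNIV. \<Sum>d\<in>UNIV. B a d p * (B d b p * \<nu> p $ b)) - (\<Sum>b\<in>UNIV. B a b p * \<nu> p $ b)"
      by (simp add: W_def left_diff_distrib sum_subtractf sum_distrib_right mult.assoc)
    also have "(\<Sum>b\<in>UNIV. \<Sum>d\<in>UNIV. B a d p * (B d b p * \<nu> p $ b)) = (\<Sum>d\<in>UNIV. B a d p * (\<Sum>b\<in>UNIV. B d b p * \<nu> p $ b))"
      unfolding sum_distrib_left by (rule sum.swap)
    finally show ?thesis by (simp add: B\<nu>)
  qed
  have W0: "W a b p = 0" for a b p
  proof -
    let ?w = "\<lambda>p. \<Sum>a\<in>UNIV. \<Sum>b\<in>UNIV. W a b p * W a b p"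
    have dW: "\<delta> c (W a b) p = \<nu> p $ a * (i p * h2 c b p - i p * (\<Sum>d\<in>UNIV. h2 c d p * B d b p))
        + \<nu> p $ b * (i p * h2 c a p - i p * (\<Sum>d\<in>UNIV. B a d p * h2 c d p))" for a b c p
    proof -
      have "\<delta> c (W a b) p = (\<Sum>d\<in>UNIV. B a d p * \<delta> c (B d b) p + \<delta> c (B a d) p * B d b p) - \<delta> c (B a b) p"
        unfolding W_def[abs_def] by (simp add: \<delta>_diff \<delta>_sum \<delta>_mult)
      also have "(\<Sum>d\<in>UNIV. B a d p * \<delta> c (B d b) p + \<delta> c (B a d) p * B d b p)
        = - i p * (\<Sum>d\<in>UNIV. B a d p * \<nu> p $ d) * h2 c b p - i p * \<nu> p $ b * (\<Sum>d\<in>UNIV. B a d p * h2 c d p)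
          - i p * \<nu> p $ a * (\<Sum>d\<in>UNIV. h2 c d p * B d b p) - i p * h2 c a p * (\<Sum>d\<in>UNIV. B b d p * \<nu> p $ d)"
      proof -
        have "B a d p * \<delta> c (B d b) p + \<delta> c (B a d) p * B d b p = - i p * (B a d p * \<nu> p $ d) * h2 c b p
            - i p * \<nu> p $ b * (B a d p * h2 c d p)
          - i p * \<nu> p $ a * (h2 c d p * B d b p) - i p * h2 c a p * (B b d p * \<nu> p $ d)" for d
          unfolding \<delta>B Bsym[of b d] by (simp add: algebra_simps)
        then show ?thesis
          by (simp only: sum_subtractf sum_distrib_left[symmetric] sum_distrib_right[symmetric])
      qed
      finally show ?thesis by (simp add: B\<nu> \<delta>B algebra_simps)
    qed
    have z: "(\<Sum>a\<in>UNIV. \<Sum>b\<in>UNIV. W a b p * (\<nu> p $ a * X b + \<nu> p $ b * Y a)) = 0" for p X Y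
    proof -
      have "(\<Sum>a\<in>UNIV. \<Sum>b\<in>UNIV. W a b p * (\<nu> p $ a * X b + \<nu> p $ b * Y a))
         = (\<Sum>a\<in>UNIV. \<Sum>b\<in>UNIV. (W b a p * \<nu> p $ a) * X b) + (\<Sum>a\<in>UNIV. \<Sum>b\<in>UNIV. (W a b p * \<nu> p $ b) * Y a)"
        unfolding sum.distrib[symmetric] by (intro sum.cong refl) (simp add: Wsym[of _ _ p] algebra_simps)
      also have "(\<Sum>a\<in>UNIV. \<Sum>b\<in>UNIV. (W b a p * \<nu> p $ a) * X b) = (\<Sum>b\<in>UNIV. (\<Sum>a\<in>UNIV. W b a p * \<nu> p $ a) * X b)"
        unfolding sum_distrib_right by (rule sum.swap)
      finally show ?thesis by (simp add: W\<nu> sum_distrib_right[symmetric])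
    qed
    have "\<delta> c ?w p = 0" for c p
    proof -
      have "\<delta> c ?w p = (\<Sum>a\<in>UNIV. \<Sum>b\<in>UNIV. 2 * (W a b p * \<delta> c (W a b) p))"
        by (simp add: \<delta>_sum \<delta>_mult algebra_simps)
      also have "\<dots> = 2 * (\<Sum>a\<in>UNIV. \<Sum>b\<in>UNIV. W a b p * \<delta> c (W a b) p)"
        by (simp only: sum_distrib_left)
      finally show ?thesis unfolding dW z by simp
    qed
    then have "?w p = ?w p1" by (intro constant_if_\<delta>_0[OF con]) simp_all
    also have "?w p1 = 0"
    proof -
      have "W a b p1 = 0" for a b
      proof -
        have "(\<Sum>d\<in>UNIV. B a d p1 * B d b p1) = (i p1)\<^sup>2 * h2 a b p1"
          by (simp add: B_def h2_def sum_distrib_left power2_eq_square mult_ac)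
        also have "\<dots> = i p1 * (i p1 * H p1) * h a b p1" by (simp add: h2l power2_eq_square mult_ac)
        finally show ?thesis by (simp add: W_def B_def iH mult.commute)
      qed
      then show ?thesis by simp
    qed
    finally have "(\<Sum>b\<in>UNIV. W a b p * W a b p) = 0"
      by (subst (asm) sum_nonneg_eq_0_iff) (auto intro!: sum_nonneg)
    then have "W a b p * W a b p = 0"
      by (subst (asm) sum_nonneg_eq_0_iff) auto
    then show ?thesis by simp
  qed
  have BB: "(\<Sum>d\<in>UNIV. B a d p * B d b p) = B a b p" for a b p
    using W0[of a b p] by (simp add: W_def)
  have h2H: "i p * h2 a b p = h a b p" for a b p
  proof -
    have "(i p)\<^sup>2 * h2 a b p = h a b p * i p"
      using BB[of a p b] by (simp add: B_def h2_def sum_distrib_left power2_eq_square mult_ac)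
    then have "H p * ((i p)\<^sup>2 * h2 a b p) = H p * (h a b p * i p)" by (simp only:)
    then have "(H p * i p) * (i p * h2 a b p) = h a b p * (H p * i p)"
      by (simp only: power2_eq_square mult_ac)
    then show ?thesis by (simp only: iH mult_1 mult_1_right)
  qed
  \<comment> \<open>the orthogonal projection onto the plane of \<open>\<nu>\<close> and the only curved direction\<close>
  define Q where "Q a b p = B a b p + \<nu> p $ a * \<nu> p $ b" for a b p
  have Qconst: "Q a b p = Q a b p1" for a b p
  proof (rule constant_if_\<delta>_0[OF con])
    show "smooth_map \<A> (Q a b)" unfolding Q_def[abs_def] by simp
    show "\<delta> c (Q a b) p = 0" for c p
    proof -
      have "\<delta> c (Q a b) p = - (\<nu> p $ a * (i p * h2 c b p)) - \<nu> p $ b * (i p * h2 c a p) + \<nu> p $ a * h c b p + h c a p * \<nu> p $ b"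
        unfolding Q_def[abs_def] by (simp add: \<delta>_add \<delta>_mult \<delta>B h_def[symmetric] algebra_simps)
      then show ?thesis by (simp add: h2H)
    qed
  qed
  have trQ: "(\<Sum>a\<in>UNIV. Q a a p1) = 2"
    by (simp add: Q_def B_def sum.distrib sum_\<nu>_sq sum_distrib_right[symmetric] H_def[symmetric] iH)
  have QQ: "(\<Sum>d\<in>UNIV. Q a d p1 * Q d b p1) = Q a b p1" for a b
  proof -
    have "Q a d p1 * Q d b p1 = B a d p1 * B d b p1 + (B a d p1 * \<nu> p1 $ d) * \<nu> p1 $ b
      + \<nu> p1 $ a * (B b d p1 * \<nu> p1 $ d) + \<nu> p1 $ a * (\<nu> p1 $ d * \<nu> p1 $ d) * \<nu> p1 $ b" for d
      by (simp add: Q_def Bsym[of b d] algebra_simps)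
    then have "(\<Sum>d\<in>UNIV. Q a d p1 * Q d b p1) = (\<Sum>d\<in>UNIV. B a d p1 * B d b p1) + (\<Sum>d\<in>UNIV. B a d p1 * \<nu> p1 $ d) * \<nu> p1 $ b
      + \<nu> p1 $ a * (\<Sum>d\<in>UNIV. B b d p1 * \<nu> p1 $ d) + \<nu> p1 $ a * (\<Sum>d\<in>UNIV. \<nu> p1 $ d * \<nu> p1 $ d) * \<nu> p1 $ b"
      by (simp only: sum.distrib sum_distrib_left sum_distrib_right)
    then show ?thesis by (simp add: BB B\<nu> sum_\<nu>_sq Q_def)
  qed
  \<comment> \<open>\<open>Q\<close> has trace 2, while the ambient dimension is at least 3; so not
    all diagonal entries are 1.\<close>
  obtain j where j: "Q j j p1 \<noteq> 1"
  proof -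
    have "\<exists>j. Q j j p1 \<noteq> 1"
    proof (rule ccontr)
      assume "\<not> ?thesis"
      then have "(\<Sum>a\<in>UNIV. Q a a p1) = real CARD('k)" by simp
      then show False using trQ card_k n2 by simp
    qed
    then show thesis using that by blast
  qed
  \<comment> \<open>The \<open>j\<close>-th column of the identity minus \<open>Q\<close>. It lies
    in the kernel because \<open>Q\<close> is idempotent, and its \<open>j\<close>-th entry is
    nonzero by the choice of \<open>j\<close>.\<close>
  define a0 where "a0 = (\<chi> d. (if d = j then 1 else 0) - Q d j p1)"
  have "a0 $ j \<noteq> 0" using j by (simp add: a0_def)
  then have "a0 \<noteq> 0" by auto
  define a where "a = a0 /\<^sub>R norm a0"
  have aa: "(\<Sum>c\<in>UNIV. a $ c * a $ c) = 1"
  proof -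
    have "norm a = 1" using \<open>a0 \<noteq> 0\<close> by (simp add: a_def)
    then show ?thesis unfolding norm_eq_1 by (simp add: inner_vec_def)
  qed
  have Qa: "(\<Sum>d\<in>UNIV. Q c d p * a $ d) = 0" for c p
  proof -
    have "Q c d p1 * a0 $ d = (if d = j then Q c j p1 else 0) - Q c d p1 * Q d j p1" for d
      by (simp add: a0_def algebra_simps)
    then have "(\<Sum>d\<in>UNIV. Q c d p1 * a0 $ d) = 0"
      by (simp add: sum_subtractf QQ)
    then show ?thesis
      unfolding Qconst[of _ _ p] by (simp add: a_def mult.left_commute sum_distrib_left[symmetric] mult.assoc)
  qed
  \<comment> \<open>The normal lies in the image of the symmetric projection \<open>Q\<close>, so
    the kernel vector \<open>a\<close> is tangential at every point.\<close>
  have \<nu>Q: "(\<Sum>c\<in>UNIV. \<nu> p $ c * Q c d p) = \<nu> p $ d" for d p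
  proof -
    have "\<nu> p $ c * Q c d p = B d c p * \<nu> p $ c + (\<nu> p $ c * \<nu> p $ c) * \<nu> p $ d" for c
      by (simp add: Q_def Bsym[of d c] algebra_simps)
    then show ?thesis by (simp add: sum.distrib B\<nu> sum_distrib_right[symmetric] sum_\<nu>_sq)
  qed
  have \<nu>a: "(\<Sum>d\<in>UNIV. \<nu> p $ d * a $ d) = 0" for p
  proof -
    have "0 = (\<Sum>c\<in>UNIV. \<nu> p $ c * (\<Sum>d\<in>UNIV. Q c d p * a $ d))" by (simp add: Qa)
    also have "\<dots> = (\<Sum>d\<in>UNIV. (\<Sum>c\<in>UNIV. \<nu> p $ c * Q c d p) * a $ d)"
      unfolding sum_distrib_left sum_distrib_right mult.assoc by (rule sum.swap)
    also have "\<dots> = (\<Sum>d\<in>UNIV. \<nu> p $ d * a $ d)" by (simp only: \<nu>Q)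
    finally show ?thesis by simp
  qed
  have ha: "(\<Sum>d\<in>UNIV. h c d p * a $ d) = 0" for c p
  proof -
    have "(\<Sum>d\<in>UNIV. Q c d p * a $ d) = (\<Sum>d\<in>UNIV. h c d p * a $ d) * i p + \<nu> p $ c * (\<Sum>d\<in>UNIV. \<nu> p $ d * a $ d)"
      by (simp add: Q_def B_def algebra_simps sum.distrib sum_distrib_left sum_distrib_right)
    then show ?thesis using Hne[of p] by (simp add: Qa \<nu>a i_def)
  qed
  define y where "y p = (\<Sum>d\<in>UNIV. F p $ d * a $ d)" for p
  have smy [simp]: "smooth_map \<A> y" unfolding y_def[abs_def] by simp
  have \<delta>y: "\<delta> c y p = a $ c" for c p
    unfolding y_def[abs_def] by (simp add: \<delta>_sum \<delta>_mult sum_\<delta>_F \<nu>a)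
  \<comment> \<open>The gradient of \<open>H\<close> is \<open>A\<close> applied to the position
    vector up to a factor, and \<open>a\<close> is in the kernel of \<open>A\<close>; hence
    \<open>H\<close> does not change along \<open>a\<close>.\<close>
  have \<delta>Ha: "(\<Sum>c\<in>UNIV. \<delta> c H p * a $ c) = 0" for p
  proof -
    have "(\<Sum>c\<in>UNIV. \<delta> c H p * a $ c) = - (1/2) * (\<Sum>c\<in>UNIV. \<Sum>d\<in>UNIV. F p $ d * (h d c p * a $ c))"
      unfolding \<delta>_H by (simp add: sum_distrib_left sum_distrib_right sum_negf h_sym mult_ac)
    also have "(\<Sum>c\<in>UNIV. \<Sum>d\<in>UNIV. F p $ d * (h d c p * a $ c)) = (\<Sum>d\<in>UNIV. F p $ d * (\<Sum>c\<in>UNIV. h d c p * a $ c))"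
      unfolding sum_distrib_left by (rule sum.swap)
    finally show ?thesis by (simp add: ha)
  qed
  define g where "g p = y p * inverse (1 + y p * y p)" for p
  have ypos: "1 + y p * y p > 0" for p using zero_le_square[of "y p"] by linarith
  have smg [simp]: "smooth_map \<A> g"
    unfolding g_def[abs_def]
    by (intro smooth_map_mult smooth_map_inverse smooth_map_add smooth_map_const smy) (metis ypos less_irrefl)
  have \<delta>g: "\<delta> c g p = (1 - y p * y p) / (1 + y p * y p)\<^sup>2 * a $ c" for c p
  proof -
    have "((\<lambda>x. x * inverse (1 + x * x)) has_real_derivative (1 - y p * y p) / (1 + y p * y p)\<^sup>2) (at (y p))"
      using ypos[of p] by (auto intro!: derivative_eq_intros simp: field_simps power2_eq_square)
    from \<delta>_compose[OF smy this, of c] show ?thesis by (simp add: g_def[abs_def] \<delta>y)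
  qed
  \<comment> \<open>Half the weighted divergence of the field \<open>H\<^sup>2 g a\<close>, namely
    half of \<open>H\<^sup>2 (g' + y g / 2)\<close> for \<open>g = y / (1 + y\<^sup>2)\<close>, over
    a common denominator.\<close>
  define E' where "E' p = (H p)\<^sup>2 * (2 - (y p)\<^sup>2 + (y p)^4) / (4 * (1 + (y p)\<^sup>2)\<^sup>2)" for p
  have pos: "2 - (y p)\<^sup>2 + (y p)^4 \<ge> 1" for p
  proof -
    have "2 - (y p)\<^sup>2 + (y p)^4 = ((y p)\<^sup>2 - 1/2)\<^sup>2 + 7/4" by (simp add: power2_eq_square power4_eq_xxxx algebra_simps)
    then show ?thesis using zero_le_power2[of "(y p)\<^sup>2 - 1/2"] by linarith
  qed
  have "E' p1 = 0"
  proof (rule liouville[of "\<lambda>c p. (H p * H p * g p) * a $ c"])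
    fix p
    show "smooth_map \<A> (\<lambda>p. (H p * H p * g p) * a $ c)" for c by simp
    show "(\<Sum>c\<in>UNIV. H p * H p * g p * a $ c * \<nu> p $ c) = 0"
      using \<nu>a[of p] by (simp add: mult.assoc mult.commute[of "a $ _"] sum_distrib_left[symmetric])
    show "0 \<le> E' p"
      unfolding E'_def using pos[of p] by (intro divide_nonneg_nonneg mult_nonneg_nonneg) auto
    show "drift_div (\<lambda>c p. H p * H p * g p * a $ c) p = 2 * E' p"
    proof -
      have dda: "drift_div (\<lambda>c p. a $ c) p = (1/2) * y p"
        by (simp add: drift_div_def y_def)
      have "\<delta> c (\<lambda>p. H p * H p * g p) p * a $ c = 2 * H p * g p * (\<delta> c H p * a $ c)
         + (H p)\<^sup>2 * ((1 - y p * y p) / (1 + y p * y p)\<^sup>2) * (a $ c * a $ c)" for c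
        by (simp add: \<delta>_mult \<delta>g power2_eq_square algebra_simps)
      then have "(\<Sum>c\<in>UNIV. \<delta> c (\<lambda>p. H p * H p * g p) p * a $ c)
         = (\<Sum>c\<in>UNIV. 2 * H p * g p * (\<delta> c H p * a $ c))
         + (\<Sum>c\<in>UNIV. (H p)\<^sup>2 * ((1 - y p * y p) / (1 + y p * y p)\<^sup>2) * (a $ c * a $ c))"
        by (simp only: sum.distrib)
      also have "\<dots> = 2 * H p * g p * (\<Sum>c\<in>UNIV. \<delta> c H p * a $ c)
         + (H p)\<^sup>2 * ((1 - y p * y p) / (1 + y p * y p)\<^sup>2) * (\<Sum>c\<in>UNIV. a $ c * a $ c)"
        by (simp only: sum_distrib_left)
      finally have 1: "(\<Sum>c\<in>UNIV. \<delta> c (\<lambda>p. H p * H p * g p) p * a $ c) = (H p)\<^sup>2 * ((1 - y p * y p) / (1 + y p * y p)\<^sup>2)"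
        by (simp only: \<delta>Ha aa mult_zero_right mult_1_right add_0_left)
      have "drift_div (\<lambda>c p. H p * H p * g p * a $ c) p = H p * H p * g p * drift_div (\<lambda>c p. a $ c) p
          + (\<Sum>c\<in>UNIV. \<delta> c (\<lambda>p. H p * H p * g p) p * a $ c)"
        by (rule drift_div_mult[of "\<lambda>p. H p * H p * g p" "\<lambda>c p. a $ c"]) simp_all
      then have "drift_div (\<lambda>c p. H p * H p * g p * a $ c) p
          = (H p)\<^sup>2 * ((1 - y p * y p) / (1 + y p * y p)\<^sup>2) + H p * H p * g p * ((1/2) * y p)"
        unfolding 1 dda by linarith
      also have "\<dots> = (H p)\<^sup>2 * ((1 - y p * y p) / (1 + y p * y p)\<^sup>2 + (1/2) * (y p * y p) / (1 + y p * y p))"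
      proof -
        have "H p * H p * g p * ((1/2) * y p) = (H p)\<^sup>2 * ((1/2) * (y p * y p) / (1 + y p * y p))"
          unfolding g_def power2_eq_square divide_inverse by (simp only: mult_ac)
        then show ?thesis by (simp only: distrib_left)
      qed
      also have "(1 - y p * y p) / (1 + y p * y p)\<^sup>2 + (1/2) * (y p * y p) / (1 + y p * y p)
         = (2 - (y p)\<^sup>2 + (y p)^4) / (2 * (1 + (y p)\<^sup>2)\<^sup>2)"
      proof -
        have "(1/2) * (y p * y p) / (1 + y p * y p) = (1/2) * (y p * y p) * (1 + y p * y p) / (1 + y p * y p)\<^sup>2"
          using ypos[of p] by (simp add: power2_eq_square)
        then have "(1 - y p * y p) / (1 + y p * y p)\<^sup>2 + (1/2) * (y p * y p) / (1 + y p * y p)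
          = ((1 - y p * y p) + (1/2) * (y p * y p) * (1 + y p * y p)) / (1 + y p * y p)\<^sup>2"
          by (simp add: add_divide_distrib)
        then show ?thesis by (simp add: power2_eq_square power4_eq_xxxx field_simps)
      qed
      finally show ?thesis by (simp add: E'_def)
    qed
    show "(\<Sum>c\<in>UNIV. (H p * H p * g p * a $ c)\<^sup>2) \<le> 4 * hh p * E' p"
    proof -
      have "(\<Sum>c\<in>UNIV. (H p * H p * g p * a $ c)\<^sup>2) = (H p)^4 * (g p)\<^sup>2"
      proof -
        have "(H p * H p * g p * a $ c)\<^sup>2 = (H p)^4 * (g p)\<^sup>2 * (a $ c * a $ c)" for c
          by (simp add: power2_eq_square power4_eq_xxxx mult_ac)
        then have "(\<Sum>c\<in>UNIV. (H p * H p * g p * a $ c)\<^sup>2) = (\<Sum>c\<in>UNIV. (H p)^4 * (g p)\<^sup>2 * (a $ c * a $ c))"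
          by (simp only:)
        then show ?thesis by (simp only: sum_distrib_left[symmetric] aa mult_1_right)
      qed
      also have "\<dots> = (H p)^4 * ((y p)\<^sup>2 / (1 + (y p)\<^sup>2)\<^sup>2)"
        by (simp add: g_def power2_eq_square divide_inverse mult_ac)
      also have "\<dots> \<le> (H p)^4 * ((2 - (y p)\<^sup>2 + (y p)^4) / (1 + (y p)\<^sup>2)\<^sup>2)"
      proof (intro mult_left_mono divide_right_mono)
        have "(2 - (y p)\<^sup>2 + (y p)^4) - (y p)\<^sup>2 = ((y p)\<^sup>2 - 1)\<^sup>2 + 1" by (simp add: power2_eq_square power4_eq_xxxx algebra_simps)
        also have "\<dots> \<ge> 0" by simp
        finally show "(y p)\<^sup>2 \<le> 2 - (y p)\<^sup>2 + (y p)^4" by simp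
      qed auto
      also have "\<dots> = 4 * hh p * E' p"
        by (simp add: hhH E'_def power2_eq_square power4_eq_xxxx mult_ac)
      finally show ?thesis .
    qed
  qed
  moreover have "E' p1 > 0"
  proof -
    have "(H p1)\<^sup>2 * (2 - (y p1)\<^sup>2 + (y p1)^4) > 0"
      using Hpos[of p1] pos[of p1] by (intro mult_pos_pos) auto
    moreover have "1 + (y p1)\<^sup>2 > 0" using ypos[of p1] by (simp add: power2_eq_square)
    ultimately show ?thesis unfolding E'_def by (intro divide_pos_pos) auto
  qed
  ultimately show False by simp
qed

end

section \<open>Proper local homeomorphisms onto convex sets\<close>

text \<open>Balls are cut with \<open>S\<close>, since the section is defined on the target only,
  and a hyperplane contains no full ball.\<close>

definition local_section :: "('m::topological_space \<Rightarrow> 'e::metric_space) \<Rightarrow> 'e set \<Rightarrow> 'm \<Rightarrow> real \<Rightarrow> ('e \<Rightarrow> 'm) \<Rightarrow> bool" where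
  "local_section f S p e s \<longleftrightarrow> continuous_on (ball (f p) e \<inter> S) s \<and> s (f p) = p \<and>
     (\<forall>y\<in>ball (f p) e \<inter> S. f (s y) = y)"

text \<open>The set where two lifts agree is open by local injectivity and closed by the Hausdorff
  property.\<close>

lemma lift_unique:
  fixes f :: "'m::t2_space \<Rightarrow> 'b" and g1 g2 :: "'c::topological_space \<Rightarrow> 'm"
  assumes inj: "\<And>p. \<exists>N. open N \<and> p \<in> N \<and> inj_on f N"
    and C: "connected C" "continuous_on C g1" "continuous_on C g2"
    and eq: "\<And>x. x \<in> C \<Longrightarrow> f (g1 x) = f (g2 x)" and x0: "x0 \<in> C" "g1 x0 = g2 x0" and x: "x \<in> C"
  shows "g1 x = g2 x"
proof -
  define T where "T = {x \<in> C. g1 x = g2 x}"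
  have "openin (top_of_set C) T"
  proof (subst openin_subopen, intro ballI)
    fix z assume "z \<in> T"
    then have z: "z \<in> C" "g1 z = g2 z" by (auto simp: T_def)
    obtain N where N: "open N" "g1 z \<in> N" "inj_on f N" using inj by blast
    let ?U = "(C \<inter> g1 -` N) \<inter> (C \<inter> g2 -` N)"
    have "openin (top_of_set C) ?U"
      by (intro openin_Int continuous_openin_preimage_gen C N)
    moreover have "z \<in> ?U" using z N by simp
    moreover have "?U \<subseteq> T" using N(3) eq by (auto simp: T_def inj_on_def)
    ultimately show "\<exists>U. openin (top_of_set C) U \<and> z \<in> U \<and> U \<subseteq> T" by blast
  qed
  moreover have "closedin (top_of_set C) T"
  proof -
    have "openin (top_of_set C) (C - T)"
    proof (subst openin_subopen, intro ballI)
      fix z assume "z \<in> C - T"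
      then have z: "z \<in> C" "g1 z \<noteq> g2 z" by (auto simp: T_def)
      obtain U V where UV: "open U" "open V" "g1 z \<in> U" "g2 z \<in> V" "U \<inter> V = {}"
        using hausdorff[OF z(2)] by blast
      let ?U = "(C \<inter> g1 -` U) \<inter> (C \<inter> g2 -` V)"
      have "openin (top_of_set C) ?U"
        by (intro openin_Int continuous_openin_preimage_gen C UV)
      moreover have "z \<in> ?U" using z UV by simp
      moreover have "?U \<subseteq> C - T" using UV by (auto simp: T_def)
      ultimately show "\<exists>U. openin (top_of_set C) U \<and> z \<in> U \<and> U \<subseteq> C - T" by blast
    qed
    then show ?thesis by (auto simp: closedin_def T_def)
  qed
  ultimately have "T = {} \<or> T = C"
    using C(1) by (auto simp: connected_clopen)
  then show ?thesis using x0 x by (auto simp: T_def)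
qed

text \<open>Halving the radii makes the section chosen at \<open>p\<close> serve all nearby points
  \<open>q\<close>. That it passes through \<open>q\<close>, and not through another preimage of
  \<open>f q\<close>, follows since its values and \<open>q\<close> both lie in \<open>N p\<close>,
  where \<open>f\<close> is injective.\<close>

lemma uniform_local_sections:
  fixes f :: "'m::t2_space \<Rightarrow> 'e::metric_space"
  assumes K: "compact K" and cont: "continuous_on UNIV f" and rng: "range f \<subseteq> S"
    and loc: "\<And>p. \<exists>N e s. open N \<and> p \<in> N \<and> inj_on f N \<and> e > 0 \<and> local_section f S p e s \<and> s ` (ball (f p) e \<inter> S) \<subseteq> N"
  obtains e where "e > 0" "\<And>p. p \<in> K \<Longrightarrow> \<exists>s. local_section f S p e s"
proof -
  obtain N e s where N: "\<And>p. open (N p)" "\<And>p. p \<in> N p" "\<And>p. inj_on f (N p)" "\<And>p. e p > 0"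
      "\<And>p. local_section f S p (e p) (s p)" "\<And>p. s p ` (ball (f p) (e p) \<inter> S) \<subseteq> N p"
    using loc by metis
  define U where "U p = N p \<inter> f -` ball (f p) (e p / 2)" for p
  have opU: "open (U p)" for p
    unfolding U_def by (intro open_Int N open_vimage cont open_ball)
  have inU: "p \<in> U p" for p unfolding U_def using N(2,4)[of p] by simp
  obtain P where P: "P \<subseteq> K" "finite P" "K \<subseteq> (\<Union>p\<in>P. U p)"
    using compactE_image[OF K, of K U] opU inU by blast
  \<comment> \<open>The inserted 1 keeps the minimum defined when \<open>K\<close>, and with it
    \<open>P\<close>, is empty.\<close>
  define d where "d = Min (insert 1 ((\<lambda>p. e p / 2) ` P))"
  have d: "d > 0" "\<And>p. p \<in> P \<Longrightarrow> d \<le> e p / 2"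
  proof -
    show "d > 0" using P(2) N(4) by (auto simp: d_def)
    show "d \<le> e p / 2" if "p \<in> P" for p
      unfolding d_def by (rule Min_le) (use that P(2) in auto)
  qed
  show thesis
  proof (rule that[OF d(1)])
    fix q assume "q \<in> K"
    then obtain p where p: "p \<in> P" "q \<in> U p" using P by blast
    then have q: "q \<in> N p" "dist (f p) (f q) < e p / 2" by (auto simp: U_def)
    have sub: "ball (f q) d \<inter> S \<subseteq> ball (f p) (e p) \<inter> S"
    proof -
      have "dist (f p) y < e p" if "dist (f q) y < d" for y
        using dist_triangle[of "f p" y "f q"] that q d(2)[OF p(1)] by linarith
      then show ?thesis by auto
    qed
    have fq: "f q \<in> ball (f q) d \<inter> S" using d rng by auto
    have "f (s p (f q)) = f q"
      using N(5)[of p] sub fq unfolding local_section_def by blast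
    moreover have "s p (f q) \<in> N p" using N(6) sub fq by blast
    ultimately have "s p (f q) = q"
      using N(3)[of p] q unfolding inj_on_def by blast
    then have "local_section f S q d (s p)"
      using N(5)[of p] sub unfolding local_section_def by (blast intro: continuous_on_subset)
    then show "\<exists>s. local_section f S q d s" by blast
  qed
qed

text \<open>A loop downstairs contracts linearly to its base point. Local sections of uniform size lift
  this contraction step by step, with both endpoints fixed.\<close>

lemma proper_local_homeomorphism_inj:
  fixes f :: "'m::t2_space \<Rightarrow> 'e::euclidean_space"
  assumes cont: "continuous_on UNIV f" and rng: "range f \<subseteq> S" and conv: "convex S"
    and proper: "\<And>K. compact K \<Longrightarrow> compact (f -` K)"
    and loc: "\<And>p. \<exists>N e s. open N \<and> p \<in> N \<and> inj_on f N \<and> e > 0 \<and> local_section f S p e s \<and> s ` (ball (f p) e \<inter> S) \<subseteq> N"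
    and path: "path \<gamma>" "pathstart \<gamma> = p" "pathfinish \<gamma> = q" and eq: "f p = f q"
  shows "p = q"
proof -
  have inj: "\<exists>N. open N \<and> p \<in> N \<and> inj_on f N" for p using loc by blast
  have fS: "f x \<in> S" for x using rng by blast
  define y where "y = f p"
  define g where "g t = f (\<gamma> t)" for t
  have contg: "continuous_on {0..1} g"
    unfolding g_def using path(1) unfolding path_def
    by (intro continuous_on_compose2[OF cont]) auto
  have g01: "g 0 = y" "g 1 = y" using path eq by (auto simp: g_def y_def pathstart_def pathfinish_def)
  define h where "h \<sigma> t = (1 - \<sigma>) *\<^sub>R g t + \<sigma> *\<^sub>R y" for \<sigma> t
  have conth: "continuous_on {0..1} (h \<sigma>)" for \<sigma>
    unfolding h_def[abs_def] by (intro continuous_intros contg)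
  have hS: "h \<sigma> t \<in> S" if "0 \<le> \<sigma>" "\<sigma> \<le> 1" for \<sigma> t
    unfolding h_def using conv fS that by (intro convexD) (auto simp: g_def y_def)
  have "compact (g ` {0..1})" by (rule compact_continuous_image[OF contg]) simp
  then have "bounded (g ` {0..1})" by (rule compact_imp_bounded)
  then obtain R where R: "\<And>t. t \<in> {0..1} \<Longrightarrow> norm (g t) \<le> R"
    unfolding bounded_iff by blast
  have hR: "h \<sigma> t \<in> cball 0 R" if "0 \<le> \<sigma>" "\<sigma> \<le> 1" "t \<in> {0..1}" for \<sigma> t
    unfolding h_def using that R[of t] R[of 0] g01
    by (intro convexD[OF convex_cball]) auto
  obtain e where e: "e > 0" "\<And>x. x \<in> f -` cball 0 R \<Longrightarrow> \<exists>s. local_section f S x e s"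
    using uniform_local_sections[OF proper[OF compact_cball] cont rng loc] by blast
  then obtain s where s: "\<And>x. f x \<in> cball 0 R \<Longrightarrow> local_section f S x e (s x)"
    by (metis vimageI)
  have dh: "dist (h \<sigma> t) (h \<sigma>' t) \<le> \<bar>\<sigma> - \<sigma>'\<bar> * (2 * R)" if "t \<in> {0..1}" for \<sigma> \<sigma>' t
  proof -
    have "h \<sigma> t - h \<sigma>' t = (\<sigma> - \<sigma>') *\<^sub>R (y - g t)" by (simp add: h_def algebra_simps)
    then have "dist (h \<sigma> t) (h \<sigma>' t) = \<bar>\<sigma> - \<sigma>'\<bar> * norm (y - g t)" by (simp add: dist_norm)
    also have "\<dots> \<le> \<bar>\<sigma> - \<sigma>'\<bar> * (2 * R)"
      using norm_triangle_ineq4[of y "g t"] R[OF that] R[of 0] g01 by (intro mult_left_mono) auto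
    finally show ?thesis .
  qed
  define lifts where "lifts \<sigma> c \<longleftrightarrow> continuous_on {0..1} c \<and> c 0 = p \<and> c 1 = q \<and> (\<forall>t\<in>{0..1}. f (c t) = h \<sigma> t)" for \<sigma> c
  \<comment> \<open>The lift at level \<open>\<sigma>\<close> is pushed to a close level
    \<open>\<sigma>'\<close> by the sections through its own points. The endpoints do not move
    because the loop is based at \<open>y\<close> at every level.\<close>
  have step: "\<exists>c. lifts \<sigma>' c" if \<sigma>: "0 \<le> \<sigma>" "\<sigma> \<le> 1" "0 \<le> \<sigma>'" "\<sigma>' \<le> 1" and near: "\<bar>\<sigma> - \<sigma>'\<bar> * (2 * R) < e / 2"
    and c: "lifts \<sigma> c" for \<sigma> \<sigma>' c
  proof -
    have cc: "continuous_on {0..1} c" "c 0 = p" "c 1 = q" "\<And>t. t \<in> {0..1} \<Longrightarrow> f (c t) = h \<sigma> t"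
      using c by (auto simp: lifts_def)
    have sec: "local_section f S (c t) e (s (c t))" if "t \<in> {0..1}" for t
      using s[of "c t"] hR[OF \<sigma>(1,2) that] cc(4)[OF that] by simp
    have close: "h \<sigma>' t \<in> ball (f (c t)) e \<inter> S" if "t \<in> {0..1}" for t
      using dh[OF that, of \<sigma> \<sigma>'] near e hS[OF \<sigma>(3,4)] cc(4)[OF that] by auto
    define c' where "c' t = s (c t) (h \<sigma>' t)" for t
    have "f (c' t) = h \<sigma>' t" if "t \<in> {0..1}" for t
      using sec[OF that] close[OF that] unfolding c'_def local_section_def by blast
    moreover have "c' 0 = p" "c' 1 = q"
      using sec[of 0] sec[of 1] cc by (auto simp: c'_def h_def g01 local_section_def)
    moreover have "continuous_on {0..1} c'"
      unfolding continuous_on_eq_continuous_within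
    proof
      fix t0 :: real assume t0: "t0 \<in> {0..1}"
      let ?s = "s (c t0)" and ?B = "ball (f (c t0)) e \<inter> S"
      note sec0 = sec[OF t0, unfolded local_section_def]
      obtain d where d: "d > 0" "\<And>t. t \<in> {0..1} \<Longrightarrow> dist t t0 < d \<Longrightarrow> dist (h \<sigma> t) (h \<sigma> t0) < e / 2"
        using conth[of \<sigma>] t0 e(1) unfolding continuous_on_iff by (meson half_gt_zero)
      define I where "I = {0..1} \<inter> ball t0 d"
      have I: "connected I" "t0 \<in> I" "I \<subseteq> {0..1}"
        using t0 d(1) by (auto simp: I_def intro!: convex_connected convex_Int)
      have hI: "h \<sigma> t \<in> ?B" "h \<sigma>' t \<in> ?B" if "t \<in> I" for t
      proof -
        have t: "t \<in> {0..1}" "dist (h \<sigma> t0) (h \<sigma> t) < e / 2"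
          using that d(2)[of t] by (auto simp: I_def dist_commute)
        have "dist (h \<sigma> t) (h \<sigma>' t) < e / 2" using dh[OF t(1), of \<sigma> \<sigma>'] near by linarith
        then show "h \<sigma> t \<in> ?B" "h \<sigma>' t \<in> ?B"
          using t(2) hS[OF \<sigma>(1,2)] hS[OF \<sigma>(3,4)] cc(4)[OF t0] e(1)
            dist_triangle[of "h \<sigma> t0" "h \<sigma>' t" "h \<sigma> t"] by auto
      qed
      \<comment> \<open>Near \<open>t0\<close> the old lift runs on the single sheet given by the
        section at \<open>c t0\<close>.\<close>
      have cs: "c t = ?s (h \<sigma> t)" if "t \<in> I" for t
      proof (rule lift_unique[OF inj I(1) _ _ _ I(2) _ that])
        show "continuous_on I c" using cc(1) I(3) continuous_on_subset by blast
        show "continuous_on I (\<lambda>t. ?s (h \<sigma> t))"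
          by (rule continuous_on_compose2[of ?B]) (use sec0 hI conth I(3) continuous_on_subset in blast)+
        show "f (c t) = f (?s (h \<sigma> t))" if "t \<in> I" for t
          using sec0 hI(1)[OF that] cc(4)[of t] I(3) that by auto
        show "c t0 = ?s (h \<sigma> t0)" using sec0 cc(4)[OF t0] by simp
      qed
      \<comment> \<open>The sections at \<open>c t\<close> and \<open>c t0\<close> agree at
        \<open>h \<sigma> t\<close>, hence on the whole intersection of their domains, which is
        convex and so connected. The new lift is therefore given near \<open>t0\<close> by one
        continuous section.\<close>
      have eqI: "c' t = ?s (h \<sigma>' t)" if t: "t \<in> I" for t
      proof -
        have t1: "t \<in> {0..1}" using t I by blast
        let ?C = "(ball (f (c t)) e \<inter> S) \<inter> ?B"
        show ?thesis
          unfolding c'_def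
        proof (rule lift_unique[OF inj, of ?C _ _ "h \<sigma> t"])
          show "connected ?C" by (intro convex_connected convex_Int conv convex_ball)
          show "continuous_on ?C (s (c t))" "continuous_on ?C ?s"
            using sec[OF t1] sec0 unfolding local_section_def by (blast intro: continuous_on_subset)+
          show "f (s (c t) z) = f (?s z)" if "z \<in> ?C" for z
            using sec[OF t1] sec0 that unfolding local_section_def by auto
          show "h \<sigma> t \<in> ?C" "h \<sigma>' t \<in> ?C"
            using hI[OF t] close[OF t1] cc(4)[OF t1] e(1) hS[OF \<sigma>(1,2)] by auto
          show "s (c t) (h \<sigma> t) = ?s (h \<sigma> t)"
            using sec[OF t1] cc(4)[OF t1] cs[OF t] unfolding local_section_def by simp
        qed
      qed
      have "continuous_on I (\<lambda>t. ?s (h \<sigma>' t))"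
        by (rule continuous_on_compose2[of ?B]) (use sec0 hI conth I(3) continuous_on_subset in blast)+
      then have "continuous_on I c'" using eqI by (simp cong: continuous_on_cong)
      then have "continuous (at t0 within I) c'"
        using I(2) continuous_on_eq_continuous_within by blast
      moreover have "at t0 within {0..1} = at t0 within I"
        by (rule at_within_nhd[of t0 "ball t0 d"]) (use d(1) in \<open>auto simp: I_def\<close>)
      ultimately show "continuous (at t0 within {0..1}) c'" by simp
    qed
    ultimately show ?thesis unfolding lifts_def by blast
  qed
  have "R \<ge> 0" using order_trans[OF norm_ge_zero R[of 0]] by simp
  \<comment> \<open>The homotopy moves every point with speed at most \<open>2 * R\<close>, so
    \<open>N\<close> equal steps stay below \<open>e / 2\<close>.\<close>
  obtain N :: nat where N: "N > 0" "(1 / N) * (2 * R) < e / 2"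
  proof -
    obtain N :: nat where "real N > 4 * R / e" using reals_Archimedean2 by blast
    then show thesis using e(1) \<open>R \<ge> 0\<close> by (intro that[of "Suc N"]) (auto simp: field_simps)
  qed
  have "\<exists>c. lifts (real j / N) c" if "j \<le> N" for j
    using that
  proof (induction j)
    case 0
    have "lifts 0 \<gamma>" using path by (auto simp: lifts_def h_def g_def path_def pathstart_def pathfinish_def)
    then show ?case by auto
  next
    case (Suc j)
    then obtain c where c: "lifts (real j / N) c" by auto
    have "real j / N - real (Suc j) / N = - (1 / N)" by (simp add: diff_divide_distrib[symmetric])
    then have "\<bar>real j / N - real (Suc j) / N\<bar> * (2 * R) < e / 2" using N by simp
    then show ?case
      by (intro step[OF _ _ _ _ _ c]) (use Suc.prems N in \<open>auto simp: field_simps\<close>)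
  qed
  from this[of N] obtain c where c: "lifts 1 c" using N by auto
  \<comment> \<open>At level 1 the loop is constant, and its lift starting at \<open>p\<close> is
    constant by uniqueness.\<close>
  have "c 1 = p"
    using c by (intro lift_unique[OF inj, of "{0..1::real}" c "\<lambda>_. p" 0 1])
      (auto simp: lifts_def h_def y_def)
  then show ?thesis using c by (simp add: lifts_def)
qed

section \<open>Vanishing mean curvature\<close>

context self_expanding
begin

text \<open>For \<open>H = 0\<close> the position vector is tangential and the Hessian identity says
  that differentiating \<open>h\<close> along it gives \<open>- h\<close>. From a maximum point,
  moving along \<open>- F\<close> stays in the preimage of the ball but increases the test
  function.\<close>

lemma second_fundamental_form_vanishes:
  assumes H0: "\<And>p. H p = 0" and proper: "properly_immersed F"
  shows "hh p = 0"
proof (rule ccontr)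
  assume nz: "hh p \<noteq> 0"
  have Hf: "H = (\<lambda>p. 0)" using H0 by blast
  have F\<nu>0: "(\<Sum>a\<in>UNIV. F q $ a * \<nu> q $ a) = 0" for q using F_\<nu>[of q] H0 by simp
  have hF: "(\<Sum>c\<in>UNIV. F q $ c * h b c q) = 0" for b q
    using \<delta>_H[of b q] by (simp add: Hf)
  have h2F: "(\<Sum>c\<in>UNIV. F q $ c * h2 c b q) = 0" for b q
  proof -
    have "(\<Sum>c\<in>UNIV. F q $ c * h2 c b q) = (\<Sum>d\<in>UNIV. (\<Sum>c\<in>UNIV. F q $ c * h d c q) * h d b q)"
      unfolding h2_def sum_distrib_left sum_distrib_right by (subst sum.swap) (simp add: h_sym[of _ _ q] mult.assoc)
    then show ?thesis by (simp add: hF)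
  qed
  have hab: "(\<Sum>c\<in>UNIV. F q $ c * \<delta> c (h a b) q) = - h a b q" for a b q
  proof -
    have "\<delta> b (\<lambda>p. 0) = (\<lambda>p. 0)" for b by (rule ext) simp
    then show ?thesis using \<delta>_\<delta>_H[of a b q] by (simp add: Hf h2F)
  qed
  have Fhh: "(\<Sum>c\<in>UNIV. F q $ c * \<delta> c hh q) = - 2 * hh q" for q
  proof -
    have "(\<Sum>c\<in>UNIV. F q $ c * \<delta> c hh q) = (\<Sum>c\<in>UNIV. \<Sum>a\<in>UNIV. \<Sum>b\<in>UNIV. 2 * h a b q * (F q $ c * \<delta> c (h a b) q))"
      unfolding \<delta>_hh by (simp add: sum_distrib_left mult_ac)
    also have "\<dots> = (\<Sum>a\<in>UNIV. \<Sum>c\<in>UNIV. \<Sum>b\<in>UNIV. 2 * h a b q * (F q $ c * \<delta> c (h a b) q))"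
      by (rule sum.swap)
    also have "\<dots> = (\<Sum>a\<in>UNIV. \<Sum>b\<in>UNIV. \<Sum>c\<in>UNIV. 2 * h a b q * (F q $ c * \<delta> c (h a b) q))"
      by (intro sum.cong refl sum.swap)
    also have "\<dots> = (\<Sum>a\<in>UNIV. \<Sum>b\<in>UNIV. 2 * h a b q * - h a b q)"
      by (simp only: sum_distrib_left[symmetric] hab)
    also have "\<dots> = - 2 * hh q"
      by (simp add: hh_def sum_distrib_left sum_negf power2_eq_square mult.assoc)
    finally show ?thesis .
  qed
  define n2 where "n2 q = (\<Sum>a\<in>UNIV. F q $ a * F q $ a)" for q
  have n2: "n2 q = (norm (F q))\<^sup>2" for q
    unfolding power2_norm_eq_inner by (simp add: n2_def inner_vec_def)
  have sm_n2 [simp]: "smooth_map \<A> n2" unfolding n2_def[abs_def] by simp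
  have \<delta>n2: "\<delta> c n2 q = 2 * F q $ c" for c q
  proof -
    have "\<delta> c n2 q = 2 * (\<Sum>a\<in>UNIV. \<delta> c (\<lambda>q. F q $ a) q * F q $ a)"
      unfolding n2_def[abs_def] by (simp add: \<delta>_sum \<delta>_mult sum_distrib_left mult_ac)
    then show ?thesis using F\<nu>0[of q] unfolding sum_\<delta>_F by (simp add: mult.commute)
  qed
  \<comment> \<open>The square of \<open>|A|\<^sup>2 |x|\<close>, taken so that the function is
    smooth also over the origin; along \<open>F\<close> it is homogeneous of degree
    \<open>-2\<close>.\<close>
  define w where "w q = hh q * hh q * n2 q" for q
  have sm_w [simp]: "smooth_map \<A> w" unfolding w_def[abs_def] by simp
  have Fw: "(\<Sum>c\<in>UNIV. F q $ c * \<delta> c w q) = - 2 * w q" for q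
  proof -
    have "F q $ c * \<delta> c w q = 2 * hh q * n2 q * (F q $ c * \<delta> c hh q) + 2 * hh q * hh q * (F q $ c * F q $ c)" for c
      unfolding w_def[abs_def] by (simp add: \<delta>_mult \<delta>n2 algebra_simps)
    then have "(\<Sum>c\<in>UNIV. F q $ c * \<delta> c w q) = 2 * hh q * n2 q * (\<Sum>c\<in>UNIV. F q $ c * \<delta> c hh q) + 2 * hh q * hh q * n2 q"
      by (simp only: sum.distrib sum_distrib_left[symmetric] n2_def[symmetric])
    then show ?thesis by (simp add: Fhh w_def)
  qed
  \<comment> \<open>Over the origin the homogeneity relation reads \<open>0 = - h a b q\<close>, so
    \<open>hh\<close> already vanishes there.\<close>
  have hh_F: "hh q = 0" if "F q = 0" for q
  proof -
    have "h a b q = 0" for a b using hab[of q a b] that by simp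
    then show ?thesis by (simp add: hh_def)
  qed
  define K where "K = F -` cball 0 (norm (F p))"
  have "compact K" unfolding K_def using proper compact_cball unfolding properly_immersed_def by blast
  moreover have "p \<in> K" by (simp add: K_def)
  moreover have "continuous_on K w" using smooth_map_continuous[OF sm_w] continuous_on_subset by blast
  ultimately obtain q where q: "q \<in> K" "\<And>x. x \<in> K \<Longrightarrow> w x \<le> w q"
    using continuous_attains_sup[of K w] by blast
  have "F p \<noteq> 0" "hh p > 0" using nz hh_F[of p] hh_nonneg[of p] by (auto simp: less_le)
  then have "w p > 0" by (simp add: w_def n2)
  then have wq: "w q > 0" using q(2)[OF \<open>p \<in> K\<close>] by simp
  then have Fq: "F q \<noteq> 0" by (auto simp: w_def n2)
  obtain c where c: "c \<in> \<A>" "q \<in> fst c" by (rule ex_chart)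
  have "- F q \<bullet> \<nu> q = 0" using F\<nu>0[of q] by (simp add: inner_vec_def sum_negf)
  then obtain v where v: "dF c (snd c q) v = - F q" using tangent_vector_eq_dF[OF c] by blast
  let ?g = "\<lambda>t. chart_inv c (snd c q + t *\<^sub>R v)"
  have d: "((\<lambda>t. f (?g t)) has_real_derivative - (\<Sum>a\<in>UNIV. F q $ a * \<delta> a f q)) (at 0)" if "smooth_map \<A> f" for f
    using coordinate_line_derivative[OF that c(1), of "snd c q" 0 v] c v
    by (simp add: inner_tgrad sum_negf mult.commute)
  have "((\<lambda>t. w (?g t)) has_real_derivative 2 * w q) (at 0)"
    using d[OF sm_w] by (simp add: Fw)
  then obtain d1 where d1: "d1 > 0" "\<And>t. t > 0 \<Longrightarrow> t < d1 \<Longrightarrow> w (?g 0) < w (?g (0 + t))"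
    using DERIV_pos_inc_right[of "\<lambda>t. w (?g t)" "2 * w q" 0] wq by auto
  have "((\<lambda>t. n2 (?g t)) has_real_derivative - 2 * n2 q) (at 0)"
    using d[OF sm_n2] by (simp add: \<delta>n2 n2_def sum_distrib_left sum_negf mult_ac)
  moreover have "- 2 * n2 q < 0" using Fq by (simp add: n2)
  ultimately obtain d2 where d2: "d2 > 0" "\<And>t. t > 0 \<Longrightarrow> t < d2 \<Longrightarrow> n2 (?g (0 + t)) < n2 (?g 0)"
    using DERIV_neg_dec_right[of "\<lambda>t. n2 (?g t)" "- 2 * n2 q" 0] by auto
  define t where "t = min d1 d2 / 2"
  have t: "t > 0" "t < d1" "t < d2" using d1 d2 by (auto simp: t_def)
  have "n2 (?g t) < n2 q" using d2(2)[of t] t c by simp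
  then have "norm (F (?g t)) \<le> norm (F q)" unfolding n2 by (simp add: power2_le_imp_le less_imp_le)
  then have "?g t \<in> K" using q(1) by (simp add: K_def)
  moreover have "w q < w (?g t)" using d1(2)[of t] t c by simp
  ultimately show False using q(2)[of "?g t"] by simp
qed

text \<open>With constant normal the chord has no normal component, so \<open>local_sheet\<close>
  makes the chart expression of \<open>F\<close> injective with Lipschitz inverse. That a relative
  ball is covered is invariance of domain.\<close>

lemma F_section_of_hyperplane:
  assumes a: "\<And>p. \<nu> p = a" and Fa: "\<And>p. a \<bullet> F p = 0"
  shows "\<exists>N e s. open N \<and> p \<in> N \<and> inj_on F N \<and> e > 0 \<and> local_section F {x. a \<bullet> x = 0} p e s \<and>
      s ` (ball (F p) e \<inter> {x. a \<bullet> x = 0}) \<subseteq> N \<and> ball (F p) e \<inter> {x. a \<bullet> x = 0} \<subseteq> range F"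
proof -
  let ?S = "{x. a \<bullet> x = 0}"
  obtain c where c: "c \<in> \<A>" "p \<in> fst c" by (rule ex_chart)
  let ?u0 = "snd c p" and ?i = "chart_inv c"
  obtain r \<kappa> M where r: "r > 0" "\<kappa> > 0" "M > 0" "cball ?u0 r \<subseteq> chart_image c"
    and "\<And>u u'. u \<in> cball ?u0 r \<Longrightarrow> u' \<in> cball ?u0 r \<Longrightarrow> norm (F (?i u) - F (?i u')) \<le> M * norm (u - u')"
    and low: "\<And>u u' x. u \<in> cball ?u0 r \<Longrightarrow> u' \<in> cball ?u0 r \<Longrightarrow> x = F (?i u) - F (?i u') \<Longrightarrow>
       \<kappa> * norm (u - u') \<le> norm (x - (x \<bullet> \<nu> (?i u)) *\<^sub>R \<nu> (?i u))"
    using local_sheet[OF c(1) chart_in_image[OF c(2)]] by blast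
  have low': "\<kappa> * norm (u - u') \<le> norm (F (?i u) - F (?i u'))" if "u \<in> cball ?u0 r" "u' \<in> cball ?u0 r" for u u'
    using low[OF that refl] a Fa by (simp add: inner_commute inner_diff_right)
  let ?B = "ball ?u0 r"
  have Bsub: "?B \<subseteq> chart_image c" "?B \<subseteq> cball ?u0 r" using r by auto
  have injB: "inj_on (\<lambda>u. F (?i u)) ?B"
  proof (rule inj_onI)
    fix u u' assume u: "u \<in> ?B" "u' \<in> ?B" "F (?i u) = F (?i u')"
    then have "\<kappa> * norm (u - u') \<le> 0" using low'[of u u'] Bsub by auto
    then show "u = u'" using r(2) by (simp add: mult_le_0_iff)
  qed
  let ?N = "?i ` ?B"
  have opN: "open ?N" by (rule open_chart_inv_image[OF c(1) open_ball Bsub(1)])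
  have pN: "p \<in> ?N" by (rule image_eqI[of _ _ ?u0]) (use c r in auto)
  have injN: "inj_on F ?N"
    using injB by (auto simp: inj_on_def)
  have contB: "continuous_on ?B (\<lambda>u. F (?i u))"
    using smooth_on_imp_continuous_on[OF smooth_map_chart[OF smooth_F c(1)]] Bsub continuous_on_subset by blast
  have "openin (top_of_set ?S) ((\<lambda>u. F (?i u)) ` ?B)"
  proof (rule invariance_of_domain_subspaces[where U=UNIV])
    show "openin (top_of_set UNIV) ?B" by simp
    show "subspace ?S" by (rule subspace_hyperplane)
    have "span ?S = ?S" by (rule span_eq_iff[THEN iffD2, OF subspace_hyperplane])
    moreover have "a \<notin> ?S" using \<nu>_\<nu>[of p] a by simp
    ultimately have "span ?S \<noteq> UNIV" by blast
    then have "dim ?S \<noteq> DIM(real^'k)" by (simp only: dim_eq_full not_False_eq_True)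
    moreover have "dim ?S \<le> DIM(real^'k)" by (rule dim_subset_UNIV)
    ultimately have "dim ?S < CARD('k)" by simp
    then show "dim ?S \<le> dim (UNIV :: (real^'n) set)" using card_k by simp
  qed (use Fa contB injB in auto)
  then obtain e where e: "e > 0" "ball (F p) e \<inter> ?S \<subseteq> (\<lambda>u. F (?i u)) ` ?B"
  proof -
    have "F p \<in> (\<lambda>u. F (?i u)) ` ?B"
      by (rule image_eqI[of _ _ ?u0]) (use c r in auto)
    then show thesis
      using \<open>openin (top_of_set ?S) ((\<lambda>u. F (?i u)) ` ?B)\<close> that unfolding openin_contains_ball by blast
  qed
  define j where "j y = inv_into ?B (\<lambda>u. F (?i u)) y" for y
  have j: "j y \<in> ?B" "F (?i (j y)) = y" if "y \<in> ball (F p) e \<inter> ?S" for y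
    using e(2) that inv_into_into[of y "\<lambda>u. F (?i u)" ?B] f_inv_into_f[of y "\<lambda>u. F (?i u)" ?B]
    unfolding j_def by blast+
  have contj: "continuous_on (ball (F p) e \<inter> ?S) j"
  proof (rule lipschitz_on_continuous_on)
    show "(1 / \<kappa>)-lipschitz_on (ball (F p) e \<inter> ?S) j"
    proof (rule lipschitz_onI)
      fix y z assume yz: "y \<in> ball (F p) e \<inter> ?S" "z \<in> ball (F p) e \<inter> ?S"
      then have "\<kappa> * norm (j y - j z) \<le> norm (y - z)"
        using low'[of "j y" "j z"] j Bsub by (metis subsetD)
      then show "dist (j y) (j z) \<le> 1 / \<kappa> * dist y z"
        using r(2) by (simp add: dist_norm field_simps)
    qed (use r in simp)
  qed
  have "local_section F ?S p e (\<lambda>y. ?i (j y))"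
    unfolding local_section_def
  proof (intro conjI ballI)
    show "continuous_on (ball (F p) e \<inter> ?S) (\<lambda>y. ?i (j y))"
      by (rule continuous_on_compose2[OF continuous_on_chart_inv[OF c(1)] contj]) (use j Bsub in blast)
    have Fp: "F p \<in> ball (F p) e \<inter> ?S" using e Fa by simp
    show "?i (j (F p)) = p"
      using inj_onD[OF injN, of "?i (j (F p))" p] j[OF Fp] pN by blast
  qed (rule j)
  moreover have "(\<lambda>y. ?i (j y)) ` (ball (F p) e \<inter> ?S) \<subseteq> ?N" using j by blast
  moreover have "ball (F p) e \<inter> ?S \<subseteq> range F" using e(2) by blast
  ultimately show ?thesis using opN pN injN e(1) by blast
qed

text \<open>With \<open>h = 0\<close> the normal is a constant \<open>a\<close>, and the expander
  equation puts the image into the hyperplane through the origin orthogonal to \<open>a\<close>.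
  What remains is that \<open>F\<close> is bijective onto it.\<close>

theorem flat_is_hyperplane:
  assumes con: "connected (UNIV :: 'm set)" and H0: "\<And>p. H p = 0" and proper: "properly_immersed F"
    and path: "\<And>p q. \<exists>\<gamma>. path \<gamma> \<and> pathstart \<gamma> = p \<and> pathfinish \<gamma> = (q::'m)"
  shows "\<exists>a. a \<noteq> 0 \<and> bij_betw F UNIV {x. a \<bullet> x = 0}"
proof -
  obtain p0 :: 'm where True by blast
  define a where "a = \<nu> p0"
  have "h c b p = 0" for b c p
  proof -
    have "(\<Sum>b\<in>UNIV. (h c b p)\<^sup>2) = 0"
      using second_fundamental_form_vanishes[OF H0 proper, of p] unfolding hh_def
      by (subst (asm) sum_nonneg_eq_0_iff) (auto intro!: sum_nonneg)
    then have "(h c b p)\<^sup>2 = 0" by (subst (asm) sum_nonneg_eq_0_iff) auto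
    then show ?thesis by simp
  qed
  then have "\<nu> p $ b = \<nu> p0 $ b" for p b
    by (intro constant_if_\<delta>_0[OF con]) (auto simp: h_def)
  then have \<nu>a: "\<nu> p = a" for p by (simp add: vec_eq_iff a_def)
  have Fa: "a \<bullet> F p = 0" for p using H_eq[of p] H0 \<nu>a by (simp add: inner_commute)
  have "a \<noteq> 0" using \<nu>_\<nu>[of p0] by (metis a_def inner_zero_left zero_neq_one)
  let ?S = "{x. a \<bullet> x = 0}"
  have sub: "range F \<subseteq> ?S" using Fa by auto
  have comp: "compact (F -` K)" if "compact K" for K
    using proper that by (auto simp: properly_immersed_def)
  have cF: "continuous_on UNIV F" by (rule smooth_map_continuous[OF smooth_F])
  have sec: "\<exists>N e s. open N \<and> p \<in> N \<and> inj_on F N \<and> e > 0 \<and> local_section F ?S p e s \<and> s ` (ball (F p) e \<inter> ?S) \<subseteq> N"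
    and sec': "\<exists>e>0. ball (F p) e \<inter> ?S \<subseteq> range F" for p
    using F_section_of_hyperplane[OF \<nu>a Fa, of p] by blast+
  have "inj F"
  proof (rule injI)
    fix p q assume pq: "F p = F q"
    obtain \<gamma> where "path \<gamma>" "pathstart \<gamma> = p" "pathfinish \<gamma> = q" using path by blast
    then show "p = q"
      using proper_local_homeomorphism_inj[OF cF sub convex_hyperplane comp sec _ _ _ pq] by blast
  qed
  \<comment> \<open>The image is relatively open by the local sections and closed by properness,
    inside a connected hyperplane.\<close>
  moreover have "range F = ?S"
  proof -
    have "openin (top_of_set ?S) (range F)"
      unfolding openin_contains_ball using sub sec' by blast
    moreover have "closedin (top_of_set ?S) (range F)"
    proof -
      have "closed (range F)"
        unfolding closed_limpt
      proof (intro allI impI)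
        fix y assume y: "y islimpt range F"
        have "range F \<inter> cball y 1 = F ` (F -` cball y 1)" by auto
        moreover have "compact (F ` (F -` cball y 1))"
          by (rule compact_continuous_image[OF continuous_on_subset[OF cF] comp]) auto
        ultimately have "closed (range F \<inter> cball y 1)" by (simp add: compact_imp_closed)
        moreover have "y islimpt (range F \<inter> cball y 1)"
          using y by (intro islimpt_Int_eventually) (auto simp: eventually_at dist_commute intro!: exI[of _ 1])
        ultimately show "y \<in> range F" using closed_limpt by blast
      qed
      then show ?thesis using sub by (simp add: closed_subset)
    qed
    moreover have "connected ?S" by (intro convex_connected convex_hyperplane)
    ultimately show ?thesis by (auto simp: connected_clopen)
  qed
  ultimately show ?thesis using \<open>a \<noteq> 0\<close> by (auto simp: bij_betw_def)
qed

end

section \<open>The geodesic distance\<close>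

lemma C1_differentiable_on_affine:
  assumes f: "f C1_differentiable_on T" and J: "open J" "T' \<subseteq> J" "\<And>s. s \<in> J \<Longrightarrow> g s = f (\<alpha> + \<beta> * s)"
    and sub: "\<And>s. s \<in> T' \<Longrightarrow> \<alpha> + \<beta> * s \<in> T"
  shows "g C1_differentiable_on T'"
proof -
  obtain D where D: "\<And>x. x \<in> T \<Longrightarrow> (f has_vector_derivative D x) (at x)" "continuous_on T D"
    using f unfolding C1_differentiable_on_def by blast
  show ?thesis
    unfolding C1_differentiable_on_def
  proof (intro exI[of _ "\<lambda>s. \<beta> *\<^sub>R D (\<alpha> + \<beta> * s)"] conjI ballI)
    fix s assume s: "s \<in> T'"
    have "((\<lambda>s. \<alpha> + \<beta> * s) has_vector_derivative \<beta>) (at s)"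
      by (auto intro!: derivative_eq_intros)
    from vector_diff_chain_at[OF this D(1)[OF sub[OF s]]]
    have "((\<lambda>s. f (\<alpha> + \<beta> * s)) has_vector_derivative \<beta> *\<^sub>R D (\<alpha> + \<beta> * s)) (at s)"
      by (simp add: o_def)
    then show "(g has_vector_derivative \<beta> *\<^sub>R D (\<alpha> + \<beta> * s)) (at s)"
      by (rule has_vector_derivative_transform_within_open[OF _ J(1)]) (use s J in auto)
  next
    show "continuous_on T' (\<lambda>s. \<beta> *\<^sub>R D (\<alpha> + \<beta> * s))"
      by (intro continuous_intros continuous_on_compose2[OF D(2)]) (use sub in auto)
  qed
qed

lemma C1_differentiable_on_open_cover:
  assumes f: "f C1_differentiable_on T \<inter> A" "f C1_differentiable_on T \<inter> B" and op: "open A" "open B" "T \<subseteq> A \<union> B"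
  shows "f C1_differentiable_on T"
proof -
  have T: "T = (T \<inter> A) \<union> (T \<inter> B)" using op by blast
  have "continuous_on ((T \<inter> A) \<union> (T \<inter> B)) (\<lambda>x. vector_derivative f (at x))"
    using f op T unfolding C1_differentiable_on_eq
    by (intro continuous_on_Un_local_open) (auto simp: openin_open)
  then show ?thesis
    using f T unfolding C1_differentiable_on_eq by auto
qed

context hypersurface
begin

text \<open>The endpoints are put among the exceptional points, which makes the set of regular
  parameters open; then two-sided derivatives and continuity arguments are unproblematic.\<close>

definition regular_curve :: "(real \<Rightarrow> 'm) \<Rightarrow> real set \<Rightarrow> bool" where
  "regular_curve \<gamma> X \<longleftrightarrow> finite X \<and> {0, 1} \<subseteq> X \<and> continuous_on {0..1} \<gamma> \<and>
     (\<forall>c\<in>\<A>. (snd c \<circ> \<gamma>) C1_differentiable_on (({0..1} - X) \<inter> \<gamma> -` fst c))"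

lemma C1_differentiable_on_subset': "f C1_differentiable_on X \<Longrightarrow> T \<subseteq> X \<Longrightarrow> f C1_differentiable_on T"
  unfolding C1_differentiable_on_def by (meson continuous_on_subset subsetD)

lemma piecewise_imp_regular:
  assumes "piecewise_C1_curve \<A> \<gamma>"
  obtains X where "regular_curve \<gamma> X"
proof -
  obtain X where X: "finite X" "continuous_on {0..1} \<gamma>"
    "\<And>c. c \<in> \<A> \<Longrightarrow> (snd c \<circ> \<gamma>) C1_differentiable_on (({0..1} - X) \<inter> \<gamma> -` fst c)"
    using assms unfolding piecewise_C1_curve_def by blast
  have "regular_curve \<gamma> (X \<union> {0, 1})"
    unfolding regular_curve_def
    using X(1,2) by (auto intro!: C1_differentiable_on_subset'[OF X(3)])
  then show thesis by (rule that)
qed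

lemma regular_imp_piecewise: "regular_curve \<gamma> X \<Longrightarrow> piecewise_C1_curve \<A> \<gamma>"
  unfolding regular_curve_def piecewise_C1_curve_def by blast

lemma regular_open: "regular_curve \<gamma> X \<Longrightarrow> open ({0..1} - X)"
proof -
  assume "regular_curve \<gamma> X"
  then have "{0..1} - X = {0<..<1} - X" "finite X"
    by (auto simp: regular_curve_def less_le)
  then show ?thesis by (auto intro: open_Diff finite_imp_closed)
qed

lemma regular_curve_velocity:
  assumes \<gamma>: "regular_curve \<gamma> X"
  shows "(F \<circ> \<gamma>) C1_differentiable_on ({0..1} - X)"
  unfolding C1_differentiable_on_eq
proof (intro conjI ballI)
  note op = regular_open[OF \<gamma>]
  have cont: "continuous_on ({0..1} - X) \<gamma>"
    using \<gamma> continuous_on_subset unfolding regular_curve_def by blast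
  have loc: "\<exists>T. open T \<and> t \<in> T \<and> (F \<circ> \<gamma>) C1_differentiable_on T" if t: "t \<in> {0..1} - X" for t
  proof -
    obtain c where c: "c \<in> \<A>" "\<gamma> t \<in> fst c" by (rule ex_chart)
    define T where "T = ({0..1} - X) \<inter> \<gamma> -` fst c"
    have T: "open T" "t \<in> T"
      using continuous_on_open_vimage[OF op] cont chart_open[OF c(1)] c t by (auto simp: T_def Int_commute)
    have "(snd c \<circ> \<gamma>) C1_differentiable_on T"
      using \<gamma> c(1) unfolding regular_curve_def T_def by blast
    then obtain D where D: "\<And>x. x \<in> T \<Longrightarrow> ((snd c \<circ> \<gamma>) has_vector_derivative D x) (at x)" "continuous_on T D"
      unfolding C1_differentiable_on_def by blast
    have im: "snd c (\<gamma> s) \<in> chart_image c" if "s \<in> T" for s using that by (auto simp: T_def)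
    have cs: "continuous_on T (\<lambda>s. snd c (\<gamma> s))"
      by (rule continuous_on_compose2[OF continuous_on_chart[OF c(1)] continuous_on_subset[OF cont]]) (auto simp: T_def)
    have "(F \<circ> \<gamma>) C1_differentiable_on T"
      unfolding C1_differentiable_on_def
    proof (intro exI[of _ "\<lambda>s. dF c (snd c (\<gamma> s)) (D s)"] conjI ballI)
      fix s assume s: "s \<in> T"
      have "((\<lambda>s. F (chart_inv c ((snd c \<circ> \<gamma>) s))) has_derivative (\<lambda>x. dF c (snd c (\<gamma> s)) (x *\<^sub>R D s))) (at s)"
        by (rule has_derivative_compose[OF D(1)[OF s, unfolded has_vector_derivative_def]])
           (simp add: F_has_derivative c im s)
      then have "((\<lambda>s. F (chart_inv c (snd c (\<gamma> s)))) has_vector_derivative dF c (snd c (\<gamma> s)) (D s)) (at s)"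
        using linear_scale[OF linear_dF[OF c(1) im[OF s]]] by (simp add: has_vector_derivative_def)
      then show "((F \<circ> \<gamma>) has_vector_derivative dF c (snd c (\<gamma> s)) (D s)) (at s)"
        by (rule has_vector_derivative_transform_within_open[OF _ T(1) s]) (use c in \<open>auto simp: T_def\<close>)
    next
      have eq: "dF c (snd c (\<gamma> s)) (D s) = (\<Sum>b\<in>Basis. (D s \<bullet> b) *\<^sub>R dF c (snd c (\<gamma> s)) b)" if "s \<in> T" for s
        by (rule linear_componentwise_expansion[OF linear_dF[OF c(1) im[OF that]]])
      have "continuous_on (chart_image c) (\<lambda>u. dF c u b)" for b
        unfolding dF_def
        by (intro smooth_on_imp_continuous_on smooth_on_frechet_derivative smooth_map_chart smooth_F c)
      then have "continuous_on T (\<lambda>s. dF c (snd c (\<gamma> s)) b)" for b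
        by (rule continuous_on_compose2[OF _ cs]) (use im in auto)
      then have "continuous_on T (\<lambda>s. \<Sum>b\<in>Basis. (D s \<bullet> b) *\<^sub>R dF c (snd c (\<gamma> s)) b)"
        by (intro continuous_intros D) auto
      then show "continuous_on T (\<lambda>s. dF c (snd c (\<gamma> s)) (D s))"
        using eq by (simp cong: continuous_on_cong)
    qed
    with T show ?thesis by blast
  qed
  show "(F \<circ> \<gamma>) differentiable at t" if "t \<in> {0..1} - X" for t
    using loc[OF that] unfolding C1_differentiable_on_eq by blast
  have "isCont (\<lambda>x. vector_derivative (F \<circ> \<gamma>) (at x)) t" if t: "t \<in> {0..1} - X" for t
  proof -
    obtain T where "open T" "t \<in> T" "continuous_on T (\<lambda>x. vector_derivative (F \<circ> \<gamma>) (at x))"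
      using loc[OF t] unfolding C1_differentiable_on_eq by blast
    then show ?thesis by (simp add: continuous_on_eq_continuous_at)
  qed
  then show "continuous_on ({0..1} - X) (\<lambda>x. vector_derivative (F \<circ> \<gamma>) (at x))"
    by (intro continuous_at_imp_continuous_on) blast
qed

text \<open>Set to zero at exceptional parameters, where the derivative is meaningless, to obtain a
  Borel function with the same integral.\<close>

definition speed :: "(real \<Rightarrow> 'm) \<Rightarrow> real set \<Rightarrow> real \<Rightarrow> real" where
  "speed \<gamma> X t = indicator ({0..1} - X) t * norm (vector_derivative (F \<circ> \<gamma>) (at t))"

lemma speed_nonneg: "0 \<le> speed \<gamma> X t"
  by (simp add: speed_def)

lemma speed_measurable:
  assumes "regular_curve \<gamma> X"
  shows "(\<lambda>t. indicator ({0..1} - X) t *\<^sub>R vector_derivative (F \<circ> \<gamma>) (at t)) \<in> borel_measurable borel"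
    and "speed \<gamma> X \<in> borel_measurable borel"
proof -
  have fin: "finite X" using assms by (simp add: regular_curve_def)
  then have "{0..1} - X \<in> sets borel"
    using regular_open[OF assms] by (rule_tac borel_open)
  moreover have "continuous_on ({0..1} - X) (\<lambda>t. vector_derivative (F \<circ> \<gamma>) (at t))"
    using regular_curve_velocity[OF assms] unfolding C1_differentiable_on_eq by blast
  ultimately show 1: "(\<lambda>t. indicator ({0..1} - X) t *\<^sub>R vector_derivative (F \<circ> \<gamma>) (at t)) \<in> borel_measurable borel"
    by (rule borel_measurable_continuous_on_indicator)
  have eq: "speed \<gamma> X = (\<lambda>t. norm (indicator ({0..1} - X) t *\<^sub>R vector_derivative (F \<circ> \<gamma>) (at t)))"
    by (auto simp: speed_def fun_eq_iff)
  show "speed \<gamma> X \<in> borel_measurable borel"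
    unfolding eq using 1 by (rule measurable_compose[OF _ borel_measurable_norm])
qed

lemma curve_length_eq:
  assumes "regular_curve \<gamma> X"
  shows "curve_length F \<gamma> = (\<integral>\<^sup>+t. ennreal (speed \<gamma> X t) \<partial>lborel)"
  unfolding curve_length_def
proof (rule nn_integral_cong_AE)
  have "AE t in lborel. t \<notin> X"
    using assms by (intro AE_not_in finite_imp_null_set_lborel) (simp add: regular_curve_def)
  then show "AE t in lborel. ennreal (norm (vector_derivative (F \<circ> \<gamma>) (at t))) * indicator {0..1} t = ennreal (speed \<gamma> X t)"
    by eventually_elim (auto simp: speed_def split: split_indicator)
qed

text \<open>Infinite length is trivial. Otherwise the velocity is absolutely integrable, and the
  fundamental theorem with finitely many exceptional points writes the chord as its
  integral.\<close>

lemma chord_le_length: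
  assumes "piecewise_C1_curve \<A> \<gamma>" "0 \<le> t" "t \<le> 1"
  shows "ennreal (norm (F (\<gamma> t) - F (\<gamma> 0))) \<le> curve_length F \<gamma>"
proof -
  obtain X where X: "regular_curve \<gamma> X" using piecewise_imp_regular[OF assms(1)] .
  let ?v = "\<lambda>t. vector_derivative (F \<circ> \<gamma>) (at t)"
  note L = curve_length_eq[OF X]
  show ?thesis
  proof (cases "curve_length F \<gamma> = top")
    case False
    let ?g = "\<lambda>s. indicator ({0..t} - X) s *\<^sub>R ?v s"
    have geq: "?g = (\<lambda>s. indicator {0..t} s *\<^sub>R (indicator ({0..1} - X) s *\<^sub>R ?v s))"
      using assms by (auto simp: fun_eq_iff split: split_indicator)
    have gm: "?g \<in> borel_measurable lborel"
      unfolding geq by (rule borel_measurable_scaleR) (use speed_measurable(1)[OF X] in simp_all)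
    have le: "norm (?g s) \<le> speed \<gamma> X s" for s
      using assms by (auto simp: speed_def split: split_indicator)
    have "(\<integral>\<^sup>+s. ennreal (norm (?g s)) \<partial>lborel) \<le> curve_length F \<gamma>"
      unfolding L by (intro nn_integral_mono ennreal_leI le)
    then have "(\<integral>\<^sup>+s. ennreal (norm (?g s)) \<partial>lborel) < \<infinity>"
      using le_less_trans False by (simp only: top.not_eq_extremum infinity_ennreal_def)
    then have gi: "integrable lborel ?g"
      by (rule integrableI_bounded[OF gm])
    have "(?v has_integral ((F \<circ> \<gamma>) t - (F \<circ> \<gamma>) 0)) {0..t}"
    proof (rule fundamental_theorem_of_calculus_interior_strong[of X])
      show "finite X" using X by (simp add: regular_curve_def)
      show "((F \<circ> \<gamma>) has_vector_derivative ?v s) (at s)" if "s \<in> {0<..<t} - X" for s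
        using regular_curve_velocity[OF X] that assms unfolding C1_differentiable_on_eq
        by (simp add: vector_derivative_works)
      have "continuous_on {0..t} \<gamma>" using X assms continuous_on_subset[of "{0..1}" \<gamma> "{0..t}"] by (simp add: regular_curve_def)
      then show "continuous_on {0..t} (F \<circ> \<gamma>)"
        unfolding o_def by (rule continuous_on_compose2[OF smooth_map_continuous[OF smooth_F]]) simp
    qed (use assms in auto)
    then have "((\<lambda>s. if s \<in> {0..t} then ?v s else 0) has_integral ((F \<circ> \<gamma>) t - (F \<circ> \<gamma>) 0)) UNIV"
      by (simp only: has_integral_restrict_UNIV)
    then have "(?g has_integral ((F \<circ> \<gamma>) t - (F \<circ> \<gamma>) 0)) UNIV"
      by (rule has_integral_spike_finite[rotated 2, of _ _ _ X])
         (use X in \<open>auto simp: regular_curve_def split: split_indicator\<close>)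
    then have e: "F (\<gamma> t) - F (\<gamma> 0) = integral\<^sup>L lborel ?g"
      using has_integral_integral_lborel[OF gi] has_integral_unique unfolding o_apply by blast
    have "ennreal (norm (F (\<gamma> t) - F (\<gamma> 0))) \<le> ennreal (\<integral>s. norm (?g s) \<partial>lborel)"
      unfolding e by (intro ennreal_leI integral_norm_bound)
    also have "\<dots> = (\<integral>\<^sup>+s. ennreal (norm (?g s)) \<partial>lborel)"
      by (rule nn_integral_eq_integral[OF integrable_norm[OF gi], symmetric]) simp
    also have "\<dots> \<le> curve_length F \<gamma>"
      unfolding L by (intro nn_integral_mono ennreal_leI le)
    finally show ?thesis .
  qed simp
qed

section \<open>Reversed curves, joined curves and coordinate segments\<close>

lemma speed_affine:
  assumes X: "regular_curve \<gamma> X" and J: "open J" "s \<in> J" "\<And>s. s \<in> J \<Longrightarrow> \<gamma>' s = \<gamma> (\<alpha> + \<beta> * s)"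
    and s: "\<alpha> + \<beta> * s \<in> {0..1} - X"
  shows "norm (vector_derivative (F \<circ> \<gamma>') (at s)) = \<bar>\<beta>\<bar> * speed \<gamma> X (\<alpha> + \<beta> * s)"
proof -
  have "((F \<circ> \<gamma>) has_vector_derivative vector_derivative (F \<circ> \<gamma>) (at (\<alpha> + \<beta> * s))) (at (\<alpha> + \<beta> * s))"
    using regular_curve_velocity[OF X] s unfolding C1_differentiable_on_eq vector_derivative_works by blast
  moreover have "((\<lambda>s. \<alpha> + \<beta> * s) has_vector_derivative \<beta>) (at s)"
    by (auto intro!: derivative_eq_intros)
  ultimately have "((F \<circ> \<gamma> \<circ> (\<lambda>s. \<alpha> + \<beta> * s)) has_vector_derivative \<beta> *\<^sub>R vector_derivative (F \<circ> \<gamma>) (at (\<alpha> + \<beta> * s))) (at s)"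
    by (intro vector_diff_chain_at)
  then have "((F \<circ> \<gamma>') has_vector_derivative \<beta> *\<^sub>R vector_derivative (F \<circ> \<gamma>) (at (\<alpha> + \<beta> * s))) (at s)"
    by (rule has_vector_derivative_transform_within_open[OF _ J(1,2)]) (simp add: J)
  then have "vector_derivative (F \<circ> \<gamma>') (at s) = \<beta> *\<^sub>R vector_derivative (F \<circ> \<gamma>) (at (\<alpha> + \<beta> * s))"
    by (rule vector_derivative_at)
  then show ?thesis using s by (simp add: speed_def)
qed

lemma nn_integral_speed_affine:
  assumes X: "regular_curve \<gamma> X" and "\<beta> \<noteq> 0"
  shows "(\<integral>\<^sup>+s. ennreal (\<bar>\<beta>\<bar> * speed \<gamma> X (\<alpha> + \<beta> * s)) \<partial>lborel) = curve_length F \<gamma>"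
proof -
  have [measurable]: "speed \<gamma> X \<in> borel_measurable borel" by (rule speed_measurable[OF X])
  have "(\<integral>\<^sup>+s. ennreal (\<bar>\<beta>\<bar> * speed \<gamma> X (\<alpha> + \<beta> * s)) \<partial>lborel) = \<bar>\<beta>\<bar> * (\<integral>\<^sup>+s. ennreal (speed \<gamma> X (\<alpha> + \<beta> * s)) \<partial>lborel)"
    by (subst nn_integral_cmult[symmetric]) (auto simp: ennreal_mult speed_nonneg)
  also have "\<dots> = curve_length F \<gamma>"
    unfolding curve_length_eq[OF X] using assms(2)
    by (subst nn_integral_real_affine[where c=\<beta> and t=\<alpha>]) auto
  finally show ?thesis .
qed

lemma reverse_curve:
  assumes \<gamma>: "piecewise_C1_curve \<A> \<gamma>"
  shows "piecewise_C1_curve \<A> (\<lambda>s. \<gamma> (1 - s))" "curve_length F (\<lambda>s. \<gamma> (1 - s)) \<le> curve_length F \<gamma>"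
proof -
  obtain X where X: "regular_curve \<gamma> X" using piecewise_imp_regular[OF \<gamma>] .
  let ?X = "(\<lambda>s. 1 - s) ` X"
  have mem: "1 - s \<in> X \<longleftrightarrow> s \<in> ?X" for s by force
  have R: "regular_curve (\<lambda>s. \<gamma> (1 - s)) ?X"
    unfolding regular_curve_def
  proof (intro conjI ballI)
    have "{0, 1} \<subseteq> X" using X unfolding regular_curve_def by (elim conjE)
    then have X01: "1 \<in> X" "0 \<in> X" by simp_all
    have "0 \<in> ?X" by (rule image_eqI[OF _ X01(1)]) simp
    moreover have "1 \<in> ?X" by (rule image_eqI[OF _ X01(2)]) simp
    ultimately show "{0, 1} \<subseteq> ?X" by (simp only: insert_subset empty_subsetI simp_thms)
    show "continuous_on {0..1} (\<lambda>s. \<gamma> (1 - s))"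
    proof (rule continuous_on_compose2[of "{0..1}" \<gamma>])
      show "continuous_on {0..1} \<gamma>" using X unfolding regular_curve_def by (elim conjE)
    qed (auto intro!: continuous_intros)
    fix c assume c: "c \<in> \<A>"
    show "(snd c \<circ> (\<lambda>s. \<gamma> (1 - s))) C1_differentiable_on ({0..1} - ?X) \<inter> (\<lambda>s. \<gamma> (1 - s)) -` fst c"
    proof (rule C1_differentiable_on_affine[where J=UNIV and \<alpha>=1 and \<beta>="-1" and f="snd c \<circ> \<gamma>"])
      show "(snd c \<circ> \<gamma>) C1_differentiable_on ({0..1} - X) \<inter> \<gamma> -` fst c"
        using X c by (simp add: regular_curve_def)
    qed (auto simp: mem)
  qed (use X in \<open>simp add: regular_curve_def\<close>)
  show "piecewise_C1_curve \<A> (\<lambda>s. \<gamma> (1 - s))" by (rule regular_imp_piecewise[OF R])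
  have sp: "speed (\<lambda>s. \<gamma> (1 - s)) ?X s \<le> \<bar>-1\<bar> * speed \<gamma> X (1 + (-1) * s)" for s
  proof (cases "s \<in> {0..1} - ?X")
    case True
    then have "1 + (-1) * s \<in> {0..1} - X" using mem by auto
    from speed_affine[OF X open_UNIV _ _ this, of "\<lambda>s. \<gamma> (1 - s)"] True show ?thesis
      by (simp add: speed_def)
  qed (simp add: speed_def)
  have "(\<integral>\<^sup>+s. ennreal (speed (\<lambda>s. \<gamma> (1 - s)) ?X s) \<partial>lborel) \<le> (\<integral>\<^sup>+s. ennreal (\<bar>-1\<bar> * speed \<gamma> X (1 + (-1) * s)) \<partial>lborel)"
    by (rule nn_integral_mono, rule ennreal_leI, rule sp)
  then show "curve_length F (\<lambda>s. \<gamma> (1 - s)) \<le> curve_length F \<gamma>"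
    unfolding curve_length_eq[OF R] by (subst (asm) nn_integral_speed_affine[OF X]) simp_all
qed

lemma join_curves:
  assumes \<gamma>: "piecewise_C1_curve \<A> \<gamma>1" "piecewise_C1_curve \<A> \<gamma>2" and eq: "\<gamma>1 1 = \<gamma>2 0"
  shows "piecewise_C1_curve \<A> (\<gamma>1 +++ \<gamma>2)" "curve_length F (\<gamma>1 +++ \<gamma>2) \<le> curve_length F \<gamma>1 + curve_length F \<gamma>2"
proof -
  obtain S1 where S1: "regular_curve \<gamma>1 S1" using piecewise_imp_regular[OF \<gamma>(1)] .
  obtain S2 where S2: "regular_curve \<gamma>2 S2" using piecewise_imp_regular[OF \<gamma>(2)] .
  let ?j = "\<gamma>1 +++ \<gamma>2"
  \<comment> \<open>The rescaled exceptional sets of both halves. Since 1 and 0 are exceptional for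
    the two curves, the corner \<open>1/2\<close> is included automatically.\<close>
  define X where "X = (\<lambda>s. s / 2) ` S1 \<union> (\<lambda>s. (s + 1) / 2) ` S2"
  have X: "finite X" "{0, 1/2, 1} \<subseteq> X"
    using S1 S2 by (auto simp: regular_curve_def X_def image_iff)
  have m1: "0 + 2 * s \<in> {0..1} - S1" if "s \<in> {0..1} - X" "s < 1/2" for s
  proof -
    have "2 * s \<notin> S1" using that imageI[of "2 * s" S1 "\<lambda>s. s / 2"] by (auto simp: X_def)
    then show ?thesis using that by auto
  qed
  have m2: "-1 + 2 * s \<in> {0..1} - S2" if "s \<in> {0..1} - X" "s > 1/2" for s
  proof -
    have "-1 + 2 * s \<notin> S2" using that imageI[of "-1 + 2 * s" S2 "\<lambda>s. (s + 1) / 2"] by (auto simp: X_def)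
    then show ?thesis using that by auto
  qed
  have j1: "?j s = \<gamma>1 (0 + 2 * s)" if "s \<in> {..<1/2}" for s using that by (simp add: joinpaths_def)
  have j2: "?j s = \<gamma>2 (-1 + 2 * s)" if "s \<in> {1/2<..}" for s using that by (simp add: joinpaths_def algebra_simps)
  have R: "regular_curve ?j X"
    unfolding regular_curve_def
  proof (intro conjI ballI)
    have "path ?j"
      using S1 S2 eq by (intro path_join_imp) (auto simp: path_def regular_curve_def pathfinish_def pathstart_def)
    then show "continuous_on {0..1} ?j" by (simp add: path_def)
    fix c assume c: "c \<in> \<A>"
    let ?T = "({0..1} - X) \<inter> ?j -` fst c"
    have "(snd c \<circ> ?j) C1_differentiable_on ?T \<inter> {..<1/2}"
    proof (rule C1_differentiable_on_affine[where J="{..<1/2}" and \<alpha>=0 and \<beta>=2 and f="snd c \<circ> \<gamma>1"])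
      show "(snd c \<circ> \<gamma>1) C1_differentiable_on ({0..1} - S1) \<inter> \<gamma>1 -` fst c"
        using S1 c by (simp add: regular_curve_def)
      show "0 + 2 * s \<in> ({0..1} - S1) \<inter> \<gamma>1 -` fst c" if "s \<in> ?T \<inter> {..<1/2}" for s
        using that m1[of s] j1[of s] by auto
    qed (auto simp: j1)
    moreover have "(snd c \<circ> ?j) C1_differentiable_on ?T \<inter> {1/2<..}"
    proof (rule C1_differentiable_on_affine[where J="{1/2<..}" and \<alpha>="-1" and \<beta>=2 and f="snd c \<circ> \<gamma>2"])
      show "(snd c \<circ> \<gamma>2) C1_differentiable_on ({0..1} - S2) \<inter> \<gamma>2 -` fst c"
        using S2 c by (simp add: regular_curve_def)
      show "-1 + 2 * s \<in> ({0..1} - S2) \<inter> \<gamma>2 -` fst c" if "s \<in> ?T \<inter> {1/2<..}" for s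
        using that m2[of s] j2[of s] by auto
    qed (auto simp: j2)
    ultimately show "(snd c \<circ> ?j) C1_differentiable_on ?T"
    proof (rule C1_differentiable_on_open_cover)
      show "?T \<subseteq> {..<1/2} \<union> {1/2<..}"
      proof
        fix s assume "s \<in> ?T"
        then have "s \<notin> X" by simp
        moreover have "1/2 \<in> X" using X by simp
        ultimately have "s \<noteq> 1/2" by metis
        then show "s \<in> {..<1/2} \<union> {1/2<..}" by auto
      qed
    qed auto
  qed (use X in auto)
  show "piecewise_C1_curve \<A> ?j" by (rule regular_imp_piecewise[OF R])
  have nonneg: "0 \<le> speed \<gamma> X s" for \<gamma> X s by (simp add: speed_def)
  have sp: "speed ?j X s \<le> \<bar>2\<bar> * speed \<gamma>1 S1 (0 + 2 * s) + \<bar>2\<bar> * speed \<gamma>2 S2 (-1 + 2 * s)" for s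
  proof (cases "s \<in> {0..1} - X")
    case True
    have "1/2 \<in> X" using X by simp
    then have "s \<noteq> 1/2" using True by (metis DiffD2)
    then consider "s < 1/2" | "s > 1/2" by linarith
    then show ?thesis
    proof cases
      case 1
      have "norm (vector_derivative (F \<circ> ?j) (at s)) = \<bar>2\<bar> * speed \<gamma>1 S1 (0 + 2 * s)"
        by (rule speed_affine[OF S1 open_lessThan[of "1/2"] _ j1 m1[OF True 1]]) (use 1 in auto)
      then have "speed ?j X s = \<bar>2\<bar> * speed \<gamma>1 S1 (0 + 2 * s)" using True by (simp add: speed_def)
      then show ?thesis using nonneg[of \<gamma>2 S2 "-1 + 2 * s"] by simp
    next
      case 2
      have "norm (vector_derivative (F \<circ> ?j) (at s)) = \<bar>2\<bar> * speed \<gamma>2 S2 (-1 + 2 * s)"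
        by (rule speed_affine[OF S2 open_greaterThan[of "1/2"] _ j2 m2[OF True 2]]) (use 2 in auto)
      then have "speed ?j X s = \<bar>2\<bar> * speed \<gamma>2 S2 (-1 + 2 * s)" using True by (simp add: speed_def)
      then show ?thesis using nonneg[of \<gamma>1 S1 "0 + 2 * s"] by simp
    qed
  next
    case False
    then show ?thesis using nonneg by (simp add: speed_def)
  qed
  have "curve_length F ?j \<le> (\<integral>\<^sup>+s. ennreal (\<bar>2\<bar> * speed \<gamma>1 S1 (0 + 2 * s) + \<bar>2\<bar> * speed \<gamma>2 S2 (-1 + 2 * s)) \<partial>lborel)"
    unfolding curve_length_eq[OF R] by (rule nn_integral_mono, rule ennreal_leI, rule sp)
  also have "\<dots> = (\<integral>\<^sup>+s. ennreal (\<bar>2\<bar> * speed \<gamma>1 S1 (0 + 2 * s)) + ennreal (\<bar>2\<bar> * speed \<gamma>2 S2 (-1 + 2 * s)) \<partial>lborel)"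
    using nonneg by (intro nn_integral_cong ennreal_plus) auto
  also have "\<dots> = (\<integral>\<^sup>+s. ennreal (\<bar>2\<bar> * speed \<gamma>1 S1 (0 + 2 * s)) \<partial>lborel) + (\<integral>\<^sup>+s. ennreal (\<bar>2\<bar> * speed \<gamma>2 S2 (-1 + 2 * s)) \<partial>lborel)"
  proof (rule nn_integral_add)
    have [measurable]: "speed \<gamma>1 S1 \<in> borel_measurable borel" "speed \<gamma>2 S2 \<in> borel_measurable borel"
      by (intro speed_measurable S1 S2)+
    show "(\<lambda>s. ennreal (\<bar>2\<bar> * speed \<gamma>1 S1 (0 + 2 * s))) \<in> borel_measurable lborel"
      "(\<lambda>s. ennreal (\<bar>2\<bar> * speed \<gamma>2 S2 (-1 + 2 * s))) \<in> borel_measurable lborel" by measurable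
  qed
  also have "\<dots> = curve_length F \<gamma>1 + curve_length F \<gamma>2"
    using nn_integral_speed_affine[OF S1, of 2 0] nn_integral_speed_affine[OF S2, of 2 "-1"] by simp
  finally show "curve_length F ?j \<le> curve_length F \<gamma>1 + curve_length F \<gamma>2" .
qed

lemma segment_curve:
  assumes c: "c \<in> \<A>" and seg: "\<And>t. 0 \<le> t \<Longrightarrow> t \<le> 1 \<Longrightarrow> u + t *\<^sub>R v \<in> chart_image c"
    and B: "\<And>t. 0 \<le> t \<Longrightarrow> t \<le> 1 \<Longrightarrow> norm (dF c (u + t *\<^sub>R v) v) \<le> B"
  shows "piecewise_C1_curve \<A> (\<lambda>t. chart_inv c (u + t *\<^sub>R v))"
    "curve_length F (\<lambda>t. chart_inv c (u + t *\<^sub>R v)) \<le> ennreal B"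
proof -
  let ?g = "\<lambda>t. chart_inv c (u + t *\<^sub>R v)"
  have R: "regular_curve ?g {0, 1}"
    unfolding regular_curve_def
  proof (intro conjI ballI)
    show "continuous_on {0..1} ?g"
      by (rule continuous_on_compose2[OF continuous_on_chart_inv[OF c]]) (use seg in \<open>auto intro!: continuous_intros\<close>)
    fix c' assume c': "c' \<in> \<A>"
    let ?T = "({0..1} - {0, 1}) \<inter> ?g -` fst c'" and ?\<tau> = "\<lambda>u. snd c' (chart_inv c u)"
    have sm: "smooth_on (snd c ` (fst c \<inter> fst c')) ?\<tau>"
      using atlas c c' by (auto simp: smooth_atlas_def o_def)
    have im: "u + t *\<^sub>R v \<in> snd c ` (fst c \<inter> fst c')" if "t \<in> ?T" for t
      using that seg[of t] c by (intro image_eqI[of _ _ "?g t"]) auto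
    show "(snd c' \<circ> ?g) C1_differentiable_on ?T"
      unfolding C1_differentiable_on_def
    proof (intro exI[of _ "\<lambda>t. frechet_derivative ?\<tau> (at (u + t *\<^sub>R v)) v"] conjI ballI)
      fix t assume "t \<in> ?T"
      from line_has_real_derivative[OF smooth_on_has_derivative[OF sm im[OF this]]]
      show "((snd c' \<circ> ?g) has_vector_derivative frechet_derivative ?\<tau> (at (u + t *\<^sub>R v)) v) (at t)"
        by (simp add: o_def)
    next
      show "continuous_on ?T (\<lambda>t. frechet_derivative ?\<tau> (at (u + t *\<^sub>R v)) v)"
        by (rule continuous_on_compose2[OF smooth_on_imp_continuous_on[OF smooth_on_frechet_derivative[OF sm]]])
           (intro continuous_intros, rule image_subsetI, rule im)
    qed
  qed auto
  show "piecewise_C1_curve \<A> ?g" by (rule regular_imp_piecewise[OF R])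
  have sp: "speed ?g {0, 1} t \<le> indicator {0..1} t * B" for t
  proof (cases "t \<in> {0..1} - {0, 1}")
    case True
    have "((\<lambda>t. F (chart_inv c (u + t *\<^sub>R v))) has_vector_derivative dF c (u + t *\<^sub>R v) v) (at t)"
      by (rule line_has_real_derivative) (use True seg[of t] c in \<open>auto intro: F_has_derivative\<close>)
    then have "vector_derivative (F \<circ> ?g) (at t) = dF c (u + t *\<^sub>R v) v"
      by (intro vector_derivative_at) (simp add: o_def)
    then show ?thesis using B[of t] True by (simp add: speed_def)
  next
    case False
    have "0 \<le> B" using order_trans[OF norm_ge_zero B[of 0]] by simp
    then show ?thesis using False by (simp add: speed_def)
  qed
  have "curve_length F ?g \<le> (\<integral>\<^sup>+t. ennreal (indicator {0..1::real} t * B) \<partial>lborel)"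
    unfolding curve_length_eq[OF R] by (rule nn_integral_mono, rule ennreal_leI, rule sp)
  also have "\<dots> = (\<integral>\<^sup>+t. ennreal B * indicator {0..1::real} t \<partial>lborel)"
    by (intro nn_integral_cong) (auto split: split_indicator)
  also have "\<dots> = ennreal B" by (simp add: nn_integral_cmult_indicator)
  finally show "curve_length F ?g \<le> ennreal B" .
qed

text \<open>The infimum is kept extended real valued, so that the triangle inequality and symmetry
  hold before finiteness is known.\<close>

definition len_dist :: "'m \<Rightarrow> 'm \<Rightarrow> ennreal" where
  "len_dist p q = (INF \<gamma>\<in>{\<gamma>. piecewise_C1_curve \<A> \<gamma> \<and> \<gamma> 0 = p \<and> \<gamma> 1 = q}. curve_length F \<gamma>)"

lemma geodesic_dist_eq: "geodesic_dist \<A> F p q = enn2real (len_dist p q)"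
  by (simp add: geodesic_dist_def len_dist_def)

lemma len_dist_le: "piecewise_C1_curve \<A> \<gamma> \<Longrightarrow> \<gamma> 0 = p \<Longrightarrow> \<gamma> 1 = q \<Longrightarrow> len_dist p q \<le> curve_length F \<gamma>"
  unfolding len_dist_def by (rule INF_lower) simp

lemma len_dist_geI:
  "(\<And>\<gamma>. piecewise_C1_curve \<A> \<gamma> \<Longrightarrow> \<gamma> 0 = p \<Longrightarrow> \<gamma> 1 = q \<Longrightarrow> x \<le> curve_length F \<gamma>) \<Longrightarrow> x \<le> len_dist p q"
  unfolding len_dist_def by (rule INF_greatest) auto

lemma len_dist_approx:
  assumes "len_dist p q < x"
  obtains \<gamma> where "piecewise_C1_curve \<A> \<gamma>" "\<gamma> 0 = p" "\<gamma> 1 = q" "curve_length F \<gamma> < x"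
  using assms unfolding len_dist_def INF_less_iff by blast

lemma chord_le_len_dist: "ennreal (norm (F q - F p)) \<le> len_dist p q"
  by (rule len_dist_geI) (use chord_le_length[of _ 1] in auto)

lemma len_dist_commute: "len_dist p q = len_dist q p"
proof -
  have "len_dist q p \<le> len_dist p q" for p q
  proof (rule len_dist_geI)
    fix \<gamma> assume \<gamma>: "piecewise_C1_curve \<A> \<gamma>" "\<gamma> 0 = p" "\<gamma> 1 = q"
    have "len_dist q p \<le> curve_length F (\<lambda>s. \<gamma> (1 - s))"
      by (rule len_dist_le[OF reverse_curve(1)[OF \<gamma>(1)]]) (use \<gamma> in auto)
    also have "\<dots> \<le> curve_length F \<gamma>" by (rule reverse_curve(2)[OF \<gamma>(1)])
    finally show "len_dist q p \<le> curve_length F \<gamma>" .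
  qed
  then show ?thesis by (blast intro: antisym)
qed

lemma len_dist_triangle: "len_dist p r \<le> len_dist p q + len_dist q r"
proof (cases "len_dist p q = top \<or> len_dist q r = top")
  case False
  show ?thesis
  proof (rule ennreal_le_epsilon)
    fix e :: real assume e: "e > 0"
    have lt: "x < x + ennreal (e/2)" if "x \<noteq> top" for x
      using e that by (cases x) (auto simp: ennreal_plus[symmetric] ennreal_less_iff simp del: ennreal_plus)
    have "len_dist p q < len_dist p q + ennreal (e/2)" "len_dist q r < len_dist q r + ennreal (e/2)"
      using False e by (auto intro!: lt)
    then obtain \<gamma>1 \<gamma>2 where g: "piecewise_C1_curve \<A> \<gamma>1" "\<gamma>1 0 = p" "\<gamma>1 1 = q" "curve_length F \<gamma>1 < len_dist p q + ennreal (e/2)"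
      "piecewise_C1_curve \<A> \<gamma>2" "\<gamma>2 0 = q" "\<gamma>2 1 = r" "curve_length F \<gamma>2 < len_dist q r + ennreal (e/2)"
      by (metis len_dist_approx)
    have "len_dist p r \<le> curve_length F (\<gamma>1 +++ \<gamma>2)"
      by (rule len_dist_le[OF join_curves(1)[OF g(1,5)]]) (use g in \<open>auto simp: joinpaths_def\<close>)
    also have "\<dots> \<le> curve_length F \<gamma>1 + curve_length F \<gamma>2"
      by (rule join_curves(2)[OF g(1,5)]) (use g in simp)
    also have "\<dots> \<le> (len_dist p q + ennreal (e/2)) + (len_dist q r + ennreal (e/2))"
      using g by (intro add_mono less_imp_le)
    also have "\<dots> = len_dist p q + len_dist q r + (ennreal (e/2) + ennreal (e/2))"
      by (simp add: add_ac)
    also have "ennreal (e/2) + ennreal (e/2) = ennreal e"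
      using e by (subst ennreal_plus[symmetric]) auto
    finally show "len_dist p r \<le> len_dist p q + len_dist q r + ennreal e" .
  qed
qed auto

lemma dF_bound:
  assumes c: "c \<in> \<A>" "u0 \<in> chart_image c"
  obtains r M where "r > 0" "M > 0" "cball u0 r \<subseteq> chart_image c"
    "\<And>u v. u \<in> cball u0 r \<Longrightarrow> norm (dF c u v) \<le> M * norm v"
proof -
  obtain K where K: "K > 0" "\<And>v. norm (dF c u0 v) \<le> K * norm v"
    using linear_bounded_pos[OF linear_dF[OF c]] by blast
  obtain r where r: "r > 0" "cball u0 r \<subseteq> chart_image c"
    "\<And>u v. u \<in> cball u0 r \<Longrightarrow> norm (dF c u v - dF c u0 v) \<le> 1 * norm v"
    using dF_close[OF c, of 1] by auto
  show thesis
  proof (rule that[of r "K + 1"])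
    fix u v assume "u \<in> cball u0 r"
    then show "norm (dF c u v) \<le> (K + 1) * norm v"
      using r(3)[of u v] K(2)[of v] norm_triangle_sub[of "dF c u v" "dF c u0 v"] by (simp add: algebra_simps)
  qed (use r K in auto)
qed

lemma len_dist_segment:
  assumes c: "c \<in> \<A>" and C: "convex C" "C \<subseteq> chart_image c" "u \<in> C" "u' \<in> C"
    and M: "\<And>w. w \<in> C \<Longrightarrow> norm (dF c w (u' - u)) \<le> B"
  shows "len_dist (chart_inv c u) (chart_inv c u') \<le> ennreal B"
proof -
  have seg: "u + t *\<^sub>R (u' - u) \<in> C" if "0 \<le> t" "t \<le> 1" for t
  proof -
    have "u + t *\<^sub>R (u' - u) = (1 - t) *\<^sub>R u + t *\<^sub>R u'" by (simp add: algebra_simps)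
    then show ?thesis using convexD_alt[OF C(1,3,4) that] by simp
  qed
  let ?g = "\<lambda>t. chart_inv c (u + t *\<^sub>R (u' - u))"
  have "len_dist (chart_inv c u) (chart_inv c u') \<le> curve_length F ?g"
    by (rule len_dist_le) (use segment_curve(1)[OF c, of u "u' - u" B] seg C M in auto)
  also have "\<dots> \<le> ennreal B"
    by (rule segment_curve(2)[OF c]) (use seg C M in auto)
  finally show ?thesis .
qed

text \<open>Finite distance is an equivalence relation, and coordinate segments show that its
  classes are neighbourhoods of their points; a connected space has one class.\<close>

lemma len_dist_finite:
  assumes con: "connected (UNIV :: 'm set)"
  shows "len_dist p q < top"
proof (rule connected_equivalence_relation[OF con, of p q "\<lambda>p q. len_dist p q < top"])
  fix x y z assume "len_dist x y < top" "len_dist y z < top"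
  then show "len_dist x z < top"
    using len_dist_triangle[of x z y] by (simp add: le_less_trans)
next
  fix p :: 'm
  obtain c where c: "c \<in> \<A>" "p \<in> fst c" by (rule ex_chart)
  obtain r M where r: "r > 0" "M > 0" "cball (snd c p) r \<subseteq> chart_image c"
    "\<And>u v. u \<in> cball (snd c p) r \<Longrightarrow> norm (dF c u v) \<le> M * norm v"
    using dF_bound[OF c(1) chart_in_image[OF c(2)]] by blast
  let ?N = "chart_inv c ` ball (snd c p) r"
  have sub: "ball (snd c p) r \<subseteq> chart_image c" using r by auto
  have "len_dist p q < top" if q: "q \<in> ?N" for q
  proof -
    obtain u where u: "u \<in> ball (snd c p) r" "q = chart_inv c u" using q by blast
    have "len_dist (chart_inv c (snd c p)) (chart_inv c u) \<le> ennreal (M * norm (u - snd c p))"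
      by (rule len_dist_segment[OF c(1) convex_ball sub]) (use u r in auto)
    then show ?thesis using u c by (simp add: le_less_trans)
  qed
  moreover have "open ?N" by (rule open_chart_inv_image[OF c(1) open_ball sub])
  moreover have "p \<in> ?N" by (rule image_eqI[of _ _ "snd c p"]) (use c r in auto)
  ultimately show "\<exists>T. openin (top_of_set UNIV) T \<and> p \<in> T \<and> (\<forall>x\<in>T. len_dist p x < top)"
    by auto
qed (auto simp: len_dist_commute)

lemma ex_path:
  assumes con: "connected (UNIV :: 'm set)"
  shows "\<exists>\<gamma>. path \<gamma> \<and> pathstart \<gamma> = p \<and> pathfinish \<gamma> = (q::'m)"
proof -
  obtain \<gamma> where "piecewise_C1_curve \<A> \<gamma>" "\<gamma> 0 = p" "\<gamma> 1 = q"
    using len_dist_approx[OF len_dist_finite[OF con, of p q]] by metis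
  then show ?thesis
    by (auto simp: piecewise_C1_curve_def path_def pathstart_def pathfinish_def)
qed

text \<open>A curve from \<open>p\<close> either ends inside the sheet around \<open>p\<close> or
  has to cross its boundary sphere. In both cases it contains a chord bounded below by
  \<open>local_sheet\<close>.\<close>

lemma len_dist_pos:
  assumes "p \<noteq> q"
  shows "len_dist p q > 0"
proof -
  obtain c where c: "c \<in> \<A>" "p \<in> fst c" by (rule ex_chart)
  let ?u0 = "snd c p" and ?i = "chart_inv c"
  obtain r \<kappa> M where r: "r > 0" "\<kappa> > 0" "M > 0" "cball ?u0 r \<subseteq> chart_image c"
    and up: "\<And>u u'. u \<in> cball ?u0 r \<Longrightarrow> u' \<in> cball ?u0 r \<Longrightarrow> norm (F (?i u) - F (?i u')) \<le> M * norm (u - u')"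
    and low: "\<And>u u' x. u \<in> cball ?u0 r \<Longrightarrow> u' \<in> cball ?u0 r \<Longrightarrow> x = F (?i u) - F (?i u') \<Longrightarrow>
       \<kappa> * norm (u - u') \<le> norm (x - (x \<bullet> \<nu> (?i u)) *\<^sub>R \<nu> (?i u))"
    using local_sheet[OF c(1) chart_in_image[OF c(2)]] by blast
  have low': "\<kappa> * norm (u - ?u0) \<le> norm (F (?i u) - F p)" if "u \<in> cball ?u0 r" for u
  proof -
    let ?x = "F (?i u) - F (?i ?u0)" and ?n = "\<nu> (?i u)"
    have "(norm (?x - (?x \<bullet> ?n) *\<^sub>R ?n))\<^sup>2 = (norm ?x)\<^sup>2 - (?x \<bullet> ?n)\<^sup>2"
      unfolding power2_norm_eq_inner
      by (simp add: inner_diff_left inner_diff_right power2_eq_square inner_commute)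
    then have "(norm (?x - (?x \<bullet> ?n) *\<^sub>R ?n))\<^sup>2 \<le> (norm ?x)\<^sup>2" by simp
    then have "norm (?x - (?x \<bullet> ?n) *\<^sub>R ?n) \<le> norm ?x" by (rule power2_le_imp_le) simp
    then show ?thesis using low[OF that _ refl, of ?u0] r c by simp
  qed
  define m where "m = (if q \<in> ?i ` cball ?u0 r then \<kappa> * norm (snd c q - ?u0) else \<kappa> * r)"
  have "m > 0"
  proof (cases "q \<in> ?i ` cball ?u0 r")
    case True
    then have "q \<in> fst c" using r c by auto
    then have "snd c q \<noteq> ?u0" using assms c by (metis chart_inv_apply)
    then show ?thesis using True r by (simp add: m_def)
  qed (use r in \<open>simp add: m_def\<close>)
  moreover have "ennreal m \<le> len_dist p q"
  proof (rule len_dist_geI)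
    fix \<gamma> assume \<gamma>: "piecewise_C1_curve \<A> \<gamma>" "\<gamma> 0 = p" "\<gamma> 1 = q"
    obtain t where t: "0 \<le> t" "t \<le> 1" "m \<le> norm (F (\<gamma> t) - F p)"
    proof (cases "q \<in> ?i ` cball ?u0 r")
      case True
      then obtain u where u: "u \<in> cball ?u0 r" "q = ?i u" by blast
      then have "snd c q = u" using r c by auto
      then have "m \<le> norm (F (\<gamma> 1) - F p)" using low'[OF u(1)] u \<gamma> True by (simp add: m_def)
      then show thesis by (intro that[of 1]) auto
    next
      case False
      \<comment> \<open>Otherwise the open sheet and the complement of the closed sheet would
        disconnect the curve; the latter is open because compact sets are closed.\<close>
      have "\<exists>t\<in>{0..1}. \<gamma> t \<in> ?i ` sphere ?u0 r"
      proof (rule ccontr)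
        assume no: "\<not> ?thesis"
        let ?U = "?i ` ball ?u0 r" and ?V = "- ?i ` cball ?u0 r"
        have "open ?U" using r by (intro open_chart_inv_image[OF c(1)]) auto
        moreover have "open ?V"
          using compact_imp_closed[OF compact_chart_inv_image[OF c(1) r(4)]] by (simp add: open_Compl)
        moreover have "connected (\<gamma> ` {0..1})"
          using \<gamma>(1) by (intro connected_continuous_image) (auto simp: piecewise_C1_curve_def)
        moreover have "\<gamma> ` {0..1} \<subseteq> ?U \<union> ?V"
        proof
          fix x assume x: "x \<in> \<gamma> ` {0..1}"
          then have "x \<notin> ?i ` sphere ?u0 r" using no by auto
          moreover have "?i ` cball ?u0 r \<subseteq> ?U \<union> ?i ` sphere ?u0 r"
            unfolding image_Un[symmetric] by (intro image_mono) (auto simp: less_le)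
          ultimately show "x \<in> ?U \<union> ?V" by blast
        qed
        moreover have "?U \<inter> ?V \<inter> \<gamma> ` {0..1} = {}" by auto
        moreover have "p \<in> ?U" by (rule image_eqI[of _ _ ?u0]) (use c r in auto)
        then have "?U \<inter> \<gamma> ` {0..1} \<noteq> {}" using \<gamma>(2) by force
        moreover have "?V \<inter> \<gamma> ` {0..1} \<noteq> {}" using \<gamma>(3) False by force
        ultimately show False unfolding connected_def by blast
      qed
      then obtain t u where t: "t \<in> {0..1}" "u \<in> sphere ?u0 r" "\<gamma> t = ?i u" by blast
      have "\<kappa> * r \<le> norm (F (\<gamma> t) - F p)"
        using low'[of u] t by (simp add: dist_norm norm_minus_commute)
      then show thesis using t False by (intro that[of t]) (auto simp: m_def)
    qed
    have "ennreal m \<le> ennreal (norm (F (\<gamma> t) - F (\<gamma> 0)))" using t \<gamma> by (intro ennreal_leI) simp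
    also have "\<dots> \<le> curve_length F \<gamma>" by (rule chord_le_length[OF \<gamma>(1) t(1,2)])
    finally show "ennreal m \<le> curve_length F \<gamma>" .
  qed
  ultimately show ?thesis by (metis ennreal_less_zero_iff less_le_trans)
qed

section \<open>The geodesic distance as a metric\<close>

lemma len_dist_refl: "len_dist p p = 0"
proof -
  obtain c where c: "c \<in> \<A>" "p \<in> fst c" by (rule ex_chart)
  have "len_dist (chart_inv c (snd c p)) (chart_inv c (snd c p)) \<le> ennreal 0"
    by (rule len_dist_segment[OF c(1), of "{snd c p}"]) (use c linear_0[OF linear_dF[OF c(1)]] in auto)
  then show ?thesis using c by simp
qed

lemma geodesic_metric:
  assumes con: "connected (UNIV :: 'm set)"
  shows "Metric_space UNIV (geodesic_dist \<A> F)"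
proof
  fix p q r :: 'm
  note fin = len_dist_finite[OF con]
  show "0 \<le> geodesic_dist \<A> F p q" by (simp add: geodesic_dist_eq)
  show "geodesic_dist \<A> F p q = geodesic_dist \<A> F q p" by (simp add: geodesic_dist_eq len_dist_commute)
  show "geodesic_dist \<A> F p q = 0 \<longleftrightarrow> p = q"
    using len_dist_pos[of p q] fin[of p q] len_dist_refl[of p]
    by (cases "p = q") (auto simp: geodesic_dist_eq enn2real_eq_0_iff)
  have "enn2real (len_dist p r) \<le> enn2real (len_dist p q + len_dist q r)"
    by (rule enn2real_mono[OF len_dist_triangle]) (use fin in simp)
  then show "geodesic_dist \<A> F p r \<le> geodesic_dist \<A> F p q + geodesic_dist \<A> F q r"
    using fin by (simp add: geodesic_dist_eq enn2real_plus)
qed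

lemma geodesic_ball_eq:
  assumes con: "connected (UNIV :: 'm set)"
  shows "geodesic_ball \<A> F p R = {q. geodesic_dist \<A> F p q < R}"
  by (simp add: geodesic_ball_def Metric_space.mball_def[OF geodesic_metric[OF con]])

lemma geodesic_dist_segment:
  assumes con: "connected (UNIV :: 'm set)"
    and c: "c \<in> \<A>" and C: "convex C" "C \<subseteq> chart_image c" "u \<in> C" "u' \<in> C"
    and M: "\<And>w. w \<in> C \<Longrightarrow> norm (dF c w (u' - u)) \<le> B"
  shows "\<bar>geodesic_dist \<A> F p (chart_inv c u') - geodesic_dist \<A> F p (chart_inv c u)\<bar> \<le> B"
proof -
  interpret Metric_space UNIV "geodesic_dist \<A> F" by (rule geodesic_metric[OF con])
  have "0 \<le> B" using M[OF C(3)] norm_ge_zero order_trans by blast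
  then have "geodesic_dist \<A> F (chart_inv c u) (chart_inv c u') \<le> B"
    using enn2real_mono[OF len_dist_segment[OF c C M]] by (simp add: geodesic_dist_eq)
  then show ?thesis
    using triangle[of p "chart_inv c u" "chart_inv c u'"] triangle[of p "chart_inv c u'" "chart_inv c u"]
      commute[of "chart_inv c u" "chart_inv c u'"] by auto
qed

lemma continuous_geodesic_dist:
  assumes con: "connected (UNIV :: 'm set)"
  shows "continuous_on UNIV (geodesic_dist \<A> F p)"
proof (rule continuous_on_if_chart)
  fix c assume c: "c \<in> \<A>"
  let ?d = "\<lambda>u. geodesic_dist \<A> F p (chart_inv c u)"
  have "isCont ?d u0" if u0: "u0 \<in> chart_image c" for u0
  proof -
    obtain r M where r: "r > 0" "M > 0" "cball u0 r \<subseteq> chart_image c"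
      "\<And>u v. u \<in> cball u0 r \<Longrightarrow> norm (dF c u v) \<le> M * norm v"
      using dF_bound[OF c u0] by blast
    have "continuous_on (ball u0 r) ?d"
    proof (rule lipschitz_on_continuous_on)
      show "M-lipschitz_on (ball u0 r) ?d"
      proof (rule lipschitz_onI)
        fix u u' assume u: "u \<in> ball u0 r" "u' \<in> ball u0 r"
        have "\<bar>?d u' - ?d u\<bar> \<le> M * norm (u' - u)"
          by (rule geodesic_dist_segment[OF con c convex_ball _ u]) (use r in auto)
        then show "dist (?d u) (?d u') \<le> M * dist u u'"
          by (simp add: dist_real_def dist_norm norm_minus_commute abs_minus_commute)
      qed (use r in simp)
    qed
    then show ?thesis using r(1) continuous_on_eq_continuous_at by (metis centre_in_ball open_ball)
  qed
  then show "continuous_on (chart_image c) ?d"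
    by (intro continuous_at_imp_continuous_on) blast
qed

text \<open>Combined with properness, this places every geodesic ball inside a compact set.\<close>

lemma norm_F_le_geodesic_dist:
  assumes con: "connected (UNIV :: 'm set)"
  shows "norm (F q - F p) \<le> geodesic_dist \<A> F p q"
  using enn2real_mono[OF chord_le_len_dist[of q p] len_dist_finite[OF con]]
  by (simp add: geodesic_dist_eq)

end

section \<open>The weighted divergence in a chart\<close>

lemma smooth_on_prod:
  fixes f :: "'i \<Rightarrow> 'a::euclidean_space \<Rightarrow> real"
  assumes "open X" "\<And>i. i \<in> I \<Longrightarrow> smooth_on X (f i)"
  shows "smooth_on X (\<lambda>x. \<Prod>i\<in>I. f i x)"
  using assms(2)
proof (induction I rule: infinite_finite_induct)
  case (insert i I)
  then show ?case
    by (simp add: smooth_on_bilinear[OF bounded_bilinear_mult assms(1)])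
qed (simp_all add: smooth_on_const assms(1))

lemma smooth_on_det:
  fixes M :: "'a::euclidean_space \<Rightarrow> real^'n^'n"
  assumes "open X" "\<And>i j. smooth_on X (\<lambda>x. M x $ i $ j)"
  shows "smooth_on X (\<lambda>x. det (M x))"
  unfolding det_def
  by (intro smooth_on_sum smooth_on_bilinear[OF bounded_bilinear_mult] smooth_on_const smooth_on_prod assms)

lemma vec_expansion: "(v :: real^'n) = (\<Sum>i\<in>UNIV. v $ i *\<^sub>R axis i 1)"
  using basis_expansion[of v] by (simp add: scalar_mult_eq_scaleR)

context hypersurface
begin

definition vol_density :: "('m, 'n) chart \<Rightarrow> real^'n \<Rightarrow> real" where
  "vol_density c u = sqrt (det (induced_metric F c (chart_inv c u)))"

definition weight :: "'m \<Rightarrow> real" where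
  "weight p = exp ((norm (F p))\<^sup>2 / 4)"

definition weighted_density :: "('m, 'n) chart \<Rightarrow> real^'n \<Rightarrow> real" where
  "weighted_density c u = vol_density c u * weight (chart_inv c u)"

text \<open>The trace does not depend on the basis. Its main use is to evaluate a divergence in a
  frame that belongs to another point.\<close>

lemma trace_frame:
  fixes E :: "'n \<Rightarrow> real^'n"
  assumes c: "c \<in> \<A>" "u \<in> chart_image c" and D: "linear D"
    and E: "\<And>i j. dF c u (E i) \<bullet> dF c u (E j) = (if i = j then 1 else 0)"
  shows "(\<Sum>j\<in>UNIV. dF c u (D (E j)) \<bullet> dF c u (E j)) = (\<Sum>i\<in>UNIV. D (axis i 1) $ i)"
proof -
  let ?T = "dF c u"
  note T = linear_dF[OF c]
  have exp: "?T (D (E j)) = (\<Sum>i\<in>UNIV. E j $ i *\<^sub>R ?T (D (axis i 1)))" for j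
  proof -
    have "D (E j) = (\<Sum>i\<in>UNIV. E j $ i *\<^sub>R D (axis i 1))"
      by (subst vec_expansion) (simp only: linear_sum[OF D] linear_scale[OF D])
    then show ?thesis by (simp only: linear_sum[OF T] linear_scale[OF T])
  qed
  have comp: "D (axis i 1) $ i = (\<Sum>j\<in>UNIV. (?T (D (axis i 1)) \<bullet> ?T (E j)) * E j $ i)" for i
    by (subst frame_coordinates[OF c E, symmetric]) (simp add: sum_component)
  have "(\<Sum>j\<in>UNIV. ?T (D (E j)) \<bullet> ?T (E j)) = (\<Sum>j\<in>UNIV. \<Sum>i\<in>UNIV. (?T (D (axis i 1)) \<bullet> ?T (E j)) * E j $ i)"
    unfolding exp inner_sum_left inner_scaleR_left by (simp only: mult.commute)
  also have "\<dots> = (\<Sum>i\<in>UNIV. D (axis i 1) $ i)"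
    unfolding comp by (rule sum.swap)
  finally show ?thesis .
qed

lemma induced_metric_nth:
  "c \<in> \<A> \<Longrightarrow> u \<in> chart_image c \<Longrightarrow>
    induced_metric F c (chart_inv c u) $ i $ j = dF c u (axis i 1) \<bullet> dF c u (axis j 1)"
  by (simp add: induced_metric_def euclidean_deriv_F)

lemma smooth_on_dF: "c \<in> \<A> \<Longrightarrow> smooth_on (chart_image c) (\<lambda>u. dF c u v)"
  unfolding dF_def by (intro smooth_on_frechet_derivative smooth_map_chart smooth_F)

text \<open>
  A constant change of basis makes the Gram matrix the identity at the given point, where the
  derivative of the determinant is the trace.
\<close>

lemma det_metric:
  fixes E :: "'n \<Rightarrow> real^'n"
  assumes c: "c \<in> \<A>" "u \<in> chart_image c"
    and E: "\<And>i j. dF c u (E i) \<bullet> dF c u (E j) = (if i = j then 1 else 0)"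
  shows det_metric_pos: "det (induced_metric F c (chart_inv c u)) > 0"
    and det_metric_derivative: "((\<lambda>u. det (induced_metric F c (chart_inv c u))) has_derivative
      (\<lambda>v. det (induced_metric F c (chart_inv c u)) *
        (2 * (\<Sum>j\<in>UNIV. frechet_derivative (\<lambda>w. dF c w (E j)) (at u) v \<bullet> dF c u (E j))))) (at u)"
proof -
  let ?g = "\<lambda>w. induced_metric F c (chart_inv c w)"
  define P :: "real^'n^'n" where "P = (\<chi> i j. E i $ j)"
  define N :: "real^'n \<Rightarrow> real^'n^'n" where "N w = (\<chi> i j. dF c w (E i) \<bullet> dF c w (E j))" for w
  have N: "N w = P ** ?g w ** transpose P" if w: "w \<in> chart_image c" for w
  proof -
    have ex: "dF c w (E i) = (\<Sum>k\<in>UNIV. E i $ k *\<^sub>R dF c w (axis k 1))" for i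
      by (subst vec_expansion) (simp only: linear_sum[OF linear_dF[OF c(1) w]] linear_scale[OF linear_dF[OF c(1) w]])
    have "N w $ i $ j = (P ** ?g w ** transpose P) $ i $ j" for i j
    proof -
      have "N w $ i $ j = (\<Sum>l\<in>UNIV. \<Sum>k\<in>UNIV. E j $ l * (E i $ k * (dF c w (axis k 1) \<bullet> dF c w (axis l 1))))"
        unfolding N_def vec_lambda_beta ex[of i] ex[of j]
        by (simp only: inner_sum_left inner_sum_right inner_scaleR_left inner_scaleR_right sum_distrib_left)
      also have "\<dots> = (\<Sum>l\<in>UNIV. \<Sum>k\<in>UNIV. E i $ k * (dF c w (axis k 1) \<bullet> dF c w (axis l 1)) * E j $ l)"
        by (simp only: mult_ac)
      also have "\<dots> = (P ** ?g w ** transpose P) $ i $ j"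
        by (simp add: matrix_matrix_mult_def transpose_def P_def induced_metric_nth[OF c(1) w] sum_distrib_right)
      finally show ?thesis .
    qed
    then show ?thesis by (simp add: vec_eq_iff)
  qed
  have dN: "det (N w) = (det P)\<^sup>2 * det (?g w)" if "w \<in> chart_image c" for w
    by (simp add: N[OF that] det_mul det_transpose power2_eq_square mult_ac)
  have N1: "N u = mat 1" by (simp add: N_def E mat_def vec_eq_iff)
  have one: "(det P)\<^sup>2 * det (?g u) = 1" using dN[OF c(2)] N1 by simp
  then have P0: "(det P)\<^sup>2 > 0" by (metis less_eq_real_def mult_zero_left zero_le_power2 zero_neq_one)
  show pos: "det (?g u) > 0"
    using one P0 by (metis zero_less_mult_pos zero_less_one)
  have inv: "det (?g u) = inverse ((det P)\<^sup>2)" using one P0 by (simp add: field_simps)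
  let ?D = "\<lambda>j. frechet_derivative (\<lambda>w. dF c w (E j)) (at u)"
  have dF': "((\<lambda>w. dF c w (E j)) has_derivative ?D j) (at u)" for j
    by (rule smooth_on_has_derivative[OF smooth_on_dF[OF c(1)] c(2)])
  have "((\<lambda>w. det (N w)) has_derivative (\<lambda>v. \<Sum>i\<in>UNIV. dF c u (E i) \<bullet> ?D i v + ?D i v \<bullet> dF c u (E i))) (at u)"
  proof (rule has_derivative_det_at_identity[where M=N and M'="\<lambda>i j v. dF c u (E i) \<bullet> ?D j v + ?D i v \<bullet> dF c u (E j)"])
    show "((\<lambda>x. N x $ i $ j) has_derivative (\<lambda>v. dF c u (E i) \<bullet> ?D j v + ?D i v \<bullet> dF c u (E j))) (at u)" for i j
      unfolding N_def vec_lambda_beta by (rule has_derivative_inner[OF dF' dF'])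
    show "N u = mat 1" by (rule N1)
  qed
  then have "((\<lambda>w. inverse ((det P)\<^sup>2) * det (N w)) has_derivative
      (\<lambda>v. inverse ((det P)\<^sup>2) * (\<Sum>i\<in>UNIV. dF c u (E i) \<bullet> ?D i v + ?D i v \<bullet> dF c u (E i)))) (at u)"
    by (rule has_derivative_mult_right)
  then have "((\<lambda>w. det (?g w)) has_derivative
      (\<lambda>v. inverse ((det P)\<^sup>2) * (\<Sum>i\<in>UNIV. dF c u (E i) \<bullet> ?D i v + ?D i v \<bullet> dF c u (E i)))) (at u)"
  proof (rule has_derivative_transform_within_open[OF _ chart_image_open[OF c(1)] c(2)])
    fix w assume "w \<in> chart_image c"
    show "inverse ((det P)\<^sup>2) * det (N w) = det (?g w)"
      using P0 dN[OF \<open>w \<in> chart_image c\<close>] by simp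
  qed
  moreover have "(\<Sum>i\<in>UNIV. dF c u (E i) \<bullet> ?D i v + ?D i v \<bullet> dF c u (E i)) = 2 * (\<Sum>i\<in>UNIV. ?D i v \<bullet> dF c u (E i))" for v
    by (simp add: inner_commute sum_distrib_left)
  ultimately show "((\<lambda>u. det (?g u)) has_derivative
      (\<lambda>v. det (?g u) * (2 * (\<Sum>j\<in>UNIV. ?D j v \<bullet> dF c u (E j))))) (at u)"
    by (simp only: inv)
qed

lemma det_metric_positive: "c \<in> \<A> \<Longrightarrow> u \<in> chart_image c \<Longrightarrow> det (induced_metric F c (chart_inv c u)) > 0"
proof -
  assume c: "c \<in> \<A>" "u \<in> chart_image c"
  obtain E :: "'n \<Rightarrow> real^'n \<Rightarrow> real^'n" where "\<And>i. smooth_on (chart_image c) (E i)"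
    "\<And>u i j. u \<in> chart_image c \<Longrightarrow> dF c u (E i u) \<bullet> dF c u (E j u) = (if i = j then 1 else 0)"
    using ex_frame[OF c(1)] by blast
  from det_metric_pos[OF c this(2)[OF c(2)]] show ?thesis .
qed

lemma vol_density_pos: "c \<in> \<A> \<Longrightarrow> u \<in> chart_image c \<Longrightarrow> vol_density c u > 0"
  by (simp add: vol_density_def det_metric_positive)

lemma weight_pos: "weight p > 0"
  by (simp add: weight_def)

lemma weighted_density_pos: "c \<in> \<A> \<Longrightarrow> u \<in> chart_image c \<Longrightarrow> weighted_density c u > 0"
  by (simp add: weighted_density_def vol_density_pos weight_pos)

lemma smooth_weight: "smooth_map \<A> weight"
proof -
  have "weight = (\<lambda>p. exp ((\<Sum>a\<in>UNIV. F p $ a * F p $ a) * (1/4)))"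
    by (simp add: weight_def power2_norm_eq_inner inner_vec_def fun_eq_iff)
  then show ?thesis
    by (simp only:) (intro smooth_map_exp smooth_map_mult smooth_map_sum smooth_F_nth smooth_map_const)
qed

lemma smooth_on_vol_density: "c \<in> \<A> \<Longrightarrow> smooth_on (chart_image c) (vol_density c)"
proof -
  assume c: "c \<in> \<A>"
  note op = chart_image_open[OF c]
  have "smooth_on (chart_image c) (\<lambda>u. induced_metric F c (chart_inv c u) $ i $ j)" for i j
  proof (subst smooth_on_cong[OF op])
    show "induced_metric F c (chart_inv c u) $ i $ j = dF c u (axis i 1) \<bullet> dF c u (axis j 1)"
      if "u \<in> chart_image c" for u using induced_metric_nth[OF c that] .
    show "smooth_on (chart_image c) (\<lambda>u. dF c u (axis i 1) \<bullet> dF c u (axis j 1))"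
      by (intro smooth_on_bilinear[OF bounded_bilinear_inner op] smooth_on_dF c)
  qed
  then have "smooth_on (chart_image c) (\<lambda>u. det (induced_metric F c (chart_inv c u)))"
    by (rule smooth_on_det[OF op])
  then show ?thesis
    unfolding vol_density_def[abs_def] by (rule smooth_on_sqrt[OF op]) (rule det_metric_positive[OF c])
qed

lemma smooth_on_weighted_density: "c \<in> \<A> \<Longrightarrow> smooth_on (chart_image c) (weighted_density c)"
  unfolding weighted_density_def[abs_def]
  by (intro smooth_on_bilinear[OF bounded_bilinear_mult] chart_image_open smooth_on_vol_density smooth_map_chart smooth_weight)

text \<open>Logarithmic derivative of the density: half the trace of the derivative of the metric,
  written in an orthonormal frame, plus the derivative of \<open>|x|\<^sup>2 / 4\<close>.\<close>

lemma weighted_density_has_derivative: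
  fixes E :: "'n \<Rightarrow> real^'n"
  assumes c: "c \<in> \<A>" "u \<in> chart_image c"
    and E: "\<And>i j. dF c u (E i) \<bullet> dF c u (E j) = (if i = j then 1 else 0)"
  shows "((weighted_density c) has_derivative (\<lambda>v. weighted_density c u *
      ((\<Sum>j\<in>UNIV. frechet_derivative (\<lambda>w. dF c w (E j)) (at u) v \<bullet> dF c u (E j))
        + (1/2) * (F (chart_inv c u) \<bullet> dF c u v)))) (at u)"
proof -
  let ?g = "\<lambda>u. det (induced_metric F c (chart_inv c u))"
  let ?s = "\<lambda>v. \<Sum>j\<in>UNIV. frechet_derivative (\<lambda>w. dF c w (E j)) (at u) v \<bullet> dF c u (E j)"
  have pos: "?g u > 0" by (rule det_metric_pos[OF c E])
  have r: "((sqrt) has_derivative (\<lambda>x. x * (inverse (sqrt (?g u)) / 2))) (at (?g u))"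
    by (rule has_derivative_eq_rhs[OF DERIV_real_sqrt[OF pos, unfolded has_field_derivative_def]])
       (simp add: fun_eq_iff mult.commute)
  have "((\<lambda>u. sqrt (?g u)) has_derivative (\<lambda>v. (?g u * (2 * ?s v)) * (inverse (sqrt (?g u)) / 2))) (at u)"
    by (rule has_derivative_compose[OF det_metric_derivative[OF c E] r])
  moreover have "(?g u * (2 * s)) * (inverse (sqrt (?g u)) / 2) = sqrt (?g u) * s" for s
  proof -
    have "?g u * inverse (sqrt (?g u)) = sqrt (?g u)"
      using pos by (simp add: real_div_sqrt divide_inverse[symmetric])
    then show ?thesis by (metis (no_types, opaque_lifting) mult.assoc mult.commute mult.left_commute nonzero_mult_div_cancel_left times_divide_eq_right zero_neq_numeral)
  qed
  ultimately have v: "((\<lambda>u. vol_density c u) has_derivative (\<lambda>v. vol_density c u * ?s v)) (at u)"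
    unfolding vol_density_def by (simp only:)
  let ?q = "\<lambda>u. (1/4) * (F (chart_inv c u) \<bullet> F (chart_inv c u))"
  have q: "(?q has_derivative (\<lambda>v. (1/4) * (F (chart_inv c u) \<bullet> dF c u v + dF c u v \<bullet> F (chart_inv c u)))) (at u)"
    by (intro has_derivative_mult_right has_derivative_inner F_has_derivative c)
  have e: "weight (chart_inv c u) = exp (?q u)" for u by (simp add: weight_def power2_norm_eq_inner)
  have w: "((\<lambda>u. weight (chart_inv c u)) has_derivative
      (\<lambda>v. weight (chart_inv c u) * ((1/2) * (F (chart_inv c u) \<bullet> dF c u v)))) (at u)"
    unfolding e
    by (rule has_derivative_eq_rhs[OF has_derivative_exp[OF q]]) (simp add: inner_commute fun_eq_iff)
  show ?thesis
    unfolding weighted_density_def[abs_def]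
    by (rule has_derivative_eq_rhs[OF has_derivative_mult[OF v w]]) (simp add: fun_eq_iff algebra_simps)
qed

text \<open>The product rule, after which symmetry of the second derivatives of \<open>F\<close>
  moves the direction \<open>v\<close> into the argument of \<open>dF\<close>. In this form the term
  matches the derivative of the density.\<close>

lemma has_derivative_dF_field:
  fixes X :: "real^'n \<Rightarrow> real^'n"
  assumes c: "c \<in> \<A>" "u \<in> chart_image c" and X: "(X has_derivative X') (at u)"
  shows "((\<lambda>w. dF c w (X w)) has_derivative
     (\<lambda>v. dF c u (X' v) + frechet_derivative (\<lambda>w. dF c w v) (at u) (X u))) (at u)"
proof -
  let ?D = "\<lambda>b. frechet_derivative (\<lambda>w. dF c w b) (at u)"
  have D: "((\<lambda>w. dF c w b) has_derivative ?D b) (at u)" for b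
    by (rule smooth_on_has_derivative[OF smooth_on_dF[OF c(1)] c(2)])
  have ex: "dF c w v = (\<Sum>b\<in>Basis. (v \<bullet> b) *\<^sub>R dF c w b)" if "w \<in> chart_image c" for w v
    by (rule linear_componentwise_expansion[OF linear_dF[OF c(1) that]])
  have "((\<lambda>w. \<Sum>b\<in>Basis. (X w \<bullet> b) *\<^sub>R dF c w b) has_derivative
      (\<lambda>v. \<Sum>b\<in>Basis. (X u \<bullet> b) *\<^sub>R ?D b v + (X' v \<bullet> b) *\<^sub>R dF c u b)) (at u)"
    by (intro has_derivative_sum has_derivative_scaleR D has_derivative_inner_left X)
  then have "((\<lambda>w. dF c w (X w)) has_derivative
      (\<lambda>v. \<Sum>b\<in>Basis. (X u \<bullet> b) *\<^sub>R ?D b v + (X' v \<bullet> b) *\<^sub>R dF c u b)) (at u)"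
    by (rule has_derivative_transform_within_open[OF _ chart_image_open[OF c(1)] c(2)]) (rule ex[symmetric])
  moreover have "(\<Sum>b\<in>Basis. (X u \<bullet> b) *\<^sub>R ?D b v + (X' v \<bullet> b) *\<^sub>R dF c u b) = dF c u (X' v) + ?D v (X u)" for v
  proof -
    have sy: "?D b v = ?D v b" for b
      using second_derivative_symmetric[OF chart_image_open[OF c(1)] smooth_map_chart[OF smooth_F c(1)] c(2), of b v]
      by (simp only: dF_def)
    have "(\<Sum>b\<in>Basis. (X u \<bullet> b) *\<^sub>R ?D b v) = ?D v (X u)"
      unfolding sy by (rule linear_componentwise_expansion[OF has_derivative_linear[OF D], symmetric])
    then show ?thesis by (simp only: sum.distrib ex[OF c(2), of "X' v", symmetric] add.commute)
  qed
  ultimately show ?thesis by (simp only:)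
qed

text \<open>Near a point the components of the field are taken in the constant basis \<open>E j w\<close>.\<close>

lemma drift_div_chart:
  fixes E :: "'n \<Rightarrow> real^'n \<Rightarrow> real^'n"
  assumes c: "c \<in> \<A>" and E: "\<And>i. smooth_on (chart_image c) (E i)"
    "\<And>u i j. u \<in> chart_image c \<Longrightarrow> dF c u (E i u) \<bullet> dF c u (E j u) = (if i = j then 1 else 0)"
    and V: "\<And>a. smooth_map \<A> (V a)" "\<And>p. (\<Sum>a\<in>UNIV. V a p * \<nu> p $ a) = 0"
  shows "\<exists>X. smooth_on (chart_image c) X \<and> (\<forall>u\<in>chart_image c. dF c u (X u) = (\<chi> a. V a (chart_inv c u))) \<and>
    (\<forall>u\<in>chart_image c. \<forall>w\<in>chart_image c. weighted_density c u * drift_div V (chart_inv c u) =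
       (\<Sum>j\<in>UNIV. dF c w (frechet_derivative (\<lambda>x. weighted_density c x *\<^sub>R X x) (at u) (E j w)) \<bullet> dF c w (E j w)))"
proof -
  note op = chart_image_open[OF c]
  define W where "W u = (\<chi> a. V a (chart_inv c u))" for u
  define X where "X u = (\<Sum>j\<in>UNIV. (W u \<bullet> dF c u (E j u)) *\<^sub>R E j u)" for u
  have sW: "smooth_on (chart_image c) W"
    unfolding W_def[abs_def]
    by (rule smooth_on_componentwise[OF op]) (simp add: smooth_map_chart V c)
  have sm: "smooth_on (chart_image c) X"
    unfolding X_def[abs_def]
  proof (intro smooth_on_sum op smooth_on_bilinear[OF bounded_bilinear_scaleR] smooth_on_bilinear[OF bounded_bilinear_inner] sW E)
    show "smooth_on (chart_image c) (\<lambda>u. dF c u (E i u))" for i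
      unfolding dF_def by (intro smooth_on_derivative_along op E smooth_map_chart smooth_F c)
  qed
  have tan: "W u \<bullet> \<nu> (chart_inv c u) = 0" for u
    using V(2)[of "chart_inv c u"] by (simp add: W_def inner_vec_def)
  have dX: "dF c u (X u) = W u" if u: "u \<in> chart_image c" for u
  proof -
    have "dF c u (X u) = (\<Sum>j\<in>UNIV. (W u \<bullet> dF c u (E j u)) *\<^sub>R dF c u (E j u))"
      unfolding X_def by (simp only: linear_sum[OF linear_dF[OF c u]] linear_scale[OF linear_dF[OF c u]])
    also have "\<dots> = W u"
      by (subst frame_expansion[of _ "chart_inv c u"]) (use E(2)[OF u] dF_normal[OF c u] tan in simp_all)
    finally show ?thesis .
  qed
  show ?thesis
  proof (intro exI[of _ X] conjI ballI)
    show "smooth_on (chart_image c) X" by (rule sm)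
  next
    fix u assume "u \<in> chart_image c" then show "dF c u (X u) = (\<chi> a. V a (chart_inv c u))" using dX by (simp add: W_def)
  next
    fix u w assume u: "u \<in> chart_image c" and w: "w \<in> chart_image c"
    let ?p = "chart_inv c u" and ?r = "weighted_density c" and ?T = "dF c u"
    let ?e = "\<lambda>j. ?T (E j u)" and ?X' = "frechet_derivative X (at u)"
    let ?D = "\<lambda>b. frechet_derivative (\<lambda>w. dF c w b) (at u)"
    \<comment> \<open>The logarithmic derivative of the weighted density in the direction
      \<open>v\<close>.\<close>
    define l where "l v = (\<Sum>j\<in>UNIV. ?D (E j u) v \<bullet> ?e j) + (1/2) * (F ?p \<bullet> ?T v)" for v
    note on = E(2)[OF u]
    have X': "(X has_derivative ?X') (at u)" by (rule smooth_on_has_derivative[OF sm u])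
    have r': "(?r has_derivative (\<lambda>v. ?r u * l v)) (at u)"
      unfolding l_def by (rule weighted_density_has_derivative[OF c u on])
    have G': "((\<lambda>x. ?r x *\<^sub>R X x) has_derivative (\<lambda>v. ?r u *\<^sub>R ?X' v + (?r u * l v) *\<^sub>R X u)) (at u)"
      by (rule has_derivative_scaleR[OF r' X'])
    have fG: "frechet_derivative (\<lambda>x. ?r x *\<^sub>R X x) (at u) = (\<lambda>v. ?r u *\<^sub>R ?X' v + (?r u * l v) *\<^sub>R X u)"
      using frechet_derivative_at[OF G'] by simp
    have linG: "linear (\<lambda>v. ?r u *\<^sub>R ?X' v + (?r u * l v) *\<^sub>R X u)" by (rule has_derivative_linear[OF G'])
    have linl: "linear l"
    proof -
      have "linear (\<lambda>v. ?r u * l v)" by (rule has_derivative_linear[OF r'])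
      then have "linear (\<lambda>v. inverse (?r u) *\<^sub>R (?r u * l v))" by (rule linear_compose_scale_right)
      moreover have "?r u \<noteq> 0" using weighted_density_pos[OF c u] by simp
      then have "(\<lambda>v. inverse (?r u) *\<^sub>R (?r u * l v)) = l" by (simp add: fun_eq_iff)
      ultimately show ?thesis by (simp only:)
    qed
    have VX: "(\<Sum>j\<in>UNIV. (?T (X u) \<bullet> ?e j) * l (E j u)) = l (X u)"
    proof -
      have "l (X u) = l (\<Sum>j\<in>UNIV. (?T (X u) \<bullet> ?e j) *\<^sub>R E j u)"
        using frame_coordinates[OF c u on, of "X u"] by simp
      then show ?thesis by (simp add: linear_sum[OF linl] linear_scale[OF linl])
    qed
    have W': "(W has_derivative (\<lambda>v. ?T (?X' v) + ?D v (X u))) (at u)"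
      by (rule has_derivative_transform_within_open[OF has_derivative_dF_field[OF c u X'] op u]) (rule dX)
    have Wa: "(?T (?X' v) + ?D v (X u)) $ a = tgrad (V a) ?p \<bullet> ?T v" for a v
    proof -
      have "((\<lambda>u. W u $ a) has_derivative (\<lambda>v. (?T (?X' v) + ?D v (X u)) $ a)) (at u)"
        by (rule bounded_linear.has_derivative[OF bounded_linear_vec_nth W'])
      moreover have "((\<lambda>u. W u $ a) has_derivative (\<lambda>v. tgrad (V a) ?p \<bullet> ?T v)) (at u)"
        using has_tgrad_chart[OF has_tgrad_tgrad[OF V(1)] c chart_inv_in[OF c u]] c u by (simp add: W_def)
      ultimately have "(\<lambda>v. (?T (?X' v) + ?D v (X u)) $ a) = (\<lambda>v. tgrad (V a) ?p \<bullet> ?T v)"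
        by (rule has_derivative_unique)
      then show ?thesis by (rule fun_cong)
    qed
    have div: "(\<Sum>j\<in>UNIV. (?T (?X' (E j u)) + ?D (E j u) (X u)) \<bullet> ?e j) = (\<Sum>a\<in>UNIV. \<delta> a (V a) ?p)"
    proof -
      have "(\<Sum>j\<in>UNIV. (?T (?X' (E j u)) + ?D (E j u) (X u)) \<bullet> ?e j) = (\<Sum>j\<in>UNIV. \<Sum>a\<in>UNIV. (tgrad (V a) ?p \<bullet> ?e j) * ?e j $ a)"
        unfolding inner_vec_def[of "_ + _"] Wa by simp
      also have "\<dots> = (\<Sum>a\<in>UNIV. (\<Sum>j\<in>UNIV. (tgrad (V a) ?p \<bullet> ?e j) *\<^sub>R ?e j) $ a)"
        by (subst sum.swap) (simp add: sum_component)
      also have "\<dots> = (\<Sum>a\<in>UNIV. \<delta> a (V a) ?p)"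
        by (subst frame_expansion[of _ ?p]) (use on dF_normal[OF c u] in \<open>simp_all add: tgrad_normal V tgrad_nth\<close>)
      finally show ?thesis .
    qed
    have FV: "F ?p \<bullet> ?T (X u) = (\<Sum>a\<in>UNIV. F ?p $ a * V a ?p)"
      by (simp add: dX[OF u] W_def inner_vec_def)
    \<comment> \<open>Both sides are the trace of the derivative of the weighted coordinate field,
      that is its Euclidean divergence; so the frame at \<open>w\<close> may be exchanged for the
      one at \<open>u\<close>.\<close>
    have "(\<Sum>j\<in>UNIV. dF c w (frechet_derivative (\<lambda>x. ?r x *\<^sub>R X x) (at u) (E j w)) \<bullet> dF c w (E j w)) =
        (\<Sum>j\<in>UNIV. ?T (?r u *\<^sub>R ?X' (E j u) + (?r u * l (E j u)) *\<^sub>R X u) \<bullet> ?e j)"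
      unfolding fG trace_frame[OF c w linG E(2)[OF w]] trace_frame[OF c u linG on] ..
    also have "\<dots> = (\<Sum>j\<in>UNIV. ?r u * (?T (?X' (E j u)) \<bullet> ?e j) + ?r u * ((?T (X u) \<bullet> ?e j) * l (E j u)))"
      by (rule sum.cong[OF refl])
         (simp only: linear_add[OF linear_dF[OF c u]] linear_scale[OF linear_dF[OF c u]] inner_add_left inner_scaleR_left mult_ac)
    also have "\<dots> = ?r u * ((\<Sum>j\<in>UNIV. ?T (?X' (E j u)) \<bullet> ?e j) + l (X u))"
      unfolding VX[symmetric] by (simp only: sum.distrib sum_distrib_left distrib_left)
    \<comment> \<open>The second derivatives of \<open>F\<close> that separate the coordinate
      divergence from the intrinsic one are the same as those in \<open>l (X u)\<close>, and they
      cancel.\<close>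
    also have "(\<Sum>j\<in>UNIV. ?T (?X' (E j u)) \<bullet> ?e j) = (\<Sum>a\<in>UNIV. \<delta> a (V a) ?p) - (\<Sum>j\<in>UNIV. ?D (E j u) (X u) \<bullet> ?e j)"
      unfolding div[symmetric] by (simp add: inner_add_left sum.distrib)
    also have "(\<Sum>a\<in>UNIV. \<delta> a (V a) ?p) - (\<Sum>j\<in>UNIV. ?D (E j u) (X u) \<bullet> ?e j) + l (X u) = drift_div V ?p"
      unfolding l_def FV drift_div_def by simp
    finally show "?r u * drift_div V ?p = (\<Sum>j\<in>UNIV. dF c w (frechet_derivative (\<lambda>x. ?r x *\<^sub>R X x) (at u) (E j w)) \<bullet> dF c w (E j w))"
      by (rule sym)
  qed
qed

end

section \<open>Smooth cutoffs\<close>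

text \<open>The classical flat function together with the powers of \<open>1 / x\<close> that its
  derivatives produce: a family closed under differentiation up to linear combinations.\<close>

definition flat :: "nat \<Rightarrow> real \<Rightarrow> real" where
  "flat m x = (if x > 0 then inverse x ^ m * exp (- inverse x) else 0)"

lemma flat_nonneg: "0 \<le> flat m x" and flat_pos: "0 < x \<Longrightarrow> 0 < flat m x"
  by (simp_all add: flat_def)

lemma flat_tendsto_0: "(flat m \<longlongrightarrow> 0) (at 0)"
proof -
  have "((\<lambda>x. inverse x ^ m / exp (inverse x)) \<longlongrightarrow> (0::real)) (at_right 0)"
    by (rule filterlim_compose[OF tendsto_power_div_exp_0 filterlim_inverse_at_top_right])
  moreover have "\<forall>\<^sub>F x::real in at_right 0. inverse x ^ m / exp (inverse x) = flat m x"
    by (rule eventually_mono[OF eventually_at_right_less[of 0]]) (simp add: flat_def exp_minus divide_inverse)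
  ultimately have "(flat m \<longlongrightarrow> 0) (at_right 0)" by (rule Lim_transform_eventually)
  moreover have "(flat m \<longlongrightarrow> 0) (at_left 0)"
  proof (rule Lim_transform_eventually[OF tendsto_const])
    show "\<forall>\<^sub>F x::real in at_left 0. 0 = flat m x"
      unfolding eventually_at_left_field by (auto simp: flat_def intro!: exI[of _ "-1"])
  qed
  ultimately show ?thesis by (simp add: filterlim_split_at)
qed

lemma flat_derivative:
  "(flat m has_real_derivative (flat (m + 2) x - real m * flat (m + 1) x)) (at x)"
proof -
  consider "x > 0" | "x < 0" | "x = 0" by linarith
  then show ?thesis
  proof cases
    case 1
    let ?y = "inverse x"
    have p: "real m * ?y ^ (m - 1) * ?y\<^sup>2 = real m * ?y ^ (m + 1)"
      by (cases m) (simp_all add: power2_eq_square)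
    have "((\<lambda>x. inverse x ^ m * exp (- inverse x)) has_real_derivative
        (real m * ?y ^ (m - 1) * (- (?y\<^sup>2))) * exp (- ?y) + ?y ^ m * (exp (- ?y) * (?y\<^sup>2))) (at x)"
      using 1 by (auto intro!: derivative_eq_intros) (simp only: power2_eq_square mult_ac)
    also have "(real m * ?y ^ (m - 1) * (- (?y\<^sup>2))) * exp (- ?y) + ?y ^ m * (exp (- ?y) * (?y\<^sup>2)) =
        ?y ^ (m + 2) * exp (- ?y) - (real m * ?y ^ (m - 1) * ?y\<^sup>2) * exp (- ?y)"
      by (simp add: power_add power2_eq_square algebra_simps)
    also have "\<dots> = flat (m + 2) x - real m * flat (m + 1) x"
      unfolding p using 1 by (simp add: flat_def)
    finally show ?thesis
      by (rule has_field_derivative_transform_within_open[of _ _ _ "{0<..}"]) (use 1 in \<open>auto simp: flat_def\<close>)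
  next
    case 2
    have "((\<lambda>x. 0) has_real_derivative 0) (at x)" by simp
    then have "(flat m has_real_derivative 0) (at x)"
      by (rule has_field_derivative_transform_within_open[of _ _ _ "{..<0}"]) (use 2 in \<open>auto simp: flat_def\<close>)
    then show ?thesis using 2 by (simp add: flat_def)
  next
    case 3
    \<comment> \<open>The difference quotient at zero is the next member of the family, which tends
      to zero.\<close>
    have "(\<lambda>y. (flat m y - flat m 0) / (y - 0)) = flat (m + 1)"
      by (auto simp: flat_def fun_eq_iff divide_inverse)
    then have "(flat m has_real_derivative 0) (at 0)"
      using flat_tendsto_0[of "m + 1"] by (simp add: has_field_derivative_iff)
    then show ?thesis using 3 by (simp add: flat_def)
  qed
qed

lemma smooth_on_flat: "smooth_on UNIV (flat m)"
  unfolding smooth_on_def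
proof (rule allI)
  fix k show "Ck_on k UNIV (flat m)"
  proof (induction k arbitrary: m)
    case 0
    then show ?case
      by (auto intro!: continuous_at_imp_continuous_on DERIV_isCont flat_derivative)
  next
    case (Suc k)
    have d: "(flat m has_derivative (\<lambda>v. (flat (m + 2) x + (- real m) * flat (m + 1) x) * v)) (at x)" for x
      using flat_derivative[of m x] by (simp add: has_field_derivative_def)
    have "Ck_on (Suc k) UNIV (flat m) \<longleftrightarrow>
        (\<forall>v. Ck_on k UNIV (\<lambda>x. (flat (m + 2) x + (- real m) * flat (m + 1) x) * v))"
      by (rule Ck_on_Suc_iff[OF open_UNIV]) (rule d)
    then show ?case
      by (simp only:) (intro allI Ck_on_mult Ck_on_add Ck_on_const open_UNIV Suc.IH)
  qed
qed

lemma ex_smooth_step: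
  fixes a b :: real
  assumes "a < b"
  obtains s :: "real \<Rightarrow> real" where "smooth_on UNIV s" "\<And>x. 0 \<le> s x" "\<And>x. s x \<le> 1"
    "\<And>x. x \<le> a \<Longrightarrow> s x = 1" "\<And>x. b \<le> x \<Longrightarrow> s x = 0"
proof -
  let ?d = "\<lambda>x. flat 0 (b - x) + flat 0 (x - a)"
  have d: "?d x > 0" for x
  proof (cases "x < b")
    case True
    then show ?thesis using flat_pos[of "b - x" 0] flat_nonneg[of 0 "x - a"] by simp
  next
    case False
    then show ?thesis using assms flat_pos[of "x - a" 0] flat_nonneg[of 0 "b - x"] by simp
  qed
  have lin: "smooth_on UNIV (\<lambda>x. \<alpha> + \<beta> * x)" for \<alpha> \<beta> :: real
    by (intro smooth_on_add smooth_on_const open_UNIV smooth_on_linear_comp[OF bounded_linear_mult_right]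
        smooth_on_bounded_linear[OF bounded_linear_ident])
  have fl: "smooth_on UNIV (\<lambda>x. flat 0 (\<alpha> + \<beta> * x))" for \<alpha> \<beta> :: real
    by (rule smooth_on_compose[OF open_UNIV open_UNIV subset_UNIV lin smooth_on_flat])
  have f: "smooth_on UNIV (\<lambda>x. flat 0 (b - x))" "smooth_on UNIV (\<lambda>x. flat 0 (x - a))"
    using fl[of b "-1"] fl[of "-a" 1] by simp_all
  show thesis
  proof (rule that[of "\<lambda>x. flat 0 (b - x) * inverse (?d x)"])
    show "smooth_on UNIV (\<lambda>x. flat 0 (b - x) * inverse (?d x))"
    proof (intro smooth_on_bilinear[OF bounded_bilinear_mult] smooth_on_inverse smooth_on_add open_UNIV f)
      show "?d x \<noteq> 0" for x using d[of x] by simp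
    qed
    fix x
    show "0 \<le> flat 0 (b - x) * inverse (?d x)"
      using d[of x] flat_nonneg[of 0 "b - x"] by simp
    show "flat 0 (b - x) * inverse (?d x) \<le> 1"
      using d[of x] flat_nonneg[of 0 "x - a"] by (simp add: divide_inverse[symmetric] divide_le_eq)
    show "flat 0 (b - x) * inverse (?d x) = 1" if "x \<le> a"
      using d[of x] that by (simp add: flat_def)
    show "flat 0 (b - x) * inverse (?d x) = 0" if "b \<le> x"
      using that by (simp add: flat_def)
  qed
qed

context hypersurface
begin

text \<open>A step function of the squared Euclidean distance to the centre. On the sheet this
  distance controls the coordinate distance, which gives a prescribed small support.\<close>

lemma ex_bump:
  assumes c: "c \<in> \<A>" "u0 \<in> chart_image c" and r: "r > 0"
  obtains \<beta> r' where "smooth_map \<A> \<beta>" "\<And>q. 0 \<le> \<beta> q" "\<And>q. \<beta> q \<le> (1::real)" "0 < r'" "ball u0 r' \<subseteq> chart_image c"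
    "\<And>u. u \<in> ball u0 r' \<Longrightarrow> \<beta> (chart_inv c u) = 1" "\<And>q. q \<notin> chart_inv c ` (cball u0 r \<inter> chart_image c) \<Longrightarrow> \<beta> q = 0"
proof -
  let ?i = "chart_inv c"
  obtain r1 \<kappa> M where r1: "r1 > 0" "\<kappa> > 0" "M > 0" "cball u0 r1 \<subseteq> chart_image c"
    and up: "\<And>u u'. u \<in> cball u0 r1 \<Longrightarrow> u' \<in> cball u0 r1 \<Longrightarrow> norm (F (?i u) - F (?i u')) \<le> M * norm (u - u')"
    and low: "\<And>u u' x. u \<in> cball u0 r1 \<Longrightarrow> u' \<in> cball u0 r1 \<Longrightarrow> x = F (?i u) - F (?i u') \<Longrightarrow>
       \<kappa> * norm (u - u') \<le> norm (x - (x \<bullet> \<nu> (?i u)) *\<^sub>R \<nu> (?i u))"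
    using local_sheet[OF c] by blast
  define r2 where "r2 = min (r1 / 2) r"
  have r2: "r2 > 0" "r2 < r1" "r2 \<le> r" using r r1 by (auto simp: r2_def)
  define b where "b = (\<kappa> * r2)\<^sup>2"
  have b: "b > 0" using r1 r2 by (simp add: b_def)
  let ?f = "\<lambda>q. F q - F (?i u0)"
  have far: "b \<le> ?f (?i u) \<bullet> ?f (?i u)" if u: "u \<in> cball u0 r1" "u \<notin> cball u0 r2" for u
  proof -
    let ?x = "F (?i u) - F (?i u0)" and ?n = "\<nu> (?i u)"
    have "\<kappa> * r2 \<le> \<kappa> * norm (u - u0)"
      using u r1 by (simp add: dist_norm norm_minus_commute)
    also have "\<dots> \<le> norm (?x - (?x \<bullet> ?n) *\<^sub>R ?n)" by (rule low[OF u(1) _ refl]) (use r1 in simp)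
    finally have "b \<le> (norm (?x - (?x \<bullet> ?n) *\<^sub>R ?n))\<^sup>2"
      unfolding b_def using r1 r2 by (intro power_mono) auto
    also have "\<dots> = ?x \<bullet> ?x - (?x \<bullet> ?n)\<^sup>2"
      unfolding power2_norm_eq_inner
      by (simp add: inner_diff_left inner_diff_right power2_eq_square inner_commute)
    finally show ?thesis using zero_le_power2[of "?x \<bullet> ?n"] by linarith
  qed
  obtain s :: "real \<Rightarrow> real" where s: "smooth_on UNIV s" "\<And>x. 0 \<le> s x" "\<And>x. s x \<le> 1"
    "\<And>x. x \<le> b / 2 \<Longrightarrow> s x = 1" "\<And>x. b \<le> x \<Longrightarrow> s x = 0"
    using ex_smooth_step[of "b / 2" b] b by auto
  define \<phi> where "\<phi> q = s (?f q \<bullet> ?f q)" for q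
  have s\<phi>: "smooth_map \<A> \<phi>"
  proof (rule smooth_mapI)
    fix c' assume c': "c' \<in> \<A>"
    note op = chart_image_open[OF c']
    have "smooth_on (chart_image c') (\<lambda>u. F (chart_inv c' u) + - F (?i u0))"
      by (intro smooth_on_add op smooth_map_chart smooth_F c' smooth_on_const)
    then have f: "smooth_on (chart_image c') (\<lambda>u. ?f (chart_inv c' u))" by simp
    show "smooth_on (chart_image c') (\<lambda>u. \<phi> (chart_inv c' u))"
      unfolding \<phi>_def
      by (rule smooth_on_compose[OF op open_UNIV subset_UNIV smooth_on_bilinear[OF bounded_bilinear_inner op f f] s(1)])
  qed
  let ?U = "?i ` ball u0 r1" and ?V = "- ?i ` cball u0 r2"
  have sub: "ball u0 r1 \<subseteq> chart_image c" "cball u0 r2 \<subseteq> chart_image c"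
    using r1 r2 by (auto intro: subset_trans[OF _ r1(4)])
  have opU: "open ?U" by (rule open_chart_inv_image[OF c(1) open_ball sub(1)])
  have opV: "open ?V"
    using compact_imp_closed[OF compact_chart_inv_image[OF c(1) sub(2) compact_cball]] by (simp add: open_Compl)
  \<comment> \<open>\<open>F\<close> need not be injective, so \<open>\<phi>\<close> can be nonzero
    on distant sheets as well; it is cut off to the sheet at hand. On the overlap
    \<open>\<phi>\<close> is already zero.\<close>
  define \<beta> where "\<beta> q = (if q \<in> ?U then \<phi> q else 0)" for q
  have out: "\<beta> q = 0" if q: "q \<in> ?V" for q
  proof (cases "q \<in> ?U")
    case True
    then obtain u where u: "u \<in> ball u0 r1" "q = ?i u" by blast
    then have "u \<notin> cball u0 r2" using q by blast
    then show ?thesis using far[of u] u s(5) True by (simp add: \<beta>_def \<phi>_def)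
  qed (simp add: \<beta>_def)
  have UV: "?U \<union> ?V = UNIV" using r2 by force
  have sm: "smooth_map \<A> \<beta>"
  proof (rule smooth_mapI)
    fix c' assume c': "c' \<in> \<A>"
    note op = continuous_open_preimage[OF continuous_on_chart_inv[OF c'] chart_image_open[OF c']]
    let ?A = "chart_image c' \<inter> chart_inv c' -` ?U" and ?B = "chart_image c' \<inter> chart_inv c' -` ?V"
    have A: "open ?A" "smooth_on ?A (\<lambda>u. \<beta> (chart_inv c' u))"
    proof -
      show A: "open ?A" by (rule op[OF opU])
      have "smooth_on ?A (\<lambda>u. \<phi> (chart_inv c' u))"
        by (rule smooth_on_subset[OF smooth_map_chart[OF s\<phi> c']]) blast
      then show "smooth_on ?A (\<lambda>u. \<beta> (chart_inv c' u))"
        by (subst smooth_on_cong[OF A, of _ "\<lambda>u. \<phi> (chart_inv c' u)"]) (auto simp: \<beta>_def)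
    qed
    have B: "open ?B" "smooth_on ?B (\<lambda>u. \<beta> (chart_inv c' u))"
    proof -
      show B: "open ?B" by (rule op[OF opV])
      show "smooth_on ?B (\<lambda>u. \<beta> (chart_inv c' u))"
        by (subst smooth_on_cong[OF B, of _ "\<lambda>u. 0"]) (use out smooth_on_const[OF B] in auto)
    qed
    show "smooth_on (chart_image c') (\<lambda>u. \<beta> (chart_inv c' u))"
    proof (rule smooth_on_local)
      fix x assume "x \<in> chart_image c'"
      then have "x \<in> ?A \<or> x \<in> ?B" using UV by blast
      then show "\<exists>T. open T \<and> x \<in> T \<and> smooth_on T (\<lambda>u. \<beta> (chart_inv c' u))" using A B by blast
    qed
  qed
  \<comment> \<open>By the upper Lipschitz bound the squared distance is at most
    \<open>b / 2\<close> here, where the step function equals 1.\<close>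
  define r' where "r' = min r1 (sqrt (b / 2) / M)"
  have r': "r' > 0" "r' \<le> r1" using b r1 by (auto simp: r'_def)
  show thesis
  proof (rule that[OF sm])
    fix q
    show "0 \<le> \<beta> q" "\<beta> q \<le> 1" using s by (auto simp: \<beta>_def \<phi>_def)
    show "\<beta> q = 0" if q: "q \<notin> ?i ` (cball u0 r \<inter> chart_image c)"
    proof (rule out, rule ComplI)
      assume "q \<in> ?i ` cball u0 r2"
      moreover have "cball u0 r2 \<subseteq> cball u0 r \<inter> chart_image c" using r2(3) sub(2) by auto
      ultimately show False using q by blast
    qed
  next
    show "0 < r'" by (rule r')
    show "ball u0 r' \<subseteq> chart_image c" using r' sub(1) by (meson order_trans subset_ball)
    fix u assume u: "u \<in> ball u0 r'"
    then have u1: "u \<in> ball u0 r1" using r' by auto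
    have "norm (?f (?i u)) \<le> M * norm (u - u0)" by (rule up) (use u1 r1 in auto)
    also have "\<dots> \<le> M * (sqrt (b / 2) / M)"
      using u r1 by (intro mult_left_mono) (auto simp: r'_def dist_norm norm_minus_commute)
    also have "\<dots> = sqrt (b / 2)" using r1 by simp
    finally have "(norm (?f (?i u)))\<^sup>2 \<le> (sqrt (b / 2))\<^sup>2" by (rule power_mono) simp
    then have "?f (?i u) \<bullet> ?f (?i u) \<le> b / 2" using b by (simp add: power2_norm_eq_inner)
    then show "\<beta> (?i u) = 1" using s(4) u1 by (simp add: \<beta>_def \<phi>_def)
  qed
qed

end

section \<open>Integration against difference quotients\<close>

lemma integral_translate:
  fixes f :: "'a::euclidean_space \<Rightarrow> real"
  assumes f: "f \<in> borel_measurable borel"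
  shows "(\<integral>x. f (a + x) \<partial>lborel) = (\<integral>x. f x \<partial>lborel)"
    and "integrable lborel (\<lambda>x. f (a + x)) \<longleftrightarrow> integrable lborel f"
proof -
  have m: "(+) a \<in> lborel \<rightarrow>\<^sub>M (borel :: 'a measure)" by simp
  show "(\<integral>x. f (a + x) \<partial>lborel) = (\<integral>x. f x \<partial>lborel)"
    using integral_distr[OF m f] by (simp add: lborel_distr_plus)
  show "integrable lborel (\<lambda>x. f (a + x)) \<longleftrightarrow> integrable lborel f"
    using integrable_distr_eq[OF m f] by (simp add: lborel_distr_plus)
qed

lemma integrable_continuous_compact_support:
  fixes f :: "'a::euclidean_space \<Rightarrow> real"
  assumes "continuous_on UNIV f" "compact K" "\<And>x. x \<notin> K \<Longrightarrow> f x = 0"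
  shows "integrable lborel f"
proof -
  have "integrable lborel (\<lambda>x. indicator K x *\<^sub>R f x)"
    by (rule borel_integrable_compact[OF assms(2) continuous_on_subset[OF assms(1)]]) simp
  also have "(\<lambda>x. indicator K x *\<^sub>R f x) = f"
    using assms(3) by (auto simp: fun_eq_iff split: split_indicator)
  finally show ?thesis .
qed

lemma integrable_bounded_mult:
  fixes f g :: "'a \<Rightarrow> real"
  assumes "integrable M f" "g \<in> borel_measurable M" "\<And>x. \<bar>g x\<bar> \<le> B"
  shows "integrable M (\<lambda>x. g x * f x)"
proof (rule Bochner_Integration.integrable_bound)
  show "integrable M (\<lambda>x. B * f x)" using assms(1) by simp
  show "(\<lambda>x. g x * f x) \<in> borel_measurable M"
    using assms by (intro borel_measurable_times) auto
  have "0 \<le> B" using assms(3) order_trans[OF abs_ge_zero] by blast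
  then show "AE x in M. norm (g x * f x) \<le> norm (B * f x)"
    using assms(3) by (simp add: abs_mult mult_right_mono)
qed

text \<open>Translation invariance moves the difference quotient from \<open>G\<close> to
  \<open>\<phi>\<close>, which only has to be bounded and measurable. The slope bound
  \<open>L\<close> may depend on the point, and the error of second order \<open>M\<close>
  disappears in the limit.\<close>

lemma integral_directional_derivative_bound:
  fixes G \<phi> L :: "'a::euclidean_space \<Rightarrow> real"
  assumes G: "\<And>x. (G has_derivative G' x) (at x)" "continuous_on UNIV (\<lambda>x. G' x e)"
    and K: "compact K" "\<And>x. x \<notin> K \<Longrightarrow> G x = 0"
    and \<phi>: "\<phi> \<in> borel_measurable borel" "\<And>x. \<bar>\<phi> x\<bar> \<le> B"
    and L: "integrable lborel (\<lambda>x. \<bar>G x\<bar> * L x)"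
    and lip: "0 < t0" "\<And>x t. x \<in> K \<Longrightarrow> 0 < t \<Longrightarrow> t < t0 \<Longrightarrow> \<bar>\<phi> (x - t *\<^sub>R e) - \<phi> x\<bar> \<le> t * (L x + t * M)"
  shows "\<bar>\<integral>x. \<phi> x * G' x e \<partial>lborel\<bar> \<le> (\<integral>x. \<bar>G x\<bar> * L x \<partial>lborel)"
proof -
  \<comment> \<open>A null sequence staying below both \<open>t0\<close> and 1; the shift by 2 makes
    the first inequality strict from the start.\<close>
  define t where "t n = min t0 1 / real (n + 2)" for n
  have t: "0 < t n" "t n < t0" "t n \<le> 1" for n
  proof -
    show "0 < t n" using lip by (simp add: t_def)
    have "min t0 1 / real (n + 2) < min t0 1 / 1" using lip by (intro divide_strict_left_mono) auto
    then show "t n < t0" "t n \<le> 1" by (simp_all add: t_def)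
  qed
  have t0: "t \<longlonglongrightarrow> 0"
    unfolding t_def
    by (rule LIMSEQ_ignore_initial_segment[OF lim_const_over_n, of _ 2])
  obtain r where "\<And>x. x \<in> K \<Longrightarrow> norm x \<le> r"
    using compact_imp_bounded[OF K(1)] unfolding bounded_iff by auto
  then have r: "K \<subseteq> cball 0 r" by auto
  define C where "C = cball (0::'a) (r + norm e)"
  \<comment> \<open>The quotient is supported in radius \<open>r + norm e\<close>, and the
    intermediate point of the mean value theorem lies at most \<open>norm e\<close> further
    out.\<close>
  have "bounded ((\<lambda>x. G' x e) ` cball 0 (r + 2 * norm e))"
    by (intro compact_imp_bounded compact_continuous_image continuous_on_subset[OF G(2)]) auto
  then obtain D where "\<forall>x\<in>cball 0 (r + 2 * norm e). \<bar>G' x e\<bar> \<le> D"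
    unfolding bounded_iff by auto
  then have D: "\<bar>G' x e\<bar> \<le> D" if "x \<in> cball 0 (r + 2 * norm e)" for x using that by blast
  have cG: "continuous_on UNIV G"
    by (intro continuous_at_imp_continuous_on ballI has_derivative_continuous[OF G(1)])
  have mG: "G \<in> borel_measurable borel" by (rule borel_measurable_continuous_onI[OF cG])
  have iG: "integrable lborel G" by (rule integrable_continuous_compact_support[OF cG K])
  have \<phi>l: "\<phi> \<in> borel_measurable lborel" using \<phi>(1) by simp
  have i0: "integrable lborel (\<lambda>x. \<phi> x * G x)"
    by (rule integrable_bounded_mult[OF iG \<phi>l \<phi>(2)])
  have i1: "integrable lborel (\<lambda>x. \<phi> x * G (x + s *\<^sub>R e))" for s
  proof (rule integrable_bounded_mult[OF _ \<phi>l \<phi>(2)])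
    show "integrable lborel (\<lambda>x. G (x + s *\<^sub>R e))"
      using integral_translate(2)[OF mG, of "s *\<^sub>R e"] iG by (simp add: add.commute)
  qed
  have m2: "(\<lambda>x. \<phi> (x - s *\<^sub>R e) * G x) \<in> borel_measurable borel" for s
    using \<phi>(1) mG by measurable
  have i2: "integrable lborel (\<lambda>x. \<phi> (x - s *\<^sub>R e) * G x)" for s
    using integral_translate(2)[OF m2[of s], of "s *\<^sub>R e"] i1[of s] by (simp add: add.commute)
  have e2: "(\<integral>x. \<phi> x * G (x + s *\<^sub>R e) \<partial>lborel) = (\<integral>x. \<phi> (x - s *\<^sub>R e) * G x \<partial>lborel)" for s
    using integral_translate(1)[OF m2[of s], of "s *\<^sub>R e"] by (simp add: add.commute)
  define q where "q n x = \<phi> x * ((G (x + t n *\<^sub>R e) - G x) / t n)" for n x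
  have qeq: "q n = (\<lambda>x. inverse (t n) * (\<phi> x * G (x + t n *\<^sub>R e) - \<phi> x * G x))" for n
    by (simp add: q_def fun_eq_iff divide_inverse algebra_simps)
  have qm: "q n \<in> borel_measurable lborel" for n
    unfolding qeq
    by (intro borel_measurable_integrable integrable_mult_right Bochner_Integration.integrable_diff i1 i0)
  have lim: "(\<lambda>n. integral\<^sup>L lborel (q n)) \<longlonglongrightarrow> (\<integral>x. \<phi> x * G' x e \<partial>lborel)"
  proof (rule integral_dominated_convergence[where w="\<lambda>x. indicator C x *\<^sub>R (B * D)"])
    show "(\<lambda>x. \<phi> x * G' x e) \<in> borel_measurable lborel"
      using \<phi>(1) borel_measurable_continuous_onI[OF G(2)] by simp
    show "q n \<in> borel_measurable lborel" for n by (rule qm)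
    show "integrable lborel (\<lambda>x. indicator C x *\<^sub>R (B * D))"
      unfolding C_def by (intro borel_integrable_compact) auto
    show "AE x in lborel. (\<lambda>n. q n x) \<longlonglongrightarrow> \<phi> x * G' x e"
    proof (rule AE_I2)
      fix x
      have "((\<lambda>s. G (x + s *\<^sub>R e)) has_vector_derivative G' x e) (at 0)"
        by (rule line_has_real_derivative) (simp add: G)
      then have "((\<lambda>s. (G (x + s *\<^sub>R e) - G x) / s) \<longlongrightarrow> G' x e) (at 0)"
        by (simp add: has_real_derivative_iff_has_vector_derivative[symmetric] has_field_derivative_iff)
      then have "(\<lambda>n. (G (x + t n *\<^sub>R e) - G x) / t n) \<longlonglongrightarrow> G' x e"
        by (rule filterlim_compose) (use t0 t in \<open>auto simp: filterlim_at less_imp_neq[symmetric]\<close>)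
      then show "(\<lambda>n. q n x) \<longlonglongrightarrow> \<phi> x * G' x e" unfolding q_def by (intro tendsto_intros)
    qed
    show "AE x in lborel. norm (q n x) \<le> indicator C x *\<^sub>R (B * D)" for n
    proof (rule AE_I2)
      fix x
      show "norm (q n x) \<le> indicator C x *\<^sub>R (B * D)"
      proof (cases "x \<in> C")
        case True
        have d: "((\<lambda>s. G (x + s *\<^sub>R e)) has_real_derivative G' (x + s *\<^sub>R e) e) (at s)" for s
          unfolding has_real_derivative_iff_has_vector_derivative by (rule line_has_real_derivative) (rule G)
        obtain s where s: "0 < s" "s < t n" "G (x + t n *\<^sub>R e) - G (x + 0 *\<^sub>R e) = (t n - 0) * G' (x + s *\<^sub>R e) e"
          using MVT2[OF t(1)[of n], of "\<lambda>s. G (x + s *\<^sub>R e)" "\<lambda>s. G' (x + s *\<^sub>R e) e"] d by blast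
        have "norm (x + s *\<^sub>R e) \<le> norm x + \<bar>s\<bar> * norm e" using norm_triangle_ineq[of x "s *\<^sub>R e"] by simp
        also have "\<dots> \<le> (r + norm e) + 1 * norm e"
          using True s t(3)[of n] by (intro add_mono mult_right_mono) (auto simp: C_def)
        finally have D': "\<bar>G' (x + s *\<^sub>R e) e\<bar> \<le> D" by (intro D) simp
        have "q n x = \<phi> x * G' (x + s *\<^sub>R e) e" using s t(1)[of n] by (simp add: q_def)
        then show ?thesis
          using True mult_mono[OF \<phi>(2)[of x] D'] order_trans[OF abs_ge_zero \<phi>(2)[of x]] by (simp add: abs_mult)
      next
        case False
        have n: "norm x > r + norm e" using False by (simp add: C_def)
        have "norm (t n *\<^sub>R e) \<le> norm e" using t[of n] by (simp add: mult_left_le_one_le)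
        then have "norm (x + t n *\<^sub>R e) > r" using n norm_triangle_ineq2[of x "- (t n *\<^sub>R e)"] by simp
        then have "x + t n *\<^sub>R e \<notin> K" using r by auto
        moreover have "x \<notin> K"
        proof
          assume "x \<in> K"
          then have "norm x \<le> r" using r by auto
          then show False using n norm_ge_zero[of e] by linarith
        qed
        ultimately show ?thesis using K(2) False by (simp add: q_def)
      qed
    qed
  qed
  have bd: "\<bar>integral\<^sup>L lborel (q n)\<bar> \<le> (\<integral>x. \<bar>G x\<bar> * L x \<partial>lborel) + t n * (M * (\<integral>x. \<bar>G x\<bar> \<partial>lborel))" for n
  proof -
    have "integral\<^sup>L lborel (q n) = inverse (t n) * ((\<integral>x. \<phi> (x - t n *\<^sub>R e) * G x \<partial>lborel) - (\<integral>x. \<phi> x * G x \<partial>lborel))"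
      unfolding qeq using i1[of "t n"] i0 by (simp add: e2)
    also have "\<dots> = (\<integral>x. inverse (t n) * (\<phi> (x - t n *\<^sub>R e) * G x - \<phi> x * G x) \<partial>lborel)"
      using i2[of "t n"] i0 by simp
    also have "\<bar>\<dots>\<bar> \<le> (\<integral>x. \<bar>G x\<bar> * L x + t n * (M * \<bar>G x\<bar>) \<partial>lborel)"
    proof (rule integral_abs_bound[THEN order_trans], rule integral_mono)
      show "integrable lborel (\<lambda>x. \<bar>inverse (t n) * (\<phi> (x - t n *\<^sub>R e) * G x - \<phi> x * G x)\<bar>)"
        using i2[of "t n"] i0 by simp
      show "integrable lborel (\<lambda>x. \<bar>G x\<bar> * L x + t n * (M * \<bar>G x\<bar>))" using L iG by simp
      fix x
      show "\<bar>inverse (t n) * (\<phi> (x - t n *\<^sub>R e) * G x - \<phi> x * G x)\<bar> \<le> \<bar>G x\<bar> * L x + t n * (M * \<bar>G x\<bar>)"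
      proof (cases "x \<in> K")
        case True
        have "\<bar>inverse (t n) * (\<phi> (x - t n *\<^sub>R e) * G x - \<phi> x * G x)\<bar> = inverse (t n) * (\<bar>\<phi> (x - t n *\<^sub>R e) - \<phi> x\<bar> * \<bar>G x\<bar>)"
          using t(1)[of n] by (simp add: abs_mult left_diff_distrib[symmetric])
        also have "\<dots> \<le> inverse (t n) * ((t n * (L x + t n * M)) * \<bar>G x\<bar>)"
          using t(1)[of n] lip(2)[OF True t(1,2)] by (intro mult_left_mono mult_right_mono) auto
        also have "\<dots> = \<bar>G x\<bar> * L x + t n * (M * \<bar>G x\<bar>)"
          using t(1)[of n] by (simp add: field_simps)
        finally show ?thesis .
      qed (simp add: K(2))
    qed
    also have "\<dots> = (\<integral>x. \<bar>G x\<bar> * L x \<partial>lborel) + t n * (M * (\<integral>x. \<bar>G x\<bar> \<partial>lborel))"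
      using L iG by simp
    finally show ?thesis .
  qed
  have "(\<lambda>n. (\<integral>x. \<bar>G x\<bar> * L x \<partial>lborel) + t n * (M * (\<integral>x. \<bar>G x\<bar> \<partial>lborel))) \<longlonglongrightarrow>
      (\<integral>x. \<bar>G x\<bar> * L x \<partial>lborel) + 0 * (M * (\<integral>x. \<bar>G x\<bar> \<partial>lborel))"
    by (intro tendsto_intros t0)
  from LIMSEQ_le[OF tendsto_rabs[OF lim] this] bd show ?thesis by simp
qed

section \<open>The weak form of the weighted divergence theorem\<close>

context hypersurface
begin

text \<open>On the open set all components are zero, so each has a local minimum at \<open>q\<close>
  and its gradient vanishes there.\<close>

lemma drift_div_eq_0:
  assumes W: "open W" "q \<in> W" and V: "\<And>a. smooth_map \<A> (V a)" "\<And>a p. p \<in> W \<Longrightarrow> V a p = 0"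
  shows "drift_div V q = 0"
proof -
  have "\<delta> a (V a) q = 0" for a
    by (rule local_min_\<delta>(1)[OF V(1) W]) (simp add: V(2) W)
  then show ?thesis by (simp add: drift_div_def V(2) W)
qed

lemma smooth_drift_div: "(\<And>a. smooth_map \<A> (V a)) \<Longrightarrow> smooth_map \<A> (drift_div V)"
  unfolding drift_div_def[abs_def]
  by (intro smooth_map_add smooth_map_mult smooth_map_sum smooth_map_const smooth_map_\<delta> smooth_F_nth) auto

definition field :: "('k \<Rightarrow> 'm \<Rightarrow> real) \<Rightarrow> 'm \<Rightarrow> real^'k" where
  "field V p = (\<chi> a. V a p)"

lemma continuous_field: "(\<And>a. smooth_map \<A> (V a)) \<Longrightarrow> continuous_on UNIV (field V)"
  unfolding field_def[abs_def] by (intro continuous_on_vec_lambda smooth_map_continuous) auto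

end

section \<open>Integration in charts and Lipschitz cutoffs\<close>

locale measured_hypersurface = hypersurface \<A> F \<nu>
  for \<A> :: "('m::{t2_space,second_countable_topology}, 'n::finite) chart set"
    and F \<nu> :: "'m \<Rightarrow> real^'k" +
  fixes \<sigma> :: "'m measure" and p0 :: 'm
  assumes vol: "volume_measure \<A> F \<sigma>" and con: "connected (UNIV :: 'm set)" and proper: "properly_immersed F"
begin

lemma sets_\<sigma> [simp, measurable_cong]: "sets \<sigma> = sets borel"
  using vol by (simp add: volume_measure_def)

lemma space_\<sigma> [simp]: "space \<sigma> = UNIV"
  using sets_eq_imp_space_eq[OF sets_\<sigma>] by simp

lemma measurable_to_\<sigma>: "f \<in> measurable N \<sigma> \<longleftrightarrow> f \<in> measurable N borel"
  by (simp only: measurable_cong_sets[OF refl sets_\<sigma>])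

lemma measurable_from_\<sigma>: "f \<in> measurable \<sigma> N \<longleftrightarrow> f \<in> measurable borel N"
  by (simp only: measurable_cong_sets[OF sets_\<sigma> refl])

lemma emeasure_\<sigma>:
  "c \<in> \<A> \<Longrightarrow> B \<in> sets borel \<Longrightarrow> B \<subseteq> fst c \<Longrightarrow>
     emeasure \<sigma> B = (\<integral>\<^sup>+u. ennreal (vol_density c u) * indicator (snd c ` B) u \<partial>lborel)"
  using vol unfolding volume_measure_def vol_density_def by blast

definition chart_density :: "('m, 'n) chart \<Rightarrow> real^'n \<Rightarrow> real" where
  "chart_density c u = indicator (chart_image c) u *\<^sub>R vol_density c u"

text \<open>Total and Borel measurable on coordinate space. The dummy value \<open>p0\<close>
  outside the chart carries no mass, because \<open>chart_density\<close> is zero there.\<close>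

definition chart_map :: "('m, 'n) chart \<Rightarrow> real^'n \<Rightarrow> 'm" where
  "chart_map c u = (if u \<in> chart_image c then chart_inv c u else p0)"

lemma chart_density_nonneg: "c \<in> \<A> \<Longrightarrow> 0 \<le> chart_density c u"
  using vol_density_pos[of c u] by (auto simp: chart_density_def less_imp_le split: split_indicator)

lemma chart_density_measurable: "c \<in> \<A> \<Longrightarrow> chart_density c \<in> borel_measurable borel"
  unfolding chart_density_def[abs_def]
  by (intro borel_measurable_continuous_on_indicator borel_open chart_image_open
      smooth_on_imp_continuous_on smooth_on_vol_density)

lemma chart_map_measurable: "c \<in> \<A> \<Longrightarrow> chart_map c \<in> borel_measurable borel"
proof (rule borel_measurableI)
  fix T :: "'m set" assume c: "c \<in> \<A>" and T: "open T"
  have "open (chart_image c \<inter> chart_inv c -` T)"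
    by (rule continuous_open_preimage[OF continuous_on_chart_inv[OF c] chart_image_open[OF c] T])
  moreover have "chart_map c -` T = (chart_image c \<inter> chart_inv c -` T) \<union> (if p0 \<in> T then - chart_image c else {})"
    by (auto simp: chart_map_def split: if_splits)
  moreover have "chart_image c \<in> sets borel" by (rule borel_open[OF chart_image_open[OF c]])
  ultimately show "chart_map c -` T \<inter> space borel \<in> sets borel" by auto
qed

text \<open>Turns the condition on Borel sets in \<open>volume_measure\<close> into an equality of
  measures, from which the change of variables for integrals follows.\<close>

lemma chart_measure:
  assumes c: "c \<in> \<A>"
  shows "density \<sigma> (\<lambda>p. ennreal (indicator (fst c) p)) = distr (density lborel (\<lambda>u. ennreal (chart_density c u))) \<sigma> (chart_map c)"
proof (rule measure_eqI)
  note m = chart_density_measurable[OF c] chart_map_measurable[OF c]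
  have fc: "fst c \<in> sets borel" by (rule borel_open[OF chart_open[OF c]])
  have m2: "chart_map c \<in> density lborel (\<lambda>u. ennreal (chart_density c u)) \<rightarrow>\<^sub>M \<sigma>"
    unfolding measurable_to_\<sigma> using m(2) by simp
  fix B assume "B \<in> sets (density \<sigma> (\<lambda>p. ennreal (indicator (fst c) p)))"
  then have B: "B \<in> sets borel" by simp
  have pre: "chart_map c -` B \<in> sets borel"
    using measurable_sets[OF m(2) B] by simp
  have "emeasure (density \<sigma> (\<lambda>p. ennreal (indicator (fst c) p))) B = (\<integral>\<^sup>+p. indicator (B \<inter> fst c) p \<partial>\<sigma>)"
  proof (subst emeasure_density)
    show "(\<lambda>p. ennreal (indicator (fst c) p)) \<in> borel_measurable \<sigma>" "B \<in> sets \<sigma>" using B fc by simp_all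
    show "(\<integral>\<^sup>+p. ennreal (indicator (fst c) p) * indicator B p \<partial>\<sigma>) = (\<integral>\<^sup>+p. indicator (B \<inter> fst c) p \<partial>\<sigma>)"
      by (rule nn_integral_cong) (simp split: split_indicator)
  qed
  also have "\<dots> = emeasure \<sigma> (B \<inter> fst c)" using B fc by simp
  also have "\<dots> = (\<integral>\<^sup>+u. ennreal (vol_density c u) * indicator (snd c ` (B \<inter> fst c)) u \<partial>lborel)"
    using B fc by (intro emeasure_\<sigma> c) auto
  also have "\<dots> = (\<integral>\<^sup>+u. ennreal (chart_density c u) * indicator (chart_map c -` B) u \<partial>lborel)"
  proof (rule nn_integral_cong)
    fix u
    have "u \<in> snd c ` (B \<inter> fst c) \<longleftrightarrow> u \<in> chart_image c \<and> chart_map c u \<in> B"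
    proof
      assume "u \<in> snd c ` (B \<inter> fst c)"
      then obtain p where p: "p \<in> B" "p \<in> fst c" "u = snd c p" by blast
      then show "u \<in> chart_image c \<and> chart_map c u \<in> B" using c by (simp add: chart_map_def)
    next
      assume u: "u \<in> chart_image c \<and> chart_map c u \<in> B"
      then show "u \<in> snd c ` (B \<inter> fst c)"
        using c by (intro image_eqI[of _ _ "chart_inv c u"]) (auto simp: chart_map_def)
    qed
    then show "ennreal (vol_density c u) * indicator (snd c ` (B \<inter> fst c)) u =
        ennreal (chart_density c u) * indicator (chart_map c -` B) u"
      by (auto simp: chart_density_def split: split_indicator)
  qed
  also have "\<dots> = emeasure (density lborel (\<lambda>u. ennreal (chart_density c u))) (chart_map c -` B)"
    using m(1) pre by (subst emeasure_density) auto
  also have "\<dots> = emeasure (distr (density lborel (\<lambda>u. ennreal (chart_density c u))) \<sigma> (chart_map c)) B"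
    using B by (subst emeasure_distr[OF m2]) auto
  finally show "emeasure (density \<sigma> (\<lambda>p. ennreal (indicator (fst c) p))) B = \<dots>" .
qed simp

lemma integral_chart:
  fixes f :: "'m \<Rightarrow> real"
  assumes c: "c \<in> \<A>" and f: "f \<in> borel_measurable borel" "\<And>p. p \<notin> fst c \<Longrightarrow> f p = 0"
  shows "(\<integral>p. f p \<partial>\<sigma>) = (\<integral>u. chart_density c u * f (chart_map c u) \<partial>lborel)"
proof -
  note m = chart_density_measurable[OF c] chart_map_measurable[OF c]
  have fc: "fst c \<in> sets borel" by (rule borel_open[OF chart_open[OF c]])
  have m2: "chart_map c \<in> density lborel (\<lambda>u. ennreal (chart_density c u)) \<rightarrow>\<^sub>M \<sigma>"
    unfolding measurable_to_\<sigma> using m(2) by simp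
  have f\<sigma>: "f \<in> borel_measurable \<sigma>" using f(1) by (simp only: measurable_from_\<sigma>)
  have "(\<integral>p. f p \<partial>\<sigma>) = (\<integral>p. indicator (fst c) p *\<^sub>R f p \<partial>\<sigma>)"
    using f(2) by (intro Bochner_Integration.integral_cong) (auto split: split_indicator)
  also have "\<dots> = (\<integral>p. f p \<partial>density \<sigma> (\<lambda>p. ennreal (indicator (fst c) p)))"
    using f\<sigma> fc by (subst integral_density) auto
  also have "\<dots> = (\<integral>u. f (chart_map c u) \<partial>density lborel (\<lambda>u. ennreal (chart_density c u)))"
    unfolding chart_measure[OF c] by (rule integral_distr[OF m2 f\<sigma>])
  also have "\<dots> = (\<integral>u. chart_density c u *\<^sub>R f (chart_map c u) \<partial>lborel)"
  proof (rule integral_density)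
    show "(\<lambda>u. f (chart_map c u)) \<in> borel_measurable lborel" using measurable_compose[OF m(2) f(1)] by simp
    show "chart_density c \<in> borel_measurable lborel" using m(1) by simp
    show "AE u in lborel. 0 \<le> chart_density c u" using chart_density_nonneg[OF c] by simp
  qed
  finally show ?thesis by simp
qed

lemma emeasure_chart_ball_finite:
  assumes c: "c \<in> \<A>" and r: "cball u r \<subseteq> chart_image c"
  shows "emeasure \<sigma> (chart_inv c ` ball u r) < \<infinity>"
proof -
  have sub: "ball u r \<subseteq> chart_image c" using r by auto
  have "continuous_on (cball u r) (vol_density c)"
    by (rule continuous_on_subset[OF smooth_on_imp_continuous_on[OF smooth_on_vol_density[OF c]] r])
  then have i: "integrable lborel (\<lambda>x. indicator (cball u r) x *\<^sub>R vol_density c x)"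
    by (rule borel_integrable_compact[OF compact_cball])
  have eq: "snd c ` (chart_inv c ` ball u r) = ball u r"
    using sub c by (force simp: image_image)
  have "emeasure \<sigma> (chart_inv c ` ball u r) = (\<integral>\<^sup>+x. ennreal (vol_density c x) * indicator (ball u r) x \<partial>lborel)"
    using borel_open[OF open_chart_inv_image[OF c open_ball sub]] sub c
    by (subst emeasure_\<sigma>[OF c]) (auto simp only: eq, auto)
  also have "\<dots> \<le> (\<integral>\<^sup>+x. ennreal (norm (indicator (cball u r) x *\<^sub>R vol_density c x)) \<partial>lborel)"
    by (intro nn_integral_mono) (auto simp: abs_mult intro!: ennreal_leI split: split_indicator)
  also have "\<dots> < \<infinity>" using i unfolding integrable_iff_bounded by blast
  finally show ?thesis .
qed

lemma emeasure_compact_finite: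
  assumes K: "compact K"
  shows "emeasure \<sigma> K < \<infinity>"
proof -
  have "\<exists>U. open U \<and> p \<in> U \<and> emeasure \<sigma> U < \<infinity>" for p
  proof -
    obtain c where c: "c \<in> \<A>" "p \<in> fst c" by (rule ex_chart)
    obtain r where r: "r > 0" "cball (snd c p) r \<subseteq> chart_image c"
      using chart_image_open[OF c(1)] chart_in_image[OF c(2)] unfolding open_contains_cball by blast
    have sub: "ball (snd c p) r \<subseteq> chart_image c" using r(2) by auto
    have "p \<in> chart_inv c ` ball (snd c p) r" by (rule image_eqI[of _ _ "snd c p"]) (use c r in auto)
    then show ?thesis
      using open_chart_inv_image[OF c(1) open_ball sub] emeasure_chart_ball_finite[OF c(1) r(2)] by blast
  qed
  then obtain U where U: "\<And>p. open (U p)" "\<And>p. p \<in> U p" "\<And>p. emeasure \<sigma> (U p) < \<infinity>" by metis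
  obtain D where D: "D \<subseteq> K" "finite D" "K \<subseteq> (\<Union>p\<in>D. U p)"
    by (rule compactE_image[OF K, of K U]) (use U in auto)
  have "emeasure \<sigma> K \<le> emeasure \<sigma> (\<Union>p\<in>D. U p)"
    by (rule emeasure_mono[OF D(3)]) (use U D in \<open>auto intro!: borel_open\<close>)
  also have "\<dots> \<le> (\<Sum>p\<in>D. emeasure \<sigma> (U p))"
    by (rule emeasure_subadditive_finite[OF D(2)]) (use U in \<open>auto intro!: borel_open\<close>)
  also have "\<dots> < \<infinity>" using U(3) D(2) by (auto simp: less_top[symmetric])
  finally show ?thesis .
qed

lemma integrable_compact_support:
  fixes f :: "'m \<Rightarrow> real"
  assumes f: "continuous_on UNIV f" and K: "compact K" "\<And>p. p \<notin> K \<Longrightarrow> f p = 0"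
  shows "integrable \<sigma> f"
proof -
  have "bounded (f ` K)" by (intro compact_imp_bounded compact_continuous_image continuous_on_subset[OF f] K) simp
  then obtain B where "\<forall>p\<in>K. \<bar>f p\<bar> \<le> B" unfolding bounded_iff by auto
  then have B: "norm (f p) \<le> norm (indicator K p *\<^sub>R B)" for p
    using K(2)[of p] by (cases "p \<in> K") force+
  show ?thesis
  proof (rule Bochner_Integration.integrable_bound)
    show "integrable \<sigma> (\<lambda>p. indicator K p *\<^sub>R B)"
      by (intro integrable_scaleR_left integrable_real_indicator emeasure_compact_finite K)
         (use borel_closed[OF compact_imp_closed[OF K(1)]] in simp)
    show "f \<in> borel_measurable \<sigma>" using borel_measurable_continuous_onI[OF f] by (simp only: measurable_from_\<sigma>)
    show "AE p in \<sigma>. norm (f p) \<le> norm (indicator K p *\<^sub>R B)" using B by (rule AE_I2)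
  qed
qed

text \<open>Equal to 1 on the ball of radius \<open>R\<close>, to 0 outside radius
  \<open>2 * R\<close>, with slope \<open>1 / R\<close> in the geodesic distance.\<close>

definition \<eta> :: "real \<Rightarrow> 'm \<Rightarrow> real" where
  "\<eta> R p = max 0 (min 1 (2 - geodesic_dist \<A> F p0 p / R))"

lemma \<eta>_range: "0 \<le> \<eta> R p" "\<eta> R p \<le> 1"
  by (auto simp: \<eta>_def)

lemma continuous_\<eta>: "R > 0 \<Longrightarrow> continuous_on UNIV (\<eta> R)"
  unfolding \<eta>_def[abs_def] by (intro continuous_intros continuous_geodesic_dist con) auto

lemma \<eta>_eq_0: "R > 0 \<Longrightarrow> 2 * R \<le> geodesic_dist \<A> F p0 p \<Longrightarrow> \<eta> R p = 0"
  by (simp add: \<eta>_def field_simps)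

lemma \<eta>_eq_1: "R > 0 \<Longrightarrow> geodesic_dist \<A> F p0 p \<le> R \<Longrightarrow> \<eta> R p = 1"
  by (simp add: \<eta>_def field_simps)

lemma \<eta>_compact:
  assumes "R > 0"
  shows "compact (F -` cball (F p0) (2 * R))" "p \<notin> F -` cball (F p0) (2 * R) \<Longrightarrow> \<eta> R p = 0"
proof -
  show "compact (F -` cball (F p0) (2 * R))" using proper by (simp add: properly_immersed_def)
  assume "p \<notin> F -` cball (F p0) (2 * R)"
  then have "2 * R < norm (F p - F p0)" by (simp add: dist_norm norm_minus_commute)
  also have "\<dots> \<le> geodesic_dist \<A> F p0 p" by (rule norm_F_le_geodesic_dist[OF con])
  finally show "\<eta> R p = 0" using assms by (intro \<eta>_eq_0) auto
qed

text \<open>Factoring the difference of squares leaves one factor \<open>\<eta> R q\<close> in the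
  term of first order. This factor is what later permits absorption into the integral of the
  divergence.\<close>

lemma \<eta>_sq_lipschitz:
  assumes R: "R > 0" and d: "\<bar>geodesic_dist \<A> F p0 p - geodesic_dist \<A> F p0 q\<bar> \<le> 2 * t"
  shows "\<bar>(\<eta> R p)\<^sup>2 - (\<eta> R q)\<^sup>2\<bar> \<le> t * (4 / R * \<eta> R q + t * (4 / R\<^sup>2))"
proof -
  have "\<bar>geodesic_dist \<A> F p0 p / R - geodesic_dist \<A> F p0 q / R\<bar> \<le> 2 * t / R"
    using R d by (simp add: diff_divide_distrib[symmetric] divide_right_mono)
  then have l: "\<bar>\<eta> R p - \<eta> R q\<bar> \<le> 2 * t / R"
    unfolding \<eta>_def by (auto simp: abs_le_iff max_def min_def)
  have "\<eta> R p + \<eta> R q \<le> 2 * \<eta> R q + 2 * t / R" using l by linarith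
  then have "\<bar>\<eta> R p - \<eta> R q\<bar> * (\<eta> R p + \<eta> R q) \<le> (2 * t / R) * (2 * \<eta> R q + 2 * t / R)"
    using l \<eta>_range by (intro mult_mono) auto
  also have "\<bar>\<eta> R p - \<eta> R q\<bar> * (\<eta> R p + \<eta> R q) = \<bar>(\<eta> R p)\<^sup>2 - (\<eta> R q)\<^sup>2\<bar>"
    using \<eta>_range[of R p] \<eta>_range[of R q] by (simp add: square_diff_square_factored power2_eq_square abs_mult mult.commute)
  finally show ?thesis using R by (simp add: field_simps power2_eq_square)
qed

definition div_integral :: "real \<Rightarrow> ('k \<Rightarrow> 'm \<Rightarrow> real) \<Rightarrow> real" where
  "div_integral R V = (\<integral>p. (\<eta> R p)\<^sup>2 * drift_div V p * weight p \<partial>\<sigma>)"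

definition norm_integral :: "real \<Rightarrow> ('k \<Rightarrow> 'm \<Rightarrow> real) \<Rightarrow> real" where
  "norm_integral R V = (\<integral>p. \<eta> R p * norm (field V p) * weight p \<partial>\<sigma>)"

lemma continuous_div_integrand:
  "R > 0 \<Longrightarrow> (\<And>a. smooth_map \<A> (V a)) \<Longrightarrow> continuous_on UNIV (\<lambda>p. (\<eta> R p)\<^sup>2 * drift_div V p * weight p)"
  by (intro continuous_intros continuous_\<eta> smooth_map_continuous smooth_drift_div smooth_weight) auto

lemma continuous_norm_integrand:
  "R > 0 \<Longrightarrow> (\<And>a. smooth_map \<A> (V a)) \<Longrightarrow> continuous_on UNIV (\<lambda>p. \<eta> R p * norm (field V p) * weight p)"
  by (intro continuous_intros continuous_\<eta> continuous_field smooth_map_continuous smooth_weight) auto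

lemma div_integrable:
  "R > 0 \<Longrightarrow> (\<And>a. smooth_map \<A> (V a)) \<Longrightarrow> integrable \<sigma> (\<lambda>p. (\<eta> R p)\<^sup>2 * drift_div V p * weight p)"
  by (rule integrable_compact_support[OF continuous_div_integrand \<eta>_compact(1)]) (auto simp: \<eta>_compact(2))

lemma norm_integrable:
  "R > 0 \<Longrightarrow> (\<And>a. smooth_map \<A> (V a)) \<Longrightarrow> integrable \<sigma> (\<lambda>p. \<eta> R p * norm (field V p) * weight p)"
  by (rule integrable_compact_support[OF continuous_norm_integrand \<eta>_compact(1)]) (auto simp: \<eta>_compact(2))

text \<open>Freezing the frame at the centre of a small chart ball costs at most the factor 2 in
  each norm.\<close>

lemma local_frame_comparison:
  assumes c: "c \<in> \<A>" "u0 \<in> chart_image c"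
  obtains r where "r > 0" "cball u0 r \<subseteq> chart_image c"
    "\<And>u v. u \<in> cball u0 r \<Longrightarrow> norm (dF c u v) \<le> 2 * norm (dF c u0 v)"
    "\<And>u v. u \<in> cball u0 r \<Longrightarrow> norm (dF c u0 v) \<le> 2 * norm (dF c u v)"
proof -
  obtain B where B: "B > 0" "\<And>v. B * norm v \<le> norm (dF c u0 v)"
    using linear_inj_bounded_below_pos[OF linear_dF[OF c] inj_dF[OF c]] by blast
  obtain r where r: "r > 0" "cball u0 r \<subseteq> chart_image c"
    "\<And>u v. u \<in> cball u0 r \<Longrightarrow> norm (dF c u v - dF c u0 v) \<le> (B / 2) * norm v"
    using dF_close[OF c, of "B / 2"] B(1) by auto
  have close: "norm (dF c u v - dF c u0 v) \<le> norm (dF c u0 v) / 2" if "u \<in> cball u0 r" for u v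
    using r(3)[OF that, of v] B(2)[of v] by simp
  show thesis
  proof (rule that[OF r(1,2)])
    fix u v assume u: "u \<in> cball u0 r"
    show "norm (dF c u v) \<le> 2 * norm (dF c u0 v)"
      using close[OF u, of v] norm_triangle_sub[of "dF c u v" "dF c u0 v"] norm_ge_zero[of "dF c u0 v"] by linarith
    show "norm (dF c u0 v) \<le> 2 * norm (dF c u v)"
      using close[OF u, of v] norm_triangle_sub[of "dF c u0 v" "dF c u v"] by (simp add: norm_minus_commute)
  qed
qed

end

context measured_hypersurface
begin

definition tangential :: "('k \<Rightarrow> 'm \<Rightarrow> real) \<Rightarrow> bool" where
  "tangential V \<longleftrightarrow> (\<forall>a. smooth_map \<A> (V a)) \<and> (\<forall>p. (\<Sum>a\<in>UNIV. V a p * \<nu> p $ a) = 0)"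

lemma tangentialD: "tangential V \<Longrightarrow> smooth_map \<A> (V a)" "tangential V \<Longrightarrow> (\<Sum>a\<in>UNIV. V a p * \<nu> p $ a) = 0"
  by (simp_all add: tangential_def)

lemma weak_divergence_supported:
  assumes c: "c \<in> \<A>" "u0 \<in> chart_image c" and r: "r > 0" "cball u0 r \<subseteq> chart_image c"
    and le1: "\<And>u v. u \<in> cball u0 r \<Longrightarrow> norm (dF c u v) \<le> 2 * norm (dF c u0 v)"
    and le2: "\<And>u v. u \<in> cball u0 r \<Longrightarrow> norm (dF c u0 v) \<le> 2 * norm (dF c u v)"
    and V: "tangential V" and supp: "\<And>p a. p \<notin> chart_inv c ` cball u0 (r / 2) \<Longrightarrow> V a p = 0"
    and R: "R > 0"
  shows "\<bar>div_integral R V\<bar> \<le> 8 * real CARD('n) / R * norm_integral R V"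
proof -
  let ?i = "chart_inv c" and ?B = "ball u0 r" and ?K = "cball u0 (r / 2)" and ?T = "dF c u0" and ?\<rho> = "weighted_density c"
  note op = chart_image_open[OF c(1)]
  have B: "?B \<subseteq> chart_image c" using r(2) ball_subset_cball by blast
  have KB: "?K \<subseteq> ?B" using r(1) by auto
  have K: "?K \<subseteq> chart_image c" using KB B by blast
  have cK: "closed (?i ` ?K)" by (rule compact_imp_closed[OF compact_chart_inv_image[OF c(1) K compact_cball]])
  have nK: "?i u \<notin> ?i ` ?K" if u: "u \<in> chart_image c" "u \<notin> ?K" for u
  proof
    assume "?i u \<in> ?i ` ?K"
    then obtain u' where u': "u' \<in> ?K" "?i u = ?i u'" by blast
    then have "u = u'" using u(1) K c(1) by (metis chart_apply_inv subsetD)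
    then show False using u' u by simp
  qed
  obtain E :: "'n \<Rightarrow> real^'n \<Rightarrow> real^'n" where E: "\<And>i. smooth_on (chart_image c) (E i)"
    "\<And>u i j. u \<in> chart_image c \<Longrightarrow> dF c u (E i u) \<bullet> dF c u (E j u) = (if i = j then 1 else 0)"
    using ex_frame[OF c(1)] by blast
  obtain X where X: "smooth_on (chart_image c) X" "\<forall>u\<in>chart_image c. dF c u (X u) = (\<chi> a. V a (?i u))"
    "\<forall>u\<in>chart_image c. \<forall>w\<in>chart_image c. ?\<rho> u * drift_div V (?i u) =
       (\<Sum>j\<in>UNIV. dF c w (frechet_derivative (\<lambda>x. ?\<rho> x *\<^sub>R X x) (at u) (E j w)) \<bullet> dF c w (E j w))"
    by (rule exE[OF drift_div_chart[OF c(1) E tangentialD[OF V]]]) (assumption, elim conjE, rule that, assumption+)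
  note X = X(1) bspec[OF X(2)] bspec[OF bspec[OF X(3)]]
  have X0: "X u = 0" if u: "u \<in> chart_image c" "u \<notin> ?K" for u
  proof -
    have "dF c u (X u) = 0"
      unfolding X(2)[OF u(1)] by (simp add: vec_eq_iff supp[OF nK[OF u]])
    also have "0 = dF c u 0" by (rule linear_0[OF linear_dF[OF c(1) u(1)], symmetric])
    finally show ?thesis using inj_dF[OF c(1) u(1)] by (rule injD[rotated])
  qed
  \<comment> \<open>The coordinate field times the weighted density, extended by zero; its Euclidean
    divergence is the weighted divergence times the density.\<close>
  define Y where "Y u = (if u \<in> ?B then ?\<rho> u *\<^sub>R X u else 0)" for u
  have Y0: "Y u = 0" if "u \<notin> ?K" for u using X0 that B by (auto simp: Y_def)
  have sB: "smooth_on ?B (\<lambda>x. ?\<rho> x *\<^sub>R X x)"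
    by (intro smooth_on_bilinear[OF bounded_bilinear_scaleR] open_ball
        smooth_on_subset[OF smooth_on_weighted_density[OF c(1)] B] smooth_on_subset[OF X(1) B])
  have sY: "smooth_on UNIV Y"
  proof (rule smooth_on_local)
    fix x
    have 1: "smooth_on ?B Y" by (subst smooth_on_cong[OF open_ball, of _ _ Y]) (use sB in \<open>auto simp: Y_def\<close>)
    have o: "open (- ?K)" by (simp add: open_Compl)
    have 2: "smooth_on (- ?K) Y"
      by (subst smooth_on_cong[OF o, of Y "\<lambda>u. 0"]) (use Y0 smooth_on_const[OF o] in auto)
    have "x \<in> ?B \<or> x \<in> - ?K" using KB by blast
    then show "\<exists>T. open T \<and> x \<in> T \<and> smooth_on T Y" using 1 2 o open_ball by blast
  qed
  let ?D = "\<lambda>u. frechet_derivative Y (at u)"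
  have DB: "?D u = frechet_derivative (\<lambda>x. ?\<rho> x *\<^sub>R X x) (at u)" if "u \<in> ?B" for u
    by (rule frechet_derivative_cong_open[OF open_ball that]) (simp add: Y_def)
  have DK: "?D u v = 0" if "u \<notin> ?K" for u v
  proof -
    have "?D u = frechet_derivative (\<lambda>x. 0) (at u)"
      by (rule frechet_derivative_cong_open[of "- ?K"]) (use that Y0 in \<open>auto simp: open_Compl\<close>)
    then show ?thesis by simp
  qed
  define e where "e j = E j u0" for j
  have on: "?T (e i) \<bullet> ?T (e j) = (if i = j then 1 else 0)" for i j unfolding e_def by (rule E(2)[OF c(2)])
  have ne: "norm (?T (e j)) = 1" for j using on[of j j] by (simp add: norm_eq_1)
  have bT: "bounded_linear ?T" using linear_dF[OF c] linear_conv_bounded_linear by blast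
  \<comment> \<open>Components of \<open>Y\<close> in the frame frozen at \<open>u0\<close>. By
    \<open>drift_div_chart\<close> the frame of the centre computes the divergence at every point of
    the ball.\<close>
  define G where "G j u = ?T (Y u) \<bullet> ?T (e j)" for j u
  define G' where "G' j u v = ?T (?D u v) \<bullet> ?T (e j)" for j u v
  have dG: "(G j has_derivative G' j u) (at u)" for j u
    unfolding G_def[abs_def] G'_def[abs_def]
    by (intro has_derivative_inner_left bounded_linear.has_derivative[OF bT] smooth_on_has_derivative[OF sY] UNIV_I)
  have cG': "continuous_on UNIV (\<lambda>u. G' j u v)" for j v
    unfolding G'_def
    by (intro continuous_intros bounded_linear.continuous_on[OF bT] smooth_on_imp_continuous_on smooth_on_frechet_derivative sY)
  have cG: "continuous_on UNIV (G j)" for j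
    unfolding G_def
    by (intro continuous_intros bounded_linear.continuous_on[OF bT] smooth_on_imp_continuous_on sY)
  have G0: "G j u = 0" if "u \<notin> ?K" for j u by (simp add: G_def Y0[OF that] linear_0[OF linear_dF[OF c]])
  have G'0: "G' j u v = 0" if "u \<notin> ?K" for j u v by (simp add: G'_def DK[OF that] linear_0[OF linear_dF[OF c]])
  have iG: "integrable lborel (\<lambda>u. \<bar>G j u\<bar>)" for j
    by (rule integrable_abs[OF integrable_continuous_compact_support[OF cG compact_cball G0]])
  have iG': "integrable lborel (\<lambda>u. G' j u v)" for j v
    by (rule integrable_continuous_compact_support[OF cG' compact_cball G'0])
  have c\<eta>: "continuous_on ?B (\<lambda>u. \<eta> R (?i u))"
    by (rule continuous_on_compose2[OF continuous_\<eta>[OF R] continuous_on_subset[OF continuous_on_chart_inv[OF c(1)] B]]) simp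
  define \<phi> where "\<phi> u = indicator ?B u *\<^sub>R (\<eta> R (?i u))\<^sup>2" for u
  define L where "L u = indicator ?B u *\<^sub>R (4 / R * \<eta> R (?i u))" for u
  have m\<phi>: "\<phi> \<in> borel_measurable borel"
    unfolding \<phi>_def[abs_def] by (intro borel_measurable_continuous_on_indicator continuous_intros c\<eta>) simp
  have mL: "L \<in> borel_measurable borel"
    unfolding L_def[abs_def] by (intro borel_measurable_continuous_on_indicator continuous_intros c\<eta>) simp
  have b\<phi>: "\<bar>\<phi> u\<bar> \<le> 1" for u
    using \<eta>_range[of R "?i u"] by (simp add: \<phi>_def power_le_one split: split_indicator)
  have bL: "\<bar>L u\<bar> \<le> 4 / R" for u
    using \<eta>_range[of R "?i u"] R by (simp add: L_def field_simps abs_mult split: split_indicator)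
  have iL: "integrable lborel (\<lambda>u. \<bar>G j u\<bar> * L u)" for j
    using integrable_bounded_mult[OF iG[of j] _ bL] mL by (simp add: mult.commute)
  define N where "N u = indicator ?K u *\<^sub>R (vol_density c u * (\<eta> R (?i u) * norm (field V (?i u)) * weight (?i u)))" for u
  have iN: "integrable lborel N"
    unfolding N_def[abs_def]
  proof (rule borel_integrable_compact[OF compact_cball], rule continuous_on_mult)
    show "continuous_on ?K (vol_density c)"
      by (rule continuous_on_subset[OF smooth_on_imp_continuous_on[OF smooth_on_vol_density[OF c(1)]] K])
    show "continuous_on ?K (\<lambda>u. \<eta> R (?i u) * norm (field V (?i u)) * weight (?i u))"
      by (rule continuous_on_compose2[OF continuous_norm_integrand[OF R tangentialD(1)[OF V]]
            continuous_on_subset[OF continuous_on_chart_inv[OF c(1)] K]]) simp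
  qed
  have Neq: "norm_integral R V = (\<integral>u. N u \<partial>lborel)"
    unfolding norm_integral_def
  proof (subst integral_chart[OF c(1)])
    show "(\<lambda>p. \<eta> R p * norm (field V p) * weight p) \<in> borel_measurable borel"
      by (rule borel_measurable_continuous_onI[OF continuous_norm_integrand[OF R tangentialD(1)[OF V]]])
    show "\<eta> R p * norm (field V p) * weight p = 0" if p: "p \<notin> fst c" for p
    proof -
      have "p \<notin> ?i ` ?K" using p K chart_inv_in[OF c(1)] by blast
      then have "field V p = 0" by (simp add: field_def vec_eq_iff supp)
      then show ?thesis by simp
    qed
    have "chart_density c u * (\<eta> R (chart_map c u) * norm (field V (chart_map c u)) * weight (chart_map c u)) = N u" for u
    proof (cases "u \<in> ?K")
      case True
      then show ?thesis using K by (auto simp: N_def chart_density_def chart_map_def)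
    next
      case False
      then have "u \<in> chart_image c \<Longrightarrow> field V (?i u) = 0" by (simp add: field_def vec_eq_iff supp[OF nK])
      then show ?thesis using False by (auto simp: N_def chart_density_def chart_map_def split: split_indicator)
    qed
    then show "(\<integral>u. chart_density c u * (\<eta> R (chart_map c u) * norm (field V (chart_map c u)) * weight (chart_map c u)) \<partial>lborel)
        = (\<integral>u. N u \<partial>lborel)" by (simp only:)
  qed
  have Deq: "div_integral R V = (\<integral>u. (\<Sum>j\<in>UNIV. \<phi> u * G' j u (e j)) \<partial>lborel)"
    unfolding div_integral_def
  proof (subst integral_chart[OF c(1)])
    have dd0: "drift_div V p = 0" if "p \<notin> ?i ` ?K" for p
      by (rule drift_div_eq_0[of "- ?i ` ?K"]) (use that cK supp tangentialD(1)[OF V] in \<open>auto simp: open_Compl\<close>)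
    show "(\<lambda>p. (\<eta> R p)\<^sup>2 * drift_div V p * weight p) \<in> borel_measurable borel"
      by (rule borel_measurable_continuous_onI[OF continuous_div_integrand[OF R tangentialD(1)[OF V]]])
    show "(\<eta> R p)\<^sup>2 * drift_div V p * weight p = 0" if p: "p \<notin> fst c" for p
    proof -
      have "p \<notin> ?i ` ?K" using p K chart_inv_in[OF c(1)] by blast
      then show ?thesis by (simp add: dd0)
    qed
    have "chart_density c u * ((\<eta> R (chart_map c u))\<^sup>2 * drift_div V (chart_map c u) * weight (chart_map c u))
        = (\<Sum>j\<in>UNIV. \<phi> u * G' j u (e j))" for u
    proof (cases "u \<in> ?B")
      case True
      have u: "u \<in> chart_image c" using True B by blast
      have "(\<Sum>j\<in>UNIV. G' j u (e j)) = ?\<rho> u * drift_div V (?i u)"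
        unfolding X(3)[OF u c(2)] G'_def e_def DB[OF True] ..
      then have "(\<Sum>j\<in>UNIV. \<phi> u * G' j u (e j)) = (\<eta> R (?i u))\<^sup>2 * (?\<rho> u * drift_div V (?i u))"
        using True by (simp add: sum_distrib_left[symmetric] \<phi>_def)
      then show ?thesis using u by (simp add: chart_density_def chart_map_def weighted_density_def)
    next
      case False
      then have "u \<notin> ?K" using KB by blast
      then have "u \<in> chart_image c \<Longrightarrow> drift_div V (?i u) = 0" by (intro dd0 nK)
      then show ?thesis using False by (auto simp: \<phi>_def chart_density_def chart_map_def split: split_indicator)
    qed
    then show "(\<integral>u. chart_density c u * ((\<eta> R (chart_map c u))\<^sup>2 * drift_div V (chart_map c u) * weight (chart_map c u)) \<partial>lborel)
        = (\<integral>u. (\<Sum>j\<in>UNIV. \<phi> u * G' j u (e j)) \<partial>lborel)" by (simp only:)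
  qed
  have est: "\<bar>\<integral>u. \<phi> u * G' j u (e j) \<partial>lborel\<bar> \<le> 8 / R * norm_integral R V" for j
  proof -
    \<comment> \<open>A step from the half ball of radius \<open>r / 2\<close> along
      \<open>e j\<close> shorter than this cannot leave the ball of radius \<open>r\<close>.\<close>
    define t0 where "t0 = r / (2 * (norm (e j) + 1))"
    have t0: "t0 > 0" using r(1) norm_ge_zero[of "e j"] by (simp add: t0_def add_nonneg_pos)
    have "\<bar>\<integral>u. \<phi> u * G' j u (e j) \<partial>lborel\<bar> \<le> (\<integral>u. \<bar>G j u\<bar> * L u \<partial>lborel)"
    proof (rule integral_directional_derivative_bound[OF dG cG' compact_cball G0 m\<phi> b\<phi> iL t0])
      fix x t :: real and y assume y: "y \<in> ?K" and t: "0 < t" "t < t0"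
      have yB: "y \<in> ?B" using y KB by blast
      have "t * (norm (e j) + 1) < t0 * (norm (e j) + 1)"
        using t by (intro mult_strict_right_mono) (simp_all add: add_nonneg_pos)
      also have "\<dots> = r / 2" using norm_ge_zero[of "e j"] by (simp add: t0_def field_simps add_nonneg_eq_0_iff)
      finally have "t * norm (e j) < r / 2" using t by (simp add: distrib_left)
      moreover have "dist u0 (y - t *\<^sub>R e j) \<le> dist u0 y + t * norm (e j)"
        using dist_triangle[of u0 "y - t *\<^sub>R e j" y] t by (simp add: dist_norm)
      ultimately have y'B: "y - t *\<^sub>R e j \<in> ?B" using y by simp
      have "\<bar>geodesic_dist \<A> F p0 (?i (y - t *\<^sub>R e j)) - geodesic_dist \<A> F p0 (?i y)\<bar> \<le> 2 * t"
      proof (rule geodesic_dist_segment[OF con c(1) convex_ball B yB y'B])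
        fix w assume "w \<in> ?B"
        then have w: "w \<in> cball u0 r" by simp
        have lin: "linear (dF c w)" using w r(2) by (intro linear_dF c(1)) blast
        have "dF c w (y - t *\<^sub>R e j - y) = (- t) *\<^sub>R dF c w (e j)"
          using linear_scale[OF lin, of "- t" "e j"] by simp
        then have "norm (dF c w (y - t *\<^sub>R e j - y)) = t * norm (dF c w (e j))" using t by simp
        also have "\<dots> \<le> t * 2" using le1[OF w, of "e j"] t ne[of j] by (intro mult_left_mono) auto
        finally show "norm (dF c w (y - t *\<^sub>R e j - y)) \<le> 2 * t" by simp
      qed
      from \<eta>_sq_lipschitz[OF R this]
      show "\<bar>\<phi> (y - t *\<^sub>R e j) - \<phi> y\<bar> \<le> t * (L y + t * (4 / R\<^sup>2))"
        using yB y'B by (simp add: \<phi>_def L_def)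
    qed
    also have "\<dots> \<le> (\<integral>u. 8 / R * N u \<partial>lborel)"
    proof (rule integral_mono[OF iL])
      show "integrable lborel (\<lambda>u. 8 / R * N u)" using iN by simp
      fix u
      show "\<bar>G j u\<bar> * L u \<le> 8 / R * N u"
      proof (cases "u \<in> ?K")
        case True
        then have uB: "u \<in> ?B" and u: "u \<in> chart_image c" "u \<in> cball u0 r" using KB B by auto
        have \<rho>: "?\<rho> u > 0" by (rule weighted_density_pos[OF c(1) u(1)])
        have "\<bar>G j u\<bar> \<le> norm (?T (Y u)) * norm (?T (e j))" unfolding G_def by (rule Cauchy_Schwarz_ineq2)
        also have "\<dots> = ?\<rho> u * norm (?T (X u))"
          using uB \<rho> by (simp add: Y_def ne linear_scale[OF linear_dF[OF c]])
        also have "\<dots> \<le> ?\<rho> u * (2 * norm (dF c u (X u)))" using le2[OF u(2)] \<rho> by (intro mult_left_mono) auto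
        also have "dF c u (X u) = field V (?i u)" by (simp add: X(2)[OF u(1)] field_def)
        finally have "\<bar>G j u\<bar> * (4 / R * \<eta> R (?i u)) \<le> (?\<rho> u * (2 * norm (field V (?i u)))) * (4 / R * \<eta> R (?i u))"
          using R \<eta>_range[of R "?i u"] by (intro mult_right_mono) auto
        also have "\<dots> = 8 / R * N u" using True by (simp add: N_def weighted_density_def)
        finally show ?thesis using uB by (simp add: L_def)
      qed (simp add: G0 N_def)
    qed
    also have "\<dots> = 8 / R * norm_integral R V" by (simp add: Neq)
    finally show ?thesis .
  qed
  have "div_integral R V = (\<Sum>j\<in>UNIV. \<integral>u. \<phi> u * G' j u (e j) \<partial>lborel)"
    unfolding Deq by (rule Bochner_Integration.integral_sum) (rule integrable_bounded_mult[OF iG' _ b\<phi>], use m\<phi> in simp)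
  then have "\<bar>div_integral R V\<bar> \<le> (\<Sum>j\<in>(UNIV::'n set). \<bar>\<integral>u. \<phi> u * G' j u (e j) \<partial>lborel\<bar>)"
    by (simp only: sum_abs)
  also have "\<dots> \<le> (\<Sum>j\<in>(UNIV::'n set). 8 / R * norm_integral R V)" by (intro sum_mono est)
  also have "\<dots> = 8 * real CARD('n) / R * norm_integral R V" by simp
  finally show ?thesis .
qed

lemma tangential_mult: "smooth_map \<A> \<beta> \<Longrightarrow> tangential V \<Longrightarrow> tangential (\<lambda>a p. \<beta> p * V a p)"
  unfolding tangential_def by (auto intro!: smooth_map_mult simp: mult.assoc sum_distrib_left[symmetric])

lemma local_weak_divergence:
  obtains \<beta> U where "smooth_map \<A> \<beta>" "\<And>q. 0 \<le> \<beta> q" "\<And>q. \<beta> q \<le> 1" "open U" "p \<in> U" "\<And>q. q \<in> U \<Longrightarrow> \<beta> q = 1"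
    "\<And>V R. tangential V \<Longrightarrow> R > 0 \<Longrightarrow>
       \<bar>div_integral R (\<lambda>a p. \<beta> p * V a p)\<bar> \<le> 8 * real CARD('n) / R * norm_integral R (\<lambda>a p. \<beta> p * V a p)"
proof -
  obtain c where c: "c \<in> \<A>" "p \<in> fst c" by (rule ex_chart)
  let ?u0 = "snd c p"
  note u0 = chart_in_image[OF c(2)]
  obtain r where r: "r > 0" "cball ?u0 r \<subseteq> chart_image c"
    "\<And>u v. u \<in> cball ?u0 r \<Longrightarrow> norm (dF c u v) \<le> 2 * norm (dF c ?u0 v)"
    "\<And>u v. u \<in> cball ?u0 r \<Longrightarrow> norm (dF c ?u0 v) \<le> 2 * norm (dF c u v)"
    using local_frame_comparison[OF c(1) u0] by blast
  have r2: "r / 2 > 0" using r(1) by simp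
  obtain \<beta> r' where \<beta>: "smooth_map \<A> \<beta>" "\<And>q. 0 \<le> \<beta> q" "\<And>q. \<beta> q \<le> (1::real)" "0 < r'" "ball ?u0 r' \<subseteq> chart_image c"
    "\<And>u. u \<in> ball ?u0 r' \<Longrightarrow> \<beta> (chart_inv c u) = 1" "\<And>q. q \<notin> chart_inv c ` (cball ?u0 (r / 2) \<inter> chart_image c) \<Longrightarrow> \<beta> q = 0"
    by (rule ex_bump[OF c(1) u0 r2]) blast
  show thesis
  proof (rule that[OF \<beta>(1,2,3), of "chart_inv c ` ball ?u0 r'"])
    show "open (chart_inv c ` ball ?u0 r')" by (rule open_chart_inv_image[OF c(1) open_ball \<beta>(5)])
    show "p \<in> chart_inv c ` ball ?u0 r'" by (rule image_eqI[of _ _ ?u0]) (use c \<beta> in auto)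
    show "\<beta> q = 1" if "q \<in> chart_inv c ` ball ?u0 r'" for q using that \<beta>(6) by blast
    fix V R assume V: "tangential V" and R: "(R::real) > 0"
    show "\<bar>div_integral R (\<lambda>a p. \<beta> p * V a p)\<bar> \<le> 8 * real CARD('n) / R * norm_integral R (\<lambda>a p. \<beta> p * V a p)"
    proof (rule weak_divergence_supported[OF c(1) u0 r tangential_mult[OF \<beta>(1) V] _ R])
      fix q a assume "q \<notin> chart_inv c ` cball ?u0 (r / 2)"
      then have "\<beta> q = 0" by (intro \<beta>(7)) blast
      then show "\<beta> q * V a q = 0" by simp
    qed
  qed
qed

text \<open>The bumps are peeled off one at a time, which replaces a partition of unity.\<close>

lemma weak_divergence_covered:
  assumes fin: "finite B" and R: "R > 0"
    and \<beta>: "\<And>\<beta>. \<beta> \<in> B \<Longrightarrow> smooth_map \<A> \<beta> \<and> (\<forall>q. 0 \<le> \<beta> q \<and> \<beta> q \<le> (1::real)) \<and>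
      (\<forall>V. tangential V \<longrightarrow> \<bar>div_integral R (\<lambda>a p. \<beta> p * V a p)\<bar> \<le> C * norm_integral R (\<lambda>a p. \<beta> p * V a p))"
    and V: "tangential V" and cov: "\<And>p. geodesic_dist \<A> F p0 p < 2 * R \<Longrightarrow> (\<forall>a. V a p = 0) \<or> (\<exists>\<beta>\<in>B. \<beta> p = 1)"
  shows "\<bar>div_integral R V\<bar> \<le> C * norm_integral R V"
  using fin \<beta> V cov
proof (induction B arbitrary: V rule: finite_induct)
  case empty
  let ?W = "{p. geodesic_dist \<A> F p0 p < 2 * R}"
  have W: "open ?W" by (intro open_Collect_less continuous_geodesic_dist con continuous_on_const)
  have zero: "V a p = 0" if "p \<in> ?W" for a p using empty(3)[of p] that by simp
  have "(\<eta> R p)\<^sup>2 * drift_div V p * weight p = 0" for p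
  proof (cases "p \<in> ?W")
    case True
    have "drift_div V p = 0"
      by (rule drift_div_eq_0[OF W True tangentialD(1)[OF empty(2)]]) (rule zero)
    then show ?thesis by simp
  next
    case False
    then show ?thesis using \<eta>_eq_0[OF R, of p] by simp
  qed
  moreover have "\<eta> R p * norm (field V p) * weight p = 0" for p
  proof (cases "p \<in> ?W")
    case True
    then show ?thesis using zero[OF True] by (simp add: field_def vec_eq_iff)
  next
    case False
    then show ?thesis using \<eta>_eq_0[OF R, of p] by simp
  qed
  ultimately show ?case
    unfolding div_integral_def norm_integral_def
    by (simp only: Bochner_Integration.integral_zero abs_zero mult_zero_right order_refl)
next
  case (insert b B)
  \<comment> \<open>The remainder vanishes where \<open>b\<close> is 1, so fewer bumps have to cover
    it. Both pieces are nonnegative multiples of \<open>V\<close> with factors summing to 1, which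
    makes the norm integrals additive.\<close>
  let ?bV = "\<lambda>a p. b p * V a p" and ?W = "\<lambda>a p. V a p - b p * V a p"
  have b: "smooth_map \<A> b" "\<And>q. 0 \<le> b q" "\<And>q. b q \<le> 1"
    "\<bar>div_integral R ?bV\<bar> \<le> C * norm_integral R ?bV"
    using insert.prems(1)[of b] insert.prems(2) by auto
  note smV = tangentialD(1)[OF insert.prems(2)]
  have tb: "tangential ?bV" by (rule tangential_mult[OF b(1) insert.prems(2)])
  have W: "?W = (\<lambda>a p. (1 - b p) * V a p)" by (simp add: fun_eq_iff algebra_simps)
  have tW: "tangential ?W"
    unfolding W by (rule tangential_mult[OF smooth_map_diff[OF smooth_map_const b(1)] insert.prems(2)])
  have IW: "\<bar>div_integral R ?W\<bar> \<le> C * norm_integral R ?W"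
  proof (rule insert.IH[OF _ tW])
    fix p assume p: "geodesic_dist \<A> F p0 p < 2 * R"
    show "(\<forall>a. V a p - b p * V a p = 0) \<or> (\<exists>\<beta>\<in>B. \<beta> p = 1)"
    proof (cases "b p = 1")
      case False
      then show ?thesis using insert.prems(3)[OF p] by auto
    qed simp
  next
    fix \<beta> assume "\<beta> \<in> B"
    then show "smooth_map \<A> \<beta> \<and> (\<forall>q. 0 \<le> \<beta> q \<and> \<beta> q \<le> (1::real)) \<and>
      (\<forall>V. tangential V \<longrightarrow> \<bar>div_integral R (\<lambda>a p. \<beta> p * V a p)\<bar> \<le> C * norm_integral R (\<lambda>a p. \<beta> p * V a p))"
      by (intro insert.prems(1)) simp
  qed
  have "(\<lambda>p. (\<eta> R p)\<^sup>2 * drift_div ?W p * weight p) =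
      (\<lambda>p. (\<eta> R p)\<^sup>2 * drift_div V p * weight p - (\<eta> R p)\<^sup>2 * drift_div ?bV p * weight p)"
    unfolding drift_div_diff[OF smV tangentialD(1)[OF tb]] by (simp add: algebra_simps)
  then have "div_integral R ?W = div_integral R V - div_integral R ?bV"
    unfolding div_integral_def
    by (simp only: Bochner_Integration.integral_diff[OF div_integrable[OF R smV] div_integrable[OF R tangentialD(1)[OF tb]]])
  moreover have "norm_integral R V = norm_integral R ?bV + norm_integral R ?W"
  proof -
    have "norm (field V p) = norm (field ?bV p) + norm (field ?W p)" for p
    proof -
      have e: "field ?bV p = b p *\<^sub>R field V p" "field ?W p = (1 - b p) *\<^sub>R field V p"
        by (simp_all add: field_def vec_eq_iff algebra_simps)
      show ?thesis unfolding e norm_scaleR using b(2,3)[of p] by (simp add: algebra_simps)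
    qed
    then have "\<eta> R p * norm (field V p) * weight p =
        \<eta> R p * norm (field ?bV p) * weight p + \<eta> R p * norm (field ?W p) * weight p" for p
      by (simp only: distrib_left distrib_right)
    then have "norm_integral R V = (\<integral>p. \<eta> R p * norm (field ?bV p) * weight p + \<eta> R p * norm (field ?W p) * weight p \<partial>\<sigma>)"
      unfolding norm_integral_def by (simp only:)
    also have "\<dots> = norm_integral R ?bV + norm_integral R ?W"
      unfolding norm_integral_def
      by (rule Bochner_Integration.integral_add[OF norm_integrable[OF R tangentialD(1)[OF tb]] norm_integrable[OF R tangentialD(1)[OF tW]]])
    finally show ?thesis .
  qed
  ultimately show ?case using IW b(4) by (simp add: distrib_left)
qed

text \<open>Finitely many bumps are equal to 1 somewhere at each point of the compact preimage that
  contains the support of the cutoff. The constant does not depend on their number, which may grow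
  with \<open>R\<close>.\<close>

theorem weak_divergence:
  assumes V: "tangential V" and R: "R > 0"
  shows "\<bar>div_integral R V\<bar> \<le> 8 * real CARD('n) / R * norm_integral R V"
proof -
  let ?P = "\<lambda>\<beta>. smooth_map \<A> \<beta> \<and> (\<forall>q. 0 \<le> \<beta> q \<and> \<beta> q \<le> (1::real)) \<and>
      (\<forall>V. tangential V \<longrightarrow> \<bar>div_integral R (\<lambda>a p. \<beta> p * V a p)\<bar> \<le> 8 * real CARD('n) / R * norm_integral R (\<lambda>a p. \<beta> p * V a p))"
  define Q where "Q p \<beta> U \<longleftrightarrow> ?P \<beta> \<and> open U \<and> p \<in> U \<and> (\<forall>q\<in>U. \<beta> q = 1)" for p \<beta> U
  have "\<exists>\<beta> U. Q p \<beta> U" for p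
  proof -
    obtain \<beta> U where "smooth_map \<A> \<beta>" "\<And>q. 0 \<le> \<beta> q" "\<And>q. \<beta> q \<le> 1" "open U" "p \<in> U" "\<And>q. q \<in> U \<Longrightarrow> \<beta> q = 1"
      "\<And>V R. tangential V \<Longrightarrow> R > 0 \<Longrightarrow>
       \<bar>div_integral R (\<lambda>a p. \<beta> p * V a p)\<bar> \<le> 8 * real CARD('n) / R * norm_integral R (\<lambda>a p. \<beta> p * V a p)"
      by (rule local_weak_divergence[of p]) blast
    then have "Q p \<beta> U" using R by (simp add: Q_def)
    then show ?thesis by blast
  qed
  then obtain \<beta> U where "\<And>p. Q p (\<beta> p) (U p)" by metis
  then have \<beta>: "\<And>p. ?P (\<beta> p)" and U: "\<And>p. open (U p)" "\<And>p. p \<in> U p" "\<And>p q. q \<in> U p \<Longrightarrow> \<beta> p q = 1"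
    by (simp_all add: Q_def)
  obtain D where D: "D \<subseteq> F -` cball (F p0) (2 * R)" "finite D" "F -` cball (F p0) (2 * R) \<subseteq> (\<Union>p\<in>D. U p)"
    by (rule compactE_image[OF \<eta>_compact(1)[OF R], of "F -` cball (F p0) (2 * R)" U]) (use U in auto)
  show ?thesis
  proof (rule weak_divergence_covered[of "\<beta> ` D", OF _ R _ V])
    show "finite (\<beta> ` D)" using D by simp
    fix b assume "b \<in> \<beta> ` D" then show "?P b" using \<beta> by blast
  next
    fix p assume "geodesic_dist \<A> F p0 p < 2 * R"
    then have "norm (F p - F p0) \<le> 2 * R" using norm_F_le_geodesic_dist[OF con, of p p0] by linarith
    then have "p \<in> F -` cball (F p0) (2 * R)" by (simp add: dist_norm norm_minus_commute)
    then obtain q where "q \<in> D" "p \<in> U q" using D(3) by blast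
    then show "(\<forall>a. V a p = 0) \<or> (\<exists>\<beta>\<in>\<beta> ` D. \<beta> p = 1)" using U(3) by blast
  qed
qed

end

section \<open>A Liouville theorem under quadratic growth\<close>

text \<open>For \<open>v\<close> the norm of the field, \<open>k\<close> the slope, \<open>t\<close>
  the cutoff, \<open>a\<close> the energy density and \<open>b\<close> the divergence. The parameter
  \<open>l\<close> decides how much is charged to the energy and how much to the divergence.\<close>

lemma weighted_am_gm:
  fixes v a b k t l :: real
  assumes v: "v\<^sup>2 \<le> 4 * a * b" and nn: "0 \<le> a" "0 \<le> b" "0 \<le> k" "0 \<le> t" "0 < l"
  shows "k * (t * v) \<le> l * (k\<^sup>2 * a) + t\<^sup>2 * b / l"
proof -
  have "v \<le> sqrt (4 * a * b)" using v by (rule real_le_rsqrt)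
  also have "\<dots> = 2 * (sqrt a * sqrt b)" by (simp add: real_sqrt_mult)
  finally have "k * (t * v) \<le> k * (t * (2 * (sqrt a * sqrt b)))" using nn by (intro mult_left_mono)
  also have "\<dots> = 2 * (sqrt l * k * sqrt a) * (t * sqrt b / sqrt l)" using nn by (simp add: field_simps)
  also have "\<dots> \<le> (sqrt l * k * sqrt a)\<^sup>2 + (t * sqrt b / sqrt l)\<^sup>2" by (rule sum_squares_bound)
  also have "\<dots> = l * (k\<^sup>2 * a) + t\<^sup>2 * b / l" using nn by (simp add: power_mult_distrib power_divide)
  finally show ?thesis .
qed

context measured_hypersurface
begin

text \<open>A nonzero value would persist on an open set, and open sets have positive volume because
  the density is positive in charts.\<close>

lemma AE_eq_0_continuous:
  fixes f :: "'m \<Rightarrow> real"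
  assumes f: "continuous_on UNIV f" and ae: "AE p in \<sigma>. f p = 0"
  shows "f p = 0"
proof (rule ccontr)
  assume p: "f p \<noteq> 0"
  obtain c where c: "c \<in> \<A>" "p \<in> fst c" by (rule ex_chart)
  have "open (f -` (- {0}))" using f by (intro open_vimage) auto
  then have op: "open (fst c \<inter> f -` (- {0}))" by (rule open_Int[OF chart_open[OF c(1)]])
  define B where "B = fst c \<inter> f -` (- {0})"
  have B: "B \<in> sets borel" using op by (simp add: B_def)
  have "AE q in \<sigma>. q \<notin> B" using ae by eventually_elim (simp add: B_def)
  then have "emeasure \<sigma> B = 0" using B by (simp add: AE_iff_measurable[of B])
  then have 0: "(\<integral>\<^sup>+u. ennreal (vol_density c u) * indicator (snd c ` B) u \<partial>lborel) = 0"
    using emeasure_\<sigma>[OF c(1) B] by (simp add: B_def)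
  have im: "snd c ` B = chart_image c \<inter> chart_inv c -` B"
    using c(1) by (force simp: B_def)
  have opi: "open (snd c ` B)"
    unfolding im
    by (rule continuous_open_preimage[OF continuous_on_chart_inv[OF c(1)] chart_image_open[OF c(1)]]) (use op in \<open>simp add: B_def\<close>)
  have eq: "ennreal (vol_density c u) * indicator (snd c ` B) u = ennreal (indicator (snd c ` B) u *\<^sub>R vol_density c u)" for u
    by (simp split: split_indicator)
  have "(\<lambda>u. ennreal (indicator (snd c ` B) u *\<^sub>R vol_density c u)) \<in> borel_measurable lborel"
    using borel_measurable_continuous_on_indicator[OF borel_open[OF opi]
        continuous_on_subset[OF smooth_on_imp_continuous_on[OF smooth_on_vol_density[OF c(1)]]]] im by simp
  then have "AE u in lborel. ennreal (vol_density c u) * indicator (snd c ` B) u = 0"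
    using 0 unfolding eq by (simp add: nn_integral_0_iff_AE)
  then have "AE u in lborel. u \<notin> snd c ` B"
  proof eventually_elim
    case (elim u)
    show ?case
    proof
      assume u: "u \<in> snd c ` B"
      then have "vol_density c u > 0" using im by (intro vol_density_pos[OF c(1)]) blast
      then show False using elim u by simp
    qed
  qed
  then have null: "emeasure lborel (snd c ` B) = 0" using opi by (simp add: AE_iff_measurable[of "snd c ` B"])
  have "snd c p \<in> snd c ` B" using p c by (simp add: B_def)
  then obtain r where r: "r > 0" "ball (snd c p) r \<subseteq> snd c ` B" using opi open_contains_ball by blast
  have "emeasure lborel (ball (snd c p) r) \<le> 0"
    using emeasure_mono[OF r(2), of lborel] opi null by simp
  then have "measure lborel (ball (snd c p) r) = 0" by (simp add: measure_def)
  then show False using content_ball_pos[OF r(1), of "snd c p"] by simp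
qed

lemma \<eta>_mono: "0 < R \<Longrightarrow> R \<le> R' \<Longrightarrow> \<eta> R p \<le> \<eta> R' p"
proof -
  assume R: "0 < R" "R \<le> R'"
  interpret G: Metric_space UNIV "geodesic_dist \<A> F" by (rule geodesic_metric[OF con])
  have "geodesic_dist \<A> F p0 p / R' \<le> geodesic_dist \<A> F p0 p / R"
    using R by (intro divide_left_mono) auto
  then show ?thesis by (auto simp: \<eta>_def max_def min_def)
qed

lemma integrable_cutoff:
  fixes f :: "'m \<Rightarrow> real"
  assumes "R > 0" "continuous_on UNIV f" "\<And>p. \<eta> R p = 0 \<Longrightarrow> f p = 0"
  shows "integrable \<sigma> f"
  by (rule integrable_compact_support[OF assms(2) \<eta>_compact(1)[OF assms(1)]]) (use assms \<eta>_compact(2) in blast)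

lemma integrable_ball:
  fixes f :: "'m \<Rightarrow> real"
  assumes R: "R > 0" and f: "continuous_on UNIV f"
  shows "integrable \<sigma> (\<lambda>p. indicator (geodesic_ball \<A> F p0 R) p * f p)"
proof (rule Bochner_Integration.integrable_bound)
  show "integrable \<sigma> (\<lambda>p. \<eta> R p * f p)"
    by (rule integrable_cutoff[OF R continuous_on_mult[OF continuous_\<eta>[OF R] f]]) simp
  have "open (geodesic_ball \<A> F p0 R)"
    unfolding geodesic_ball_eq[OF con] by (intro open_Collect_less continuous_geodesic_dist con continuous_on_const)
  then have "(\<lambda>p. indicator (geodesic_ball \<A> F p0 R) p *\<^sub>R f p) \<in> borel_measurable borel"
    by (intro borel_measurable_continuous_on_indicator continuous_on_subset[OF f]) auto
  then show "(\<lambda>p. indicator (geodesic_ball \<A> F p0 R) p * f p) \<in> borel_measurable \<sigma>"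
    by (simp only: measurable_from_\<sigma> real_scaleR_def)
  show "AE p in \<sigma>. norm (indicator (geodesic_ball \<A> F p0 R) p * f p) \<le> norm (\<eta> R p * f p)"
    by (rule AE_I2) (auto simp: geodesic_ball_eq[OF con] \<eta>_eq_1[OF R] split: split_indicator)
qed

text \<open>\<open>a R\<close> is the cut-off total of \<open>E\<close>. The estimate
  \<open>pt\<close> is used with \<open>l = 1\<close> to bound it, then with \<open>l\<close> small
  outside a fixed ball to show that its supremum \<open>T\<close> is at most zero.\<close>

theorem liouville:
  assumes V: "tangential V" and div: "\<And>p. drift_div V p = 2 * E p" and E0: "\<And>p. 0 \<le> E p"
    and VE: "\<And>p. (\<Sum>a\<in>UNIV. (V a p)\<^sup>2) \<le> 4 * hh p * E p"
    and C: "C > 0" and growth: "\<forall>\<^sub>F R in at_top.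
      (\<integral>\<^sup>+p\<in>geodesic_ball \<A> F p0 R. ennreal (hh p * weight p) \<partial>\<sigma>) < ennreal (C * R\<^sup>2)"
  shows "E p = 0"
proof -
  have "smooth_map \<A> (\<lambda>p. (1/2) * drift_div V p)"
    by (rule smooth_map_mult[OF smooth_map_const smooth_drift_div[OF tangentialD(1)[OF V]]])
  then have "smooth_map \<A> E" by (simp add: div)
  note cE = smooth_map_continuous[OF this]
  note cw = smooth_map_continuous[OF smooth_weight]
  have chh: "continuous_on UNIV hh"
    unfolding hh_def[abs_def] by (intro continuous_intros smooth_map_continuous smooth_h)
  define n where "n = 8 * real CARD('n)"
  have n: "n \<ge> 0" by (simp add: n_def)
  define a where "a R = (\<integral>p. (\<eta> R p)\<^sup>2 * E p * weight p \<partial>\<sigma>)" for R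
  have ia: "integrable \<sigma> (\<lambda>p. (\<eta> R p)\<^sup>2 * E p * weight p)" if "R > 0" for R
    by (rule integrable_cutoff[OF that]) (auto intro!: continuous_intros continuous_\<eta> that cE cw)
  have mono: "a R \<le> a R'" if "0 < R" "R \<le> R'" for R R'
    unfolding a_def
    by (intro integral_mono ia mult_right_mono power_mono \<eta>_mono that \<eta>_range E0)
       (use that weight_pos in \<open>auto simp: less_imp_le\<close>)
  have a0: "a R \<ge> 0" for R
    unfolding a_def by (intro integral_nonneg_AE AE_I2 mult_nonneg_nonneg zero_le_power2 E0 less_imp_le[OF weight_pos])
  have main: "2 * a R \<le> n / R * norm_integral R V" if R: "R > 0" for R
  proof -
    have "div_integral R V = 2 * a R"
      unfolding div_integral_def a_def div
      by (subst Bochner_Integration.integral_mult_right_zero[symmetric]) (simp only: mult_ac)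
    then show ?thesis using weak_divergence[OF V R] by (simp add: n_def)
  qed
  have VE': "(norm (field V p))\<^sup>2 \<le> 4 * hh p * E p" for p
  proof -
    have "(norm (field V p))\<^sup>2 = (\<Sum>a\<in>UNIV. (V a p)\<^sup>2)"
      unfolding power2_norm_eq_inner by (simp add: inner_vec_def field_def power2_eq_square)
    then show ?thesis using VE[of p] by (simp only:)
  qed
  obtain R1 where R1: "R1 > 0" "\<And>R. R \<ge> R1 \<Longrightarrow>
      (\<integral>\<^sup>+p\<in>geodesic_ball \<A> F p0 R. ennreal (hh p * weight p) \<partial>\<sigma>) < ennreal (C * R\<^sup>2)"
  proof -
    from growth obtain R0 where R0: "\<forall>R\<ge>R0. (\<integral>\<^sup>+p\<in>geodesic_ball \<A> F p0 R. ennreal (hh p * weight p) \<partial>\<sigma>) < ennreal (C * R\<^sup>2)"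
      unfolding eventually_at_top_linorder by blast
    show thesis by (rule that[of "max R0 1"]) (use R0 in auto)
  qed
  define I where "I R p = indicator (geodesic_ball \<A> F p0 (2 * R)) p * (hh p * weight p)" for R p
  have iI: "integrable \<sigma> (I R)" if "R > 0" for R
    unfolding I_def[abs_def] by (rule integrable_ball) (use that chh cw in \<open>auto intro!: continuous_intros\<close>)
  have I0: "0 \<le> I R p" for R p
    using weight_pos[of p] by (simp add: I_def less_imp_le)
  have IR: "(\<integral>p. I R p \<partial>\<sigma>) \<le> 4 * C * R\<^sup>2" if R: "R \<ge> R1" for R
  proof -
    have "ennreal (\<integral>p. I R p \<partial>\<sigma>) = (\<integral>\<^sup>+p. ennreal (I R p) \<partial>\<sigma>)"
      using R R1 by (intro nn_integral_eq_integral[symmetric] iI AE_I2 I0) auto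
    also have "\<dots> = (\<integral>\<^sup>+p\<in>geodesic_ball \<A> F p0 (2 * R). ennreal (hh p * weight p) \<partial>\<sigma>)"
      by (intro nn_integral_cong) (simp add: I_def split: split_indicator)
    also have "\<dots> < ennreal (C * (2 * R)\<^sup>2)" using R R1 by (intro R1(2)) auto
    finally have "(\<integral>p. I R p \<partial>\<sigma>) < C * (2 * R)\<^sup>2" using I0 by (subst (asm) ennreal_less_iff) auto
    then show ?thesis by (simp add: power_mult_distrib)
  qed
  define A where "A = n\<^sup>2 * (4 * C)"
  have A: "A \<ge> 0" using C by (simp add: A_def)
  have pt: "n / R * (\<eta> R p * norm (field V p) * weight p) \<le> l * (n\<^sup>2 / R\<^sup>2) * I R p + 1 / l * ((\<eta> R p)\<^sup>2 * E p * weight p)"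
    if R: "R > 0" and l: "l > 0" for R l p
  proof (cases "p \<in> geodesic_ball \<A> F p0 (2 * R)")
    case True
    have "n / R * (\<eta> R p * norm (field V p)) \<le> l * ((n / R)\<^sup>2 * hh p) + (\<eta> R p)\<^sup>2 * E p / l"
      by (rule weighted_am_gm[OF VE' hh_nonneg E0 _ _ l]) (use n R \<eta>_range in auto)
    then have "n / R * (\<eta> R p * norm (field V p)) * weight p \<le> (l * ((n / R)\<^sup>2 * hh p) + (\<eta> R p)\<^sup>2 * E p / l) * weight p"
      using weight_pos[of p] by (intro mult_right_mono) auto
    then show ?thesis using True by (simp add: I_def power_divide algebra_simps)
  next
    case False
    then have "\<eta> R p = 0" using R by (intro \<eta>_eq_0) (auto simp: geodesic_ball_eq[OF con])
    then show ?thesis using False by (simp add: I_def)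
  qed
  \<comment> \<open>Quadratic growth on the ball of radius \<open>2 * R\<close> cancels the squared
    slope; the 4 in \<open>A\<close> comes from the doubled radius.\<close>
  have AI: "l * (n\<^sup>2 / R\<^sup>2) * (\<integral>p. I R p \<partial>\<sigma>) \<le> l * A" if "R \<ge> R1" "l > 0" for R l
  proof -
    have "l * (n\<^sup>2 / R\<^sup>2) * (\<integral>p. I R p \<partial>\<sigma>) \<le> l * (n\<^sup>2 / R\<^sup>2) * (4 * C * R\<^sup>2)"
      using that by (intro mult_left_mono IR) auto
    also have "\<dots> = l * A" using that R1 by (simp add: A_def field_simps)
    finally show ?thesis .
  qed
  \<comment> \<open>With \<open>l = 1\<close> the right side contains \<open>a R\<close> once and
    the left side twice, so it can be absorbed.\<close>
  have bound: "a R \<le> A" if R: "R \<ge> R1" for R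
  proof -
    have R0: "R > 0" using R R1 by simp
    have "n / R * norm_integral R V = (\<integral>p. n / R * (\<eta> R p * norm (field V p) * weight p) \<partial>\<sigma>)"
      by (simp add: norm_integral_def)
    also have "\<dots> \<le> (\<integral>p. 1 * (n\<^sup>2 / R\<^sup>2) * I R p + 1 / 1 * ((\<eta> R p)\<^sup>2 * E p * weight p) \<partial>\<sigma>)"
      by (rule integral_mono)
         (use norm_integrable[OF R0 tangentialD(1)[OF V]] iI[OF R0] ia[OF R0] pt[OF R0, of 1] in auto)
    also have "\<dots> = 1 * (n\<^sup>2 / R\<^sup>2) * (\<integral>p. I R p \<partial>\<sigma>) + a R"
      using iI[OF R0] ia[OF R0] by (simp add: a_def)
    finally show ?thesis using main[OF R0] AI[OF R, of 1] by simp
  qed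
  define T where "T = (SUP R\<in>{R1..}. a R)"
  have bdd: "bdd_above (a ` {R1..})" using bound by (intro bdd_aboveI[of _ A]) auto
  have aT: "a R \<le> T" if "R \<ge> R1" for R unfolding T_def by (rule cSUP_upper[OF _ bdd]) (use that in simp)
  have small: "2 * T \<le> 5 * \<epsilon>" if \<epsilon>: "\<epsilon> > 0" for \<epsilon>
  proof -
    \<comment> \<open>Makes the energy term \<open>l * A\<close> at most \<open>\<epsilon>\<close>;
      the added 1 covers \<open>A = 0\<close>.\<close>
    define l where "l = \<epsilon> / (A + 1)"
    have l: "l > 0" using \<epsilon> A by (simp add: l_def)
    have lA: "l * A \<le> \<epsilon>" using \<epsilon> A by (simp add: l_def field_simps)
    have "T - min \<epsilon> (l * \<epsilon>) < T" using \<epsilon> l by simp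
    \<comment> \<open>Two tolerances are needed: \<open>l * \<epsilon>\<close> compensates the
      factor \<open>1 / l\<close> in front of the divergence outside, and \<open>\<epsilon>\<close>
      is used to compare \<open>T\<close> with \<open>a R\<close> at the end.\<close>
    then obtain R0 where R0: "R0 \<ge> R1" "T - min \<epsilon> (l * \<epsilon>) < a R0"
      unfolding T_def by (subst (asm) less_cSUP_iff[OF _ bdd]) auto
    have R0p: "R0 > 0" using R0 R1 by simp
    define M where "M = (\<integral>p. (\<eta> R0 p)\<^sup>2 * (norm (field V p) * weight p) \<partial>\<sigma>)"
    have cv: "continuous_on UNIV (\<lambda>p. norm (field V p) * weight p)"
      by (intro continuous_intros continuous_field tangentialD[OF V] cw)
    have iM: "integrable \<sigma> (\<lambda>p. (\<eta> R0 p)\<^sup>2 * (norm (field V p) * weight p))"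
      by (rule integrable_cutoff[OF R0p]) (auto intro!: continuous_intros continuous_\<eta> R0p cv)
    \<comment> \<open>The first bound makes the cutoff at scale \<open>R\<close> equal to 1 on the
      support of the one at scale \<open>R0\<close>; the second makes the slope times the fixed
      inner integral \<open>M\<close> at most \<open>\<epsilon>\<close>.\<close>
    define R where "R = max (2 * R0) (n * M / \<epsilon>)"
    have R: "R \<ge> 2 * R0" "R > 0" "R \<ge> R1" using R0 R0p by (auto simp: R_def)
    have "n * M / \<epsilon> \<le> R" by (simp add: R_def)
    then have nM: "n / R * M \<le> \<epsilon>" using R \<epsilon> by (simp add: field_simps)
    let ?z = "\<lambda>p. (\<eta> R0 p)\<^sup>2"
    have z: "0 \<le> 1 - ?z p" "1 - ?z p \<le> 1" for p using \<eta>_range[of R0 p] by (auto simp: power_le_one)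
    have key: "(\<eta> R p)\<^sup>2 * E p * weight p * (1 - ?z p) = (\<eta> R p)\<^sup>2 * E p * weight p - ?z p * E p * weight p" for p
    proof (cases "geodesic_dist \<A> F p0 p \<le> R")
      case True
      then show ?thesis using \<eta>_eq_1[OF R(2) True] by (simp add: algebra_simps)
    next
      case False
      then have "\<eta> R0 p = 0" using R by (intro \<eta>_eq_0[OF R0p]) simp
      then show ?thesis by simp
    qed
    \<comment> \<open>The integrand is split with the weight \<open>?z\<close>: inside only the
      small slope is used, outside the AM-GM estimate, whose divergence part becomes
      \<open>a R - a R0\<close> after integration by \<open>key\<close>.\<close>
    have pt': "n / R * (\<eta> R p * norm (field V p) * weight p) \<le>
        n / R * (?z p * (norm (field V p) * weight p)) + l * (n\<^sup>2 / R\<^sup>2) * I R p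
        + 1 / l * ((\<eta> R p)\<^sup>2 * E p * weight p - ?z p * E p * weight p)" for p
    proof -
      have vw: "0 \<le> norm (field V p) * weight p" using weight_pos[of p] by simp
      have "n / R * (\<eta> R p * norm (field V p) * weight p) * (1 - ?z p) \<le>
          (l * (n\<^sup>2 / R\<^sup>2) * I R p + 1 / l * ((\<eta> R p)\<^sup>2 * E p * weight p)) * (1 - ?z p)"
        by (rule mult_right_mono[OF pt[OF R(2) l] z(1)])
      also have "\<dots> = l * (n\<^sup>2 / R\<^sup>2) * I R p * (1 - ?z p) + 1 / l * ((\<eta> R p)\<^sup>2 * E p * weight p * (1 - ?z p))"
        by (simp only: distrib_right mult.assoc)
      also have "\<dots> \<le> l * (n\<^sup>2 / R\<^sup>2) * I R p + 1 / l * ((\<eta> R p)\<^sup>2 * E p * weight p - ?z p * E p * weight p)"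
        unfolding key using mult_left_mono[OF z(2), of "l * (n\<^sup>2 / R\<^sup>2) * I R p"] I0[of R p] l by simp
      finally have 1: "n / R * (\<eta> R p * norm (field V p) * weight p) * (1 - ?z p) \<le> \<dots>" .
      have "\<eta> R p * (norm (field V p) * weight p) * ?z p \<le> 1 * (norm (field V p) * weight p) * ?z p"
        by (intro mult_right_mono \<eta>_range vw zero_le_power2)
      then have "n / R * (\<eta> R p * (norm (field V p) * weight p) * ?z p) \<le> n / R * (1 * (norm (field V p) * weight p) * ?z p)"
        using n R by (intro mult_left_mono) auto
      also have "1 * (norm (field V p) * weight p) * ?z p = ?z p * (norm (field V p) * weight p)" by simp
      finally have 2: "n / R * (\<eta> R p * (norm (field V p) * weight p) * ?z p) \<le> n / R * \<dots>" .
      have "k * (e * m * w) = k * (e * m * w) * (1 - z) + k * (e * (m * w) * z)" for k e m w z :: real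
        by (simp add: algebra_simps)
      note split = this[of "n / R" "\<eta> R p" "norm (field V p)" "weight p" "?z p"]
      have "x \<le> y + b + d" if "x = x1 + x2" "x1 \<le> b + d" "x2 \<le> y" for x x1 x2 y b d :: real
        using that by linarith
      from this[OF split 1 2] show ?thesis .
    qed
    have "n / R * norm_integral R V = (\<integral>p. n / R * (\<eta> R p * norm (field V p) * weight p) \<partial>\<sigma>)"
      by (simp add: norm_integral_def)
    also have "\<dots> \<le> (\<integral>p. n / R * (?z p * (norm (field V p) * weight p)) + l * (n\<^sup>2 / R\<^sup>2) * I R p
        + 1 / l * ((\<eta> R p)\<^sup>2 * E p * weight p - ?z p * E p * weight p) \<partial>\<sigma>)"
    proof (rule integral_mono[OF _ _ pt'])
      show "integrable \<sigma> (\<lambda>p. n / R * (\<eta> R p * norm (field V p) * weight p))"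
        by (intro integrable_mult_right norm_integrable R tangentialD[OF V])
      show "integrable \<sigma> (\<lambda>p. n / R * (?z p * (norm (field V p) * weight p)) + l * (n\<^sup>2 / R\<^sup>2) * I R p
        + 1 / l * ((\<eta> R p)\<^sup>2 * E p * weight p - ?z p * E p * weight p))"
        by (intro Bochner_Integration.integrable_add Bochner_Integration.integrable_diff integrable_mult_right iM iI ia R R0p)
    qed
    also have "\<dots> = n / R * M + l * (n\<^sup>2 / R\<^sup>2) * (\<integral>p. I R p \<partial>\<sigma>) + 1 / l * (a R - a R0)"
      unfolding M_def a_def
      using iM iI[OF R(2)] ia[OF R(2)] ia[OF R0p]
      by (subst Bochner_Integration.integral_add Bochner_Integration.integral_diff; (simp (no_asm_simp))?)+ 
    also have "\<dots> \<le> \<epsilon> + \<epsilon> + 1 / l * (l * \<epsilon>)"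
    proof (intro add_mono nM order_trans[OF AI[OF R(3) l] lA] mult_left_mono)
      show "a R - a R0 \<le> l * \<epsilon>" using aT[OF R(3)] R0(2) by linarith
    qed (use l in simp)
    finally have "2 * a R \<le> 3 * \<epsilon>" using main[OF R(2)] l by simp
    moreover have "T \<le> a R + \<epsilon>" using mono[OF R0p, of R] R(1) R0p R0(2) by linarith
    ultimately show ?thesis by linarith
  qed
  have "T \<le> 0"
  proof (rule ccontr)
    assume "\<not> T \<le> 0"
    then show False using small[of "T / 5"] by simp
  qed
  then have zero: "a R = 0" if "R \<ge> R1" for R using aT[OF that] a0[of R] by linarith
  \<comment> \<open>A radius beyond the threshold at which the cutoff equals 1 at the given point
    \<open>p\<close>, so that vanishing of the integral gives \<open>E p = 0\<close>.\<close>
  define R where "R = max R1 (geodesic_dist \<A> F p0 p)"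
  have R: "R \<ge> R1" "R > 0" "geodesic_dist \<A> F p0 p \<le> R" using R1 by (auto simp: R_def)
  have "AE q in \<sigma>. (\<eta> R q)\<^sup>2 * E q * weight q = 0"
    using zero[OF R(1)] integral_nonneg_eq_0_iff_AE[OF ia[OF R(2)]] weight_pos E0
    unfolding a_def by (simp add: less_imp_le)
  then have "(\<eta> R p)\<^sup>2 * E p * weight p = 0"
    by (rule AE_eq_0_continuous[rotated]) (intro continuous_intros continuous_\<eta> R cE cw)
  then show ?thesis using \<eta>_eq_1[OF R(2,3)] weight_pos[of p] by simp
qed

end

theorem corollary1p1:
  fixes \<A> :: "('m::{t2_space,second_countable_topology}, 'n::finite) chart set"
    and F \<nu> :: "'m \<Rightarrow> real^'k"
    and \<sigma> :: "'m measure"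
    and p0 :: 'm
  assumes "CARD('n) \<ge> 2" and "CARD('k) = CARD('n) + 1"
    and "connected (UNIV :: 'm set)"
    and "smooth_atlas \<A>"
    and "immersion \<A> F"
    and "unit_normal_field \<A> F \<nu>"
    and "self_expander \<A> F \<nu>"
    and "mean_convex \<A> F \<nu>"
    and "properly_immersed F"
    and "complete_immersed \<A> F"
    and "volume_measure \<A> F \<sigma>"
    and "\<exists>C>0. \<forall>\<^sub>F R in at_top.
           (\<integral>\<^sup>+p\<in>geodesic_ball \<A> F p0 R.
              ennreal (sff_norm_sq \<A> F \<nu> p * exp ((norm (F p))\<^sup>2 / 4)) \<partial>\<sigma>)
           < ennreal (C * R\<^sup>2)"
  shows "\<exists>a. a \<noteq> 0 \<and> bij_betw F UNIV {x. a \<bullet> x = 0}"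
proof -
  interpret self_expanding \<A> F \<nu>
    by unfold_locales (rule assms)+
  interpret measured_hypersurface \<A> F \<nu> \<sigma> p0
    by unfold_locales (rule assms)+
  have H0: "H p \<ge> 0" for p
    using assms(8) unfolding mean_convex_def mean_curvature_eq H_def by blast
  obtain C where C: "C > 0" "\<forall>\<^sub>F R in at_top.
      (\<integral>\<^sup>+p\<in>geodesic_ball \<A> F p0 R. ennreal (hh p * weight p) \<partial>\<sigma>) < ennreal (C * R\<^sup>2)"
    using assms(12) unfolding sff_norm_sq_eq hh_def[symmetric] weight_def[symmetric] by blast
  \<comment> \<open>This supplies the zero of \<open>H\<close> from which the strong maximum
    principle spreads.\<close>
  have "\<not> (\<forall>p. H p > 0)"
  proof
    assume pos: "\<forall>p. H p > 0"
    show False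
    proof (rule no_positive_mean_curvature[OF assms(3,1)])
      show "H p > 0" for p using pos by blast
    next
      fix V E p
      assume V: "\<And>a. smooth_map \<A> (V a)" "\<And>p. (\<Sum>a\<in>UNIV. V a p * \<nu> p $ a) = 0"
        "\<And>p. drift_div V p = 2 * E p" "\<And>p. 0 \<le> E p" "\<And>p. (\<Sum>a\<in>UNIV. (V a p)\<^sup>2) \<le> 4 * hh p * E p"
      have "tangential V" using V(1,2) by (simp add: tangential_def)
      then show "E p = 0" by (rule liouville[OF _ V(3,4,5) C])
    qed
  qed
  then obtain p1 where "\<not> H p1 > 0" by blast
  then have "H p1 = 0" using H0[of p1] by linarith
  then have "H p = 0" for p by (rule mean_curvature_strong_maximum_principle[OF assms(3) H0])
  then show ?thesis by (rule flat_is_hyperplane[OF assms(3) _ assms(9) ex_path[OF assms(3)]])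
qed

end
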